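(* Let $A$ be a discriminant form of odd signature and level $N$, let $k\in\mathbb{Z}+\tfrac12$, let $p$ be a prime coprime to $N$, and let $\xi=\left(\begin{pmatrix}p^2&0\\0&1\end{pmatrix},1,p,1\right)\in\mathcal{Q}_2(N)$. Let $f\in M_{k,A}$ and write $f(\tau)=\sum_{\lambda\in A}\sum_{n\in\mathbb{Z}+\lambda^2/2}c(\lambda,n)e(n\tau)\otimes\mathfrak e_\lambda$ and $f\mid_{k,A}T(\xi)=\sum_{\lambda\in A}\sum_{n\in\mathbb{Z}+\lambda^2/2}b(\lambda,n)e(n\tau)\otimes\mathfrak e_\lambda$. Then \[ b(\lambda,n)=c(p\lambda,p^2n)+\epsilon_p^{\operatorname{sig}(A)+\left(\frac{-1}{|A|}\right)}\left(\frac{p}{|A|2^{\operatorname{sig}(A)}}\right)p^{k-3/2}\left(\frac{-n}{p}\right)c(\lambda,n)+p^{2k-2}c(\lambda/p,n/p^2), \] where $\epsilon_d=1$ if $d\equiv1\pmod4$ and $\epsilon_d=i$ if $d\equiv-1\pmod4$ (for odd $d$), and $c(\lambda/p,n/p^2)$ is understood to be $0$ if $p^2\nmid n$.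
   Context: The symbols $\left(\frac{\cdot}{\cdot}\right)$ are quadratic residue (Kronecker/Jacobi) symbols; $\left(\frac{-n}{p}\right)$ for rational $n$ with denominator prime to $p$ is the Legendre symbol of $-n$ modulo $p$; $\operatorname{sig}(A)$ in exponents is represented by an integer. A discriminant form is a finite abelian group $A$ with a non-degenerate quadratic form $\lambda\mapsto\lambda^2/2\in\mathbb{Q}/\mathbb{Z}$, bilinear form $(\lambda,\mu)=(\lambda+\mu)^2/2-\lambda^2/2-\mu^2/2$; level $N$ = smallest positive integer with $N\lambda^2/2=0$ for all $\lambda$ (so $A$ is a $\mathbb{Z}/N\mathbb{Z}$-module; $U(N)=(\mathbb{Z}/N\mathbb{Z})^\times$, $\lambda/p:=p^{-1}\lambda$). $e(z)=e^{2\pi iz}$; $\operatorname{sig}(A)\in\mathbb{Z}/8\mathbb{Z}$ is given by $\sum_\lambda e(\lambda^2/2)=\sqrt{|A|}e(\operatorname{sig}(A)/8)$; when it is odd, $4\mid N$. $g_d(A)=\sum_\lambda e(d\lambda^2/2)$, $g(A)=g_1(A)$. Metaplectic group: pairs $(M,\phi)$, $M=\begin{pmatrix}a&b\\c&d\end{pmatrix}\in\operatorname{GL}_2^+(\mathbb{R})$, $\phi$ holomorphic on $\mathbb{H}$ with $\phi^2=c\tau+d$, product $(M,\phi)(M',\phi')=(MM',\phi(M'\tau)\phi'(\tau))$; action $(h\mid_k(M,\phi))(\tau)=\det(M)^{k/2}\phi(\tau)^{-2k}h(M\tau)$. $\tilde\Gamma$ = preimage of $\operatorname{SL}_2(\mathbb{Z})$,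 generated by $(\begin{pmatrix}1&1\\0&1\end{pmatrix},1)$, $(\begin{pmatrix}0&-1\\1&0\end{pmatrix},\sqrt\tau)$; the Weil representation $\rho_A$ of $\tilde\Gamma$ on $\mathbb{C}[A]$ maps these to $\mathfrak e_\lambda\mapsto e(\lambda^2/2)\mathfrak e_\lambda$ and $\mathfrak e_\lambda\mapsto\frac{e(-\operatorname{sig}(A)/8)}{\sqrt{|A|}}\sum_\mu e(-(\lambda,\mu))\mathfrak e_\mu$; if $\gamma,\gamma'\in\tilde\Gamma$ have matrices congruent mod $N$ then $\rho_A(\gamma)=\pm\rho_A(\gamma')$. $M_{k,A}$: holomorphic $f:\mathbb{H}\to\mathbb{C}[A]$ with $f(M\tau)=\phi(\tau)^{2k}\rho_A(M,\phi)f(\tau)$ for all $(M,\phi)\in\tilde\Gamma$, holomorphic at $\infty$. $\mathcal{G}(N)$: $M\in\operatorname{GL}_2^+(\mathbb{Q})$ with $nM\in M_2(\mathbb{Z})$, $\gcd(\det(nM),N)=1$ for some $n$ coprime to $N$; reduction $\bar M=n^{-1}\overline{nM}$. $\mathcal{Q}(N)=\{(M,r)\in\mathcal{G}(N)\times U(N):\det M\equiv r^2\pmod N\}$. For $g=(M,r)\in\mathcal{Q}(N)$ choose $\gamma_g\in\tilde\Gamma$ with matrix $\equiv r^{-1}\bar M\pmod N$ and fix a unitary $\tilde\rho_A(g)=\pm\frac{g(A)}{g_r(A)}\rho_A(\gamma_g)$, normalized so that $\tilde\rho_A(M,1)=\rho_A(M,\sqrt{c\tau+d})$ (principal branch) for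 $M\in\operatorname{SL}_2(\mathbb{Z})$ and $\tilde\rho_A(\operatorname{diag}(m^2,1),m)\mathfrak e_\lambda=\mathfrak e_{m^{-1}\lambda}$ for positive $m$ coprime to $N$. Define $c(g_1,g_2)\in\{\pm1\}$ by $\tilde\rho_A(g_1g_2)=c(g_1,g_2)\tilde\rho_A(g_1)\tilde\rho_A(g_2)$. $\mathcal{H}(N)=\{M\in\mathcal{G}(N):\det M$ square mod $N\}$. $\mathcal{Q}_2(N)$: tuples $(M,\phi,r,t)$ with $(M,\phi)$ metaplectic, $M\in\mathcal{H}(N)$, $r\in U(N)$, $\det M\equiv r^2$, $t=\pm1$; product $(M_1,\phi_1,r_1,t_1)(M_2,\phi_2,r_2,t_2)=((M_1,\phi_1)(M_2,\phi_2),r_1r_2,t_1t_2c((M_1,r_1),(M_2,r_2))^{-1})$; $\rho_A(M,\phi,r,t)=t\tilde\rho_A(M,r)$; $f\mid_{k,A}(M,\phi,r,t)=\sum_\lambda(f_\lambda\mid_k(M,\phi))\otimes\rho_A(M,\phi,r,t)^{-1}\mathfrak e_\lambda$ for $f=\sum_\lambda f_\lambda\otimes\mathfrak e_\lambda$. $\Delta=\{(M,\varepsilon\sqrt{c\tau+d},1,\varepsilon):M\in\operatorname{SL}_2(\mathbb{Z}),\varepsilon=\pm1\}$. For $\xi=(M,\phi,r,t)$ with $\Delta\xi\Delta=\bigsqcup_i\Delta\xi_i$: $f\mid_{k,A}T(\xi)=\det(M)^{k/2-1}\sum_i f\mid_{k,A}\xi_i$. *)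

theory Defs
  imports
    "HOL-Complex_Analysis.Complex_Analysis"
    "HOL-Number_Theory.Number_Theory"
    "HOL-Algebra.Coset"
begin

section \<open>Quadratic residue symbols\<close>

text \<open>Kronecker symbol for a positive lower argument; at the prime 2 it is
  \<open>0\<close> for even \<open>a\<close>, \<open>1\<close> for \<open>a \<equiv> \<plusminus>1 (mod 8)\<close> and \<open>-1\<close> for \<open>a \<equiv> \<plusminus>3 (mod 8)\<close>.\<close>

definition kronecker_prime :: "int \<Rightarrow> nat \<Rightarrow> int" where
  "kronecker_prime a l =
     (if l = 2 then (if even a then 0 else if a mod 8 \<in> {1, 7} then 1 else -1)
      else Legendre a (int l))"

definition kronecker :: "int \<Rightarrow> nat \<Rightarrow> int" where
  "kronecker a n = (\<Prod>l\<in>#prime_factorization n. kronecker_prime a l)"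

text \<open>Legendre symbol of a rational number whose denominator is prime to \<open>p\<close>, i.e. of its
  residue class modulo \<open>p\<close>.\<close>

definition rat_legendre :: "rat \<Rightarrow> nat \<Rightarrow> int" where
  "rat_legendre x p =
     (case quotient_of x of (a, b) \<Rightarrow> Legendre (a * modular_inverse (int p) b) (int p))"

text \<open>Divisibility of a rational number by an integer, where the denominator of the rational is
  understood to be prime to that integer (it divides the level in the application).\<close>

definition dvd_rat :: "int \<Rightarrow> rat \<Rightarrow> bool" where
  "dvd_rat m x \<longleftrightarrow> m dvd fst (quotient_of x)"

definition eps :: "nat \<Rightarrow> complex" where
  "eps d = (if [d = 1] (mod 4) then 1 else \<i>)"

definition ee :: "complex \<Rightarrow> complex" where
  "ee z = exp (2 * of_real pi * \<i> * z)"

section \<open>Discriminant forms\<close>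

text \<open>A discriminant form is a finite abelian group \<open>'a\<close> together with a quadratic form with values
  in \<open>\<rat>/\<int>\<close>. The map \<open>q :: 'a \<Rightarrow> rat\<close> is an arbitrary lift of \<open>\<lambda> \<mapsto> \<lambda>\<^sup>2/2\<close> to \<open>\<rat>\<close>, so identities in
  \<open>\<rat>/\<int>\<close> become membership of a difference in \<open>\<int>\<close>.\<close>

definition zmult :: "int \<Rightarrow> 'a::ab_group_add \<Rightarrow> 'a" where
  "zmult n x = (if 0 \<le> n then (\<Sum>i<nat n. x) else - (\<Sum>i<nat (- n). x))"

definition bil :: "('a::ab_group_add \<Rightarrow> rat) \<Rightarrow> 'a \<Rightarrow> 'a \<Rightarrow> rat" where
  "bil q x y = q (x + y) - q x - q y"

definition discriminant_form :: "('a::{finite,ab_group_add} \<Rightarrow> rat) \<Rightarrow> bool" where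
  "discriminant_form q \<longleftrightarrow>
     (\<forall>n x. q (zmult n x) - of_int (n\<^sup>2) * q x \<in> \<int>) \<and>
     (\<forall>x y z. bil q (x + y) z - (bil q x z + bil q y z) \<in> \<int>) \<and>
     (\<forall>x. (\<forall>y. bil q x y \<in> \<int>) \<longrightarrow> x = 0)"

definition level :: "('a::{finite,ab_group_add} \<Rightarrow> rat) \<Rightarrow> int" where
  "level q = int (LEAST n::nat. 0 < n \<and> (\<forall>x. of_nat n * q x \<in> \<int>))"

definition gauss :: "('a::{finite,ab_group_add} \<Rightarrow> rat) \<Rightarrow> int \<Rightarrow> complex" where
  "gauss q d = (\<Sum>x\<in>UNIV. ee (of_int d * of_rat (q x)))"

text \<open>\<open>s\<close> represents the signature, an element of \<open>\<int>/8\<int>\<close>.\<close>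

definition has_signature :: "('a::{finite,ab_group_add} \<Rightarrow> rat) \<Rightarrow> nat \<Rightarrow> bool" where
  "has_signature q s \<longleftrightarrow>
     (\<Sum>x\<in>UNIV. ee (of_rat (q x))) = of_real (sqrt (real CARD('a))) * ee (of_nat s / 8)"

definition sig :: "('a::{finite,ab_group_add} \<Rightarrow> rat) \<Rightarrow> nat" where
  "sig q = (LEAST s. has_signature q s)"

section \<open>The metaplectic group\<close>

definition uhp :: "complex set" where
  "uhp = {z. 0 < Im z}"

definition mat2 :: "'b \<Rightarrow> 'b \<Rightarrow> 'b \<Rightarrow> 'b \<Rightarrow> 'b::zero^2^2" where
  "mat2 a b c d = vector [vector [a, b], vector [c, d]]"

definition auto_factor :: "real^2^2 \<Rightarrow> complex \<Rightarrow> complex" where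
  "auto_factor M z = of_real (M$2$1) * z + of_real (M$2$2)"

definition moebius :: "real^2^2 \<Rightarrow> complex \<Rightarrow> complex" where
  "moebius M z = (of_real (M$1$1) * z + of_real (M$1$2)) / auto_factor M z"

text \<open>A holomorphic function on the upper half plane is represented by the HOL function that is
  \<open>undefined\<close> elsewhere, so that equality of metaplectic elements is equality on \<open>uhp\<close>.\<close>

type_synonym mp = "(real^2^2) \<times> (complex \<Rightarrow> complex)"

definition Mp2R :: "mp set" where
  "Mp2R = {(M, \<phi>). 0 < det M \<and> \<phi> \<in> extensional uhp \<and> \<phi> holomorphic_on uhp \<and>
                    (\<forall>z\<in>uhp. (\<phi> z)\<^sup>2 = auto_factor M z)}"

definition mp_mult :: "mp \<Rightarrow> mp \<Rightarrow> mp" where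
  "mp_mult g h =
     (fst g ** fst h, restrict (\<lambda>z. snd g (moebius (fst h) z) * snd h z) uhp)"

definition SL2Z :: "(real^2^2) set" where
  "SL2Z = {M. det M = 1 \<and> (\<forall>i j. M$i$j \<in> \<int>)}"

definition Mp2Z :: "mp set" where
  "Mp2Z = {g \<in> Mp2R. fst g \<in> SL2Z}"

definition root_factor :: "real^2^2 \<Rightarrow> complex \<Rightarrow> complex" where
  "root_factor M = restrict (\<lambda>z. csqrt (auto_factor M z)) uhp"

definition mpT :: mp where
  "mpT = (mat2 1 1 0 1, restrict (\<lambda>z. 1) uhp)"

definition mpS :: mp where
  "mpS = (mat2 0 (-1) 1 0, restrict csqrt uhp)"

section \<open>The Weil representation\<close>

text \<open>The group algebra \<open>\<complex>[A]\<close> is \<open>complex^'a\<close> with basis vectors \<open>axis x 1\<close>; operators are matrices,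
  whose column \<open>x\<close> is the image of \<open>axis x 1\<close>.\<close>

type_synonym 'a group_alg = "(complex, 'a) vec"

type_synonym 'a operator = "((complex, 'a) vec, 'a) vec"

definition weil_T :: "('a::{finite,ab_group_add} \<Rightarrow> rat) \<Rightarrow> 'a operator" where
  "weil_T q = (\<chi> y x. if y = x then ee (of_rat (q x)) else 0)"

definition weil_S :: "('a::{finite,ab_group_add} \<Rightarrow> rat) \<Rightarrow> 'a operator" where
  "weil_S q = (\<chi> y x. ee (- (of_nat (sig q) / 8)) / of_real (sqrt (real CARD('a)))
                       * ee (- of_rat (bil q x y)))"

text \<open>As \<open>mpT\<close> and \<open>mpS\<close> generate \<open>Mp2Z\<close>, this determines \<open>\<rho>\<close> on \<open>Mp2Z\<close>.\<close>

definition weil_representation ::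
    "('a::{finite,ab_group_add} \<Rightarrow> rat) \<Rightarrow> (mp \<Rightarrow> 'a operator) \<Rightarrow> bool" where
  "weil_representation q \<rho> \<longleftrightarrow>
     (\<forall>g\<in>Mp2Z. \<forall>h\<in>Mp2Z. \<rho> (mp_mult g h) = \<rho> g ** \<rho> h) \<and>
     \<rho> mpT = weil_T q \<and> \<rho> mpS = weil_S q"

section \<open>The group \<open>\<Q>(N)\<close> and the extended operators\<close>

text \<open>The units of \<open>\<int>/N\<int>\<close>, represented by their least nonnegative residues.\<close>

definition unitsN :: "int \<Rightarrow> int set" where
  "unitsN N = {r. 0 \<le> r \<and> r < N \<and> coprime r N}"

text \<open>\<open>n\<close> is an integer prime to \<open>N\<close> with \<open>nM\<close> integral of determinant prime to \<open>N\<close>.\<close>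

definition clears :: "int \<Rightarrow> real^2^2 \<Rightarrow> nat \<Rightarrow> bool" where
  "clears N M n \<longleftrightarrow> 0 < n \<and> coprime (int n) N \<and>
     (\<exists>X::int^2^2. (\<forall>i j. real n * M$i$j = real_of_int (X$i$j)) \<and> coprime (det X) N)"

text \<open>The condition forces the entries of \<open>M\<close> to be rational.\<close>

definition GN :: "int \<Rightarrow> (real^2^2) set" where
  "GN N = {M. 0 < det M \<and> (\<exists>n. clears N M n)}"

text \<open>The reduction \<open>n\<^sup>-\<^sup>1 (nM)\<close> modulo \<open>N\<close>, with entries in \<open>{0..<N}\<close>; it does not depend on the
  choice of \<open>n\<close>. The residue of \<open>det M\<close> modulo \<open>N\<close> is the determinant of the reduction.\<close>

definition reduction :: "int \<Rightarrow> real^2^2 \<Rightarrow> int^2^2" where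
  "reduction N M = (let n = (LEAST n. clears N M n) in
     \<chi> i j. (modular_inverse N (int n) * \<lfloor>real n * M$i$j\<rfloor>) mod N)"

definition HN :: "int \<Rightarrow> (real^2^2) set" where
  "HN N = {M \<in> GN N. \<exists>r\<in>unitsN N. [det (reduction N M) = r\<^sup>2] (mod N)}"

definition QN :: "int \<Rightarrow> ((real^2^2) \<times> int) set" where
  "QN N = {(M, r). M \<in> GN N \<and> r \<in> unitsN N \<and> [det (reduction N M) = r\<^sup>2] (mod N)}"

definition qn_mult :: "int \<Rightarrow> (real^2^2) \<times> int \<Rightarrow> (real^2^2) \<times> int \<Rightarrow> (real^2^2) \<times> int" where
  "qn_mult N g h = (fst g ** fst h, (snd g * snd h) mod N)"

definition cscale :: "complex \<Rightarrow> 'a::finite operator \<Rightarrow> 'a operator" where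
  "cscale z U = (\<chi> i j. z * U$i$j)"

definition unitary_matrix :: "'a::finite operator \<Rightarrow> bool" where
  "unitary_matrix U \<longleftrightarrow> U ** (\<chi> i j. cnj (U$j$i)) = mat 1 \<and> (\<chi> i j. cnj (U$j$i)) ** U = mat 1"

text \<open>\<open>\<rho>'\<close> is an admissible choice of the operators extending \<open>\<rho>\<close> to \<open>QN N\<close>, which are only fixed
  up to sign apart from the two normalizations.\<close>

definition weil_extension ::
    "('a::{finite,ab_group_add} \<Rightarrow> rat) \<Rightarrow> (mp \<Rightarrow> 'a operator) \<Rightarrow>
     ((real^2^2) \<times> int \<Rightarrow> 'a operator) \<Rightarrow> bool" where
  "weil_extension q \<rho> \<rho>' \<longleftrightarrow> (let N = level q in
     (\<forall>(M, r)\<in>QN N. unitary_matrix (\<rho>' (M, r)) \<and>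
        (\<exists>\<gamma>\<in>Mp2Z.
           (\<forall>i j. [\<lfloor>fst \<gamma>$i$j\<rfloor> = modular_inverse N r * reduction N M$i$j] (mod N)) \<and>
           (\<exists>\<sigma>\<in>{1, -1}. \<rho>' (M, r) = cscale (\<sigma> * (gauss q 1 / gauss q r)) (\<rho> \<gamma>)))) \<and>
     (\<forall>M\<in>SL2Z. \<rho>' (M, 1 mod N) = \<rho> (M, root_factor M)) \<and>
     (\<forall>m. 0 < m \<and> coprime m N \<longrightarrow>
        (\<forall>x. \<rho>' (mat2 (real_of_int (m\<^sup>2)) 0 0 1, m mod N) *v axis x 1
               = axis (zmult (modular_inverse N m) x) 1)))"

definition cocycle ::
    "int \<Rightarrow> ((real^2^2) \<times> int \<Rightarrow> 'a::finite operator) \<Rightarrow>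
     (real^2^2) \<times> int \<Rightarrow> (real^2^2) \<times> int \<Rightarrow> real" where
  "cocycle N \<rho>' g h =
     (THE c. c \<in> {1, -1} \<and> \<rho>' (qn_mult N g h) = c *\<^sub>R (\<rho>' g ** \<rho>' h))"

section \<open>The group \<open>\<Q>\<^sub>2(N)\<close> and Hecke operators\<close>

type_synonym q2 = "(real^2^2) \<times> (complex \<Rightarrow> complex) \<times> int \<times> real"

definition Q2 :: "int \<Rightarrow> ((real^2^2) \<times> int \<Rightarrow> 'a::finite operator) \<Rightarrow> q2 monoid" where
  "Q2 N \<rho>' = \<lparr>
     carrier = {(M, \<phi>, r, t). (M, \<phi>) \<in> Mp2R \<and> M \<in> HN N \<and> r \<in> unitsN N \<and>
                  [det (reduction N M) = r\<^sup>2] (mod N) \<and> t \<in> {1, -1}},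
     mult = (\<lambda>(M\<^sub>1, \<phi>\<^sub>1, r\<^sub>1, t\<^sub>1) (M\<^sub>2, \<phi>\<^sub>2, r\<^sub>2, t\<^sub>2).
               (M\<^sub>1 ** M\<^sub>2, snd (mp_mult (M\<^sub>1, \<phi>\<^sub>1) (M\<^sub>2, \<phi>\<^sub>2)), (r\<^sub>1 * r\<^sub>2) mod N,
                t\<^sub>1 * t\<^sub>2 * inverse (cocycle N \<rho>' (M\<^sub>1, r\<^sub>1) (M\<^sub>2, r\<^sub>2)))),
     one = (mat 1, restrict (\<lambda>z. 1) uhp, 1 mod N, 1) \<rparr>"

definition rhoA :: "((real^2^2) \<times> int \<Rightarrow> 'a::finite operator) \<Rightarrow> q2 \<Rightarrow> 'a operator" where
  "rhoA \<rho>' = (\<lambda>(M, \<phi>, r, t). t *\<^sub>R \<rho>' (M, r))"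

text \<open>The weight \<open>k\<close> is a half-integer, so \<open>2k\<close> is the integer \<open>\<lfloor>2 * k\<rfloor>\<close>.\<close>

definition slash :: "real \<Rightarrow> mp \<Rightarrow> (complex \<Rightarrow> complex) \<Rightarrow> complex \<Rightarrow> complex" where
  "slash k g h z =
     of_real (det (fst g) powr (k / 2)) * (snd g z) powi (- \<lfloor>2 * k\<rfloor>) * h (moebius (fst g) z)"

definition slashA :: "real \<Rightarrow> ((real^2^2) \<times> int \<Rightarrow> 'a::finite operator) \<Rightarrow>
    (complex \<Rightarrow> 'a group_alg) \<Rightarrow> q2 \<Rightarrow> complex \<Rightarrow> 'a group_alg" where
  "slashA k \<rho>' f = (\<lambda>(M, \<phi>, r, t) z.
     \<Sum>x\<in>UNIV. slash k (M, \<phi>) (\<lambda>w. f w $ x) z *s (matrix_inv (rhoA \<rho>' (M, \<phi>, r, t)) *v axis x 1))"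

definition Delta :: "int \<Rightarrow> q2 set" where
  "Delta N = {(M, \<phi>, r, t). M \<in> SL2Z \<and> t \<in> {1, -1} \<and> r = 1 mod N \<and>
                \<phi> = restrict (\<lambda>z. of_real t * root_factor M z) uhp}"

text \<open>The sum runs over the cosets \<open>\<Delta>\<xi>\<^sub>i\<close> contained in \<open>\<Delta>\<xi>\<Delta>\<close>, with one (arbitrary) representative
  for each; on modular forms the choice is irrelevant.\<close>

definition hecke :: "real \<Rightarrow> int \<Rightarrow> ((real^2^2) \<times> int \<Rightarrow> 'a::finite operator) \<Rightarrow>
    q2 \<Rightarrow> (complex \<Rightarrow> 'a group_alg) \<Rightarrow> complex \<Rightarrow> 'a group_alg" where
  "hecke k N \<rho>' \<xi> f z =
     of_real (det (fst \<xi>) powr (k / 2 - 1)) *s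
       (\<Sum>C \<in> (\<lambda>\<eta>. Delta N #>\<^bsub>Q2 N \<rho>'\<^esub> \<eta>) ` ((Delta N #>\<^bsub>Q2 N \<rho>'\<^esub> \<xi>) <#>\<^bsub>Q2 N \<rho>'\<^esub> Delta N).
          slashA k \<rho>' f (SOME \<eta>. \<eta> \<in> C) z)"

section \<open>Vector valued modular forms\<close>

definition fourier_expansion :: "('a::{finite,ab_group_add} \<Rightarrow> rat) \<Rightarrow>
    (complex \<Rightarrow> 'a group_alg) \<Rightarrow> ('a \<Rightarrow> rat \<Rightarrow> complex) \<Rightarrow> bool" where
  "fourier_expansion q f c \<longleftrightarrow>
     (\<forall>z\<in>uhp. \<forall>x. ((\<lambda>n. c x n * ee (of_rat n * z)) has_sum f z $ x) {n. n - q x \<in> \<int>})"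

definition modular_forms :: "real \<Rightarrow> ('a::{finite,ab_group_add} \<Rightarrow> rat) \<Rightarrow>
    (mp \<Rightarrow> 'a operator) \<Rightarrow> (complex \<Rightarrow> 'a group_alg) set" where
  "modular_forms k q \<rho> = {f.
     (\<forall>x. (\<lambda>z. f z $ x) holomorphic_on uhp) \<and>
     (\<forall>(M, \<phi>)\<in>Mp2Z. \<forall>z\<in>uhp.
        f (moebius M z) = (\<phi> z) powi \<lfloor>2 * k\<rfloor> *s (\<rho> (M, \<phi>) *v f z)) \<and>
     (\<exists>c. fourier_expansion q f c \<and> (\<forall>x n. n < 0 \<longrightarrow> c x n = 0))}"

end

theory Submission
  imports Defs "HOL-Algebra.Sylow"
begin

text \<open>Write \<open>D\<close> for \<open>diag (p\<^sup>2, 1)\<close>, \<open>P\<close> for its operator and \<open>g\<^sub>u\<close> for the Gauss sum of \<open>u q\<close>. For \<open>c\<close> prime to the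
  level, the Weil representation of \<open>(a, b; c, d)\<close> is an explicit kernel with constant
  \<open>\<plusminus> (a / |c|) conj (g\<^sub>c) / |A|\<close>: along a word in the generators, its restriction to each primary
  component of \<open>A\<close> satisfies a recursion, and the constants match by the closed form
  \<open>g\<^sub>u = sqrt |A| (|A| / u) e (u s / 8)\<close> and quadratic reciprocity. This formula gives
  \<open>\<rho> g P = P \<rho> h\<close> whenever \<open>g D = D h\<close>, so that \<open>\<alpha> D \<beta> \<mapsto> \<rho> \<alpha> P \<rho> \<beta>\<close> is well defined. It agrees with
  \<open>\<rho>'\<close> up to sign, and therefore describes the double coset together with all its cocycle signs. The
  right cosets are represented by \<open>(p\<^sup>2, 0; 0, 1)\<close>, by \<open>(p, j; 0, p)\<close> with \<open>0 < j < p\<close> and by \<open>(1, j; 0, p\<^sup>2)\<close>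
  with \<open>0 \<le> j < p\<^sup>2\<close>, whose operators are monomial; the middle ones carry the factor
  \<open>(j / p) g\<^sub>1 / g\<^sub>p\<close>. Summing over \<open>j\<close> is a character sum for the last family and a quadratic Gauss
  sum for the middle one, and the three terms of the formula result.\<close>

text \<open>Knowing \<rho> up to sign on matrices congruent modulo \<open>N\<close> does not
  suffice: the Hecke operator is a sum over cosets, and one wrong sign would spoil the character
  sums. The constants therefore have to be exact. The recursion cannot be run on all of
  \<open>A\<close>, because a word passes through matrices whose entries \<open>a\<close> and
  \<open>c\<close> both have factors in common with \<open>N\<close>, where no formula of this kind
  is at hand. At a single prime one of \<open>a\<close>, \<open>c\<close> is a unit, since ad - bc =
  1; so on a primary component the formula holds either at once or after one step with the generator
  \<open>S\<close>. The metaplectic sign and the symbol (a / |c|) then have to be assigned to one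
  component. Odd signature forces \<open>N\<close> to be even, and the even component is the one
  whose Gauss sums see \<open>c\<close> modulo 8. The closed form of the Gauss sums is obtained by
  congruences modulo primes in a cyclotomic ring and not from a classification of discriminant
  forms; it rests on the fact that g_u / sqrt |A| is a root of unity.\<close>

no_notation fps_nth (infixl \<open>$\<close> 75)

section \<open>Roots of unity attached to rational numbers\<close>

definition er :: "rat \<Rightarrow> complex" where "er x = ee (of_rat x)"

lemma ee_add: "ee (x + y) = ee x * ee y"
  by (simp add: ee_def ring_distribs exp_add)

lemma ee_0 [simp]: "ee 0 = 1"
  by (simp add: ee_def)

lemma ee_minus: "ee (- x) = inverse (ee x)"
  by (simp add: ee_def exp_minus)

lemma ee_nonzero [simp]: "ee x \<noteq> 0"
  by (simp add: ee_def)

lemma ee_of_nat_mult: "ee (of_nat n * x) = ee x ^ n"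
  by (induction n) (simp_all add: ee_add ring_distribs mult.commute)

lemma ee_of_int_mult: "ee (of_int n * x) = ee x powi n"
proof (cases "0 \<le> n")
  case True
  then show ?thesis using ee_of_nat_mult[of "nat n" x] by (simp add: power_int_def)
next
  case False
  then have "ee (of_int (- n) * x) = ee x ^ nat (- n)"
    using ee_of_nat_mult[of "nat (- n)" x] by simp
  then have "ee (of_int n * x) = inverse (ee x ^ nat (- n))"
    using ee_minus[of "of_int (- n) * x"] by simp
  then show ?thesis using False by (simp add: power_int_def power_inverse)
qed

lemma ee_of_int [simp]: "ee (of_int n) = 1"
proof -
  have "ee 1 = 1" by (simp add: ee_def mult.commute)
  then show ?thesis using ee_of_int_mult[of n 1] by simp
qed

lemma ee_of_real_eq_1_iff: "ee (of_real x) = 1 \<longleftrightarrow> x \<in> \<int>"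
proof
  assume "ee (of_real x) = 1"
  then have "exp (2 * of_real pi * \<i> * of_real x) = 1" by (simp add: ee_def)
  then obtain n :: int where n: "Im (2 * of_real pi * \<i> * of_real x) = of_int (2 * n) * pi"
    unfolding exp_eq_1 by blast
  then have "x = of_int n" by simp
  then show "x \<in> \<int>" by simp
next
  assume "x \<in> \<int>"
  then obtain n where "x = of_int n" by (elim Ints_cases)
  then show "ee (of_real x) = 1" using ee_of_int[of n] by simp
qed

lemma er_add: "er (x + y) = er x * er y"
  by (simp add: er_def of_rat_add ee_add)

lemma er_0 [simp]: "er 0 = 1"
  by (simp add: er_def)

lemma er_minus: "er (- x) = inverse (er x)"
  by (simp add: er_def of_rat_minus ee_minus)

lemma er_diff: "er (x - y) = er x / er y"
  using er_add[of x "- y"] by (simp add: er_minus field_simps)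

lemma er_nonzero [simp]: "er x \<noteq> 0"
  by (simp add: er_def)

lemma complex_of_rat: "(of_rat x :: complex) = of_real (of_rat x)"
proof (cases "quotient_of x")
  case (Pair a b)
  then have "x = of_int a / of_int b" using quotient_of_div by blast
  then show ?thesis by (simp add: of_rat_divide)
qed

lemma of_rat_in_Ints_iff: "(of_rat x :: real) \<in> \<int> \<longleftrightarrow> x \<in> \<int>"
proof
  assume "(of_rat x :: real) \<in> \<int>"
  then obtain n where "(of_rat x :: real) = of_int n" by (elim Ints_cases)
  then have "(of_rat x :: real) = of_rat (of_int n)" by simp
  then have "x = of_int n" by (simp only: of_rat_eq_iff)
  then show "x \<in> \<int>" by simp
next
  assume "x \<in> \<int>"
  then show "(of_rat x :: real) \<in> \<int>" by (elim Ints_cases) simp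
qed

text \<open>A lift \<open>q\<close> satisfies its identities only modulo the integers. This
  equivalence turns them into equations between complex numbers; \<open>er_cong\<close> is the form
  used below.\<close>

lemma er_eq_1_iff: "er x = 1 \<longleftrightarrow> x \<in> \<int>"
  unfolding er_def complex_of_rat ee_of_real_eq_1_iff of_rat_in_Ints_iff ..

lemma er_eq_iff: "er x = er y \<longleftrightarrow> x - y \<in> \<int>"
  using er_eq_1_iff[of "x - y"] by (simp add: er_diff)

lemma er_cong: "x - y \<in> \<int> \<Longrightarrow> er x = er y"
  by (simp add: er_eq_iff)

lemma er_power: "er x ^ n = er (of_nat n * x)"
  by (simp add: er_def of_rat_mult ee_of_nat_mult)

lemma norm_er [simp]: "norm (er x) = 1"
  by (simp add: er_def ee_def complex_of_rat)

lemma cnj_er: "cnj (er x) = er (- x)"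
proof -
  have "er x * cnj (er x) = 1" using complex_norm_square[of "er x"] by simp
  then show ?thesis by (simp add: er_minus field_simps)
qed

section \<open>Integer multiples\<close>

lemma zmult_0 [simp]: "zmult 0 x = 0"
  by (simp add: zmult_def)

lemma zmult_1 [simp]: "zmult 1 x = x"
  by (simp add: zmult_def)

lemma zmult_plus1: "zmult (n + 1) x = zmult n x + x"
proof (cases "0 \<le> n")
  case True
  then have "nat (n + 1) = Suc (nat n)" by simp
  then show ?thesis using True by (simp add: zmult_def add.commute)
next
  case False
  then have e: "nat (- n) = Suc (nat (- (n + 1)))" by simp
  show ?thesis
  proof (cases "n = - 1")
    case True
    then show ?thesis by (simp add: zmult_def)
  next
    case F: False
    then have "\<not> 0 \<le> n + 1" using False by simp
    then show ?thesis using False e unfolding zmult_def by (simp del: minus_add_distrib)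
  qed
qed

lemma zmult_minus1: "zmult (n - 1) x = zmult n x - x"
  using zmult_plus1[of "n - 1" x] by (simp add: algebra_simps)

lemma zmult_add: "zmult (m + n) x = zmult m x + zmult n x"
proof (induction n rule: int_induct[of _ 0])
  case base
  show ?case by simp
next
  case (step1 i)
  then show ?case using zmult_plus1[of "m + i" x] zmult_plus1[of i x] by (simp add: algebra_simps)
next
  case (step2 i)
  have "zmult (m + (i - 1)) x = zmult (m + i) x - x"
    using zmult_minus1[of "m + i" x] by (simp add: algebra_simps)
  also have "\<dots> = zmult m x + (zmult i x - x)" using step2 by simp
  finally show ?case by (simp only: zmult_minus1)
qed

lemma zmult_add_right: "zmult m (x + y) = zmult m x + zmult m y"
proof (induction m rule: int_induct[of _ 0])
  case base
  show ?case by simp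
next
  case (step1 i)
  then show ?case by (simp add: zmult_plus1)
next
  case (step2 i)
  then show ?case by (simp add: zmult_minus1)
qed

lemma zmult_zmult: "zmult m (zmult n x) = zmult (m * n) x"
proof (induction m rule: int_induct[of _ 0])
  case base
  show ?case by simp
next
  case (step1 i)
  then show ?case by (simp add: zmult_plus1 zmult_add ring_distribs)
next
  case (step2 i)
  have "zmult ((i - 1) * n) x = zmult (i * n) x - zmult n x"
    using zmult_add[of "(i - 1) * n" n x] by (simp add: algebra_simps)
  then show ?case using step2 by (simp add: zmult_minus1)
qed

lemma zmult_0_right [simp]: "zmult m 0 = 0"
  using zmult_add_right[of m 0 0] by simp

lemma zmult_uminus: "zmult (- m) x = - zmult m x"
  using zmult_add[of m "- m" x] by (simp add: eq_neg_iff_add_eq_0 add.commute)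

lemma zmult_neg1 [simp]: "zmult (- 1) x = - x"
  by (simp add: zmult_uminus)

lemma zmult_uminus_right: "zmult m (- x) = - zmult m x"
  using zmult_zmult[of m "- 1" x] by (simp add: zmult_uminus)

section \<open>Finite quadratic modules\<close>

text \<open>The submodule \<open>H\<close> is a parameter because the primary components of the discriminant form
  have to be treated separately, although they are not types.\<close>

locale fqm =
  fixes H :: "'a::{finite,ab_group_add} set" and q :: "'a \<Rightarrow> rat" and m :: int
  assumes H_0: "0 \<in> H" and H_add: "x \<in> H \<Longrightarrow> y \<in> H \<Longrightarrow> x + y \<in> H"
    and H_uminus: "x \<in> H \<Longrightarrow> - x \<in> H"
    and q_zmult: "x \<in> H \<Longrightarrow> q (zmult n x) - of_int (n\<^sup>2) * q x \<in> \<int>"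
    and bil_add_left: "x \<in> H \<Longrightarrow> y \<in> H \<Longrightarrow> z \<in> H \<Longrightarrow> bil q (x + y) z - (bil q x z + bil q y z) \<in> \<int>"
    and nondeg: "x \<in> H \<Longrightarrow> (\<And>y. y \<in> H \<Longrightarrow> bil q x y \<in> \<int>) \<Longrightarrow> x = 0"
    and m_pos: "0 < m" and m_q: "x \<in> H \<Longrightarrow> of_int m * q x \<in> \<int>"
begin

text \<open>Only \<open>u\<close> modulo \<open>m\<close> matters (\<open>g_cong\<close>), but
  \<open>u\<close> is kept as an integer because it is later a matrix entry such as
  \<open>c\<close>, or a product such as \<open>a * c\<close>.\<close>

definition g :: "int \<Rightarrow> complex" where
  "g u = (\<Sum>x\<in>H. er (of_int u * q x))"

lemma H_zmult: "x \<in> H \<Longrightarrow> zmult n x \<in> H"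
proof (induction n rule: int_induct[of _ 0])
  case base
  then show ?case by (simp add: H_0)
next
  case (step1 i)
  then show ?case by (simp add: zmult_plus1 H_add)
next
  case (step2 i)
  then show ?case using H_add[of "zmult i x" "- x"] H_uminus by (simp add: zmult_minus1)
qed

lemma H_diff: "x \<in> H \<Longrightarrow> y \<in> H \<Longrightarrow> x - y \<in> H"
  using H_add[of x "- y"] H_uminus by simp

lemma q_0: "q 0 \<in> \<int>"
  using q_zmult[of 0 0] H_0 by simp

lemma q_uminus: "x \<in> H \<Longrightarrow> q (- x) - q x \<in> \<int>"
  using q_zmult[of x "- 1"] by simp

lemma bil_commute: "bil q x y = bil q y x"
  by (simp add: bil_def add.commute)

lemma er_bil_add_left: "x \<in> H \<Longrightarrow> y \<in> H \<Longrightarrow> z \<in> H \<Longrightarrow> er (bil q (x + y) z) = er (bil q x z) * er (bil q y z)"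
  using er_cong[OF bil_add_left] by (simp add: er_add)

lemma er_bil_zmult_left: "x \<in> H \<Longrightarrow> z \<in> H \<Longrightarrow> er (bil q (zmult n x) z) = er (of_int n * bil q x z)"
proof (induction n rule: int_induct[of _ 0])
  case base
  have "er (bil q (0 + 0) z) = er (bil q 0 z) * er (bil q 0 z)"
    using base H_0 by (intro er_bil_add_left) auto
  then show ?case by simp
next
  case (step1 i)
  then show ?case using er_bil_add_left[of "zmult i x" x z] H_zmult
    by (simp add: zmult_plus1 er_add ring_distribs)
next
  case (step2 i)
  have "er (bil q (zmult (i - 1) x) z) * er (bil q x z) = er (bil q (zmult i x) z)"
    using er_bil_add_left[of "zmult (i - 1) x" x z] H_zmult[of x "i - 1"] step2 by (simp add: zmult_minus1)
  moreover have "er (of_int i * bil q x z) = er (of_int (i - 1) * bil q x z) * er (bil q x z)"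
    by (simp add: algebra_simps flip: er_add)
  ultimately have "er (bil q (zmult (i - 1) x) z) * er (bil q x z) = er (of_int (i - 1) * bil q x z) * er (bil q x z)"
    using step2 by simp
  then show ?case by simp
qed

lemma bil_zmult_left: "x \<in> H \<Longrightarrow> z \<in> H \<Longrightarrow> bil q (zmult n x) z - of_int n * bil q x z \<in> \<int>"
  using er_bil_zmult_left[of x z n] by (simp only: er_eq_iff)

lemma bil_zmult_right: "x \<in> H \<Longrightarrow> z \<in> H \<Longrightarrow> bil q x (zmult n z) - of_int n * bil q x z \<in> \<int>"
  using bil_zmult_left[of z x n] by (simp add: bil_commute)

lemma bil_self: "x \<in> H \<Longrightarrow> bil q x x - 2 * q x \<in> \<int>"
proof -
  assume x: "x \<in> H"
  have "zmult 2 x = x + x" using zmult_plus1[of 1 x] by simp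
  then have "q (x + x) - 4 * q x \<in> \<int>" using q_zmult[OF x, of 2] by simp
  then show ?thesis by (simp add: bil_def)
qed

lemma m_bil: "x \<in> H \<Longrightarrow> y \<in> H \<Longrightarrow> of_int m * bil q x y \<in> \<int>"
  using m_q[of "x + y"] m_q[of x] m_q[of y] H_add by (auto simp: bil_def ring_distribs)

lemma er_q_cong: "x \<in> H \<Longrightarrow> [u = v] (mod m) \<Longrightarrow> er (of_int u * q x) = er (of_int v * q x)"
proof (rule er_cong)
  assume x: "x \<in> H" and "[u = v] (mod m)"
  then obtain k where "u - v = m * k" by (metis cong_iff_dvd_diff dvd_def)
  then have "of_int u * q x - of_int v * q x = of_int k * (of_int m * q x)"
    by (metis (no_types, lifting) left_diff_distrib mult.assoc mult.commute of_int_diff of_int_mult)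
  then show "of_int u * q x - of_int v * q x \<in> \<int>" using m_q[OF x] by simp
qed

lemma er_bil_cong: "x \<in> H \<Longrightarrow> y \<in> H \<Longrightarrow> [u = v] (mod m) \<Longrightarrow> er (of_int u * bil q x y) = er (of_int v * bil q x y)"
proof (rule er_cong)
  assume x: "x \<in> H" "y \<in> H" and "[u = v] (mod m)"
  then obtain k where "u - v = m * k" by (metis cong_iff_dvd_diff dvd_def)
  then have "of_int u * bil q x y - of_int v * bil q x y = of_int k * (of_int m * bil q x y)"
    by (metis (no_types, lifting) left_diff_distrib mult.assoc mult.commute of_int_diff of_int_mult)
  then show "of_int u * bil q x y - of_int v * bil q x y \<in> \<int>" using m_bil[OF x] by simp
qed

lemma zmult_m: "x \<in> H \<Longrightarrow> zmult m x = 0"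
proof (rule nondeg)
  show "x \<in> H \<Longrightarrow> zmult m x \<in> H" by (rule H_zmult)
  fix y assume "x \<in> H" "y \<in> H"
  then have "bil q (zmult m x) y - of_int m * bil q x y + of_int m * bil q x y \<in> \<int>"
    by (intro Ints_add bil_zmult_left m_bil)
  then show "bil q (zmult m x) y \<in> \<int>" by simp
qed

lemma zmult_cong: "x \<in> H \<Longrightarrow> [u = v] (mod m) \<Longrightarrow> zmult u x = zmult v x"
proof -
  assume x: "x \<in> H" and "[u = v] (mod m)"
  then obtain k where "u = v + k * m" by (metis cong_iff_lin cong_sym mult.commute)
  then show ?thesis using zmult_zmult[of k m x] by (simp add: zmult_add zmult_m[OF x])
qed

lemma g_cong: "[u = v] (mod m) \<Longrightarrow> g u = g v"
  unfolding g_def by (intro sum.cong refl er_q_cong)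

lemma g_minus: "g (- u) = cnj (g u)"
  by (simp add: g_def cnj_er)

lemma sum_shift: "y \<in> H \<Longrightarrow> (\<Sum>x\<in>H. F (x + y)) = (\<Sum>x\<in>H. (F x :: complex))"
  by (rule sum.reindex_bij_witness[of _ "\<lambda>x. x - y" "\<lambda>x. x + y"]) (auto simp: H_add H_diff)

lemma sum_zmult:
  assumes "coprime u m"
  shows "(\<Sum>x\<in>H. F (zmult u x)) = (\<Sum>x\<in>H. (F x :: complex))"
proof -
  obtain v where v: "[u * v = 1] (mod m)" using cong_solve_coprime_int[OF assms] by auto
  have v': "[v * u = 1] (mod m)" using v by (simp add: mult.commute)
  show ?thesis
    by (rule sum.reindex_bij_witness[of _ "zmult v" "zmult u"])
       (auto simp: H_zmult zmult_zmult zmult_cong[OF _ v] zmult_cong[OF _ v'])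
qed

text \<open>The substitution of \<open>zmult v x\<close> for \<open>x\<close> is a bijection when
  \<open>v\<close> is a unit. It lets \<open>a / c\<close> be replaced by \<open>a * c\<close> and
  removes the factor \<open>p\<^sup>2\<close> from Gauss sums.\<close>

lemma g_square: "coprime v m \<Longrightarrow> g (u * v\<^sup>2) = g u"
proof -
  assume v: "coprime v m"
  have "g u = (\<Sum>x\<in>H. er (of_int u * q (zmult v x)))"
    unfolding g_def by (rule sum_zmult[OF v, symmetric])
  also have "\<dots> = g (u * v\<^sup>2)"
    unfolding g_def
  proof (rule sum.cong[OF refl], rule er_cong)
    fix x assume "x \<in> H"
    then have "of_int u * (q (zmult v x) - of_int (v\<^sup>2) * q x) \<in> \<int>" by (intro Ints_mult q_zmult) auto
    then show "of_int u * q (zmult v x) - of_int (u * v\<^sup>2) * q x \<in> \<int>" by (simp add: algebra_simps)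
  qed
  finally show ?thesis by simp
qed

lemma character_sum:
  assumes x: "x \<in> H"
  shows "(\<Sum>y\<in>H. er (bil q x y)) = (if x = 0 then of_nat (card H) else 0)"
proof (cases "x = 0")
  case True
  have "er (bil q 0 y) = 1" if "y \<in> H" for y
    using er_bil_zmult_left[OF H_0 that, of 0] by simp
  then show ?thesis using True by simp
next
  case False
  then obtain y where y: "y \<in> H" "bil q x y \<notin> \<int>" using nondeg[OF x] by blast
  have "(\<Sum>z\<in>H. er (bil q x z)) = (\<Sum>z\<in>H. er (bil q x (z + y)))"
    by (rule sum_shift[OF y(1), symmetric])
  also have "\<dots> = (\<Sum>z\<in>H. er (bil q x z)) * er (bil q x y)"
    unfolding sum_distrib_right
    using er_bil_add_left[OF _ y(1) x] by (intro sum.cong refl) (simp add: bil_commute)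
  finally have "(\<Sum>z\<in>H. er (bil q x z)) * (1 - er (bil q x y)) = 0" by (simp add: ring_distribs)
  moreover have "er (bil q x y) \<noteq> 1" using y(2) by (simp add: er_eq_1_iff)
  ultimately show ?thesis using False by simp
qed

lemma q_add: "q (x + y) = q x + q y + bil q x y"
  by (simp add: bil_def)

text \<open>The shift by \<open>zmult v y\<close>, with \<open>v\<close> inverse to
  \<open>u\<close>, makes the mixed term cancel the linear one.\<close>

lemma complete_square:
  assumes u: "[u * v = 1] (mod m)" and y: "y \<in> H"
  shows "(\<Sum>x\<in>H. er (of_int u * q x - bil q x y)) = g u * er (- of_int v * q y)"
proof -
  let ?w = "zmult v y"
  have w: "?w \<in> H" using y by (rule H_zmult)
  have "(\<Sum>x\<in>H. er (of_int u * q x - bil q x y)) = (\<Sum>x\<in>H. er (of_int u * q (x + ?w) - bil q (x + ?w) y))"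
    by (rule sum_shift[OF w, symmetric])
  also have "\<dots> = (\<Sum>x\<in>H. er (of_int u * q x) * er (- of_int v * q y))"
  proof (rule sum.cong[OF refl])
    fix x assume x: "x \<in> H"
    \<comment> \<open>The identities for multiples hold only modulo the integers, so three
      integrality facts are collected first and then converted into equations of \<open>er\<close>
      values.\<close>
    have 1: "of_int u * bil q x ?w - of_int (u * v) * bil q x y \<in> \<int>"
    proof -
      have "of_int u * (bil q x ?w - of_int v * bil q x y) \<in> \<int>"
        using x y by (intro Ints_mult bil_zmult_right) auto
      then show ?thesis by (simp add: algebra_simps)
    qed
    have 2: "of_int u * q ?w - of_int (u * v * v) * q y \<in> \<int>"
    proof -
      have "of_int u * (q ?w - of_int (v\<^sup>2) * q y) \<in> \<int>" using y by (intro Ints_mult q_zmult) auto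
      then show ?thesis by (simp add: algebra_simps power2_eq_square)
    qed
    have 3: "bil q ?w y - of_int (2 * v) * q y \<in> \<int>"
    proof -
      have "of_int v * (bil q y y - 2 * q y) \<in> \<int>" using y by (intro Ints_mult bil_self) auto
      moreover have "bil q ?w y - of_int v * bil q y y \<in> \<int>" using y by (rule bil_zmult_left[OF _ y])
      ultimately have "(bil q ?w y - of_int v * bil q y y) + of_int v * (bil q y y - 2 * q y) \<in> \<int>" by simp
      then show ?thesis by (simp add: algebra_simps)
    qed
    have e1: "er (of_int u * bil q x ?w) = er (bil q x y)"
      using er_cong[OF 1] er_bil_cong[OF x y u] by simp
    have "[u * v * v = v] (mod m)" using cong_scalar_right[OF u, of v] by simp
    then have e2: "er (of_int u * q ?w) = er (of_int v * q y)"
      using er_cong[OF 2] er_q_cong[OF y] by metis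
    have e3: "er (bil q ?w y) = er (of_int v * q y) * er (of_int v * q y)"
      using er_cong[OF 3] by (simp add: algebra_simps flip: er_add)
    have "er (of_int u * q (x + ?w) - bil q (x + ?w) y)
        = er (of_int u * q x) * er (of_int u * q ?w) * er (of_int u * bil q x ?w) / er (bil q (x + ?w) y)"
      by (simp add: q_add er_diff er_add ring_distribs)
    also have "\<dots> = er (of_int u * q x) * er (of_int v * q y) * er (bil q x y) /
         (er (bil q x y) * (er (of_int v * q y) * er (of_int v * q y)))"
      using er_bil_add_left[OF x w y] by (simp add: e1 e2 e3)
    also have "\<dots> = er (of_int u * q x) * er (- of_int v * q y)"
      by (simp add: er_minus field_simps)
    finally show "er (of_int u * q (x + ?w) - bil q (x + ?w) y) = er (of_int u * q x) * er (- of_int v * q y)" .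
  qed
  finally show ?thesis by (simp add: g_def sum_distrib_right)
qed

text \<open>Replacing \<open>x\<close> by \<open>x + y\<close> separates the double sum, and the
  inner sum over \<open>y\<close> is a character sum that removes every \<open>x\<close> except
  0.\<close>

lemma g_mult_cnj:
  assumes "coprime u m"
  shows "g u * cnj (g u) = of_nat (card H)"
proof -
  have "g u * cnj (g u) = (\<Sum>y\<in>H. \<Sum>x\<in>H. er (of_int u * q x) * er (- (of_int u * q y)))"
    unfolding g_def cnj_sum cnj_er sum_product by (subst sum.swap) simp
  also have "\<dots> = (\<Sum>y\<in>H. \<Sum>x\<in>H. er (of_int u * q (x + y)) * er (- (of_int u * q y)))"
    by (intro sum.cong refl sum_shift[symmetric])
  also have "\<dots> = (\<Sum>x\<in>H. er (of_int u * q x) * (\<Sum>y\<in>H. er (bil q (zmult u x) y)))"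
    unfolding sum_distrib_left
    by (subst sum.swap, intro sum.cong refl)
      (simp add: q_add er_add er_minus er_bil_zmult_left ring_distribs field_simps)
  also have "\<dots> = (\<Sum>x\<in>H. er (of_int u * q x) * (if zmult u x = 0 then of_nat (card H) else 0))"
    using H_zmult by (intro sum.cong refl) (simp add: character_sum)
  also have "\<dots> = (\<Sum>x\<in>H. if x = 0 then of_nat (card H) else 0)"
  proof (rule sum.cong[OF refl])
    fix x assume x: "x \<in> H"
    obtain v where v: "[v * u = 1] (mod m)"
      using cong_solve_coprime_int[OF assms] by (auto simp: mult.commute)
    have "zmult u x = 0 \<longleftrightarrow> x = 0"
      using zmult_zmult[of v u x] zmult_cong[OF x v] by auto
    moreover have "er (of_int u * q 0) = 1" using q_0 by (simp add: er_eq_1_iff)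
    ultimately show "er (of_int u * q x) * (if zmult u x = 0 then of_nat (card H) else 0) = (if x = 0 then of_nat (card H) else 0)"
      by auto
  qed
  also have "\<dots> = of_nat (card H)" by (simp add: sum.delta H_0)
  finally show ?thesis .
qed

lemma card_H_pos: "0 < card H"
  using H_0 by (auto simp: card_gt_0_iff)

lemma g_nonzero: "coprime u m \<Longrightarrow> g u \<noteq> 0"
  using g_mult_cnj[of u] card_H_pos by auto

end

lemma fqm_level:
  assumes "discriminant_form q"
  shows "fqm UNIV q (level q)"
proof -
  let ?P = "\<lambda>n::nat. 0 < n \<and> (\<forall>x. of_nat n * q x \<in> \<int>)"
  let ?n = "\<Prod>x\<in>UNIV. nat (snd (quotient_of (q x)))"
  \<comment> \<open>\<open>LEAST\<close> has the intended meaning only once some multiple clears all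
    values of \<open>q\<close>; the product of all denominators does.\<close>
  have "?P ?n"
  proof (intro conjI allI)
    show "0 < ?n" by (simp add: prod_pos quotient_of_denom_pos')
    fix x
    have "?n = nat (snd (quotient_of (q x))) * (\<Prod>y\<in>UNIV - {x}. nat (snd (quotient_of (q y))))"
      by (subst prod.remove[of _ x]) auto
    moreover have "of_nat (nat (snd (quotient_of (q x)))) * q x \<in> \<int>"
    proof (cases "quotient_of (q x)")
      case (Pair a b)
      then have "b > 0" "q x = of_int a / of_int b"
        using quotient_of_denom_pos quotient_of_div by blast+
      then show ?thesis using Pair by simp
    qed
    ultimately show "of_nat ?n * q x \<in> \<int>"
      by (simp only: of_nat_mult) (metis Ints_mult Ints_of_nat mult.assoc mult.commute)
  qed
  then have "?P (LEAST n. ?P n)" by (rule LeastI)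
  then have "0 < level q" "\<And>x. of_int (level q) * q x \<in> \<int>"
    unfolding level_def by auto
  then show ?thesis
    using assms unfolding discriminant_form_def by unfold_locales auto
qed

section \<open>The Jacobi symbol\<close>

lemma Legendre_values: "Legendre a p \<in> {-1, 0, 1}"
  by (auto simp: Legendre_def)

lemma Legendre_eq_0_iff: "Legendre a p = 0 \<longleftrightarrow> p dvd a"
  by (auto simp: Legendre_def cong_0_iff)

lemma Legendre_cong: "[a = b] (mod p) \<Longrightarrow> Legendre a p = Legendre b p"
proof -
  assume "[a = b] (mod p)"
  then have "[x = a] (mod p) \<longleftrightarrow> [x = b] (mod p)" "[a = x] (mod p) \<longleftrightarrow> [b = x] (mod p)" for x
    by (auto simp: cong_def)
  then show ?thesis by (simp add: Legendre_def QuadRes_def)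
qed

text \<open>Euler's criterion gives congruences; symbols are small enough to be recovered from
  them.\<close>

lemma eq_of_cong_sign:
  fixes x y p :: int
  assumes "[x = y] (mod p)" "x \<in> {-1, 0, 1}" "y \<in> {-1, 0, 1}" "2 < p"
  shows "x = y"
proof -
  have "p dvd x - y" using assms(1) by (simp add: cong_iff_dvd_diff)
  moreover have "\<bar>x - y\<bar> < p" using assms by auto
  ultimately show ?thesis using dvd_imp_le_int[of "x - y" p] assms(4) by auto
qed

lemma Legendre_mult:
  assumes "prime p" "2 < p"
  shows "Legendre (a * b) (int p) = Legendre a (int p) * Legendre b (int p)"
proof (rule eq_of_cong_sign)
  let ?k = "(p - 1) div 2"
  have "[Legendre (a * b) (int p) = (a * b) ^ ?k] (mod int p)"
    using euler_criterion[OF assms] by simp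
  moreover have "[Legendre a (int p) * Legendre b (int p) = a ^ ?k * b ^ ?k] (mod int p)"
    using euler_criterion[OF assms] by (intro cong_mult) auto
  ultimately show "[Legendre (a * b) (int p) = Legendre a (int p) * Legendre b (int p)] (mod int p)"
    by (metis cong_sym cong_trans power_mult_distrib)
qed (use assms Legendre_values[of a "int p"] Legendre_values[of b "int p"] Legendre_values[of "a * b" "int p"] in auto)

lemma Legendre_square: "prime p \<Longrightarrow> 2 < p \<Longrightarrow> \<not> int p dvd a \<Longrightarrow> Legendre a (int p) * Legendre a (int p) = 1"
  using Legendre_values[of a "int p"] Legendre_eq_0_iff[of a "int p"] by auto

lemma Legendre_1: "prime p \<Longrightarrow> Legendre 1 (int p) = 1"
  using prime_gt_1_int[of "int p"]
  by (auto simp: Legendre_def cong_0_iff QuadRes_def intro: exI[of _ 1])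

lemma kronecker_1 [simp]: "kronecker a 1 = 1" "kronecker a (Suc 0) = 1"
  by (simp_all add: kronecker_def)

lemma kronecker_prime_eq: "prime p \<Longrightarrow> kronecker a p = kronecker_prime a p"
  by (simp add: kronecker_def prime_factorization_prime)

lemma kronecker_odd_prime: "prime p \<Longrightarrow> p \<noteq> 2 \<Longrightarrow> kronecker a p = Legendre a (int p)"
  by (simp add: kronecker_prime_eq kronecker_prime_def)

lemma kronecker_mult_right:
  "0 < m \<Longrightarrow> 0 < n \<Longrightarrow> kronecker a (m * n) = kronecker a m * kronecker a n"
  by (simp add: kronecker_def prime_factorization_mult)

lemma kronecker_power_right: "0 < m \<Longrightarrow> kronecker a (m ^ k) = kronecker a m ^ k"
  by (induction k) (simp_all add: kronecker_mult_right)

text \<open>One prime factor is split off at a time, matching the multiplicativity of the Kronecker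
  symbol in its lower argument.\<close>

lemma odd_induct [consumes 1, case_names one mult]:
  fixes n :: nat
  assumes "odd n" "P 1"
    and "\<And>p n. prime p \<Longrightarrow> 2 < p \<Longrightarrow> odd p \<Longrightarrow> odd n \<Longrightarrow> 0 < n \<Longrightarrow> P n \<Longrightarrow> P (p * n)"
  shows "P n"
  using assms(1)
proof (induction n rule: less_induct)
  case (less n)
  show ?case
  proof (cases "n = 1")
    case False
    then obtain p k where p: "prime p" "n = p * k" by (metis prime_factor_nat dvd_def)
    then have "odd p" "odd k" using less.prems by auto
    then have k: "0 < k" by (auto intro: Nat.gr0I)
    have "2 < p" using p(1) \<open>odd p\<close> prime_ge_2_nat[of p] by (cases "p = 2") auto
    moreover have "k < n" using p k prime_gt_1_nat[of p] by auto
    ultimately show ?thesis using assms(3)[OF p(1) _ \<open>odd p\<close> \<open>odd k\<close> k] less.IH[of k] \<open>odd k\<close> p(2) by simp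
  qed (use assms(2) in simp)
qed

lemma kronecker_mult_left: "odd n \<Longrightarrow> kronecker (a * b) n = kronecker a n * kronecker b n"
proof (induction n rule: odd_induct)
  case (mult p n)
  then show ?case
    by (simp add: kronecker_mult_right kronecker_odd_prime Legendre_mult prime_gt_0_nat)
qed simp

lemma kronecker_cong: "odd n \<Longrightarrow> [a = b] (mod int n) \<Longrightarrow> kronecker a n = kronecker b n"
proof (induction n rule: odd_induct)
  case (mult p n)
  then have "[a = b] (mod int p)" "[a = b] (mod int n)"
    by (auto intro: cong_dvd_modulus)
  then show ?case using mult Legendre_cong[of a b "int p"]
    by (simp add: kronecker_mult_right kronecker_odd_prime prime_gt_0_nat)
qed simp

lemma kronecker_square: "odd n \<Longrightarrow> coprime a (int n) \<Longrightarrow> kronecker a n * kronecker a n = 1"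
proof (induction n rule: odd_induct)
  case (mult p n)
  then have c: "coprime a (int p)" "coprime a (int n)" by auto
  have "\<not> int p dvd a"
    using c(1) mult(1) by (metis coprime_absorb_right not_prime_unit prime_nat_int_transfer coprime_commute)
  then have "Legendre a (int p) * Legendre a (int p) = 1" using mult by (intro Legendre_square)
  then have "(Legendre a (int p) * Legendre a (int p)) * (kronecker a n * kronecker a n) = 1"
    using mult.IH[OF c(2)] by simp
  then show ?case using mult.hyps
    by (simp add: kronecker_mult_right kronecker_odd_prime prime_gt_0_nat algebra_simps)
qed simp

lemma kronecker_sign: "odd n \<Longrightarrow> coprime a (int n) \<Longrightarrow> kronecker a n \<in> {1, -1}"
  using kronecker_square[of n a] by (auto simp: zmult_eq_1_iff)

lemma kronecker_1_left: "odd n \<Longrightarrow> kronecker 1 n = 1"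
proof (induction n rule: odd_induct)
  case (mult p n)
  then show ?case by (simp add: kronecker_mult_right kronecker_odd_prime Legendre_1 prime_gt_0_nat)
qed simp

lemma odd_mod4: "odd (n::nat) \<Longrightarrow> n mod 4 = 1 \<or> n mod 4 = 3"
  by presburger

lemma mod4_mult:
  "(m * n :: nat) mod 4 = ((m mod 4) * (n mod 4)) mod 4"
  by (simp add: mod_mult_eq)

lemma power_neg1_mod4: "odd (n::nat) \<Longrightarrow> (-1 :: int) ^ ((n - 1) div 2) = (if n mod 4 = 1 then 1 else -1)"
proof -
  assume "odd n"
  then consider k where "n = 4 * k + 1" | k where "n = 4 * k + 3"
    by (metis add.commute mod_eqE odd_mod4 mod_mult_div_eq)
  then show ?thesis
  proof cases
    case (1 k)
    then have "(n - 1) div 2 = 2 * k" "n mod 4 = 1" by presburger+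
    then show ?thesis by (simp add: power_mult)
  next
    case (2 k)
    then have "(n - 1) div 2 = 2 * k + 1" "n mod 4 = 3" by presburger+
    then show ?thesis by (simp add: power_mult)
  qed
qed

lemma kronecker_minus_1: "odd n \<Longrightarrow> kronecker (-1) n = (if n mod 4 = 1 then 1 else -1)"
proof (induction n rule: odd_induct)
  case (mult p n)
  have "Legendre (-1) (int p) = (-1) ^ ((p - 1) div 2)"
    using euler_criterion[OF mult(1,2), of "-1"] mult Legendre_values[of "-1" "int p"]
    by (intro eq_of_cong_sign[of _ _ "int p"]) (simp_all add: minus_one_power_iff)
  then have "Legendre (-1) (int p) = (if p mod 4 = 1 then 1 else -1)"
    using power_neg1_mod4[OF mult(3)] by simp
  then show ?case using mult odd_mod4[of p] odd_mod4[of n] mod4_mult[of p n]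
    by (auto simp: kronecker_mult_right kronecker_odd_prime prime_gt_0_nat)
qed simp

lemma Legendre_reciprocity:
  assumes "prime p" "2 < p" "prime r" "2 < r" "p \<noteq> r"
  shows "Legendre (int p) (int r) * Legendre (int r) (int p) = (if p mod 4 = 3 \<and> r mod 4 = 3 then -1 else 1)"
proof -
  have o: "odd p" "odd r" using assms by (simp_all add: prime_odd_nat)
  have "Legendre (int p) (int r) * Legendre (int r) (int p) = (-1::int) ^ ((p - 1) div 2 * ((r - 1) div 2))"
    using Quadratic_Reciprocity[OF assms] by simp
  also have "\<dots> = ((-1) ^ ((p - 1) div 2)) ^ ((r - 1) div 2)" by (simp only: power_mult)
  also have "\<dots> = (if p mod 4 = 1 then 1 else (if r mod 4 = 1 then 1 else -1))"
    using power_neg1_mod4[OF o(1)] power_neg1_mod4[OF o(2)] by simp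
  finally show ?thesis using odd_mod4[OF o(1)] odd_mod4[OF o(2)] by auto
qed

text \<open>Both sides are multiplicative in \<open>m\<close> and in \<open>n\<close>, so two
  inductions over prime factors reduce the claim to the reciprocity law for two distinct odd primes.
  The first induction treats a prime in one argument.\<close>

theorem kronecker_reciprocity:
  assumes "odd m" "odd n" "coprime m n"
  shows "kronecker (int m) n * kronecker (int n) m = (if m mod 4 = 3 \<and> n mod 4 = 3 then -1 else 1)"
proof -
  have prime_case: "kronecker (int p) n * kronecker (int n) p = (if p mod 4 = 3 \<and> n mod 4 = 3 then -1 else 1)"
    if p: "prime p" "2 < p" "odd p" and "odd n" "coprime p n" for p n :: nat
    using that(4,5)
  proof (induction n rule: odd_induct)
    case one
    then show ?case by (simp add: kronecker_1_left[OF p(3)])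
  next
    case (mult r n)
    then have c: "coprime p n" "p \<noteq> r" using p by (auto simp: coprime_def dest: prime_gt_1_nat)
    have "kronecker (int p) (r * n) * kronecker (int (r * n)) p
       = (Legendre (int p) (int r) * Legendre (int r) (int p)) * (kronecker (int p) n * kronecker (int n) p)"
    proof -
      have "kronecker (int p) (r * n) = Legendre (int p) (int r) * kronecker (int p) n"
        using mult by (simp add: kronecker_mult_right kronecker_odd_prime prime_gt_0_nat)
      moreover have "kronecker (int (r * n)) p = Legendre (int r) (int p) * kronecker (int n) p"
        using p by (simp add: kronecker_mult_left) (simp add: kronecker_odd_prime)
      ultimately show ?thesis by (simp only: mult_ac)
    qed
    also have "\<dots> = (if p mod 4 = 3 \<and> r mod 4 = 3 then -1 else 1) * (if p mod 4 = 3 \<and> n mod 4 = 3 then -1 else 1)"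
      using mult.IH[OF c(1)] Legendre_reciprocity[OF p(1,2) mult(1,2) c(2)] by simp
    also have "\<dots> = (if p mod 4 = 3 \<and> (r * n) mod 4 = 3 then -1 else 1)"
      using mult odd_mod4[of r] odd_mod4[of n] mod4_mult[of r n] by auto
    finally show ?case .
  qed
  show ?thesis using assms(1,3)
  proof (induction m rule: odd_induct)
    case one
    then show ?case by (simp add: kronecker_1_left[OF assms(2)])
  next
    case (mult p m)
    then have c: "coprime p n" "coprime m n" by auto
    have "kronecker (int (p * m)) n * kronecker (int n) (p * m)
       = (kronecker (int p) n * kronecker (int n) p) * (kronecker (int m) n * kronecker (int n) m)"
      using mult assms by (simp add: kronecker_mult_right kronecker_mult_left prime_gt_0_nat)
    also have "\<dots> = (if p mod 4 = 3 \<and> n mod 4 = 3 then -1 else 1) * (if m mod 4 = 3 \<and> n mod 4 = 3 then -1 else 1)"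
      using mult.IH[OF c(2)] prime_case[OF mult(1-3) assms(2) c(1)] by simp
    also have "\<dots> = (if (p * m) mod 4 = 3 \<and> n mod 4 = 3 then -1 else 1)"
      using mult odd_mod4[of p] odd_mod4[of m] mod4_mult[of p m] by auto
    finally show ?case .
  qed
qed

section \<open>The quadratic Gauss sum\<close>

text \<open>The sign is determined as in Gauss' original proof: the alternating sum of the \<open>q\<close>-binomial
  coefficients of order \<open>p - 1\<close> at a \<open>p\<close>-th root of unity is on one hand the Gauss sum and on the
  other hand a product of sines.\<close>

primrec qbinomial :: "complex \<Rightarrow> nat \<Rightarrow> nat \<Rightarrow> complex" where
  "qbinomial z 0 j = (if j = 0 then 1 else 0)"
| "qbinomial z (Suc m) j = (case j of 0 \<Rightarrow> 1 | Suc i \<Rightarrow> qbinomial z m i + z ^ Suc i * qbinomial z m (Suc i))"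

lemma qbinomial_0 [simp]: "qbinomial z m 0 = 1"
  by (cases m) auto

lemma qbinomial_gt [simp]: "m < j \<Longrightarrow> qbinomial z m j = 0"
  by (induction m arbitrary: j) (auto split: nat.split)

lemma qbinomial_Suc_Suc: "qbinomial z (Suc m) (Suc i) = qbinomial z m i + z ^ Suc i * qbinomial z m (Suc i)"
  by simp

text \<open>The second Pascal rule for Gaussian binomials. Comparing it with the defining one yields
  the ratio of neighbouring coefficients without dividing by quantities that may vanish at a root of
  unity.\<close>

lemma qbinomial_Suc_Suc':
  "i \<le> m \<Longrightarrow> qbinomial z (Suc m) (Suc i) = z ^ (m - i) * qbinomial z m i + qbinomial z m (Suc i)"
proof (induction m arbitrary: i)
  case (Suc m)
  show ?case
  proof (cases i)
    case 0
    then show ?thesis using Suc.IH[of 0] by (simp add: algebra_simps)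
  next
    case i: (Suc k)
    show ?thesis
    proof (cases "k = m")
      case True
      then show ?thesis using i by simp
    next
      case False
      then have k: "k < m" using Suc.prems i by simp
      then obtain d where m: "m = Suc k + d" using less_iff_Suc_add by auto
      have a: "qbinomial z (Suc m) (Suc k) = z ^ Suc d * qbinomial z m k + qbinomial z m (Suc k)"
        using Suc.IH[of k] k m by simp
      have b: "qbinomial z (Suc m) (Suc (Suc k)) = z ^ d * qbinomial z m (Suc k) + qbinomial z m (Suc (Suc k))"
        using Suc.IH[of "Suc k"] k m by simp
      have "qbinomial z (Suc (Suc m)) (Suc i) = qbinomial z (Suc m) (Suc k) + z ^ Suc (Suc k) * qbinomial z (Suc m) (Suc (Suc k))"
        using i by (simp only: qbinomial_Suc_Suc)
      also have "\<dots> = z ^ Suc d * qbinomial z m k + qbinomial z m (Suc k)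
         + z ^ Suc (Suc k) * (z ^ d * qbinomial z m (Suc k) + qbinomial z m (Suc (Suc k)))"
        by (simp only: a b)
      also have "\<dots> = z ^ Suc d * (qbinomial z m k + z ^ Suc k * qbinomial z m (Suc k))
          + (qbinomial z m (Suc k) + z ^ Suc (Suc k) * qbinomial z m (Suc (Suc k)))"
        by (simp add: algebra_simps power_add)
      also have "\<dots> = z ^ (Suc m - i) * qbinomial z (Suc m) i + qbinomial z (Suc m) (Suc i)"
        using i m by (simp only: qbinomial_Suc_Suc) simp
      finally show ?thesis .
    qed
  qed
qed simp

text \<open>Each Pascal rule gives one relation between the alternating sum \<open>f\<close> and its
  twist \<open>h\<close>; eliminating \<open>h\<close> leaves Gauss' recursion from \<open>m\<close>
  to \<open>m + 2\<close> with the factor \<open>1 - z ^ Suc m\<close>.\<close>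

lemma qbinomial_alternating_sum:
  defines "f \<equiv> \<lambda>z m. \<Sum>j\<le>m. (-1) ^ j * qbinomial z m j"
  shows "f z (2 * r) = (\<Prod>t<r. 1 - z ^ (2 * t + 1))"
proof -
  define h where "h m = (\<Sum>j\<le>m. (-1) ^ j * z ^ j * qbinomial z m j)" for m
  have ext: "(\<Sum>j\<le>Suc m. (-1) ^ j * c j * qbinomial z m j) = (\<Sum>j\<le>m. (-1) ^ j * c j * qbinomial z m j)" for m c
    by simp
  have f1: "f z (Suc m) = h m - f z m" for m
  proof -
    have "f z (Suc m) = 1 + (\<Sum>j\<le>m. (-1) ^ Suc j * qbinomial z (Suc m) (Suc j))"
      unfolding f_def by (subst sum.atMost_Suc_shift) simp
    also have "\<dots> = (1 + (\<Sum>j\<le>m. (-1) ^ Suc j * z ^ Suc j * qbinomial z m (Suc j))) - f z m"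
      unfolding qbinomial_Suc_Suc f_def by (simp add: algebra_simps sum.distrib sum_negf sum_subtractf)
    also have "1 + (\<Sum>j\<le>m. (-1) ^ Suc j * z ^ Suc j * qbinomial z m (Suc j)) = (\<Sum>j\<le>Suc m. (-1) ^ j * z ^ j * qbinomial z m j)"
      by (subst sum.atMost_Suc_shift) simp
    also have "\<dots> = h m" unfolding h_def by (rule ext)
    finally show ?thesis .
  qed
  have h1: "h (Suc m) = h m - z ^ Suc m * f z m" for m
  proof -
    have "h (Suc m) = 1 + (\<Sum>j\<le>m. (-1) ^ Suc j * z ^ Suc j * qbinomial z (Suc m) (Suc j))"
      unfolding h_def by (subst sum.atMost_Suc_shift) simp
    also have "(\<Sum>j\<le>m. (-1) ^ Suc j * z ^ Suc j * qbinomial z (Suc m) (Suc j))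
       = (\<Sum>j\<le>m. (-1) ^ Suc j * z ^ Suc j * qbinomial z m (Suc j) - z ^ Suc m * ((-1) ^ j * qbinomial z m j))"
    proof (rule sum.cong[OF refl])
      fix j assume "j \<in> {..m}"
      then have j: "j \<le> m" by simp
      have "z ^ Suc m = z ^ Suc j * z ^ (m - j)" using j by (simp flip: power_add)
      then show "(-1) ^ Suc j * z ^ Suc j * qbinomial z (Suc m) (Suc j)
         = (-1) ^ Suc j * z ^ Suc j * qbinomial z m (Suc j) - z ^ Suc m * ((-1) ^ j * qbinomial z m j)"
        by (simp only: qbinomial_Suc_Suc'[OF j]) (simp add: algebra_simps)
    qed
    also have "\<dots> = (\<Sum>j\<le>m. (-1) ^ Suc j * z ^ Suc j * qbinomial z m (Suc j)) - z ^ Suc m * f z m"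
      unfolding f_def by (simp add: sum_subtractf sum_distrib_left)
    also have "1 + (\<dots>) = (\<Sum>j\<le>Suc m. (-1) ^ j * z ^ j * qbinomial z m j) - z ^ Suc m * f z m"
      by (subst sum.atMost_Suc_shift) simp
    also have "(\<Sum>j\<le>Suc m. (-1) ^ j * z ^ j * qbinomial z m j) = h m" unfolding h_def by (rule ext)
    finally show ?thesis .
  qed
  have f2: "f z (Suc (Suc m)) = (1 - z ^ Suc m) * f z m" for m
    unfolding f1[of "Suc m"] h1 f1[of m] by (simp add: algebra_simps)
  show ?thesis
  proof (induction r)
    case 0
    then show ?case by (simp add: f_def)
  next
    case (Suc r)
    then show ?case using f2[of "2 * r"] by simp
  qed
qed

section \<open>Sums over residue classes and additive characters\<close>

lemma sum_periodic_shift: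
  fixes F :: "int \<Rightarrow> complex"
  assumes "\<And>x. F (x mod n) = F x" "0 < n"
  shows "(\<Sum>x\<in>{0..<n}. F (x + c)) = (\<Sum>x\<in>{0..<n}. F x)"
proof (rule sum.reindex_bij_witness[of _ "\<lambda>x. (x - c) mod n" "\<lambda>x. (x + c) mod n"])
  fix x assume "x \<in> {0..<n}"
  then show "((x + c) mod n - c) mod n = x" "((x - c) mod n + c) mod n = x"
    by (simp_all add: mod_diff_left_eq mod_add_left_eq)
  show "F ((x + c) mod n) = F (x + c)" by (rule assms)
qed (use assms in auto)

lemma sum_periodic_mult:
  fixes F :: "int \<Rightarrow> complex"
  assumes "\<And>x. F (x mod n) = F x" "0 < n" "coprime u n"
  shows "(\<Sum>x\<in>{0..<n}. F (u * x)) = (\<Sum>x\<in>{0..<n}. F x)"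
proof -
  obtain v where v: "[u * v = 1] (mod n)" using cong_solve_coprime_int[OF assms(3)] by auto
  have vu: "(v * (u * x)) mod n = x mod n" "(u * (v * x)) mod n = x mod n" for x
    using cong_scalar_right[OF v, of x] by (simp_all add: cong_def algebra_simps)
  show ?thesis
  proof (rule sum.reindex_bij_witness[of _ "\<lambda>x. (v * x) mod n" "\<lambda>x. (u * x) mod n"])
    fix x assume "x \<in> {0..<n}"
    then show "(v * ((u * x) mod n)) mod n = x" "(u * ((v * x) mod n)) mod n = x"
      by (simp_all add: mod_mult_right_eq vu)
    show "F ((u * x) mod n) = F (u * x)" by (rule assms)
  qed (use assms in auto)
qed

definition efr :: "int \<Rightarrow> int \<Rightarrow> complex" where
  "efr n x = er (of_int x / of_int n)"

lemma efr_add: "efr n (x + y) = efr n x * efr n y"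
  by (simp add: efr_def add_divide_distrib er_add)

lemma efr_0 [simp]: "efr n 0 = 1"
  by (simp add: efr_def)

lemma efr_power: "efr n x ^ k = efr n (int k * x)"
  by (simp add: efr_def er_power)

lemma cnj_efr: "cnj (efr n x) = efr n (- x)"
  by (simp add: efr_def cnj_er)

lemma efr_eq_1_iff: "0 < n \<Longrightarrow> efr n x = 1 \<longleftrightarrow> n dvd x"
proof -
  assume n: "0 < n"
  have "of_int x / of_int n \<in> (\<int> :: rat set) \<longleftrightarrow> n dvd x"
  proof
    assume "of_int x / of_int n \<in> (\<int> :: rat set)"
    then obtain k where "of_int x / of_int n = (of_int k :: rat)" by (elim Ints_cases)
    then have "of_int x = (of_int (n * k) :: rat)" using n by (simp add: field_simps)
    then show "n dvd x" by (simp only: of_int_eq_iff dvd_triv_left)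
  next
    assume "n dvd x"
    then show "of_int x / of_int n \<in> (\<int> :: rat set)" using n by (elim dvdE) simp
  qed
  then show ?thesis by (simp only: efr_def er_eq_1_iff)
qed

lemma efr_cong: "0 < n \<Longrightarrow> [x = y] (mod n) \<Longrightarrow> efr n x = efr n y"
proof -
  assume n: "0 < n" and "[x = y] (mod n)"
  then have "efr n (x - y) = 1" by (simp only: efr_eq_1_iff[OF n] cong_iff_dvd_diff)
  then show ?thesis using efr_add[of n "x - y" y] by simp
qed

lemma efr_mod: "0 < n \<Longrightarrow> efr n (x mod n) = efr n x"
  by (rule efr_cong) (simp_all add: cong_def)

lemma sum_efr:
  assumes "0 < n"
  shows "(\<Sum>x\<in>{0..<n}. efr n (j * x)) = (if n dvd j then of_int n else 0)"
proof -
  define F where "F x = efr n (j * x)" for x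
  have per: "F (x mod n) = F x" for x
    unfolding F_def by (intro efr_cong assms cong_scalar_left) (simp add: cong_def)
  have "(\<Sum>x\<in>{0..<n}. F x) = (\<Sum>x\<in>{0..<n}. F (x + 1))"
    using sum_periodic_shift[of F n 1] per assms by simp
  also have "\<dots> = (\<Sum>x\<in>{0..<n}. F x) * efr n j"
    unfolding sum_distrib_right F_def by (intro sum.cong refl) (simp add: ring_distribs efr_add)
  finally have *: "(\<Sum>x\<in>{0..<n}. F x) * (1 - efr n j) = 0" by (simp add: ring_distribs)
  show ?thesis
  proof (cases "n dvd j")
    case True
    then have "F x = 1" for x unfolding F_def using assms by (simp add: efr_eq_1_iff)
    then show ?thesis using True assms unfolding F_def by simp
  next
    case False
    then show ?thesis using * efr_eq_1_iff[OF assms, of j] unfolding F_def by simp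
  qed
qed

section \<open>The quadratic Gauss sum of an odd prime\<close>

definition quad_gauss :: "nat \<Rightarrow> complex" where
  "quad_gauss p = (\<Sum>x\<in>{0..<int p}. efr (int p) (x\<^sup>2))"

context
  fixes p :: nat
  assumes p: "prime p" "2 < p"
begin

lemma p_odd: "odd p"
  using p by (simp add: prime_odd_nat)

lemma p_pos: "0 < int p"
  using p by simp

lemma quad_gauss_periodic: "efr (int p) ((x mod int p)\<^sup>2) = efr (int p) (x\<^sup>2)"
  by (intro efr_cong p_pos cong_pow) (simp add: cong_def)

text \<open>Shift and orthogonality again; 2 is invertible because \<open>p\<close> is odd. This
  settles the modulus, so that only the argument is left to the sine product.\<close>

lemma quad_gauss_norm: "quad_gauss p * cnj (quad_gauss p) = of_nat p"
proof -
  let ?e = "efr (int p)"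
  note add = efr_add[of "int p"]
  have "quad_gauss p * cnj (quad_gauss p) = (\<Sum>y\<in>{0..<int p}. \<Sum>x\<in>{0..<int p}. ?e (x\<^sup>2) * ?e (- y\<^sup>2))"
    unfolding quad_gauss_def cnj_sum cnj_efr sum_product by (subst sum.swap) simp
  also have "\<dots> = (\<Sum>y\<in>{0..<int p}. \<Sum>x\<in>{0..<int p}. ?e ((x + y)\<^sup>2) * ?e (- y\<^sup>2))"
    unfolding sum_distrib_right[symmetric]
    using sum_periodic_shift[of "\<lambda>x. ?e (x\<^sup>2)", OF quad_gauss_periodic p_pos] by simp
  also have "\<dots> = (\<Sum>y\<in>{0..<int p}. \<Sum>x\<in>{0..<int p}. ?e (x\<^sup>2) * ?e (2 * x * y))"
    by (intro sum.cong refl) (simp add: power2_eq_square algebra_simps flip: add)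
  also have "\<dots> = (\<Sum>x\<in>{0..<int p}. ?e (x\<^sup>2) * (\<Sum>y\<in>{0..<int p}. ?e (2 * x * y)))"
    by (subst sum.swap) (simp add: sum_distrib_left)
  also have "\<dots> = (\<Sum>x\<in>{0..<int p}. if x = 0 then of_nat p else 0)"
  proof (rule sum.cong[OF refl])
    fix x assume x: "x \<in> {0..<int p}"
    have "int p dvd 2 * x \<longleftrightarrow> x = 0"
    proof
      assume "int p dvd 2 * x"
      moreover have "coprime (int p) 2" using p_odd by simp
      ultimately have "int p dvd x" by (simp add: coprime_dvd_mult_right_iff)
      then show "x = 0" using x zdvd_imp_le[of "int p" x] by (cases "x = 0") auto
    qed simp
    then show "?e (x\<^sup>2) * (\<Sum>y\<in>{0..<int p}. ?e (2 * x * y)) = (if x = 0 then of_nat p else 0)"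
      using sum_efr[OF p_pos, of "2 * x"] by simp
  qed
  also have "\<dots> = of_nat p" using p_pos by (simp add: sum.delta)
  finally show ?thesis .
qed

lemma quad_gauss_sine_product:
  "quad_gauss p = \<i> ^ ((p - 1) div 2) * of_real (\<Prod>t<(p - 1) div 2. 2 * sin (2 * pi * real (2 * t + 1) / real p))"
proof -
  let ?e = "efr (int p)"
  define r where "r = (p - 1) div 2"
  have pr: "p = 2 * r + 1" using p_odd by (auto simp: r_def elim: oddE)
  note add = efr_add[of "int p"]
  note pow = efr_power[of "int p"]
  \<comment> \<open>At this root of unity \<open>1 - z ^ (2 * r - j)\<close> and
    \<open>1 - z ^ Suc j\<close> differ only by a phase, so the coefficients become explicit phases
    with quadratic exponent.\<close>
  define z where "z = ?e (-2)"
  have z_pow: "z ^ k = ?e (- 2 * int k)" for k unfolding z_def by (simp add: pow mult.commute)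
  have gb: "qbinomial z (2 * r) j = (-1) ^ j * ?e (int j * (int j + 1))" if "j \<le> 2 * r" for j
    using that
  proof (induction j)
    case (Suc j)
    have j: "j \<le> 2 * r" using Suc by simp
    \<comment> \<open>Equating the two Pascal rules gives the quotient of neighbouring coefficients;
      dividing is legitimate because \<open>j + 1 < p\<close>.\<close>
    have "qbinomial z (2 * r) j + z ^ Suc j * qbinomial z (2 * r) (Suc j)
        = z ^ (2 * r - j) * qbinomial z (2 * r) j + qbinomial z (2 * r) (Suc j)"
      using qbinomial_Suc_Suc[of z "2 * r" j] qbinomial_Suc_Suc'[OF j, of z] by metis
    then have eq: "qbinomial z (2 * r) (Suc j) * (1 - z ^ Suc j) = qbinomial z (2 * r) j * (1 - z ^ (2 * r - j))"
      by (simp add: algebra_simps)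
    have zz: "z ^ (2 * r - j) = ?e (2 * (int j + 1))"
      unfolding z_pow
    proof (rule efr_cong[OF p_pos])
      have "- 2 * int (2 * r - j) - 2 * (int j + 1) = int p * (- 2)"
        using j pr by (simp add: of_nat_diff)
      then show "[- 2 * int (2 * r - j) = 2 * (int j + 1)] (mod int p)"
        by (metis cong_iff_dvd_diff dvd_triv_left)
    qed
    have zs: "z ^ Suc j = ?e (- (2 * (int j + 1)))" by (simp only: z_pow) (simp add: algebra_simps)
    have inv: "?e (2 * (int j + 1)) * ?e (- (2 * (int j + 1))) = 1" by (simp flip: add)
    have "1 - z ^ (2 * r - j) = - ?e (2 * (int j + 1)) * (1 - z ^ Suc j)"
      unfolding zz zs using inv by (simp add: algebra_simps)
    moreover have "1 - z ^ Suc j \<noteq> 0"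
    proof
      assume "1 - z ^ Suc j = 0"
      then have "?e (- 2 * (int j + 1)) = 1" using zs by simp
      then have "int p dvd - (2 * (int j + 1))" using efr_eq_1_iff[OF p_pos, of "- 2 * (int j + 1)"] by simp
      then have "int p dvd 2 * (int j + 1)" by (simp only: dvd_minus_iff)
      moreover have "coprime (int p) 2" using p_odd by simp
      ultimately have "int p dvd int j + 1" using coprime_dvd_mult_right_iff by blast
      then show False using zdvd_imp_le[of "int p" "int j + 1"] Suc.prems pr by simp
    qed
    moreover have "qbinomial z (2 * r) (Suc j) * (1 - z ^ Suc j) = (- ?e (2 * (int j + 1)) * qbinomial z (2 * r) j) * (1 - z ^ Suc j)"
      unfolding eq calculation(1) by (simp only: mult_ac)
    ultimately have "qbinomial z (2 * r) (Suc j) = - ?e (2 * (int j + 1)) * qbinomial z (2 * r) j"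
      by (metis mult_right_cancel)
    also have "\<dots> = (-1) ^ Suc j * (?e (2 * (int j + 1)) * ?e (int j * (int j + 1)))"
      using Suc.IH[OF j] by simp
    also have "?e (2 * (int j + 1)) * ?e (int j * (int j + 1)) = ?e (int (Suc j) * (int (Suc j) + 1))"
      by (simp add: algebra_simps flip: add)
    finally show ?case .
  qed simp
  \<comment> \<open>\<open>h\<close> is the inverse of 2 modulo \<open>p\<close>, so
    \<open>x * (x + 1)\<close> becomes a square after the shift by \<open>h\<close>.\<close>
  define h where "h = int r + 1"
  have "(\<Sum>j\<le>2 * r. (-1) ^ j * qbinomial z (2 * r) j) = (\<Sum>j\<le>2 * r. ?e (int j * (int j + 1)))"
    by (intro sum.cong refl) (simp add: gb flip: mult.assoc power_add)
  also have "\<dots> = (\<Sum>x\<in>{0..<int p}. ?e (x * (x + 1)))"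
    by (rule sum.reindex_bij_witness[of _ nat int]) (auto simp: pr)
  finally have s: "(\<Prod>t<r. 1 - z ^ (2 * t + 1)) = (\<Sum>x\<in>{0..<int p}. ?e (x * (x + 1)))"
    using qbinomial_alternating_sum[of z r] by simp
  have "quad_gauss p = (\<Sum>x\<in>{0..<int p}. ?e ((x + h)\<^sup>2))"
    unfolding quad_gauss_def by (rule sum_periodic_shift[symmetric]) (use quad_gauss_periodic p_pos in auto)
  also have "\<dots> = (\<Sum>x\<in>{0..<int p}. ?e (h\<^sup>2) * ?e (x * (x + 1)))"
  proof (rule sum.cong[OF refl])
    fix x
    have "(x + h)\<^sup>2 - (h\<^sup>2 + x * (x + 1)) = int p * x"
      using pr by (simp add: h_def power2_eq_square algebra_simps)
    then have "[(x + h)\<^sup>2 = h\<^sup>2 + x * (x + 1)] (mod int p)" by (metis cong_iff_dvd_diff dvd_triv_left)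
    then show "?e ((x + h)\<^sup>2) = ?e (h\<^sup>2) * ?e (x * (x + 1))"
      using efr_cong[OF p_pos] add by metis
  qed
  also have "\<dots> = ?e (h\<^sup>2) * (\<Prod>t<r. 1 - z ^ (2 * t + 1))" by (simp only: s sum_distrib_left)
  also have "(\<Prod>t<r. 1 - z ^ (2 * t + 1)) = (\<Prod>t<r. ?e (- int (2 * t + 1)) * (2 * \<i> * of_real (sin (2 * pi * real (2 * t + 1) / real p))))"
  proof (rule prod.cong[OF refl])
    fix t :: nat
    let ?k = "2 * t + 1"
    have ek: "?e (int ?k) = cis (2 * pi * real ?k / real p)"
      by (simp add: efr_def er_def ee_def cis_conv_exp of_rat_divide of_rat_add of_rat_mult field_simps)
    have "2 * \<i> * of_real (sin (2 * pi * real ?k / real p)) = ?e (int ?k) - ?e (- int ?k)"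
    proof -
      have "?e (- int ?k) = cnj (?e (int ?k))" by (simp only: cnj_efr)
      then show ?thesis unfolding ek by (simp add: complex_eq_iff)
    qed
    then show "1 - z ^ ?k = ?e (- int ?k) * (2 * \<i> * of_real (sin (2 * pi * real ?k / real p)))"
      unfolding z_pow by (simp add: right_diff_distrib flip: add)
  qed
  also have "\<dots> = (\<Prod>t<r. ?e (- int (2 * t + 1))) * (\<Prod>t<r. \<i> * of_real (2 * sin (2 * pi * real (2 * t + 1) / real p)))"
    by (simp add: prod.distrib mult_ac)
  also have "(\<Prod>t<r. ?e (- int (2 * t + 1))) = ?e (- (int r)\<^sup>2)"
    by (induction r) (simp_all add: power2_eq_square algebra_simps flip: add)
  also have "(\<Prod>t<r. \<i> * of_real (2 * sin (2 * pi * real (2 * t + 1) / real p)))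
     = \<i> ^ r * of_real (\<Prod>t<r. 2 * sin (2 * pi * real (2 * t + 1) / real p))"
    by (simp add: prod.distrib)
  also have "?e (h\<^sup>2) * (?e (- (int r)\<^sup>2) * (\<i> ^ r * of_real (\<Prod>t<r. 2 * sin (2 * pi * real (2 * t + 1) / real p))))
     = \<i> ^ r * of_real (\<Prod>t<r. 2 * sin (2 * pi * real (2 * t + 1) / real p))"
  proof -
    \<comment> \<open>The phase from completing the square cancels against the product of the phases
      split off from the factors.\<close>
    have "h\<^sup>2 + - (int r)\<^sup>2 = int p" using pr by (simp add: h_def power2_eq_square algebra_simps)
    then have "?e (h\<^sup>2) * ?e (- (int r)\<^sup>2) = 1"
      using efr_eq_1_iff[OF p_pos, of "int p"] by (simp only: add[symmetric]) simp
    then show ?thesis by (simp flip: mult.assoc)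
  qed
  finally show ?thesis unfolding r_def .
qed

text \<open>Of the \<open>r\<close> sines exactly the last \<open>a = p div 4\<close> have an
  argument between pi and 2 pi and are negative. With the modulus from
  \<open>quad_gauss_norm\<close> this gives \<open>R = (- 1) ^ a * sqrt p\<close>, and
  \<open>\<i> ^ r * (- 1) ^ a\<close> is \<open>eps p\<close>.\<close>

theorem quad_gauss_value: "quad_gauss p = eps p * of_real (sqrt (real p))"
proof -
  define r where "r = (p - 1) div 2"
  define a where "a = p div 4"
  define R where "R = (\<Prod>t<r. 2 * sin (2 * pi * real (2 * t + 1) / real p))"
  have pr: "p = 2 * r + 1" using p_odd by (auto simp: r_def elim: oddE)
  have a: "(p mod 4 = 1 \<and> p = 4 * a + 1 \<and> r = 2 * a) \<or> (p mod 4 = 3 \<and> p = 4 * a + 3 \<and> r = 2 * a + 1)"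
    using odd_mod4[OF p_odd] pr unfolding a_def by presburger
  have G: "quad_gauss p = \<i> ^ r * of_real R"
    using quad_gauss_sine_product by (simp add: r_def R_def)
  have pos: "0 < sin (2 * pi * real (2 * t + 1) / real p)" if "t < r - a" for t
  proof (rule sin_gt_zero)
    show "0 < 2 * pi * real (2 * t + 1) / real p" using p_pos by simp
    have "2 * (2 * t + 1) < p" using that a by auto
    then have "pi * real (2 * (2 * t + 1)) < pi * real p" by (simp only: of_nat_less_iff mult_less_cancel_left_pos pi_gt_zero)
    then show "2 * pi * real (2 * t + 1) / real p < pi" using p_pos pi_gt_zero
      by (simp add: field_simps)
  qed
  have neg: "sin (2 * pi * real (2 * t + 1) / real p) < 0" if "r - a \<le> t" "t < r" for t
  proof (rule sin_lt_zero)
    have "p < 2 * (2 * t + 1)" using that a by auto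
    then have "pi * real p < pi * real (2 * (2 * t + 1))" by (simp only: of_nat_less_iff mult_less_cancel_left_pos pi_gt_zero)
    then show "pi < 2 * pi * real (2 * t + 1) / real p" using p_pos pi_gt_zero
      by (simp add: field_simps)
    have "2 * t + 1 < p" using that pr by auto
    then have "(2 * pi) * real (2 * t + 1) < (2 * pi) * real p" by simp
    then show "2 * pi * real (2 * t + 1) / real p < 2 * pi" using p_pos pi_gt_zero
      by (simp add: field_simps)
  qed
  have ra: "a \<le> r" using a by auto
  have "R = (\<Prod>t\<in>{..<r - a}. 2 * sin (2 * pi * real (2 * t + 1) / real p)) * (\<Prod>t\<in>{r - a..<r}. 2 * sin (2 * pi * real (2 * t + 1) / real p))"
    unfolding R_def by (subst prod.union_disjoint[symmetric]) (auto intro!: prod.cong)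
  also have "(\<Prod>t\<in>{r - a..<r}. 2 * sin (2 * pi * real (2 * t + 1) / real p))
      = (-1) ^ a * (\<Prod>t\<in>{r - a..<r}. - (2 * sin (2 * pi * real (2 * t + 1) / real p)))"
    using ra by (simp add: prod_uminus flip: power_add mult.assoc)
  finally have "(-1) ^ a * R = (\<Prod>t\<in>{..<r - a}. 2 * sin (2 * pi * real (2 * t + 1) / real p))
       * (\<Prod>t\<in>{r - a..<r}. - (2 * sin (2 * pi * real (2 * t + 1) / real p)))"
    by (simp flip: power_add mult.assoc)
  also have "\<dots> > 0" by (intro mult_pos_pos prod_pos) (use pos neg in auto)
  finally have Rpos: "0 < (-1) ^ a * R" .
  have "of_real (R\<^sup>2) = (of_real (real p) :: complex)"
  proof -
    have "quad_gauss p * cnj (quad_gauss p) = of_real (R\<^sup>2)"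
      unfolding G by (simp add: power2_eq_square power_mult_distrib[symmetric] flip: complex_cnj_power)
         (simp flip: power_mult_distrib mult.assoc add: mult_ac)
    then show ?thesis using quad_gauss_norm by simp
  qed
  then have "((-1) ^ a * R)\<^sup>2 = real p" by (simp only: of_real_eq_iff power_mult_distrib flip: power_mult) simp
  then have Rv: "(-1) ^ a * R = sqrt (real p)" using Rpos real_sqrt_unique by fastforce
  then have "R = (-1) ^ a * sqrt (real p)" by (metis (no_types, lifting) mult.assoc mult_1 power_add power_mult_distrib left_minus_one_mult_self)
  moreover have "\<i> ^ r * (-1) ^ a = eps p"
    using a
  proof
    assume h: "p mod 4 = 1 \<and> p = 4 * a + 1 \<and> r = 2 * a"
    then have "eps p = 1" by (simp add: eps_def cong_def)
    then show ?thesis using h by (simp add: power_mult flip: power_mult_distrib)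
  next
    assume h: "p mod 4 = 3 \<and> p = 4 * a + 3 \<and> r = 2 * a + 1"
    then have "eps p = \<i>" by (simp add: eps_def cong_def)
    then show ?thesis using h by (simp add: power_mult mult.assoc flip: power_mult_distrib)
  qed
  ultimately show ?thesis unfolding G by (simp flip: mult.assoc)
qed

text \<open>A residue class \<open>b\<close> has \<open>1 + Legendre b p\<close> square roots modulo
  \<open>p\<close>, also for \<open>b = 0\<close>; the sum is grouped by the square of
  \<open>x\<close>.\<close>

lemma sum_over_squares:
  fixes F :: "int \<Rightarrow> complex"
  assumes per: "\<And>x. F (x mod int p) = F x"
  shows "(\<Sum>x\<in>{0..<int p}. F (x\<^sup>2)) = (\<Sum>b\<in>{0..<int p}. (1 + of_int (Legendre b (int p))) * F b)"
proof -
  have cnt: "of_nat (card {x \<in> {0..<int p}. x\<^sup>2 mod int p = b}) = (1 + of_int (Legendre b (int p)) :: complex)"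
    if b: "b \<in> {0..<int p}" for b
  proof -
    let ?S = "{x \<in> {0..<int p}. x\<^sup>2 mod int p = b}"
    have dvd_pow: "int p dvd x\<^sup>2 \<longleftrightarrow> int p dvd x" for x
      using p(1) by (simp add: prime_dvd_power_iff)
    consider "b = 0" | "b \<noteq> 0" "\<not> QuadRes (int p) b" | y where "b \<noteq> 0" "[y\<^sup>2 = b] (mod int p)"
      unfolding QuadRes_def by blast
    then show ?thesis
    proof cases
      case 1
      have "?S = {0}"
      proof (intro equalityI subsetI)
        fix x assume "x \<in> ?S"
        then have "int p dvd x" "0 \<le> x" "x < int p" using 1 dvd_pow[of x] by auto
        then show "x \<in> {0}" using zdvd_imp_le[of "int p" x] by (cases "x = 0") auto
      qed (use 1 p_pos in auto)
      moreover have "Legendre b (int p) = 0" using 1 by (simp add: Legendre_eq_0_iff)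
      ultimately show ?thesis by simp
    next
      case 2
      have "?S = {}" using 2 b unfolding QuadRes_def by (auto simp: cong_def)
      moreover have "\<not> int p dvd b" using 2 b zdvd_imp_le[of "int p" b] by auto
      ultimately show ?thesis using 2 by (simp only: Legendre_def cong_0_iff) simp
    next
      case (3 y)
      define x where "x = y mod int p"
      have x: "x \<in> {0..<int p}" "x\<^sup>2 mod int p = b"
        using p_pos 3 b by (auto simp: x_def cong_def power_mod)
      have nd: "\<not> int p dvd b" using 3 b zdvd_imp_le[of "int p" b] by auto
      then have x0: "x \<noteq> 0" using x(2) by auto
      have "?S = {x, int p - x}"
      proof (intro equalityI subsetI)
        fix w assume w: "w \<in> ?S"
        then have "w\<^sup>2 mod int p = x\<^sup>2 mod int p" using x by simp
        then have "int p dvd w\<^sup>2 - x\<^sup>2" by (simp add: mod_eq_dvd_iff)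
        then have "int p dvd (w - x) * (w + x)" by (simp add: power2_eq_square algebra_simps)
        then have "int p dvd w - x \<or> int p dvd w + x" using p(1) by (simp add: prime_dvd_mult_iff)
        then show "w \<in> {x, int p - x}"
        proof
          assume "int p dvd w - x"
          then have "w mod int p = x mod int p" by (simp add: mod_eq_dvd_iff)
          then show ?thesis using w x by simp
        next
          assume d: "int p dvd w + x"
          then obtain k where k: "w + x = int p * k" by (elim dvdE)
          have "0 < w + x" "w + x < 2 * int p" using w x x0 by auto
          then have "0 < k" "k < 2" using k p_pos
            by (auto simp: zero_less_mult_iff)
          then have "k = 1" by simp
          then show ?thesis using k by auto
        qed
      next
        fix w assume "w \<in> {x, int p - x}"
        moreover have "(int p - x)\<^sup>2 mod int p = x\<^sup>2 mod int p"
          by (simp add: mod_eq_dvd_iff power2_eq_square algebra_simps)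
        ultimately show "w \<in> ?S" using x x0 by auto
      qed
      moreover have "x \<noteq> int p - x" using p_odd by presburger
      moreover have "Legendre b (int p) = 1"
        using nd 3 unfolding Legendre_def QuadRes_def by (auto simp: cong_0_iff)
      ultimately show ?thesis by simp
    qed
  qed
  have "(\<Sum>x\<in>{0..<int p}. F (x\<^sup>2)) = (\<Sum>x\<in>{0..<int p}. F (x\<^sup>2 mod int p))" by (simp add: per)
  also have "\<dots> = (\<Sum>b\<in>{0..<int p}. \<Sum>x\<in>{x \<in> {0..<int p}. x\<^sup>2 mod int p = b}. F (x\<^sup>2 mod int p))"
    by (rule sum.group[symmetric]) (use p_pos in auto)
  also have "\<dots> = (\<Sum>b\<in>{0..<int p}. of_nat (card {x \<in> {0..<int p}. x\<^sup>2 mod int p = b}) * F b)"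
    by (intro sum.cong refl) simp
  also have "\<dots> = (\<Sum>b\<in>{0..<int p}. (1 + of_int (Legendre b (int p))) * F b)"
    by (intro sum.cong refl) (simp only: cnt)
  finally show ?thesis .
qed

text \<open>For \<open>j\<close> prime to \<open>p\<close>, substitute \<open>j * b\<close> for
  \<open>b\<close>. If \<open>p\<close> divides \<open>j\<close>, both sides vanish, because
  residues and nonresidues balance; this case is met when the exponent \<open>n\<close> is divisible
  by \<open>p\<close>.\<close>

theorem Legendre_gauss_sum:
  "(\<Sum>b\<in>{0..<int p}. of_int (Legendre b (int p)) * efr (int p) (j * b))
     = of_int (Legendre j (int p)) * (eps p * of_real (sqrt (real p)))"
proof -
  let ?e = "efr (int p)"
  let ?L = "\<lambda>b. of_int (Legendre b (int p)) :: complex"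
  have Lper: "Legendre (x mod int p) (int p) = Legendre x (int p)" for x
    by (rule Legendre_cong) (simp add: cong_def)
  have eper: "?e (x mod int p) = ?e x" for x by (rule efr_mod[OF p_pos])
  have one: "(\<Sum>b\<in>{0..<int p}. ?L b * ?e b) = quad_gauss p"
  proof -
    have "quad_gauss p = (\<Sum>b\<in>{0..<int p}. (1 + ?L b) * ?e b)"
      unfolding quad_gauss_def by (rule sum_over_squares) (rule eper)
    also have "\<dots> = (\<Sum>b\<in>{0..<int p}. ?e (1 * b)) + (\<Sum>b\<in>{0..<int p}. ?L b * ?e b)"
      by (simp add: ring_distribs sum.distrib)
    also have "(\<Sum>b\<in>{0..<int p}. ?e (1 * b)) = 0"
      using sum_efr[OF p_pos, of 1] p by (auto simp: zdvd1_eq)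
    finally show ?thesis by simp
  qed
  show ?thesis
  proof (cases "int p dvd j")
    case True
    have "(\<Sum>x\<in>{0..<int p}. 1) = (\<Sum>b\<in>{0..<int p}. (1 + ?L b) * 1)"
      by (rule sum_over_squares) simp
    then have "(\<Sum>b\<in>{0..<int p}. ?L b) = 0" by (simp add: sum.distrib)
    moreover have "?e (j * b) = 1" for b using True efr_eq_1_iff[OF p_pos, of "j * b"] by simp
    moreover have "Legendre j (int p) = 0" using True by (simp add: Legendre_eq_0_iff)
    ultimately show ?thesis by simp
  next
    case False
    have cop: "coprime j (int p)" using False p(1) by (metis coprime_commute prime_imp_coprime prime_nat_int_transfer)
    have LL: "?L j * ?L j = 1" using Legendre_square[OF p False] by (metis of_int_1 of_int_mult)
    have "(\<Sum>b\<in>{0..<int p}. ?L b * ?e (j * b)) = (\<Sum>b\<in>{0..<int p}. ?L j * (?L (j * b) * ?e (j * b)))"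
      using LL by (intro sum.cong refl) (simp add: Legendre_mult[OF p] flip: mult.assoc)
    also have "\<dots> = ?L j * (\<Sum>b\<in>{0..<int p}. ?L (j * b) * ?e (j * b))" by (simp add: sum_distrib_left)
    also have "(\<Sum>b\<in>{0..<int p}. ?L (j * b) * ?e (j * b)) = (\<Sum>b\<in>{0..<int p}. ?L b * ?e b)"
      by (rule sum_periodic_mult[of "\<lambda>b. ?L b * ?e b"]) (use p_pos cop Lper eper in auto)
    finally show ?thesis using one quad_gauss_value by simp
  qed
qed

end

section \<open>Rings of cyclotomic integers\<close>

definition ipoly :: "complex \<Rightarrow> int poly \<Rightarrow> complex" where
  "ipoly z P = poly (map_poly of_int P) z"

lemma ipoly_pCons [simp]: "ipoly z (pCons a P) = of_int a + z * ipoly z P"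
  by (simp add: ipoly_def map_poly_pCons)

lemma ipoly_0 [simp]: "ipoly z 0 = 0"
  by (simp add: ipoly_def)

lemma ipoly_1 [simp]: "ipoly z 1 = 1"
  by (simp add: one_pCons)

lemma ipoly_add: "ipoly z (P + Q) = ipoly z P + ipoly z Q"
  by (induction P Q rule: poly_induct2) (simp_all add: algebra_simps)

lemma ipoly_smult: "ipoly z (Polynomial.smult a P) = of_int a * ipoly z P"
  by (induction P) (simp_all add: algebra_simps)

lemma ipoly_diff: "ipoly z (P - Q) = ipoly z P - ipoly z Q"
  using ipoly_add[of z "P - Q" Q] by simp

lemma ipoly_mult: "ipoly z (P * Q) = ipoly z P * ipoly z Q"
  by (induction P) (simp_all add: ipoly_add ipoly_smult algebra_simps)

lemma ipoly_monom: "ipoly z (Polynomial.monom a n) = of_int a * z ^ n"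
  by (induction n) (simp_all add: monom_0 monom_Suc)

text \<open>The ring generated by an \<open>m\<close>-th root of unity, as an image of integer
  polynomials: each element comes with a polynomial whose coefficients can be reduced modulo
  \<open>p\<close>.\<close>

definition cyclo_ring :: "nat \<Rightarrow> complex set" where
  "cyclo_ring m = range (\<lambda>P. ipoly (efr (int m) 1) P)"

lemma cyclo_ring_of_int [simp]: "of_int k \<in> cyclo_ring m"
  unfolding cyclo_ring_def by (rule range_eqI[of _ _ "[:k:]"]) simp

lemma cyclo_ring_0 [simp]: "0 \<in> cyclo_ring m" and cyclo_ring_1 [simp]: "1 \<in> cyclo_ring m"
  and cyclo_ring_of_nat [simp]: "of_nat n \<in> cyclo_ring m"
  using cyclo_ring_of_int[of 0 m] cyclo_ring_of_int[of 1 m] cyclo_ring_of_int[of "int n" m] by simp_all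

lemma cyclo_ring_add: "x \<in> cyclo_ring m \<Longrightarrow> y \<in> cyclo_ring m \<Longrightarrow> x + y \<in> cyclo_ring m"
  unfolding cyclo_ring_def by (auto simp flip: ipoly_add)

lemma cyclo_ring_mult: "x \<in> cyclo_ring m \<Longrightarrow> y \<in> cyclo_ring m \<Longrightarrow> x * y \<in> cyclo_ring m"
  unfolding cyclo_ring_def by (auto simp flip: ipoly_mult)

lemma cyclo_ring_uminus: "x \<in> cyclo_ring m \<Longrightarrow> - x \<in> cyclo_ring m"
  using cyclo_ring_mult[OF cyclo_ring_of_int[of "- 1" m], of x] by simp

lemma cyclo_ring_diff: "x \<in> cyclo_ring m \<Longrightarrow> y \<in> cyclo_ring m \<Longrightarrow> x - y \<in> cyclo_ring m"
  using cyclo_ring_add[of x m "- y"] cyclo_ring_uminus by simp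

lemma cyclo_ring_power: "x \<in> cyclo_ring m \<Longrightarrow> x ^ k \<in> cyclo_ring m"
  by (induction k) (auto intro: cyclo_ring_mult)

lemma cyclo_ring_sum: "(\<And>x. x \<in> S \<Longrightarrow> f x \<in> cyclo_ring m) \<Longrightarrow> sum f S \<in> cyclo_ring m"
  by (induction S rule: infinite_finite_induct) (auto intro: cyclo_ring_add)

lemma cyclo_ring_efr: "0 < m \<Longrightarrow> efr (int m) j \<in> cyclo_ring m"
proof -
  assume m: "0 < m"
  have "efr (int m) 1 \<in> cyclo_ring m"
    unfolding cyclo_ring_def by (rule range_eqI[of _ _ "[:0, 1:]"]) simp
  then have "efr (int m) 1 ^ nat (j mod int m) \<in> cyclo_ring m" by (rule cyclo_ring_power)
  then show ?thesis using m efr_mod[of "int m" j] by (simp add: efr_power)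
qed

text \<open>Pseudo-division keeps the coefficients integral, and the remainder vanishes by
  minimality. The multiplier that it introduces is removed by Gauss' lemma on contents, since
  \<open>g\<close> is primitive.\<close>

lemma min_int_poly_divides:
  fixes g F :: "int poly" and z :: complex
  assumes g: "content g = 1" "ipoly z g = 0"
    and min: "\<And>r. r \<noteq> 0 \<Longrightarrow> degree r < degree g \<Longrightarrow> ipoly z r \<noteq> 0"
    and F: "ipoly z F = 0"
  shows "g dvd F"
proof -
  have g0: "g \<noteq> 0" using g(1) by auto
  define r where "r = pseudo_mod F g"
  obtain a Q where a: "a \<noteq> 0" "Polynomial.smult a F = g * Q + r" and r: "r = 0 \<or> degree r < degree g"
    using pseudo_mod[OF g0, of F] r_def by metis
  have "ipoly z (Polynomial.smult a F) = (0 :: complex)" using F by (simp add: ipoly_smult)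
  then have "ipoly z r = 0"
    unfolding a(2) using g(2) by (simp add: ipoly_add ipoly_mult)
  then have "r = 0" using min r by blast
  then have e: "Polynomial.smult a F = g * Q" using a by simp
  then have "content Q = normalize a * content F"
    using g(1) by (metis content_mult content_smult mult_1)
  then have "a dvd content Q" by simp
  then have "[:a:] dvd Q" by (simp add: const_poly_dvd_iff_dvd_content)
  then obtain R where "Q = Polynomial.smult a R" by (auto elim!: dvdE)
  then have "Polynomial.smult a F = Polynomial.smult a (g * R)" using e by simp
  then show ?thesis using a(1) by (metis dvd_triv_left smult_cancel)
qed

text \<open>Otherwise \<open>1 / p\<close> would be a cyclotomic integer, that is, a polynomial
  \<open>F\<close> congruent to 1 modulo \<open>p\<close> would vanish at the root of unity. Its
  minimal polynomial \<open>g\<close> divides a monic polynomial, so its leading coefficient is a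
  unit and \<open>g\<close> keeps its positive degree modulo \<open>p\<close>; it cannot divide 1
  there.\<close>

theorem cyclo_ring_dvd:
  assumes p: "prime p" and m: "0 < m" and y: "y \<in> cyclo_ring m" and k: "of_int k = of_nat p * y"
  shows "int p dvd k"
proof (rule ccontr)
  assume "\<not> int p dvd k"
  then have "coprime k (int p)" using p by (metis coprime_commute prime_imp_coprime prime_nat_int_transfer)
  then obtain u v where uv: "u * k + v * int p = 1" by (metis bezout_int coprime_imp_gcd_eq_1)
  \<comment> \<open>A Bezout combination replaces \<open>k\<close> by 1.\<close>
  define y' where "y' = of_int u * y + of_int v"
  have "(1 :: complex) = of_int (u * k + v * int p)" using uv by simp
  also have "\<dots> = of_nat p * y'" using k by (simp add: y'_def algebra_simps)
  finally have y': "of_nat p * y' = 1" by simp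
  have "y' \<in> cyclo_ring m" unfolding y'_def by (intro cyclo_ring_add cyclo_ring_mult y) auto
  then obtain P where P: "y' = ipoly (efr (int m) 1) P" unfolding cyclo_ring_def by auto
  define z where "z = efr (int m) 1"
  define F where "F = 1 - Polynomial.smult (int p) P"
  have F: "ipoly z F = 0"
    using y' P by (simp add: F_def z_def ipoly_diff ipoly_smult)
  define G :: "int poly" where "G = Polynomial.monom 1 m - 1"
  have G: "ipoly z G = 0"
  proof -
    have "z ^ m = 1" using efr_eq_1_iff[of "int m" "int m"] m by (simp add: z_def efr_power)
    then show ?thesis by (simp add: G_def ipoly_diff ipoly_monom)
  qed
  have coeffG: "Polynomial.coeff G m = 1" using m by (simp add: G_def)
  then have G0: "G \<noteq> 0" by auto
  define S where "S = {r :: int poly. r \<noteq> 0 \<and> ipoly z r = 0}"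
  have "G \<in> S" using G0 G by (simp add: S_def)
  then obtain g0 where g0: "g0 \<in> S" "\<And>r. r \<in> S \<Longrightarrow> degree g0 \<le> degree r"
    using ex_has_least_nat[of "\<lambda>r. r \<in> S" G degree] by blast
  define g where "g = primitive_part g0"
  have g0_0: "g0 \<noteq> 0" using g0 by (simp add: S_def)
  have gg: "g0 = Polynomial.smult (content g0) g" by (simp add: g_def)
  have c1: "content g = 1" using g0_0 by (simp add: g_def)
  have gz: "ipoly z g = 0"
  proof -
    have "ipoly z (Polynomial.smult (content g0) g) = 0"
      using g0(1) gg by (simp add: S_def)
    then show ?thesis using g0_0 by (simp add: ipoly_smult)
  qed
  have dg: "degree g = degree g0" by (simp add: g_def)
  have min: "ipoly z r \<noteq> 0" if "r \<noteq> 0" "degree r < degree g" for r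
    using g0(2)[of r] that dg by (auto simp: S_def)
  have "g dvd G" by (rule min_int_poly_divides[OF c1 gz min G])
  then obtain h where h: "G = g * h" by (elim dvdE)
  have "degree G = m"
  proof (rule antisym)
    show "degree G \<le> m" unfolding G_def by (intro degree_diff_le) (auto simp: degree_monom_le)
    show "m \<le> degree G" using coeffG by (intro le_degree) simp
  qed
  then have "lead_coeff g * lead_coeff h = 1" using h coeffG lead_coeff_mult[of g h] by simp
  then have lg: "is_unit (lead_coeff g)" by (metis dvd_triv_left)
  have "g dvd F" by (rule min_int_poly_divides[OF c1 gz min F])
  then obtain k where k: "F = g * k" by (elim dvdE)
  have dg1: "0 < degree g"
  proof (rule ccontr)
    assume "\<not> 0 < degree g"
    then obtain c where "g = [:c:]" by (metis degree_eq_zeroE gr0I)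
    then show False using gz c1 by auto
  qed
  have coeffF: "int p dvd Polynomial.coeff F i" if "0 < i" for i
    using that by (auto simp: F_def coeff_1)
  have "\<exists>j. \<not> int p dvd Polynomial.coeff k j"
  proof (rule ccontr)
    assume "\<nexists>j. \<not> int p dvd Polynomial.coeff k j"
    then have "int p dvd Polynomial.coeff (g * k) 0" by (auto simp: coeff_mult intro!: dvd_sum)
    then have "int p dvd 1 - int p * Polynomial.coeff P 0" by (simp add: F_def flip: k)
    then have "int p dvd 1" by (metis dvd_diff_right_iff dvd_triv_left dvd_add_left_iff diff_add_cancel)
    then show False using p by (simp add: prime_nat_iff)
  qed
  moreover have "j \<le> degree k" if "\<not> int p dvd Polynomial.coeff k j" for j
    using that by (metis dvd_0_right le_degree)
  \<comment> \<open>\<open>j\<close> is the degree of \<open>k\<close> modulo \<open>p\<close>. In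
    the coefficient of \<open>F\<close> at \<open>degree g + j\<close>, every product except that of
    the two leading coefficients is 0 or divisible by \<open>p\<close>.\<close>
  ultimately obtain j where j: "\<not> int p dvd Polynomial.coeff k j" "\<And>i. \<not> int p dvd Polynomial.coeff k i \<Longrightarrow> i \<le> j"
    using GreatestI_nat[of "\<lambda>j. \<not> int p dvd Polynomial.coeff k j" _ "degree k"]
      Greatest_le_nat[of "\<lambda>j. \<not> int p dvd Polynomial.coeff k j" _ "degree k"] by blast
  let ?n = "degree g + j"
  have "Polynomial.coeff F ?n = (\<Sum>i\<le>?n. Polynomial.coeff g i * Polynomial.coeff k (?n - i))" by (simp add: k coeff_mult)
  also have "\<dots> = Polynomial.coeff g (degree g) * Polynomial.coeff k j + (\<Sum>i\<in>{..?n} - {degree g}. Polynomial.coeff g i * Polynomial.coeff k (?n - i))"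
    by (subst sum.remove[of _ "degree g"]) auto
  finally have "Polynomial.coeff g (degree g) * Polynomial.coeff k j = Polynomial.coeff F ?n - (\<Sum>i\<in>{..?n} - {degree g}. Polynomial.coeff g i * Polynomial.coeff k (?n - i))"
    by simp
  moreover have "int p dvd (\<Sum>i\<in>{..?n} - {degree g}. Polynomial.coeff g i * Polynomial.coeff k (?n - i))"
  proof (rule dvd_sum)
    fix i assume i: "i \<in> {..?n} - {degree g}"
    show "int p dvd Polynomial.coeff g i * Polynomial.coeff k (?n - i)"
    proof (cases "i < degree g")
      case True
      then have "\<not> ?n - i \<le> j" by simp
      then have "int p dvd Polynomial.coeff k (?n - i)" using j(2) by blast
      then show ?thesis by simp
    next
      case False
      then have "Polynomial.coeff g i = 0" using i by (intro coeff_eq_0) auto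
      then show ?thesis by simp
    qed
  qed
  ultimately have "int p dvd lead_coeff g * Polynomial.coeff k j" using coeffF[of ?n] dg1 by (simp only: dvd_diff)
  then show False using j(1) lg p by (metis dvd_mult_unit_iff mult.commute)
qed

section \<open>Frobenius congruences modulo a prime, and the supplementary law for 2\<close>

lemma binomial_prime_dvd: "prime p \<Longrightarrow> 0 < k \<Longrightarrow> k < p \<Longrightarrow> p dvd (p choose k)"
  by (rule dvd_choose_prime) auto

lemma frobenius_add:
  assumes p: "prime p" and x: "x \<in> cyclo_ring m" and y: "y \<in> cyclo_ring m"
  shows "\<exists>r\<in>cyclo_ring m. (x + y) ^ p = x ^ p + y ^ p + of_nat p * r"
proof -
  define c where "c k = (p choose k) div p" for k
  have "(x + y) ^ p = (\<Sum>k\<le>p. of_nat (p choose k) * x ^ k * y ^ (p - k))" by (rule binomial_ring)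
  also have "{..p} = insert 0 (insert p {1..<p})" using prime_gt_0_nat[OF p] by auto
  also have "(\<Sum>k\<in>\<dots>. of_nat (p choose k) * x ^ k * y ^ (p - k))
     = y ^ p + (x ^ p + (\<Sum>k\<in>{1..<p}. of_nat (p choose k) * x ^ k * y ^ (p - k)))"
    using prime_gt_0_nat[OF p] by simp
  also have "(\<Sum>k\<in>{1..<p}. of_nat (p choose k) * x ^ k * y ^ (p - k))
      = (\<Sum>k\<in>{1..<p}. of_nat p * (of_nat (c k) * x ^ k * y ^ (p - k)))"
  proof (rule sum.cong[OF refl])
    fix k assume "k \<in> {1..<p}"
    then have "p choose k = p * c k" using binomial_prime_dvd[OF p] by (simp add: c_def)
    then have "(of_nat (p choose k) :: complex) = of_nat p * of_nat (c k)" by (simp only: of_nat_mult)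
    then show "of_nat (p choose k) * x ^ k * y ^ (p - k) = of_nat p * (of_nat (c k) * x ^ k * y ^ (p - k))"
      by simp
  qed
  finally show ?thesis
    by (intro bexI[of _ "\<Sum>k\<in>{1..<p}. of_nat (c k) * x ^ k * y ^ (p - k)"] cyclo_ring_sum cyclo_ring_mult
        cyclo_ring_power x y) (auto simp: sum_distrib_left algebra_simps)
qed

lemma frobenius_sum:
  assumes p: "prime p" and "finite S" and "\<And>x. x \<in> S \<Longrightarrow> f x \<in> cyclo_ring m"
  shows "\<exists>r\<in>cyclo_ring m. (sum f S) ^ p = (\<Sum>x\<in>S. f x ^ p) + of_nat p * r"
  using assms(2,3)
proof (induction S)
  case empty
  show ?case using prime_gt_0_nat[OF p] by (intro bexI[of _ 0]) simp_all
next
  case (insert a S)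
  then obtain r where r: "r \<in> cyclo_ring m" "(sum f S) ^ p = (\<Sum>x\<in>S. f x ^ p) + of_nat p * r" by auto
  obtain r' where r': "r' \<in> cyclo_ring m" "(f a + sum f S) ^ p = f a ^ p + (sum f S) ^ p + of_nat p * r'"
    using frobenius_add[OF p, of "f a" m "sum f S"] insert.prems cyclo_ring_sum[of S f m] by auto
  show ?case
    using insert.hyps r r' by (intro bexI[of _ "r + r'"] cyclo_ring_add) (simp_all add: algebra_simps)
qed

text \<open>If \<eta> were not 1, its powers would sum to 0, and \<open>M\<close> would be the sum
  of all \<open>1 - \<eta> ^ j\<close>, a multiple of \<open>\<eta> - 1\<close>. The congruence
  would then make \<open>p\<close> divide \<open>n * M\<close>.\<close>

lemma root_of_unity_eq_1:
  assumes p: "prime p" and M: "0 < M" "\<not> p dvd M" and eta: "\<eta> ^ M = 1"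
    and n: "\<not> p dvd n" and r: "r \<in> cyclo_ring M" "of_nat n * (\<eta> - 1) = of_nat p * r"
  shows "\<eta> = 1"
proof (rule ccontr)
  assume ne: "\<eta> \<noteq> 1"
  have "\<eta> \<in> {exp (2 * of_real pi * \<i> * of_nat j / of_nat M) | j. j < M}"
    using complex_roots_unity[of M] M eta by auto
  then obtain j where "\<eta> = exp (2 * of_real pi * \<i> * of_nat j / of_nat M)" by blast
  then have "\<eta> = efr (int M) (int j)" by (simp add: efr_def er_def ee_def of_rat_divide)
  then have etaR: "\<eta> \<in> cyclo_ring M" using cyclo_ring_efr M by simp
  have "(\<Sum>j<M. \<eta> ^ j) = 0" using geometric_sum[OF ne, of M] eta by simp
  then have "of_nat M = (\<Sum>j<M. 1 - \<eta> ^ j)" by (simp add: sum_subtractf)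
  also have "\<dots> = (\<Sum>j<M. (1 - \<eta>) * (\<Sum>i<j. \<eta> ^ i))"
    by (intro sum.cong refl) (simp add: one_diff_power_eq)
  also have "\<dots> = - (\<eta> - 1) * (\<Sum>j<M. \<Sum>i<j. \<eta> ^ i)" by (simp add: sum_distrib_left)
  finally have "of_nat n * of_nat M = - (of_nat n * (\<eta> - 1)) * (\<Sum>j<M. \<Sum>i<j. \<eta> ^ i)" by (simp only: mult_ac mult_minus_left mult_minus_right)
  also have "\<dots> = of_nat p * - (r * (\<Sum>j<M. \<Sum>i<j. \<eta> ^ i))" using r(2) by simp
  finally have "of_int (int (n * M)) = of_nat p * - (r * (\<Sum>j<M. \<Sum>i<j. \<eta> ^ i))" by simp
  then have "int p dvd int (n * M)"
    by (rule cyclo_ring_dvd[OF p M(1), rotated])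
      (intro cyclo_ring_uminus cyclo_ring_mult cyclo_ring_sum cyclo_ring_power etaR r)
  then show False using p M(2) n by (simp add: prime_dvd_mult_iff flip: of_nat_mult)
qed

lemma er_half: "er (1 / 2) = - 1"
  by (simp add: er_def ee_def of_rat_divide)

text \<open>For an eighth root of unity \<zeta> the number \<open>w\<close> = \<zeta> + 1/\<zeta>
  has square 2. Modulo \<open>p\<close>, its \<open>p\<close>-th power is (2/p) \<open>w\<close> by
  Euler's criterion and \<sigma> \<open>w\<close> by Frobenius, where \<sigma> depends on
  \<open>p\<close> modulo 8.\<close>

lemma kronecker_2_left:
  assumes p: "prime p" "2 < p"
  shows "Legendre 2 (int p) = kronecker (int p) 2"
proof -
  have podd: "odd p" using p by (simp add: prime_odd_nat)
  define w where "w = efr 8 1 + efr 8 (- 1)"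
  have e4: "efr 8 4 = - 1" using er_half by (simp add: efr_def)
  have sq: "w * w = 2"
  proof -
    have "efr 8 2 + efr 8 (-2) = 0"
      using efr_add[of 8 "-2" 4] e4 by simp
    then show ?thesis unfolding w_def by (simp add: algebra_simps flip: efr_add)
  qed
  define \<sigma> where "\<sigma> = kronecker (int p) 2"
  have s: "efr 8 (int p) + efr 8 (- int p) = of_int \<sigma> * w"
  proof -
    have mod8: "efr 8 (int p) = efr 8 (int p mod 8)" "efr 8 (- int p) = efr 8 (- (int p mod 8))"
      by (intro efr_cong; simp add: cong_def mod_minus_eq)+
    have "int p mod 8 = 1 \<or> int p mod 8 = 3 \<or> int p mod 8 = 5 \<or> int p mod 8 = 7" using podd by presburger
    moreover have em4: "efr 8 (-4) = - 1" using efr_add[of 8 4 "-4"] e4 by (simp add: minus_equation_iff)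
    moreover have "efr 8 3 = - efr 8 (-1)" "efr 8 (-3) = - efr 8 1"
      using efr_add[of 8 "-1" 4] efr_add[of 8 1 "-4"] em4 e4 by simp_all
    moreover have "efr 8 5 = - efr 8 1" "efr 8 (-5) = - efr 8 (-1)" "efr 8 7 = efr 8 (-1)" "efr 8 (-7) = efr 8 1"
      using efr_add[of 8 1 4] efr_add[of 8 "-1" "-4"] em4 e4
        efr_cong[of 8 7 "-1"] efr_cong[of 8 "-7" 1] by (simp_all add: cong_def)
    ultimately show ?thesis using podd
      unfolding \<sigma>_def kronecker_prime_eq[OF two_is_prime_nat] kronecker_prime_def w_def mod8 by auto
  qed
  define k where "k = (p - 1) div 2"
  have pk: "p = 2 * k + 1" using podd by (auto simp: k_def elim: oddE)
  have "[Legendre 2 (int p) = 2 ^ k] (mod int p)" using euler_criterion[OF p] by (simp add: k_def)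
  then obtain j where j: "2 ^ k = Legendre 2 (int p) + int p * j" by (metis cong_iff_lin)
  have R: "efr 8 1 \<in> cyclo_ring 8" "efr 8 (-1) \<in> cyclo_ring 8"
    using cyclo_ring_efr[of 8] by simp_all
  then have wR: "w \<in> cyclo_ring 8" unfolding w_def by (rule cyclo_ring_add)
  obtain r where r: "r \<in> cyclo_ring 8" "w ^ p = efr 8 (int p) + efr 8 (- int p) + of_nat p * r"
    using frobenius_add[OF p(1) R] unfolding w_def by (auto simp: efr_power)
  have "w ^ p = w * (w * w) ^ k" unfolding pk by (simp add: power_mult power2_eq_square)
  also have "\<dots> = w * of_int (2 ^ k)" by (simp add: sq)
  also have "\<dots> = w * (of_int (Legendre 2 (int p)) + of_nat p * of_int j)" by (simp only: j) simp
  finally have "w * of_int (Legendre 2 (int p) - \<sigma>) = of_nat p * (r - w * of_int j)"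
    using r(2) s by (simp add: algebra_simps)
  \<comment> \<open>Multiplying by \<open>w\<close> turns the factor in front into the integer 2,
    which is prime to \<open>p\<close>.\<close>
  then have "w * (w * of_int (Legendre 2 (int p) - \<sigma>)) = w * (of_nat p * (r - w * of_int j))"
    by (rule arg_cong)
  then have "(w * w) * of_int (Legendre 2 (int p) - \<sigma>) = of_nat p * (w * (r - w * of_int j))"
    by (simp only: mult_ac)
  then have "of_int (2 * (Legendre 2 (int p) - \<sigma>)) = of_nat p * (w * (r - w * of_int j))"
    by (simp add: sq)
  then have d2: "int p dvd 2 * (Legendre 2 (int p) - \<sigma>)"
    by (rule cyclo_ring_dvd[OF p(1), of 8, rotated -1])
      (auto intro!: cyclo_ring_mult cyclo_ring_diff wR r)
  have "coprime (int p) 2" using podd by simp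
  then have "int p dvd Legendre 2 (int p) - \<sigma>"
    using coprime_dvd_mult_right_iff d2 by blast
  then have "[Legendre 2 (int p) = \<sigma>] (mod int p)" by (simp add: cong_iff_dvd_diff)
  then show ?thesis unfolding \<sigma>_def[symmetric]
    by (rule eq_of_cong_sign)
      (use p Legendre_values in \<open>auto simp: \<sigma>_def kronecker_prime_eq kronecker_prime_def\<close>)
qed

section \<open>Gauss sums of a discriminant form\<close>

text \<open>Sylow's theorem provides a subgroup of order \<open>p\<close>; a non-zero element of it
  would be killed by both \<open>p\<close> and \<open>m\<close>.\<close>

lemma fqm_card_coprime:
  fixes q :: "'a::{finite,ab_group_add} \<Rightarrow> rat"
  assumes "fqm UNIV q m" and p: "prime p" and c: "coprime (int p) m"
  shows "\<not> p dvd CARD('a)"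
proof
  assume dvd: "p dvd CARD('a)"
  interpret fqm UNIV q m by fact
  define G :: "'a monoid" where "G = \<lparr>carrier = (UNIV :: 'a set), monoid.mult = (+), one = 0\<rparr>"
  interpret G: group G
    by (rule groupI) (auto simp: G_def add.assoc intro: exI[of _ "- _"])
  have ord: "order G = p ^ 1 * (CARD('a) div p)" using dvd by (simp add: order_def G_def)
  have "finite (carrier G)" by (simp add: G_def)
  then obtain K where K: "subgroup K G" "card K = p ^ 1"
    using sylow_thm[OF p G.is_group ord] by blast
  have "1 < card K" using K p prime_gt_1_nat by simp
  then obtain x where x: "x \<in> K" "x \<noteq> 0" by (metis card_le_Suc0_iff_eq finite not_less One_nat_def)
  interpret K: group "G\<lparr>carrier := K\<rparr>" using K(1) G.is_group by (rule subgroup.subgroup_is_group)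
  have pw: "x [^]\<^bsub>G\<lparr>carrier := K\<rparr>\<^esub> n = zmult (int n) x" for n :: nat
  proof (induction n)
    case (Suc n)
    then show ?case using zmult_plus1[of "int n" x] by (simp add: G_def add.commute)
  qed (simp add: G_def)
  have "x [^]\<^bsub>G\<lparr>carrier := K\<rparr>\<^esub> order (G\<lparr>carrier := K\<rparr>) = \<one>\<^bsub>G\<lparr>carrier := K\<rparr>\<^esub>"
    using x by (intro K.pow_order_eq_1) simp
  then have "zmult (int p) x = 0" unfolding pw using K(2) by (simp add: G_def order_def)
  moreover obtain v where "[v * int p = 1] (mod m)"
    using cong_solve_coprime_int[OF c] by (auto simp: mult.commute)
  ultimately have "x = 0" using zmult_zmult[of v "int p" x] zmult_cong[of x "v * int p" 1] by simp
  then show False using x by simp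
qed

lemma det_cscale: "det (cscale z U) = z ^ CARD('a) * det (U :: 'a::finite operator)"
proof -
  have "cscale z U = (\<chi> i. z *s U $ i)" by (simp add: cscale_def vec_eq_iff)
  then show ?thesis using det_rows_mul[of "\<lambda>_. z" "\<lambda>i. U $ i"] by simp
qed

text \<open>Determinants are taken in \<open>F ** D ** F = cscale (g u) (D' ** F ** D')\<close>, the
  matrix form of completing the square. \<open>F\<close> has fourth power \<open>n\<^sup>2\<close>,
  \<open>D'\<close> is inverse to \<open>D\<close>, and \<open>det D\<close> is an
  \<open>m\<close>-th root of unity. So \<open>g u / sqrt n\<close> is a root of unity, whatever the
  structure of the group.\<close>

lemma gauss_root_of_unity:
  fixes q :: "'a::{finite,ab_group_add} \<Rightarrow> rat"
  assumes fqm: "fqm UNIV q m" and u: "coprime u m"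
  shows "fqm.g UNIV q u ^ (4 * CARD('a) * nat m) = of_nat CARD('a) ^ (2 * CARD('a) * nat m)"
proof -
  interpret fqm UNIV q m by fact
  let ?n = "CARD('a)"
  define F :: "'a operator" where "F = (\<chi> x y. er (- of_int u * bil q x y))"
  define D :: "'a operator" where "D = (\<chi> x y. if x = y then er (of_int u * q x) else 0)"
  define D' :: "'a operator" where "D' = (\<chi> x y. if x = y then er (- of_int u * q x) else 0)"
  obtain v where v: "[u * v = 1] (mod m)" using cong_solve_coprime_int[OF u] by auto
  have FDF: "F ** D ** F = cscale (g u) (D' ** F ** D')"
  proof (intro vec_eq_iff[THEN iffD2] allI)
    fix x y
    have FD: "(F ** D) $ x $ w = er (- of_int u * bil q x w) * er (of_int u * q w)" for w
      by (simp add: matrix_matrix_mult_def F_def D_def if_distrib cong: if_cong)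
    have D'FD': "(D' ** F ** D') $ x $ y = er (- of_int u * q x) * er (- of_int u * bil q x y) * er (- of_int u * q y)"
      by (simp add: matrix_matrix_mult_def F_def D'_def if_distrib if_distribR cong: if_cong)
    have "(F ** D ** F) $ x $ y = (\<Sum>w\<in>UNIV. er (of_int u * q w - bil q w (zmult u (x + y))))"
      unfolding matrix_matrix_mult_def[of "F ** D"]
    proof (simp add: FD, rule sum.cong[OF refl])
      fix w
      have "er (bil q w (zmult u (x + y))) = er (of_int u * bil q (x + y) w)"
        using er_bil_zmult_left[of "x + y" w u] by (simp add: bil_commute)
      also have "\<dots> = er (of_int u * bil q x w) * er (of_int u * bil q w y)"
      proof -
        have "of_int u * (bil q (x + y) w - (bil q x w + bil q y w)) \<in> \<int>"
          by (intro Ints_mult bil_add_left) auto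
        then have "of_int u * bil q (x + y) w - (of_int u * bil q x w + of_int u * bil q w y) \<in> \<int>"
          by (simp add: algebra_simps bil_commute)
        then show ?thesis by (metis er_add er_cong)
      qed
      finally show "er (- (of_int u * bil q x w)) * er (of_int u * q w) * F $ w $ y = er (of_int u * q w - bil q w (zmult u (x + y)))"
        by (simp add: F_def er_diff er_minus field_simps)
    qed
    also have "\<dots> = g u * er (- of_int v * q (zmult u (x + y)))"
      by (rule complete_square[OF v]) auto
    also have "er (- of_int v * q (zmult u (x + y))) = er (- of_int u * q (x + y))"
    proof -
      have "of_int (- v) * (q (zmult u (x + y)) - of_int (u\<^sup>2) * q (x + y)) \<in> \<int>"
        by (intro Ints_mult q_zmult) auto
      then have "- of_int v * q (zmult u (x + y)) - of_int (- (u * v) * u) * q (x + y) \<in> \<int>"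
        by (simp add: algebra_simps power2_eq_square)
      then have "er (- of_int v * q (zmult u (x + y))) = er (of_int (- (u * v) * u) * q (x + y))" by (rule er_cong)
      also have "\<dots> = er (of_int (- 1 * u) * q (x + y))"
        using v by (intro er_q_cong cong_scalar_right) (auto simp: cong_minus_minus_iff)
      finally show ?thesis by simp
    qed
    also have "g u * er (- of_int u * q (x + y)) = cscale (g u) (D' ** F ** D') $ x $ y"
      unfolding cscale_def D'FD'[symmetric] vec_lambda_beta unfolding D'FD'
      by (simp add: q_add ring_distribs er_add er_minus er_diff field_simps)
    finally show "(F ** D ** F) $ x $ y = cscale (g u) (D' ** F ** D') $ x $ y" .
  qed
  have FF: "F ** F = (\<chi> x y. if x + y = 0 then of_nat ?n else 0)"
  proof (intro vec_eq_iff[THEN iffD2] allI)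
    fix x y
    have "(F ** F) $ x $ y = (\<Sum>w\<in>UNIV. er (bil q (zmult (- u) (x + y)) w))"
      unfolding matrix_matrix_mult_def F_def
    proof (simp, rule sum.cong[OF refl])
      fix w
      have "er (bil q (zmult (- u) (x + y)) w) = er (of_int (- u) * bil q (x + y) w)"
        by (rule er_bil_zmult_left) auto
      also have "\<dots> = er (- (of_int u * bil q x w)) * er (- (of_int u * bil q w y))"
      proof -
        have "of_int (- u) * (bil q (x + y) w - (bil q x w + bil q y w)) \<in> \<int>"
          by (intro Ints_mult bil_add_left) auto
        then have "of_int (- u) * bil q (x + y) w - (- (of_int u * bil q x w) + - (of_int u * bil q w y)) \<in> \<int>"
          by (simp add: algebra_simps bil_commute)
        then show ?thesis by (metis er_add er_cong)
      qed
      finally show "er (- (of_int u * bil q x w)) * er (- (of_int u * bil q w y)) = er (bil q (zmult (- u) (x + y)) w)" by simp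
    qed
    also have "\<dots> = (if zmult (- u) (x + y) = 0 then of_nat ?n else 0)" by (rule character_sum) simp
    also have "zmult (- u) (x + y) = 0 \<longleftrightarrow> x + y = 0"
    proof
      assume "zmult (- u) (x + y) = 0"
      then have "zmult u (x + y) = 0" by (simp add: zmult_uminus)
      then show "x + y = 0"
        using zmult_zmult[of v u "x + y"] zmult_cong[of "x + y" "v * u" 1] v by (simp add: mult.commute)
    qed simp
    finally show "(F ** F) $ x $ y = (\<chi> x y. if x + y = 0 then of_nat ?n else 0) $ x $ y" by simp
  qed
  have "(F ** F) ** (F ** F) = cscale ((of_nat ?n)\<^sup>2) (mat 1 :: 'a operator)"
  proof (intro vec_eq_iff[THEN iffD2] allI)
    fix x y
    have "((F ** F) ** (F ** F)) $ x $ y = (\<Sum>w\<in>UNIV. (F ** F) $ x $ w * (F ** F) $ w $ y)"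
      by (simp add: matrix_matrix_mult_def[of "F ** F"])
    also have "\<dots> = (\<Sum>w\<in>UNIV. (if w = - x then of_nat ?n * (if w + y = 0 then of_nat ?n else 0) else 0))"
      unfolding FF by (rule sum.cong) (auto simp: eq_neg_iff_add_eq_0 add.commute)
    also have "\<dots> = of_nat ?n * (if x = y then of_nat ?n else 0)" by (simp add: sum.delta)
    finally show "((F ** F) ** (F ** F)) $ x $ y = cscale ((of_nat ?n)\<^sup>2) (mat 1 :: 'a operator) $ x $ y"
      by (simp add: mat_def cscale_def power2_eq_square)
  qed
  then have detF4: "det F ^ 4 = (of_nat ?n) ^ (2 * ?n)"
  proof -
    assume "(F ** F) ** (F ** F) = cscale ((of_nat ?n)\<^sup>2) (mat 1 :: 'a operator)"
    then have "det ((F ** F) ** (F ** F)) = det (cscale ((of_nat ?n)\<^sup>2) (mat 1 :: 'a operator))" by simp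
    then have "det F * det F * (det F * det F) = of_nat ?n ^ (2 * ?n)" by (simp add: det_mul det_cscale flip: power_mult)
    then show ?thesis by (simp add: eval_nat_numeral mult_ac)
  qed
  then have detF: "det F \<noteq> 0" by auto
  have detD: "det D = (\<Prod>x\<in>UNIV. er (of_int u * q x))" "det D' = (\<Prod>x\<in>UNIV. er (- of_int u * q x))"
    by (subst det_diagonal; simp add: D_def D'_def)+
  have DD': "det D * det D' = 1"
    unfolding detD by (simp add: er_minus flip: prod.distrib)
  have Dm: "det D ^ nat m = 1"
  proof -
    have "er (of_int u * q x) ^ nat m = 1" for x
    proof -
      have "of_int u * (of_int m * q x) \<in> \<int>" by (rule Ints_mult[OF Ints_of_int m_q]) simp
      then show ?thesis using m_pos by (simp add: er_power er_eq_1_iff mult.left_commute)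
    qed
    then show ?thesis unfolding detD by (simp add: prod_power_distrib)
  qed
  have "det F * det D * det F = g u ^ ?n * (det D' * det F * det D')"
    using arg_cong[OF FDF, of det] by (simp add: det_mul det_cscale)
  then have "det F * det D = g u ^ ?n * det D' * det D'" using detF by (simp add: mult_ac)
  then have "det F * det D * det D * det D = g u ^ ?n * (det D * det D') * (det D * det D')" by (simp only: mult_ac)
  then have "det F * det D * det D * det D = g u ^ ?n" unfolding DD' by simp
  then have gn: "g u ^ ?n = det F * det D ^ 3" by (simp add: power3_eq_cube mult.assoc)
  have "g u ^ (4 * ?n * nat m) = ((g u ^ ?n) ^ 4) ^ nat m" by (simp add: power_mult mult.commute flip: power_mult)
  also have "\<dots> = (det F ^ 4) ^ nat m * (det D ^ nat m) ^ 12"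
    unfolding gn by (simp add: power_mult_distrib mult.commute flip: power_mult)
  also have "\<dots> = of_nat ?n ^ (2 * ?n * nat m)" unfolding detF4 Dm by (simp flip: power_mult)
  finally show ?thesis .
qed

lemma ee_add_of_int: "ee (x + of_int k) = ee x"
  by (simp add: ee_add)

lemma ee_eighth_power: "ee (of_nat s / 8) ^ 8 = 1"
  using ee_of_nat_mult[of 8 "of_nat s / 8"] ee_of_int[of "int s"] by simp

lemma ee_eighth_efr: "0 < K \<Longrightarrow> ee (of_nat s / 8) = efr (int (8 * K)) (int (s * K))"
  by (simp add: efr_def er_def of_rat_divide of_rat_mult)

lemma er_mult_in_cyclo_ring:
  assumes "of_int m * x \<in> \<int>" "0 < m" "0 < K" "nat m dvd K"
  shows "er (of_int u * x) \<in> cyclo_ring K"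
proof -
  obtain j where j: "of_int m * x = of_int j" using assms(1) by (elim Ints_cases)
  obtain L where L: "K = nat m * L" using assms(4) by (elim dvdE)
  have L0: "0 < L" using L assms by (auto intro: Nat.gr0I)
  have KL: "int K = m * int L" using L assms by simp
  have "x = of_int j / of_int m" using j assms by (simp add: field_simps)
  then have "of_int u * x = of_int (u * j * int L) / of_int (int K)"
    using L0 assms unfolding KL by simp
  then have "er (of_int u * x) = efr (int K) (u * j * int L)" by (simp only: efr_def)
  then show ?thesis using cyclo_ring_efr assms by simp
qed

lemma complex_sqrt_square: "of_real (sqrt (real n)) * of_real (sqrt (real n)) = (of_nat n :: complex)"
  by (simp flip: of_real_mult)

text \<open>The induction step multiplies \<open>u\<close> by a prime \<open>p\<close>: Frobenius gives the congruence
  \<open>g (p * u) \<equiv> (g u)\<^sup>p\<close> modulo \<open>p\<close>, and both sides of the claim are roots of unity of order prime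
  to \<open>p\<close> times \<open>sqrt n\<close>, so the congruence is an equality.\<close>

theorem gauss_closed_form:
  fixes q :: "'a::{finite,ab_group_add} \<Rightarrow> rat"
  assumes fqm: "fqm UNIV q m"
    and sgn: "fqm.g UNIV q 1 = of_real (sqrt (real CARD('a))) * ee (of_nat s / 8)"
    and u: "odd u" "coprime (int u) m"
  shows "fqm.g UNIV q (int u) = of_real (sqrt (real CARD('a))) * (of_int (kronecker (int CARD('a)) u) * ee (of_nat (u * s) / 8))"
  using u
proof (induction u rule: odd_induct)
  case one
  then show ?case using sgn by (simp add: kronecker_1)
next
  case (mult p u)
  interpret fqm UNIV q m by fact
  let ?n = "CARD('a)"
  have cop: "coprime (int p) m" "coprime (int u) m" "coprime (int (p * u)) m" using mult.prems by auto
  define S :: complex where "S = of_real (sqrt (real ?n))"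
  define w :: "nat \<Rightarrow> complex" where "w v = of_int (kronecker (int ?n) v) * ee (of_nat (v * s) / 8)" for v
  \<comment> \<open>Large enough for eighth roots of unity and for all values of \<open>q\<close>,
    and a multiple of the exponents 8 and \<open>4 * n * m\<close> that trivialize the two factors
    of \<eta>.\<close>
  define K where "K = 32 * ?n * nat m"
  have n0: "0 < ?n" by (simp add: card_gt_0_iff)
  have K0: "0 < K" using n0 m_pos by (simp add: K_def)
  have SS: "S * S = of_nat ?n" unfolding S_def by (rule complex_sqrt_square)
  then have S0: "S \<noteq> 0" using n0 by auto
  have pn: "\<not> p dvd ?n" using fqm_card_coprime[OF fqm mult(1) cop(1)] .
  have pK: "\<not> p dvd K"
  proof
    assume "p dvd K"
    then have "p dvd 2 ^ 5 \<or> p dvd ?n \<or> p dvd nat m"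
      using mult(1) by (simp add: K_def prime_dvd_mult_iff)
    moreover have "\<not> p dvd 2 ^ 5" using mult(1-3) by (metis dvd_triv_right even_mult_iff prime_dvd_power nat_dvd_not_less zero_less_numeral not_less_iff_gr_or_eq)
    moreover have "\<not> p dvd nat m"
    proof
      assume "p dvd nat m"
      then have "int p dvd m" using m_pos by (metis int_dvd_int_iff int_nat_eq less_imp_le)
      then have "is_unit (int p)" using cop(1) by (meson coprime_common_divisor dvd_refl)
      then show False using mult(1) by simp
    qed
    ultimately show False using pn by blast
  qed
  have eeR: "ee (of_nat v / 8) \<in> cyclo_ring K" for v
  proof -
    have "ee (of_nat v / 8) = efr (int K) (int (v * (4 * ?n * nat m)))"
      using ee_eighth_efr[of "4 * ?n * nat m" v] n0 m_pos by (simp add: K_def mult.assoc)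
    then show ?thesis using cyclo_ring_efr[OF K0] by simp
  qed
  have erR: "er (of_int v * q x) \<in> cyclo_ring K" for v x
    by (rule er_mult_in_cyclo_ring[of m]) (use m_q K0 m_pos in \<open>auto simp: K_def\<close>)
  have gR: "g v \<in> cyclo_ring K" for v unfolding g_def by (intro cyclo_ring_sum erR)
  have e8: "ee (of_nat v / 8) * ee (of_nat (7 * v) / 8) = 1" for v
    using ee_add[of "of_nat v / 8" "of_nat (7 * v) / 8"] ee_of_int[of "int v"] by (simp add: add_divide_distrib[symmetric])
  have SR: "S \<in> cyclo_ring K"
  proof -
    have "S = g 1 * ee (of_nat (7 * s) / 8)"
      using sgn e8[of s] by (simp add: S_def mult.assoc)
    then show ?thesis using cyclo_ring_mult[OF gR eeR] by metis
  qed
  have kron: "kronecker (int ?n) v * kronecker (int ?n) v = 1" if "odd v" "coprime (int v) m" for v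
  proof (rule kronecker_square[OF that(1)])
    show "coprime (int ?n) (int v)"
    proof (rule ccontr)
      assume "\<not> coprime (int ?n) (int v)"
      then have "\<not> coprime ?n v" by simp
      then have "gcd ?n v \<noteq> 1" by (rule contrapos_nn) (rule gcd_eq_1_imp_coprime)
      from prime_factor_nat[OF this] obtain r where "prime r" "r dvd gcd ?n v" by auto
      then have r: "prime r" "r dvd ?n" "r dvd v" by auto
      then have "coprime (int r) m" using that(2) coprime_divisors[of "int r" "int v" m m] by simp
      then show False using fqm_card_coprime[OF fqm r(1)] r(2) by blast
    qed
  qed
  have wR: "w v \<in> cyclo_ring K" for v unfolding w_def by (intro cyclo_ring_mult eeR cyclo_ring_of_int)
  \<comment> \<open>The inverse of \<open>w (p * u)\<close>; writing 7 for -1 modulo 8 keeps the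
    exponent a natural number.\<close>
  define w' where "w' = of_int (kronecker (int ?n) (p * u)) * ee (of_nat (7 * (p * u * s)) / 8)"
  have opu: "odd (p * u)" using mult by simp
  have kk: "of_int (kronecker (int ?n) (p * u)) * of_int (kronecker (int ?n) (p * u)) = (1 :: complex)"
    using kron[OF opu cop(3)] by (metis of_int_1 of_int_mult)
  have ww': "w (p * u) * w' = 1"
  proof -
    have "w (p * u) * w' = (of_int (kronecker (int ?n) (p * u)) * of_int (kronecker (int ?n) (p * u))) *
       (ee (of_nat (p * u * s) / 8) * ee (of_nat (7 * (p * u * s)) / 8))"
      by (simp only: w_def w'_def mult_ac)
    then show ?thesis using kk e8 by (simp only: mult_1)
  qed
  have w'R: "w' \<in> cyclo_ring K" unfolding w'_def by (intro cyclo_ring_mult eeR cyclo_ring_of_int)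
  define k where "k = (p - 1) div 2"
  have pk: "p = 2 * k + 1" using mult(3) by (auto simp: k_def elim: oddE)
  have "[Legendre (int ?n) (int p) = int ?n ^ k] (mod int p)"
    using euler_criterion[OF mult(1,2)] by (simp add: k_def)
  then obtain j where j: "int ?n ^ k = Legendre (int ?n) (int p) + int p * j" by (metis cong_iff_lin)
  have IH: "g (int u) = S * w u" using mult.IH[OF cop(2)] by (simp add: S_def w_def)
  have Sp: "S ^ p = S * (of_int (Legendre (int ?n) (int p)) + of_nat p * of_int j)"
  proof -
    have "S ^ p = S * (S * S) ^ k" unfolding pk by (simp add: power_mult power2_eq_square)
    also have "\<dots> = S * of_int (int ?n ^ k)" by (simp add: SS)
    finally show ?thesis by (simp only: j) simp
  qed
  have wp: "w u ^ p = of_int (kronecker (int ?n) u) * ee (of_nat (p * u * s) / 8)"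
  proof -
    have "kronecker (int ?n) u ^ p = kronecker (int ?n) u"
      using kron[OF mult(4) cop(2)] unfolding pk by (simp add: power_mult power2_eq_square)
    then have "(of_int (kronecker (int ?n) u) :: complex) ^ p = of_int (kronecker (int ?n) u)"
      by (metis of_int_power)
    moreover have "ee (of_nat (u * s) / 8) ^ p = ee (of_nat (p * u * s) / 8)"
      using ee_of_nat_mult[of p "of_nat (u * s) / 8"] by (simp add: mult_ac)
    ultimately show ?thesis by (simp add: w_def power_mult_distrib)
  qed
  have wpu: "w (p * u) = of_int (Legendre (int ?n) (int p)) * w u ^ p"
    unfolding wp unfolding w_def
    using mult by (simp add: kronecker_mult_right kronecker_odd_prime prime_gt_0_nat)
  obtain r where r: "r \<in> cyclo_ring K" "g (int u) ^ p = g (int (p * u)) + of_nat p * r"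
  proof -
    obtain r where "r \<in> cyclo_ring K" "g (int u) ^ p = (\<Sum>x\<in>UNIV. er (of_int (int u) * q x) ^ p) + of_nat p * r"
      using frobenius_sum[OF mult(1) finite, of UNIV "\<lambda>x. er (of_int (int u) * q x)" K] erR[of "int u"]
      unfolding g_def by blast
    moreover have "(\<Sum>x\<in>UNIV. er (of_int (int u) * q x) ^ p) = g (int (p * u))"
      unfolding g_def by (simp add: er_power mult.assoc)
    ultimately show ?thesis using that by simp
  qed
  have "g (int u) ^ p = S * w (p * u) + of_nat p * (S * of_int j * w u ^ p)"
    unfolding IH power_mult_distrib Sp wpu by (simp add: algebra_simps)
  then have diff: "g (int (p * u)) - S * w (p * u) = of_nat p * (S * of_int j * w u ^ p - r)"
    using r(2) by (simp add: algebra_simps)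
  \<comment> \<open>The quotient of the Gauss sum by its predicted value.\<close>
  define \<eta> where "\<eta> = g (int (p * u)) * w' * inverse S"
  have g_eta: "g (int (p * u)) = S * w (p * u) * \<eta>"
    using ww' S0 by (simp add: \<eta>_def field_simps)
  have "\<eta> = 1"
  proof (rule root_of_unity_eq_1[OF mult(1) K0 pK _ pn])
    have "g (int (p * u)) ^ K = (g (int (p * u)) ^ (4 * ?n * nat m)) ^ 8"
      by (simp add: K_def mult_ac flip: power_mult)
    also have "\<dots> = (of_nat ?n ^ (2 * ?n * nat m)) ^ 8"
      using gauss_root_of_unity[OF fqm cop(3)] by simp
    also have "\<dots> = (S * S) ^ (16 * ?n * nat m)" by (simp add: SS mult_ac flip: power_mult)
    also have "\<dots> = S ^ K" by (simp add: K_def mult_ac flip: power2_eq_square power_mult)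
    finally have 1: "g (int (p * u)) ^ K = S ^ K" .
    have "w' ^ 8 = 1"
    proof -
      have "w' ^ 8 = (of_int (kronecker (int ?n) (p * u)) * of_int (kronecker (int ?n) (p * u))) ^ 4 * ee (of_nat (7 * (p * u * s)) / 8) ^ 8"
        unfolding w'_def by (simp add: power_mult_distrib flip: power_add)
      then show ?thesis by (simp only: kk ee_eighth_power) simp
    qed
    moreover have "K = 8 * (4 * ?n * nat m)" by (simp add: K_def)
    ultimately have 2: "w' ^ K = 1" by (simp only: power_mult power_one)
    show "\<eta> ^ K = 1" using 1 2 S0 by (simp add: \<eta>_def power_mult_distrib power_inverse)
    have "S * w (p * u) * (\<eta> - 1) = of_nat p * (S * of_int j * w u ^ p - r)"
      using diff unfolding g_eta by (simp add: right_diff_distrib)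
    \<comment> \<open>The multiplier turns the factor in front of \<open>\<eta> - 1\<close> into
      \<open>S * S\<close>, the order of the group, which is an integer prime to
      \<open>p\<close>.\<close>
    then have "(S * w') * (S * w (p * u) * (\<eta> - 1)) = (S * w') * (of_nat p * (S * of_int j * w u ^ p - r))"
      by (rule arg_cong)
    then have "(S * S) * (w (p * u) * w') * (\<eta> - 1) = of_nat p * ((S * w') * (S * of_int j * w u ^ p - r))"
      by (simp only: mult_ac)
    then show "of_nat ?n * (\<eta> - 1) = of_nat p * ((S * w') * (S * of_int j * w u ^ p - r))"
      by (simp only: SS ww' mult_1_right)
    show "(S * w') * (S * of_int j * w u ^ p - r) \<in> cyclo_ring K"
      by (intro cyclo_ring_mult cyclo_ring_diff cyclo_ring_power SR w'R wR r cyclo_ring_of_int)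
  qed
  then show ?case using g_eta by (simp add: S_def w_def)
qed

text \<open>For odd \<open>m\<close> the number \<open>u = 1 + 2 * m\<close> is 1 modulo
  \<open>m\<close>, so the Gauss sum at \<open>u\<close> is unchanged. The closed form, however,
  multiplies it by a sign times e(m s / 4), which is a primitive fourth root of unity when
  \<open>m\<close> and \<open>s\<close> are odd.\<close>

lemma level_even:
  fixes q :: "'a::{finite,ab_group_add} \<Rightarrow> rat"
  assumes fqm: "fqm UNIV q m"
    and sgn: "fqm.g UNIV q 1 = of_real (sqrt (real CARD('a))) * ee (of_nat s / 8)"
    and s: "odd s"
  shows "even m"
proof (rule ccontr)
  assume "odd m"
  interpret fqm UNIV q m by fact
  define u where "u = 1 + 2 * nat m"
  have iu: "int u = 1 + m * 2" using m_pos by (simp add: u_def)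
  have "[int u = 1] (mod m)" unfolding iu by (metis cong_add_lcancel_0 cong_mult_self_left)
  then have cu: "coprime (int u) m" "g (int u) = g 1"
    using cong_imp_coprime[OF cong_sym, of "int u" 1 m] by (auto intro: g_cong)
  have "odd u" by (simp add: u_def)
  define kr where "kr = kronecker (int CARD('a)) u"
  have n0: "0 < CARD('a)" by (simp add: card_gt_0_iff)
  have "of_int kr * ee (of_nat (u * s) / 8) = ee (of_nat s / 8)"
    using gauss_closed_form[OF fqm sgn \<open>odd u\<close> cu(1)] sgn cu(2) n0 by (simp add: kr_def)
  moreover have "ee (of_nat (u * s) / 8) = ee (of_nat s / 8) * ee (of_nat (nat m * s) / 4)"
    unfolding u_def by (simp add: ring_distribs add_divide_distrib mult_ac flip: ee_add)
  ultimately have 1: "of_int kr * ee (of_nat (nat m * s) / 4) = 1" by simp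
  then have "of_int (kr * kr) * (ee (of_nat (nat m * s) / 4) * ee (of_nat (nat m * s) / 4)) = 1"
    by (metis (no_types, lifting) mult.assoc mult.commute mult_1 of_int_mult)
  moreover have "norm (of_int kr * ee (of_nat (nat m * s) / 4)) = 1" using 1 by simp
  then have "\<bar>kr\<bar> = 1" by (simp add: norm_mult ee_def)
  then have "kr * kr = 1" by (metis abs_mult_self_eq mult_1)
  ultimately have "ee (of_nat (nat m * s) / 4) * ee (of_nat (nat m * s) / 4) = 1" by simp
  then have "ee (of_real (real (nat m * s) / 2)) = 1"
    by (simp flip: ee_add add: add_divide_distrib[symmetric] mult_ac)
  then have "real (nat m * s) / 2 \<in> \<int>" by (simp only: ee_of_real_eq_1_iff)
  then obtain k where "real (nat m * s) / 2 = of_int k" by (elim Ints_cases)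
  then have "real_of_int (int (nat m * s)) = real_of_int (2 * k)" by (simp only: of_int_of_nat_eq of_int_mult)
  then have "int (nat m * s) = 2 * k" by (simp only: of_int_eq_iff)
  then have "even (nat m * s)" by presburger
  then show False using s \<open>odd m\<close> m_pos by (simp add: even_nat_iff)
qed

section \<open>Words in the generators of the metaplectic group\<close>

text \<open>The tuple \<open>(a, b, c, d, e)\<close> with \<open>ad - bc = 1\<close> and \<open>e = \<plusminus>1\<close> stands for the metaplectic element
  with matrix \<open>(a, b; c, d)\<close> and \<open>\<phi>(\<tau>) = e * csqrt (c\<tau> + d)\<close>; the sign \<open>sg a c\<close> compares
  \<open>csqrt (M\<tau>) * csqrt (c\<tau> + d)\<close> with \<open>csqrt (a\<tau> + b)\<close>.\<close>

type_synonym mt = "int \<times> int \<times> int \<times> int \<times> int"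

definition sg :: "int \<Rightarrow> int \<Rightarrow> int" where
  "sg a c = (if a < 0 \<and> 0 \<le> c then -1 else 1)"

lemma sg_square [simp]: "sg a c * sg a c = 1" "e * sg a c * sg a c = e"
  by (auto simp: sg_def)

fun mt_ok :: "mt \<Rightarrow> bool" where
  "mt_ok (a, b, c, d, e) \<longleftrightarrow> a * d - b * c = 1 \<and> e \<in> {1, -1}"

text \<open>Left multiplication by the metaplectic generator \<open>mpS\<close>, see
  \<open>mpS_mult\<close>; the sign records the behaviour of the principal root.\<close>

fun tS :: "mt \<Rightarrow> mt" where
  "tS (a, b, c, d, e) = (- c, - d, a, b, e * sg a c)"

fun tSi :: "mt \<Rightarrow> mt" where
  "tSi (a, b, c, d, e) = (c, d, - a, - b, e * sg c (- a))"

fun tT :: "mt \<Rightarrow> mt" where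
  "tT (a, b, c, d, e) = (a + c, b + d, c, d, e)"

fun tT' :: "mt \<Rightarrow> mt" where
  "tT' (a, b, c, d, e) = (a - c, b - d, c, d, e)"

lemma mt_ok_steps: "mt_ok X \<Longrightarrow> mt_ok (tS X)" "mt_ok X \<Longrightarrow> mt_ok (tSi X)"
  "mt_ok X \<Longrightarrow> mt_ok (tT X)" "mt_ok X \<Longrightarrow> mt_ok (tT' X)"
  by (cases X; auto simp: sg_def algebra_simps)+

lemma tS_tSi [simp]: "tS (tSi X) = X" and tSi_tS [simp]: "tSi (tS X) = X"
  and tT_tT' [simp]: "tT (tT' X) = X" and tT'_tT [simp]: "tT' (tT X) = X"
  by (cases X; simp)+

text \<open>The relation STS = T'ST', with T' inverse to T, holds including the metaplectic sign. It
  is the detour used in \<open>R_T\<close> where the closed formula fails.\<close>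

lemma tS_braid: "mt_ok X \<Longrightarrow> tS (tT (tS X)) = tT' (tS (tT' X))"
  by (cases X) (auto simp: sg_def)

lemma tS_tS_tT: "mt_ok X \<Longrightarrow> tS (tS (tT X)) = tT (tS (tS X))"
  by (cases X) (auto simp: sg_def)

section \<open>Kernels of the Weil representation\<close>

text \<open>Division by \<open>g 1\<close> takes the place of e(- sig / 8) / sqrt |A|. It makes
  sense on every submodule and is multiplicative under orthogonal decompositions, so no signature of
  a component has to be introduced.\<close>

definition opS :: "('a::{finite,ab_group_add} \<Rightarrow> rat) \<Rightarrow> 'a set \<Rightarrow> ('a \<Rightarrow> complex) \<Rightarrow> 'a \<Rightarrow> complex" where
  "opS q H F y = (\<Sum>x\<in>H. er (- bil q x y) * F x) / fqm.g H q 1"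

definition opT :: "('a::{finite,ab_group_add} \<Rightarrow> rat) \<Rightarrow> ('a \<Rightarrow> complex) \<Rightarrow> 'a \<Rightarrow> complex" where
  "opT q F y = er (q y) * F y"

definition opT' :: "('a::{finite,ab_group_add} \<Rightarrow> rat) \<Rightarrow> ('a \<Rightarrow> complex) \<Rightarrow> 'a \<Rightarrow> complex" where
  "opT' q F y = er (- q y) * F y"

text \<open>A word in the generators gives simultaneously a metaplectic element and, for every submodule
  \<open>H\<close>, the kernel of the corresponding operator on \<open>\<complex>[H]\<close>.\<close>

inductive reach :: "('a::{finite,ab_group_add} \<Rightarrow> rat) \<Rightarrow> mt \<Rightarrow> ('a set \<Rightarrow> 'a \<Rightarrow> 'a \<Rightarrow> complex) \<Rightarrow> bool"
  for q where
  base: "reach q (1, 0, 0, 1, 1) (\<lambda>H x y. if x = y then 1 else 0)"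
| S: "reach q X K \<Longrightarrow> reach q (tS X) (\<lambda>H x. opS q H (K H x))"
| T: "reach q X K \<Longrightarrow> reach q (tT X) (\<lambda>H x. opT q (K H x))"
| T': "reach q X K \<Longrightarrow> reach q (tT' X) (\<lambda>H x. opT' q (K H x))"

lemma reach_ok: "reach q X K \<Longrightarrow> mt_ok X"
  by (induction rule: reach.induct) (auto intro: mt_ok_steps)

lemma opT'_opT [simp]: "opT' q (opT q F) = F"
  by (simp_all add: opT_def opT'_def er_minus fun_eq_iff)

lemma opS_cong: "(\<And>x. x \<in> H \<Longrightarrow> F x = G x) \<Longrightarrow> opS q H F y = opS q H G y"
  unfolding opS_def by (simp cong: sum.cong)

context fqm
begin

lemma H_nonempty [simp]: "H \<noteq> {}"
  using H_0 by auto

lemma g1_nonzero: "g 1 \<noteq> 0"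
  by (rule g_nonzero) simp

lemma er_bil_add_right: "x \<in> H \<Longrightarrow> y \<in> H \<Longrightarrow> z \<in> H \<Longrightarrow> er (bil q x (y + z)) = er (bil q x y) * er (bil q x z)"
  using er_bil_add_left[of y z x] by (simp add: bil_commute)

lemma opS_opS:
  assumes y: "y \<in> H"
  shows "opS q H (opS q H F) y = of_nat (card H) / (g 1)\<^sup>2 * F (- y)"
proof -
  have "(\<Sum>w\<in>H. er (- bil q w y) * (\<Sum>x\<in>H. er (- bil q x w) * F x)) = (\<Sum>x\<in>H. F x * (\<Sum>w\<in>H. er (bil q (- (x + y)) w)))"
    unfolding sum_distrib_left
  proof (subst sum.swap, intro sum.cong refl)
    fix x w assume x: "x \<in> H" and w: "w \<in> H"
    have "er (bil q (- (x + y)) w) = er (- bil q (x + y) w)"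
      using er_bil_zmult_left[OF H_add[OF x y] w, of "- 1"] by simp
    also have "\<dots> = er (- bil q x w) * er (- bil q w y)"
      using er_bil_add_left[OF x y w] by (simp add: er_minus bil_commute)
    finally show "er (- bil q w y) * (er (- bil q x w) * F x) = F x * er (bil q (- (x + y)) w)"
      by (simp add: mult_ac)
  qed
  also have "\<dots> = (\<Sum>x\<in>H. F x * (if - (x + y) = 0 then of_nat (card H) else 0))"
    using y by (intro sum.cong refl arg_cong2[of _ _ _ _ "(*)"] character_sum H_uminus H_add)
  also have "\<dots> = (\<Sum>x\<in>H. if x = - y then F x * of_nat (card H) else 0)"
  proof (intro sum.cong refl)
    fix x
    have "- (x + y) = 0 \<longleftrightarrow> x = - y" by (metis add.inverse_inverse eq_neg_iff_add_eq_0 neg_equal_0_iff_equal)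
    then show "F x * (if - (x + y) = 0 then of_nat (card H) else 0) = (if x = - y then F x * of_nat (card H) else 0)" by simp
  qed
  also have "\<dots> = F (- y) * of_nat (card H)"
    using H_uminus[OF y] by (simp add: sum.delta)
  finally show ?thesis
    unfolding opS_def by (simp add: power2_eq_square field_simps flip: sum_divide_distrib)
qed

lemma opS_inject:
  assumes "\<And>y. y \<in> H \<Longrightarrow> opS q H F y = opS q H G y" and y: "y \<in> H"
  shows "F y = G y"
proof -
  have "opS q H (opS q H F) (- y) = opS q H (opS q H G) (- y)"
    by (rule opS_cong) (rule assms)
  then show ?thesis using card_H_pos g1_nonzero H_uminus[OF y] by (simp add: opS_opS)
qed

lemma opS_opS_opT:
  assumes y: "y \<in> H"
  shows "opS q H (opS q H (opT q F)) y = opT q (opS q H (opS q H F)) y"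
  using y er_cong[OF q_uminus[OF y]] by (simp add: opS_opS opT_def)

text \<open>The operator counterpart of \<open>tS_braid\<close>. Completing the square evaluates the
  inner sum, and the resulting \<open>g 1\<close> cancels one of the two normalizations.\<close>

lemma opS_braid:
  assumes y: "y \<in> H"
  shows "opS q H (opT q (opS q H F)) y = opT' q (opS q H (opT' q F)) y"
proof -
  have "(\<Sum>w\<in>H. er (- bil q w y) * (er (q w) * (\<Sum>x\<in>H. er (- bil q x w) * F x)))
      = (\<Sum>x\<in>H. F x * (\<Sum>w\<in>H. er (of_int 1 * q w - bil q w (x + y))))"
    unfolding sum_distrib_left
  proof (subst sum.swap, intro sum.cong refl)
    fix x w assume x: "x \<in> H" and w: "w \<in> H"
    show "er (- bil q w y) * (er (q w) * (er (- bil q x w) * F x)) = F x * er (of_int 1 * q w - bil q w (x + y))"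
      using er_bil_add_right[OF w x y] by (simp add: er_diff er_minus bil_commute field_simps)
  qed
  also have "\<dots> = (\<Sum>x\<in>H. F x * (g 1 * er (- of_int 1 * q (x + y))))"
    using y by (intro sum.cong refl arg_cong2[of _ _ _ _ "(*)"] complete_square H_add) simp_all
  also have "\<dots> = g 1 * (er (- q y) * (\<Sum>x\<in>H. er (- bil q x y) * (er (- q x) * F x)))"
    unfolding sum_distrib_left by (intro sum.cong refl) (simp add: q_add er_minus er_diff er_add field_simps)
  finally have *: "(\<Sum>w\<in>H. er (- bil q w y) * (er (q w) * (\<Sum>x\<in>H. er (- bil q x w) * F x)))
      = g 1 * (er (- q y) * (\<Sum>x\<in>H. er (- bil q x y) * (er (- q x) * F x)))" .
  have "opS q H (opT q (opS q H F)) y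
      = (\<Sum>w\<in>H. er (- bil q w y) * (er (q w) * (\<Sum>x\<in>H. er (- bil q x w) * F x))) / g 1 / g 1"
  proof -
    have "er (- bil q w y) * opT q (opS q H F) w = (er (- bil q w y) * (er (q w) * (\<Sum>x\<in>H. er (- bil q x w) * F x))) / g 1" for w
      by (simp add: opS_def opT_def)
    then show ?thesis unfolding opS_def[of q H "opT q (opS q H F)"] by (simp only: sum_divide_distrib)
  qed
  also have "\<dots> = er (- q y) * ((\<Sum>x\<in>H. er (- bil q x y) * (er (- q x) * F x)) / g 1)"
    unfolding * using g1_nonzero by simp
  also have "\<dots> = opT' q (opS q H (opT' q F)) y" by (simp only: opS_def opT'_def)
  finally show ?thesis .
qed

text \<open>With \<open>v\<close> inverse to \<open>c\<close>, the exponent is (a q(y) - (x, y) + d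
  q(x)) / c, the classical kernel of a matrix with entries \<open>a\<close>, \<open>c\<close>,
  \<open>d\<close>.\<close>

definition gker :: "int \<Rightarrow> int \<Rightarrow> int \<Rightarrow> 'a \<Rightarrow> 'a \<Rightarrow> complex" where
  "gker v a d x y = er (of_int (v * a) * q y - of_int v * bil q x y + of_int (v * d) * q x)"

lemma gker_cong:
  assumes "[v = v'] (mod m)" "x \<in> H" "y \<in> H"
  shows "gker v a d x y = gker v' a d x y"
proof -
  have "[v * a = v' * a] (mod m)" "[v * d = v' * d] (mod m)" using assms(1) by (auto intro: cong_scalar_right)
  then show ?thesis
    unfolding gker_def er_add er_diff
    by (simp only: er_q_cong[OF assms(3), of "v * a" "v' * a"] er_q_cong[OF assms(2), of "v * d" "v' * d"]
        er_bil_cong[OF assms(2,3,1)])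
qed

lemma opT_gker:
  assumes "[c * v = 1] (mod m)" "x \<in> H" "y \<in> H"
  shows "er (q y) * gker v a d x y = gker v (a + c) d x y"
proof -
  have "[v * (a + c) = v * a + 1] (mod m)" using assms(1) by (simp add: ring_distribs mult.commute cong_add_lcancel)
  then have "er (of_int (v * (a + c)) * q y) = er (q y) * er (of_int (v * a) * q y)"
    using er_q_cong[OF assms(3), of "v * (a + c)" "v * a + 1"] by (simp only: of_int_add of_int_1 ring_distribs er_add) simp
  then show ?thesis by (simp only: gker_def er_add er_diff) simp
qed

text \<open>The sum over \<open>z\<close> is Gaussian with coefficient \<open>a / c\<close>.
  Completing the square produces the Gauss sum at \<open>a / c\<close> and the kernel whose lower
  left entry is \<open>a\<close>.\<close>

lemma opS_gker:
  assumes ok: "a * d - b * c = 1" and v: "[c * v = 1] (mod m)" and w: "[a * w = 1] (mod m)"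
    and x: "x \<in> H" and y: "y \<in> H"
  shows "(\<Sum>z\<in>H. er (- bil q z y) * gker v a d x z) = g (a * c) * gker w (- c) b x y"
proof -
  let ?y = "y + zmult v x"
  have vx: "zmult v x \<in> H" using x by (rule H_zmult)
  have "(\<Sum>z\<in>H. er (- bil q z y) * gker v a d x z) = (\<Sum>z\<in>H. er (of_int (v * d) * q x) * er (of_int (v * a) * q z - bil q z ?y))"
  proof (rule sum.cong[OF refl])
    fix z assume z: "z \<in> H"
    have "er (bil q z ?y) = er (bil q z y) * er (of_int v * bil q x z)"
      using er_bil_add_right[OF z y vx] er_bil_zmult_left[OF x z, of v] by (simp add: bil_commute)
    then show "er (- bil q z y) * gker v a d x z = er (of_int (v * d) * q x) * er (of_int (v * a) * q z - bil q z ?y)"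
      by (simp add: gker_def er_add er_diff er_minus field_simps)
  qed
  also have "\<dots> = er (of_int (v * d) * q x) * (g (v * a) * er (- of_int (c * w) * q ?y))"
  proof -
    have "[(v * a) * (c * w) = 1 * 1] (mod m)"
      using cong_mult[OF v w] by (simp add: mult_ac)
    then have "[v * a * (c * w) = 1] (mod m)" by simp
    from complete_square[OF this H_add[OF y vx]] show ?thesis by (simp only: sum_distrib_left[symmetric])
  qed
  also have "g (v * a) = g (a * c)"
  proof -
    have cv: "coprime v m" using v by (metis cong_imp_coprime cong_sym coprime_1_left coprime_mult_left_iff)
    \<comment> \<open>\<open>a / c\<close> and \<open>a * c\<close> differ by the square of a
      unit.\<close>
    have "g (a * c) = g (a * c * v\<^sup>2)" by (rule g_square[OF cv, symmetric])
    also have "\<dots> = g (v * a)"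
    proof (rule g_cong)
      have "[(c * v) * (v * a) = 1 * (v * a)] (mod m)" by (intro cong_scalar_right v)
      then show "[a * c * v\<^sup>2 = v * a] (mod m)" by (simp add: power2_eq_square mult_ac)
    qed
    finally show ?thesis by simp
  qed
  also have "er (- of_int (c * w) * q ?y) = er (of_int (- (c * w)) * q y) * er (of_int (- w) * bil q x y) * er (of_int (- (w * v)) * q x)"
  proof -
    have i1: "of_int (- (c * w)) * (q (zmult v x) - of_int (v\<^sup>2) * q x) \<in> \<int>" using x by (intro Ints_mult q_zmult) auto
    have e1: "er (of_int (- (c * w)) * q (zmult v x)) = er (of_int (- (w * v)) * q x)"
    proof -
      have "er (of_int (- (c * w)) * q (zmult v x)) = er (of_int (- (c * w) * v\<^sup>2) * q x)"
        using er_cong[of "of_int (- (c * w)) * q (zmult v x)" "of_int (- (c * w) * v\<^sup>2) * q x"] i1 by (simp add: algebra_simps)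
      also have "\<dots> = er (of_int (- (w * v)) * q x)"
      proof (rule er_q_cong[OF x])
        have "[(c * v) * (- (w * v)) = 1 * (- (w * v))] (mod m)" by (intro cong_scalar_right v)
        then show "[- (c * w) * v\<^sup>2 = - (w * v)] (mod m)" by (simp add: power2_eq_square mult_ac)
      qed
      finally show ?thesis .
    qed
    have i2: "of_int (- (c * w)) * (bil q (zmult v x) y - of_int v * bil q x y) \<in> \<int>"
      using x y by (intro Ints_mult bil_zmult_left) auto
    have e2: "er (of_int (- (c * w)) * bil q y (zmult v x)) = er (of_int (- w) * bil q x y)"
    proof -
      have "er (of_int (- (c * w)) * bil q y (zmult v x)) = er (of_int (- (c * w) * v) * bil q x y)"
        using er_cong[of "of_int (- (c * w)) * bil q y (zmult v x)" "of_int (- (c * w) * v) * bil q x y"] i2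
        by (simp add: algebra_simps bil_commute[of y])
      also have "\<dots> = er (of_int (- w) * bil q x y)"
      proof (rule er_bil_cong[OF x y])
        have "[(c * v) * (- w) = 1 * (- w)] (mod m)" by (intro cong_scalar_right v)
        then show "[- (c * w) * v = - w] (mod m)" by (simp add: mult_ac)
      qed
      finally show ?thesis .
    qed
    have "- of_int (c * w) * q ?y = of_int (- (c * w)) * q y + of_int (- (c * w)) * bil q y (zmult v x) + of_int (- (c * w)) * q (zmult v x)"
      by (simp add: q_add algebra_simps)
    then show ?thesis by (simp only: er_add e1 e2)
  qed
  also have "er (of_int (v * d) * q x) * (g (a * c) * (er (of_int (- (c * w)) * q y) * er (of_int (- w) * bil q x y) * er (of_int (- (w * v)) * q x)))
     = g (a * c) * (er (of_int (- (c * w)) * q y) * er (of_int (- w) * bil q x y) * er (of_int (v * d + - (w * v)) * q x))"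
  proof -
    have "er (of_int (v * d + - (w * v)) * q x) = er (of_int (v * d) * q x) * er (of_int (- (w * v)) * q x)"
      by (simp only: of_int_add distrib_right er_add)
    then show ?thesis by (simp only: mult_ac)
  qed
  \<comment> \<open>The determinant enters here: d / c - 1 / (a c) = b / a modulo
    \<open>m\<close>.\<close>
  also have "er (of_int (v * d + - (w * v)) * q x) = er (of_int (w * b) * q x)"
  proof (rule er_q_cong[OF x])
    have "[v * d * (a * w) + - (w * v) = v * d * 1 + - (w * v)] (mod m)"
      by (intro cong_add cong_scalar_left w cong_refl)
    moreover have "v * d * (a * w) + - (w * v) = (c * v) * (w * b)"
    proof -
      have "v * d * (a * w) = (a * d) * (v * w)" by (simp only: mult_ac)
      also have "a * d = 1 + b * c" using ok by simp
      finally show ?thesis by (simp add: algebra_simps)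
    qed
    moreover have "[(c * v) * (w * b) = 1 * (w * b)] (mod m)" by (intro cong_scalar_right v)
    ultimately show "[v * d + - (w * v) = w * b] (mod m)"
      unfolding mult_1 mult_1_right using cong_sym cong_trans by metis
  qed
  finally show ?thesis
    by (simp add: gker_def er_add er_diff er_minus field_simps)
qed

end

text \<open>Only one prime divides \<open>m\<close>. \<open>J\<close> is the still undetermined sign
  of the formula; \<open>J_T\<close> and \<open>J_S\<close> are what makes the closed kernel
  compatible with the generators as long as the lower left entries are units.\<close>

locale fqm_local = fqm +
  fixes l :: int and J :: "mt \<Rightarrow> int"
  assumes l: "prime l" "\<And>x. coprime x m \<longleftrightarrow> \<not> l dvd x"
    and J_base: "J (0, 1, -1, 0, 1) = 1"
    and J_T: "mt_ok (a, b, c, d, e) \<Longrightarrow> \<not> l dvd c \<Longrightarrow> J (tT (a, b, c, d, e)) = J (a, b, c, d, e)"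
    and J_S: "mt_ok (a, b, c, d, e) \<Longrightarrow> \<not> l dvd a \<Longrightarrow> \<not> l dvd c \<Longrightarrow>
        of_int (J (tS (a, b, c, d, e))) * g c * g 1 = of_int (J (a, b, c, d, e)) * g a * g (a * c)"
begin

text \<open>For a unit \<open>c\<close> the factor \<open>cnj (g c) / card H\<close> equals
  \<open>1 / g c\<close>; in this shape a step \<open>S\<close> becomes the multiplicative condition
  \<open>J_S\<close>.\<close>

fun Ru :: "mt \<Rightarrow> 'a \<Rightarrow> 'a \<Rightarrow> complex" where
  "Ru (a, b, c, d, e) x y = of_int (J (a, b, c, d, e)) * cnj (g c) / of_nat (card H) * gker (modular_inverse m c) a d x y"

text \<open>If \<open>l\<close> divides \<open>c\<close> there is no closed formula; then \<open>l\<close> does not divide \<open>a\<close> and one step with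
  the generator \<open>S\<close> leads back to the other case.\<close>

fun R :: "mt \<Rightarrow> 'a \<Rightarrow> 'a \<Rightarrow> complex" where
  "R (a, b, c, d, e) x = (if l dvd c then opS q H (Ru (tSi (a, b, c, d, e)) x) else Ru (a, b, c, d, e) x)"

lemma minv: "\<not> l dvd c \<Longrightarrow> [c * modular_inverse m c = 1] (mod m)"
  using l(2) by (intro cong_modular_inverse1) simp

lemma not_both: "mt_ok (a, b, c, d, e) \<Longrightarrow> l dvd c \<Longrightarrow> \<not> l dvd a"
proof
  assume "mt_ok (a, b, c, d, e)" "l dvd c" "l dvd a"
  then have "l dvd a * d - b * c" by (intro dvd_diff) auto
  then show False using l(1) \<open>mt_ok (a, b, c, d, e)\<close> by (simp add: not_prime_unit)
qed

lemma Ru_T: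
  assumes "mt_ok (a, b, c, d, e)" "\<not> l dvd c" "x \<in> H" "y \<in> H"
  shows "Ru (tT (a, b, c, d, e)) x y = opT q (Ru (a, b, c, d, e) x) y"
  using J_T[OF assms(1,2)] opT_gker[OF minv[OF assms(2)] assms(3,4), of a d]
  by (simp add: opT_def)

lemma Ru_T':
  assumes "mt_ok (a, b, c, d, e)" "\<not> l dvd c" "x \<in> H" "y \<in> H"
  shows "Ru (tT' (a, b, c, d, e)) x y = opT' q (Ru (a, b, c, d, e) x) y"
proof -
  have "Ru (a, b, c, d, e) x y = opT q (Ru (tT' (a, b, c, d, e)) x) y"
    using Ru_T[of "a - c" "b - d" c d e x y] mt_ok_steps(4)[OF assms(1)] assms by simp
  then show ?thesis by (simp add: opT_def opT'_def er_minus del: Ru.simps)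
qed

lemma Ru_S:
  assumes ok: "mt_ok (a, b, c, d, e)" and "\<not> l dvd c" "\<not> l dvd a" and x: "x \<in> H" and y: "y \<in> H"
  shows "Ru (tS (a, b, c, d, e)) x y = opS q H (Ru (a, b, c, d, e) x) y"
proof -
  let ?v = "modular_inverse m c" and ?w = "modular_inverse m a"
  have u: "coprime a m" "coprime c m" using l(2) assms by auto
  have n: "of_nat (card H) \<noteq> (0 :: complex)" using card_H_pos by simp
  have cnj_g: "cnj (g u) = of_nat (card H) / g u" if "coprime u m" for u
    using g_mult_cnj[OF that] g_nonzero[OF that] by (simp add: field_simps)
  have "opS q H (Ru (a, b, c, d, e) x) y
      = of_int (J (a, b, c, d, e)) * cnj (g c) / of_nat (card H) * (\<Sum>z\<in>H. er (- bil q z y) * gker ?v a d x z) / g 1"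
    unfolding opS_def by (simp add: sum_distrib_left sum_divide_distrib mult_ac)
  also have "(\<Sum>z\<in>H. er (- bil q z y) * gker ?v a d x z) = g (a * c) * gker ?w (- c) b x y"
    using ok assms by (intro opS_gker minv) auto
  finally have "opS q H (Ru (a, b, c, d, e) x) y = of_int (J (a, b, c, d, e)) * g (a * c) / (g c * g 1) * gker ?w (- c) b x y"
    using n by (simp add: cnj_g[OF u(2)] del: Ru.simps)
  moreover have "of_int (J (a, b, c, d, e)) * g (a * c) / (g c * g 1) = of_int (J (tS (a, b, c, d, e))) / g a"
  proof -
    have "of_int (J (tS (a, b, c, d, e))) * g c * g 1 = of_int (J (a, b, c, d, e)) * g a * g (a * c)"
      using J_S ok assms by blast
    moreover have "coprime (a * c) m" using u by simp
    ultimately show ?thesis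
      using g_nonzero[OF u(1)] g_nonzero[OF u(2)] g1_nonzero
      by (simp add: frac_eq_eq mult_ac)
  qed
  ultimately show ?thesis using n by (simp add: cnj_g[OF u(1)])
qed

text \<open>The intermediate lower left entry \<open>a\<close> may be divisible by \<open>l\<close>.
  Then \<open>a + c\<close> is not, and since the square of \<open>S\<close> commutes with
  \<open>T\<close>, the claim for the tuple follows from the one for its image under
  \<open>T\<close>.\<close>

lemma Ru_SS:
  assumes ok: "mt_ok (a, b, c, d, e)" and c: "\<not> l dvd c" and x: "x \<in> H" and y: "y \<in> H"
  shows "Ru (tS (tS (a, b, c, d, e))) x y = opS q H (opS q H (Ru (a, b, c, d, e) x)) y"
proof -
  have unit: "Ru (tS (tS (a, b, c, d, e))) x y = opS q H (opS q H (Ru (a, b, c, d, e) x)) y"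
    if ok: "mt_ok (a, b, c, d, e)" and a: "\<not> l dvd a" and c: "\<not> l dvd c" and y: "y \<in> H" for a b c d e y
  proof -
    have "Ru (tS (tS (a, b, c, d, e))) x y = opS q H (Ru (tS (a, b, c, d, e)) x) y"
      using Ru_S[of "- c" "- d" a b "e * sg a c" x y] mt_ok_steps(1)[OF ok] a c x y by simp
    also have "\<dots> = opS q H (opS q H (Ru (a, b, c, d, e) x)) y"
      by (rule opS_cong) (use Ru_S[OF ok c a x] in simp)
    finally show ?thesis .
  qed
  show ?thesis
  proof (cases "l dvd a")
    case False
    then show ?thesis using unit[OF ok _ c y] by blast
  next
    case True
    then have ac: "\<not> l dvd a + c" using c by (simp add: dvd_add_right_iff)
    let ?W = "(a, b, c, d, e)"
    have "opT q (Ru (tS (tS ?W)) x) y = Ru (tT (tS (tS ?W))) x y"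
      using Ru_T[of "- a" "- b" "- c" "- d" "e * sg a c * sg (- c) a" x y] mt_ok_steps(1)[OF mt_ok_steps(1)[OF ok]] c x y
      by simp
    also have "\<dots> = Ru (tS (tS (tT ?W))) x y" by (simp only: tS_tS_tT[OF ok])
    also have "\<dots> = opS q H (opS q H (Ru (tT ?W) x)) y"
      using unit[of "a + c" "b + d" c d e y] mt_ok_steps(3)[OF ok] ac c y by simp
    also have "\<dots> = opS q H (opS q H (opT q (Ru ?W x))) y"
      by (intro opS_cong) (use Ru_T[OF ok c x] in simp)
    also have "\<dots> = opT q (opS q H (opS q H (Ru ?W x))) y" using y by (rule opS_opS_opT)
    finally show ?thesis by (simp add: opT_def del: Ru.simps)
  qed
qed

lemma R_S:
  assumes ok: "mt_ok X" and x: "x \<in> H" and y: "y \<in> H"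
  shows "R (tS X) x y = opS q H (R X x) y"
proof (cases X)
  case X: (fields a b c d e)
  show ?thesis
  proof (cases "l dvd c")
    case True
    then have a: "\<not> l dvd a" using not_both ok X by blast
    have "opS q H (R X x) y = opS q H (opS q H (Ru (tSi X) x)) y"
      using True by (simp add: X)
    also have "\<dots> = Ru (tS (tS (tSi X))) x y"
      using Ru_SS[of c d "- a" "- b" "e * sg c (- a)" x y] mt_ok_steps(2)[OF ok] a x y by (simp add: X)
    also have "\<dots> = R (tS X) x y" using a by (simp only: tS_tSi) (simp add: X)
    finally show ?thesis by simp
  next
    case c: False
    show ?thesis
    proof (cases "l dvd a")
      case True
      then have "R (tS X) x = opS q H (Ru (tSi (tS X)) x)" by (simp add: X del: tSi_tS)
      also have "Ru (tSi (tS X)) x = R X x" using c by (simp only: tSi_tS) (simp add: X fun_eq_iff)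
      finally show ?thesis by simp
    next
      case False
      then have "R (tS X) x y = Ru (tS X) x y" by (simp add: X)
      also have "\<dots> = opS q H (R X x) y" using Ru_S[of a b c d e x y] ok c False x y by (simp add: X)
      finally show ?thesis .
    qed
  qed
qed

text \<open>The case that \<open>l\<close> divides \<open>c\<close> is the delicate one, since
  neither side has a closed formula. After applying \<open>S\<close> to both sides, the braid
  relation rewrites the word so that it passes only through tuples with a unit in the lower left;
  \<open>opS\<close> is injective, so it can be removed again.\<close>

lemma R_T:
  assumes ok: "mt_ok X" and x: "x \<in> H" and y: "y \<in> H"
  shows "R (tT X) x y = opT q (R X x) y"
proof (cases X)
  case X: (fields a b c d e)
  show ?thesis
  proof (cases "l dvd c")
    case False
    then show ?thesis using Ru_T[of a b c d e x y] ok x y by (simp add: X opT_def)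
  next
    case True
    then have a: "\<not> l dvd a" using not_both ok X by blast
    then have ac: "\<not> l dvd a + c" "\<not> l dvd c + a" using True by (simp_all add: dvd_add_left_iff dvd_add_right_iff)
    define Y where "Y = tSi X"
    have Yf: "Y = (c, d, - a, - b, e * sg c (- a))" by (simp add: Y_def X)
    define W where "W = tSi (tT X)"
    have Wf: "W = (c, d, - (a + c), - (b + d), e * sg c (- (a + c)))" by (simp add: W_def X)
    have okY: "mt_ok Y" "mt_ok (tT' Y)" "mt_ok (tS (tT' Y))" and okW: "mt_ok W"
      unfolding Y_def W_def by (intro mt_ok_steps ok)+
    have *: "opS q H (opT q (opS q H (Ru Y x))) z = opS q H (opS q H (Ru W x)) z" if z: "z \<in> H" for z
    proof -
      have "opS q H (opT q (opS q H (Ru Y x))) z = opT' q (opS q H (opT' q (Ru Y x))) z"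
        using z by (rule opS_braid)
      also have "\<dots> = opT' q (opS q H (Ru (tT' Y) x)) z"
      proof -
        have "opT' q (Ru Y x) u = Ru (tT' Y) x u" if "u \<in> H" for u
          using Ru_T'[of c d "- a" "- b" "e * sg c (- a)" x u] okY(1) a x that unfolding Yf by (simp del: Ru.simps tT'.simps)
        then have "opS q H (opT' q (Ru Y x)) z = opS q H (Ru (tT' Y) x) z" by (rule opS_cong)
        then show ?thesis
          by (simp only: opT'_def[of q "opS q H (opT' q (Ru Y x))"] opT'_def[of q "opS q H (Ru (tT' Y) x)"])
      qed
      also have "opT' q (opS q H (Ru (tT' Y) x)) z = opT' q (Ru (tS (tT' Y)) x) z"
        using Ru_S[of "c + a" "d + b" "- a" "- b" "e * sg c (- a)" x z] okY(2) a ac x z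
        unfolding opT'_def by (simp add: Yf del: Ru.simps)
      also have "\<dots> = Ru (tT' (tS (tT' Y))) x z"
        using Ru_T'[of a b "c + a" "d + b" "e * sg c (- a) * sg (c + a) (- a)" x z] okY(3) a ac x z by (simp add: Yf del: Ru.simps)
      also have "tT' (tS (tT' Y)) = tS (tT (tS Y))" using tS_braid[OF okY(1)] by simp
      also have "tS Y = X" by (simp add: Y_def)
      also have "tT X = tS W" by (simp add: W_def)
      also have "Ru (tS (tS W)) x z = opS q H (opS q H (Ru W x)) z"
        using Ru_SS[of c d "- (a + c)" "- (b + d)" "e * sg c (- (a + c))" x z] okW ac x z
          dvd_minus_iff[of l "a + c"] unfolding Wf by blast
      finally show ?thesis .
    qed
    have "opT q (opS q H (Ru Y x)) y = opS q H (Ru W x) y" by (rule opS_inject[OF * y])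
    moreover have "R X x = opS q H (Ru Y x)" using True by (simp add: X Y_def)
    moreover have "R (tT X) x = opS q H (Ru W x)" using True by (simp add: X W_def)
    ultimately show ?thesis by (simp add: opT_def)
  qed
qed

lemma R_T':
  assumes "mt_ok X" "x \<in> H" "y \<in> H"
  shows "R (tT' X) x y = opT' q (R X x) y"
  using R_T[OF mt_ok_steps(4)[OF assms(1)] assms(2,3)] by (simp add: opT_def opT'_def er_minus)

text \<open>The identity has lower left entry 0, so this is the case of one step \<open>S\<close>
  from \<open>(0, 1, -1, 0, 1)\<close>, and \<open>J_base\<close> together with orthogonality of
  characters gives the identity kernel.\<close>

lemma R_base:
  assumes x: "x \<in> H" and y: "y \<in> H"
  shows "R (1, 0, 0, 1, 1) x y = (if x = y then 1 else 0)"
proof -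
  have mi: "[modular_inverse m (- 1) = - 1] (mod m)"
    using cong_modular_inverse1[of "- 1" m] by (simp add: cong_minus_minus_iff[of "modular_inverse m (- 1)" "- 1", symmetric])
  have "R (1, 0, 0, 1, 1) x y = (\<Sum>z\<in>H. er (- bil q z y) * (cnj (g (- 1)) / of_nat (card H) * gker (- 1) 0 0 x z)) / g 1"
  proof -
    have "gker (modular_inverse m (- 1)) 0 0 x z = gker (- 1) 0 0 x z" if "z \<in> H" for z
      by (rule gker_cong[OF mi x that])
    then show ?thesis using J_base by (simp add: opS_def sg_def)
  qed
  also have "cnj (g (- 1)) = g 1" using g_minus[of 1] by simp
  also have "(\<Sum>z\<in>H. er (- bil q z y) * (g 1 / of_nat (card H) * gker (- 1) 0 0 x z))
      = g 1 / of_nat (card H) * (\<Sum>z\<in>H. er (bil q (x - y) z))"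
    unfolding sum_distrib_left
  proof (rule sum.cong[OF refl])
    fix z assume z: "z \<in> H"
    have "er (bil q (x - y) z) = er (bil q x z) * er (bil q (- y) z)"
      using er_bil_add_left[OF x H_uminus[OF y] z] by simp
    also have "er (bil q (- y) z) = er (- bil q z y)"
      using er_bil_zmult_left[OF y z, of "- 1"] by (simp add: bil_commute)
    finally show "er (- bil q z y) * (g 1 / of_nat (card H) * gker (- 1) 0 0 x z) = g 1 / of_nat (card H) * er (bil q (x - y) z)"
      by (simp add: gker_def)
  qed
  also have "(\<Sum>z\<in>H. er (bil q (x - y) z)) = (if x - y = 0 then of_nat (card H) else 0)"
    using x y by (intro character_sum H_diff)
  finally show ?thesis using g1_nonzero card_H_pos by simp
qed

text \<open>The kernel is built from a word, while \<open>R\<close> depends only on the tuple; hence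
  different words for the same metaplectic element act alike on the component.\<close>

theorem reach_R:
  assumes "reach q X K" "x \<in> H" "y \<in> H"
  shows "K H x y = R X x y"
  using assms
proof (induction arbitrary: y rule: reach.induct)
  case base
  then show ?case using R_base by simp
next
  case (S X K)
  have "opS q H (K H x) y = opS q H (R X x) y" by (rule opS_cong) (use S in auto)
  then show ?case using R_S[OF reach_ok[OF S(1)]] S by simp
next
  case (T X K)
  then show ?case using R_T[OF reach_ok[OF T(1)]] by (simp add: opT_def)
next
  case (T' X K)
  then show ?case using R_T'[OF reach_ok[OF T'(1)]] by (simp add: opT'_def)
qed

lemma reach_local_formula:
  assumes "reach q (a, b, c, d, e) K" "\<not> l dvd c" "[c * v = 1] (mod m)" "x \<in> H" "y \<in> H"
  shows "K H x y = of_int (J (a, b, c, d, e)) * cnj (g c) / of_nat (card H) * gker v a d x y"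
proof -
  have "[modular_inverse m c * (c * v) = modular_inverse m c * 1] (mod m)" by (intro cong_scalar_left assms)
  moreover have "[c * modular_inverse m c * v = 1 * v] (mod m)" by (intro cong_scalar_right minv assms)
  ultimately have "[modular_inverse m c = v] (mod m)" by (simp add: mult_ac) (metis cong_sym cong_trans)
  then show ?thesis using reach_R[OF assms(1,4,5)] assms(2) gker_cong[OF _ assms(4,5)] by simp
qed

end

section \<open>Primary decomposition of the Weil representation\<close>

lemma coprime_not_both_even:
  "coprime (a :: int) b \<Longrightarrow> \<not> (even a \<and> even b)" "coprime (m :: nat) n \<Longrightarrow> \<not> (even m \<and> even n)"
  using coprime_common_divisor[of a b 2] coprime_common_divisor[of m n 2] by auto

text \<open>For odd \<open>a\<close> and \<open>c\<close> this is (-1) to the power (a - 1)/2 times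
  (c + 1)/2.\<close>

definition sqr4 :: "int \<Rightarrow> int \<Rightarrow> int" where
  "sqr4 a c = (if a mod 4 = 1 \<or> c mod 4 = 3 then 1 else - 1)"

text \<open>The sign of the step \<open>S\<close> compensates the reciprocity law for negative arguments.\<close>

lemma kronecker_tS:
  assumes o: "odd a" "odd c" and cop: "coprime a c"
  shows "sg a c * kronecker (- c) (nat \<bar>a\<bar>) = kronecker a (nat \<bar>c\<bar>) * sqr4 a c"
proof -
  define A C where "A = nat \<bar>a\<bar>" and "C = nat \<bar>c\<bar>"
  have oAC: "odd A" "odd C" using o by (simp_all add: A_def C_def even_nat_iff)
  have copAC: "coprime A C" using cop by (simp add: A_def C_def coprime_int_iff[symmetric])
  have sA: "kronecker (int C) A \<in> {1, -1}" "kronecker (int A) C \<in> {1, -1}"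
    using kronecker_sign[OF oAC(1), of "int C"] kronecker_sign[OF oAC(2), of "int A"] copAC
    by (simp_all add: coprime_commute)
  have rec: "kronecker (int A) C = (if A mod 4 = 3 \<and> C mod 4 = 3 then -1 else 1) * kronecker (int C) A"
    using kronecker_reciprocity[OF oAC copAC] sA by auto
  have neg: "kronecker (- int C) A = (if A mod 4 = 1 then 1 else -1) * kronecker (int C) A"
      "kronecker (- int A) C = (if C mod 4 = 1 then 1 else -1) * kronecker (int A) C"
    using kronecker_mult_left[OF oAC(1), of "- 1" "int C"] kronecker_mult_left[OF oAC(2), of "- 1" "int A"]
    by (simp_all add: kronecker_minus_1 oAC)
  have a: "a = int A \<or> a = - int A" "c = int C \<or> c = - int C" by (auto simp: A_def C_def)
  have mods: "a = int A \<Longrightarrow> a mod 4 = 1 \<longleftrightarrow> A mod 4 = 1" "a = - int A \<Longrightarrow> a mod 4 = 1 \<longleftrightarrow> A mod 4 = 3"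
    "c = int C \<Longrightarrow> c mod 4 = 3 \<longleftrightarrow> C mod 4 = 3" "c = - int C \<Longrightarrow> c mod 4 = 3 \<longleftrightarrow> C mod 4 = 1"
    by presburger+
  have pos: "A \<noteq> 0" "C \<noteq> 0" using oAC by (auto intro: ccontr)
  have m4: "A mod 4 = 1 \<or> A mod 4 = 3" "C mod 4 = 1 \<or> C mod 4 = 3" using odd_mod4 oAC by auto
  have "sg a c * kronecker (- c) A = kronecker a C * sqr4 a c"
  proof (rule disjE[OF a(1)]; rule disjE[OF a(2)])
    assume h: "a = int A" "c = int C"
    show "sg a c * kronecker (- c) A = kronecker a C * sqr4 a c" using m4 mods(1)[OF h(1)] mods(3)[OF h(2)] pos by (auto simp: h rec neg sg_def sqr4_def)
  next
    assume h: "a = int A" "c = - int C"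
    show "sg a c * kronecker (- c) A = kronecker a C * sqr4 a c" using m4 mods(1)[OF h(1)] mods(4)[OF h(2)] pos by (auto simp: h rec neg sg_def sqr4_def)
  next
    assume h: "a = - int A" "c = int C"
    show "sg a c * kronecker (- c) A = kronecker a C * sqr4 a c" using m4 mods(2)[OF h(1)] mods(3)[OF h(2)] pos by (auto simp: h rec neg sg_def sqr4_def)
  next
    assume h: "a = - int A" "c = - int C"
    show "sg a c * kronecker (- c) A = kronecker a C * sqr4 a c" using m4 mods(2)[OF h(1)] mods(4)[OF h(2)] pos by (auto simp: h rec neg sg_def sqr4_def)
  qed
  then show ?thesis unfolding A_def C_def .
qed

text \<open>The exponent is one half of (a - 1)/2 times (c + 1)/2 times \<open>s\<close>, and the
  odd \<open>s\<close> does not affect its parity. This is the sign by which the eighth roots of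
  unity in the Gauss sums fail to be multiplicative.\<close>

lemma ee_sqr4:
  assumes o: "odd a" "odd c" and s: "odd s"
  shows "ee (of_int ((a - 1) * (c + 1) * int s) / 8) = of_int (sqr4 a c)"
proof -
  obtain i where i: "a = 2 * i + 1" using o by (elim oddE)
  obtain j where j: "c = 2 * j + 1" using o by (elim oddE)
  have e: "ee (of_int ((a - 1) * (c + 1) * int s) / 8) = ee (of_int (i * (j + 1) * int s) * (1 / 2))"
    by (rule arg_cong[of _ _ ee]) (simp add: i j field_simps)
  have half: "ee (1 / 2) = - 1" using er_half by (simp add: er_def of_rat_divide)
  have "ee (of_int ((a - 1) * (c + 1) * int s) / 8) = (- 1) powi (i * (j + 1) * int s)"
    unfolding e ee_of_int_mult half ..
  also have "\<dots> = (if even (i * (j + 1) * int s) then 1 else - 1)" by (simp add: power_int_minus_left)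
  also have "\<dots> = of_int (sqr4 a c)"
  proof -
    have "even (i * (j + 1) * int s) \<longleftrightarrow> even i \<or> odd j" using s by auto
    also have "\<dots> \<longleftrightarrow> a mod 4 = 1 \<or> c mod 4 = 3" unfolding i j by presburger
    finally show ?thesis by (simp add: sqr4_def)
  qed
  finally show ?thesis .
qed

locale odd_disc =
  fixes q :: "'a::{finite,ab_group_add} \<Rightarrow> rat" and N s :: nat
  assumes fqm_UNIV: "fqm UNIV q (int N)"
    and sgn: "fqm.g UNIV q 1 = of_real (sqrt (real CARD('a))) * ee (of_nat s / 8)"
    and odd_s: "odd s"
begin

sublocale A: fqm UNIV q "int N"
  by (rule fqm_UNIV)

definition tors :: "nat \<Rightarrow> 'a set" where
  "tors m = {x. zmult (int m) x = 0}"

lemma N_even: "even N"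
  using level_even[OF fqm_UNIV sgn odd_s] by simp

lemma N_pos: "0 < N"
  using A.m_pos by simp

lemma tors_bezout:
  assumes "coprime m1 (m2 :: nat)"
  obtains u v where "u * int m1 + v * int m2 = 1"
    using assms by (metis bezout_int coprime_iff_gcd_eq_1 coprime_int_iff)

lemma tors_zmult: "x \<in> tors m \<Longrightarrow> zmult (k * int m) x = 0"
  using zmult_zmult[of k "int m" x] by (simp add: tors_def)

lemma tors_N: "tors N = UNIV"
  using A.zmult_m[OF UNIV_I] by (auto simp: tors_def)

text \<open>On the \<open>m\<close>-torsion both \<open>m\<^sup>2\<close> and
  \<open>N = m * m'\<close> clear \<open>q\<close>, and \<open>m\<close> is an integral combination
  of them. Non-degeneracy is inherited because an element of the \<open>m\<close>-torsion pairs
  trivially with the \<open>m'\<close>-part.\<close>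

lemma fqm_tors:
  assumes N: "N = m * m'" and cop: "coprime m m'"
  shows "fqm (tors m) q (int m)"
proof -
  obtain u v where uv: "u * int m + v * int m' = 1" using tors_bezout[OF cop] .
  show ?thesis
  proof unfold_locales
    show "0 < int m" using N N_pos by simp
  next
    fix x assume x: "x \<in> tors m"
    have 1: "of_int ((int m)\<^sup>2) * q x \<in> \<int>"
    proof -
      have "q (zmult (int m) x) - of_int ((int m)\<^sup>2) * q x \<in> \<int>" by (rule A.q_zmult) simp
      then have "q 0 - (q 0 - of_int ((int m)\<^sup>2) * q x) \<in> \<int>"
        using x A.q_0 by (intro Ints_diff) (auto simp: tors_def)
      then show ?thesis by simp
    qed
    have 2: "of_int (int N) * q x \<in> \<int>" by (rule A.m_q) simp
    have "of_int u * (of_int ((int m)\<^sup>2) * q x) + of_int v * (of_int (int N) * q x) \<in> \<int>"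
      by (intro Ints_add Ints_mult[OF Ints_of_int] 1 2)
    also have "of_int u * (of_int ((int m)\<^sup>2) * q x) + of_int v * (of_int (int N) * q x)
        = of_int (int m * (u * int m + v * int m')) * q x"
      unfolding N by (simp add: algebra_simps power2_eq_square)
    finally show "of_int (int m) * q x \<in> \<int>" unfolding uv by simp
  next
    fix x assume x: "x \<in> tors m" and *: "\<And>y. y \<in> tors m \<Longrightarrow> bil q x y \<in> \<int>"
    show "x = 0"
    proof (rule A.nondeg)
      fix z :: 'a
      let ?y = "zmult (v * int m') z"
      have "zmult (int m) ?y = zmult (v * int N) z" unfolding zmult_zmult N by (simp add: mult_ac)
      then have y: "?y \<in> tors m"
        using A.zmult_m[of z] zmult_zmult[of v "int N" z] by (simp add: tors_def)
      have "z = zmult (u * int m) z + ?y" using zmult_add[of "u * int m" "v * int m'" z] uv by simp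
      then have "er (bil q x z) = er (bil q x (zmult (u * int m) z)) * er (bil q x ?y)"
        using A.er_bil_add_right[of x "zmult (u * int m) z" ?y] by simp
      also have "er (bil q x ?y) = 1" using *[OF y] by (simp only: er_eq_1_iff)
      also have "er (bil q x (zmult (u * int m) z)) = er (of_int (u * int m) * bil q x z)"
        using A.er_bil_zmult_left[of z x "u * int m"] by (simp add: A.bil_commute)
      also have "\<dots> = er (bil q (zmult (u * int m) x) z)"
        by (rule A.er_bil_zmult_left[symmetric]) auto
      also have "\<dots> = er (of_int 0 * bil q x z)"
        using A.er_bil_zmult_left[of x z 0] tors_zmult[OF x] by simp
      finally show "bil q x z \<in> \<int>" by (simp add: er_eq_1_iff)
    qed simp
  next
    show "q (zmult n x) - of_int (n\<^sup>2) * q x \<in> \<int>" for n x by (rule A.q_zmult) simp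
    show "bil q (x + y) z - (bil q x z + bil q y z) \<in> \<int>" for x y z by (rule A.bil_add_left) simp_all
  qed (auto simp: tors_def zmult_add_right zmult_uminus_right)
qed

context
  fixes m1 m2 :: nat
  assumes cop: "coprime m1 m2"
begin

lemma tors_orth: "x \<in> tors m1 \<Longrightarrow> y \<in> tors m2 \<Longrightarrow> er (bil q x y) = 1"
proof -
  assume x: "x \<in> tors m1" and y: "y \<in> tors m2"
  obtain u v where uv: "u * int m1 + v * int m2 = 1" using tors_bezout[OF cop] .
  have "er (bil q x y) = er (of_int (u * int m1) * bil q x y + of_int (v * int m2) * bil q x y)"
    using uv by (simp only: distrib_right[symmetric] of_int_add[symmetric]) simp
  also have "\<dots> = er (bil q (zmult (u * int m1) x) y) * er (bil q (zmult (v * int m2) y) x)"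
    by (simp only: er_add A.er_bil_zmult_left UNIV_I A.bil_commute[of y])
  also have "\<dots> = er (bil q (zmult 0 x) y) * er (bil q (zmult 0 y) x)" using x y by (simp add: tors_zmult)
  also have "\<dots> = 1" by (simp only: A.er_bil_zmult_left UNIV_I) simp
  finally show ?thesis .
qed

lemma tors_add: "x \<in> tors m1 \<Longrightarrow> y \<in> tors m2 \<Longrightarrow> x + y \<in> tors (m1 * m2)"
  using tors_zmult[of x m1 "int m2"] tors_zmult[of y m2 "int m1"]
  by (simp add: tors_def zmult_add_right mult.commute)

lemma tors_split: "z \<in> tors (m1 * m2) \<Longrightarrow> \<exists>x\<in>tors m1. \<exists>y\<in>tors m2. z = x + y"
proof -
  assume z: "z \<in> tors (m1 * m2)"
  obtain u v where uv: "u * int m1 + v * int m2 = 1" using tors_bezout[OF cop] .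
  have "zmult (v * int m2) z \<in> tors m1" "zmult (u * int m1) z \<in> tors m2"
    using tors_zmult[OF z, of v] tors_zmult[OF z, of u] by (simp_all add: tors_def zmult_zmult mult_ac)
  moreover have "z = zmult (v * int m2) z + zmult (u * int m1) z"
    using zmult_add[of "v * int m2" "u * int m1" z] uv by (simp add: add.commute)
  ultimately show ?thesis by blast
qed

lemma tors_inter: "x \<in> tors m1 \<Longrightarrow> x \<in> tors m2 \<Longrightarrow> x = 0"
proof -
  assume x: "x \<in> tors m1" "x \<in> tors m2"
  obtain u v where uv: "u * int m1 + v * int m2 = 1" using tors_bezout[OF cop] .
  have "x = zmult (u * int m1 + v * int m2) x" by (simp add: uv)
  then show "x = 0" using x by (simp add: zmult_add tors_zmult)
qed

lemma tors_diff: "x \<in> tors m \<Longrightarrow> y \<in> tors m \<Longrightarrow> x - y \<in> tors m"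
  using zmult_add_right[of "int m" x "- y"] by (simp add: tors_def zmult_uminus_right)

lemma tors_unique:
  assumes "x \<in> tors m1" "x' \<in> tors m1" "y \<in> tors m2" "y' \<in> tors m2"
  shows "x + y = x' + y' \<longleftrightarrow> x = x' \<and> y = y'"
proof
  assume "x + y = x' + y'"
  then have e: "x - x' = y' - y" by (simp add: algebra_simps)
  then have "x - x' = 0" using tors_diff[OF assms(1,2)] tors_diff[OF assms(4,3)] tors_inter by metis
  then show "x = x' \<and> y = y'" using e by simp
qed simp

lemma tors_bij: "bij_betw (\<lambda>(x, y). x + y) (tors m1 \<times> tors m2) (tors (m1 * m2))"
  unfolding bij_betw_def
proof
  show "inj_on (\<lambda>(x, y). x + y) (tors m1 \<times> tors m2)"
    by (auto simp: inj_on_def tors_unique)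
  show "(\<lambda>(x, y). x + y) ` (tors m1 \<times> tors m2) = tors (m1 * m2)"
    using tors_add tors_split by fastforce
qed

lemma sum_tors: "(\<Sum>z\<in>tors (m1 * m2). F z) = (\<Sum>x\<in>tors m1. \<Sum>y\<in>tors m2. F (x + y) :: complex)"
  using sum.reindex_bij_betw[OF tors_bij, of F] by (simp add: sum.cartesian_product case_prod_unfold)

lemma card_tors: "card (tors (m1 * m2)) = card (tors m1) * card (tors m2)"
  using bij_betw_same_card[OF tors_bij] by (simp only: card_cartesian_product)

lemma er_q_tors: "x \<in> tors m1 \<Longrightarrow> y \<in> tors m2 \<Longrightarrow> er (of_int c * q (x + y)) = er (of_int c * q x) * er (of_int c * q y)"
proof -
  assume x: "x \<in> tors m1" and y: "y \<in> tors m2"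
  have "bil q x y \<in> \<int>" using tors_orth[OF x y] by (simp only: er_eq_1_iff)
  then have "er (of_int c * bil q x y) = 1" by (simp add: er_eq_1_iff)
  then show ?thesis by (simp add: A.q_add er_add ring_distribs)
qed

lemma er_bil_tors:
  assumes "x \<in> tors m1" "x' \<in> tors m1" "y \<in> tors m2" "y' \<in> tors m2"
  shows "er (of_int c * bil q (x + y) (x' + y')) = er (of_int c * bil q x x') * er (of_int c * bil q y y')"
proof -
  have "er (of_int c * bil q (x + y) (x' + y')) = er (bil q (zmult c x + zmult c y) (x' + y'))"
    using A.er_bil_zmult_left[of "x + y" "x' + y'" c] by (simp add: zmult_add_right)
  also have "\<dots> = (er (bil q (zmult c x) x') * er (bil q (zmult c x) y')) * (er (bil q (zmult c y) x') * er (bil q (zmult c y) y'))"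
    by (simp add: A.er_bil_add_left A.er_bil_add_right)
  also have "er (bil q (zmult c x) y') = 1"
    using assms by (intro tors_orth) (auto simp: tors_def zmult_zmult mult.commute[of _ c] zmult_zmult[symmetric])
  also have "er (bil q (zmult c y) x') = 1"
    unfolding A.bil_commute[of "zmult c y"]
    using assms by (intro tors_orth) (auto simp: tors_def zmult_zmult mult.commute[of _ c] zmult_zmult[symmetric])
  finally show ?thesis by (simp add: A.er_bil_zmult_left)
qed

lemma g_tors: "fqm.g (tors (m1 * m2)) q c = fqm.g (tors m1) q c * fqm.g (tors m2) q c"
  if "fqm (tors m1) q (int m1)" "fqm (tors m2) q (int m2)" "fqm (tors (m1 * m2)) q (int (m1 * m2))"
  unfolding fqm.g_def[OF that(1)] fqm.g_def[OF that(2)] fqm.g_def[OF that(3)] sum_tors sum_product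
  by (intro sum.cong refl er_q_tors)

text \<open>The two components are orthogonal, so every generator acts as a tensor product; for
  \<open>S\<close> this also uses that the Gauss sums multiply.\<close>

lemma reach_tensor:
  assumes fqms: "fqm (tors m1) q (int m1)" "fqm (tors m2) q (int m2)" "fqm (tors (m1 * m2)) q (int (m1 * m2))"
    and "reach q X K" and x: "x1 \<in> tors m1" "x2 \<in> tors m2" and "y1 \<in> tors m1" "y2 \<in> tors m2"
  shows "K (tors (m1 * m2)) (x1 + x2) (y1 + y2) = K (tors m1) x1 y1 * K (tors m2) x2 y2"
  using assms(4,7,8)
proof (induction arbitrary: y1 y2 rule: reach.induct)
  case base
  then show ?case using x by (simp add: tors_unique)
next
  case (S X K)
  have "(\<Sum>z\<in>tors (m1 * m2). er (- bil q z (y1 + y2)) * K (tors (m1 * m2)) (x1 + x2) z)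
      = (\<Sum>z1\<in>tors m1. \<Sum>z2\<in>tors m2. (er (- bil q z1 y1) * K (tors m1) x1 z1) * (er (- bil q z2 y2) * K (tors m2) x2 z2))"
    unfolding sum_tors using S er_bil_tors[of _ y1 _ y2 "- 1"]
    by (intro sum.cong refl) simp
  then show ?case
    unfolding opS_def g_tors[OF fqms] by (simp add: sum_product)
next
  case (T X K)
  then show ?case using er_q_tors[of y1 y2 1] by (simp add: opT_def)
next
  case (T' X K)
  then show ?case using er_q_tors[of y1 y2 "- 1"] by (simp add: opT'_def)
qed

end

text \<open>The metaplectic sign and the symbol are assigned to the even component. Of two coprime
  factors at most one is even, so these signs multiply correctly, and \<open>N\<close> itself is
  even.\<close>

definition Jm :: "nat \<Rightarrow> mt \<Rightarrow> int" where
  "Jm m X = (case X of (a, b, c, d, e) \<Rightarrow> if even m then e * kronecker a (nat \<bar>c\<bar>) else 1)"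

definition good :: "nat \<Rightarrow> bool" where
  "good m \<longleftrightarrow> (\<forall>a b c d e K v x y. reach q (a, b, c, d, e) K \<longrightarrow> coprime c (int m) \<longrightarrow> [c * v = 1] (mod int m) \<longrightarrow>
     x \<in> tors m \<longrightarrow> y \<in> tors m \<longrightarrow>
     K (tors m) x y = of_int (Jm m (a, b, c, d, e)) * cnj (fqm.g (tors m) q c) / of_nat (card (tors m)) * fqm.gker q v a d x y)"

lemma good_1: "good 1"
proof -
  have f: "fqm (tors 1) q (int 1)" by (rule fqm_tors[of 1 N]) simp_all
  have t: "tors 1 = {0 :: 'a}" by (auto simp: tors_def)
  have q0: "er (of_int c * q 0) = 1" for c
    using A.q_0 by (simp only: er_eq_1_iff) (rule Ints_mult[OF Ints_of_int])
  have b0: "er (of_int c * bil q 0 0) = 1" for c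
    using A.q_0 unfolding er_eq_1_iff bil_def by (simp add: Ints_mult)
  have g1: "fqm.g (tors 1) q c = 1" for c unfolding fqm.g_def[OF f] unfolding t using q0 by simp
  have K: "K (tors 1) 0 0 = 1" if "reach q X K" for X K
    using that
  proof (induction rule: reach.induct)
    case (S X K)
    then have "(\<Sum>x\<in>tors 1. er (- bil q x 0) * K (tors 1) 0 x) = 1"
      unfolding t using b0[of "- 1"] by simp
    then show ?case unfolding opS_def g1 by simp
  next
    case (T X K)
    then show ?case using q0[of 1] by (simp add: opT_def)
  next
    case (T' X K)
    then show ?case using q0[of "- 1"] by (simp add: opT'_def)
  qed simp
  have "fqm.gker q v a d 0 0 = 1" for v a d
    unfolding A.gker_def er_add er_diff q0 b0 by simp
  then show ?thesis unfolding good_def using K g1 t by (auto simp: Jm_def)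
qed

lemma good_mult:
  assumes N: "N = m1 * m2 * m'" and cop: "coprime m1 m2" "coprime (m1 * m2) m'"
    and good: "good m1" "good m2"
  shows "good (m1 * m2)"
  unfolding good_def
proof (intro allI impI)
  fix a b c d e v K x y
  assume K: "reach q (a, b, c, d, e) K" and c: "coprime c (int (m1 * m2))" and v: "[c * v = 1] (mod int (m1 * m2))"
    and x: "x \<in> tors (m1 * m2)" and y: "y \<in> tors (m1 * m2)"
  have f: "fqm (tors m1) q (int m1)" "fqm (tors m2) q (int m2)" "fqm (tors (m1 * m2)) q (int (m1 * m2))"
    using fqm_tors[of m1 "m2 * m'"] fqm_tors[of m2 "m1 * m'"] fqm_tors[OF N cop(2)] N cop
    by (auto simp: mult_ac coprime_commute)
  have c12: "coprime c (int m1)" "coprime c (int m2)" using c by auto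
  have v12: "[c * v = 1] (mod int m1)" "[c * v = 1] (mod int m2)"
    using v by (auto intro: cong_dvd_modulus)
  obtain x1 x2 where x12: "x1 \<in> tors m1" "x2 \<in> tors m2" "x = x1 + x2" using tors_split[OF cop(1) x] by blast
  obtain y1 y2 where y12: "y1 \<in> tors m1" "y2 \<in> tors m2" "y = y1 + y2" using tors_split[OF cop(1) y] by blast
  have gk: "fqm.gker q v a d x y = fqm.gker q v a d x1 y1 * fqm.gker q v a d x2 y2"
    unfolding A.gker_def x12 y12 er_add er_diff
    by (simp only: er_q_tors[OF cop(1) y12(1,2)] er_q_tors[OF cop(1) x12(1,2)]
        er_bil_tors[OF cop(1) x12(1) y12(1) x12(2) y12(2)]) simp
  have "\<not> (even m1 \<and> even m2)" using cop(1) by (rule coprime_not_both_even(2))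
  then have J: "Jm (m1 * m2) (a, b, c, d, e) = Jm m1 (a, b, c, d, e) * Jm m2 (a, b, c, d, e)"
    by (auto simp: Jm_def)
  have "K (tors m1) x1 y1 = of_int (Jm m1 (a, b, c, d, e)) * cnj (fqm.g (tors m1) q c) / of_nat (card (tors m1 :: 'a set)) * fqm.gker q v a d x1 y1"
       "K (tors m2) x2 y2 = of_int (Jm m2 (a, b, c, d, e)) * cnj (fqm.g (tors m2) q c) / of_nat (card (tors m2 :: 'a set)) * fqm.gker q v a d x2 y2"
    using good K c12 v12 x12 y12 unfolding good_def by blast+
  then show "K (tors (m1 * m2)) x y = of_int (Jm (m1 * m2) (a, b, c, d, e)) * cnj (fqm.g (tors (m1 * m2)) q c) /
      of_nat (card (tors (m1 * m2) :: 'a set)) * fqm.gker q v a d x y"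
    using reach_tensor[OF cop(1) f K x12(1,2) y12(1,2)]
    unfolding J gk card_tors[OF cop(1)] g_tors[OF cop(1) f] unfolding x12(3) y12(3) by simp
qed

lemma card_prime_to: "coprime (int t) (int N) \<Longrightarrow> coprime (int CARD('a)) (int t)"
proof (rule ccontr)
  assume t: "coprime (int t) (int N)" and "\<not> coprime (int CARD('a)) (int t)"
  then have "\<not> coprime CARD('a) t" by simp
  then have "gcd CARD('a) t \<noteq> 1" by (rule contrapos_nn) (rule gcd_eq_1_imp_coprime)
  from prime_factor_nat[OF this] obtain r where r: "prime r" "r dvd CARD('a)" "r dvd t" by auto
  then have "coprime (int r) (int N)" using t coprime_divisors[of "int r" "int t" "int N" "int N"] by simp
  then show False using fqm_card_coprime[OF fqm_UNIV r(1)] r(2) by blast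
qed

text \<open>Gauss sums of a primary component are evaluated through Gauss sums of the whole form at an
  integer that is congruent to 1 modulo the other primes.\<close>

lemma good_prime_power:
  assumes N: "N = m * m'" and cop: "coprime m m'" and l: "prime (l :: nat)" and m: "m = l ^ k" "0 < k"
  shows "good m"
proof -
  have m0: "0 < m" "0 < m'" using N N_pos by auto
  have f: "fqm (tors m) q (int m)" by (rule fqm_tors[OF N cop])
  have f': "fqm (tors m') q (int m')" by (rule fqm_tors) (use N cop in \<open>auto simp: mult.commute coprime_commute\<close>)
  interpret H: fqm "tors m" q "int m" by (rule f)
  interpret H': fqm "tors m'" q "int m'" by (rule f')
  \<comment> \<open>The closed form depends on its argument modulo 8 through an eighth root of
    unity, so the modulus that contains the prime 2 is enlarged by 8.\<close>
  define M1 M2 where "M1 = (if even m then 8 * m else m)" and "M2 = (if even m then m' else 8 * m')"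
  have par: "even m \<longleftrightarrow> odd m'" using N N_even coprime_not_both_even(2)[OF cop] by auto
  have copM: "coprime M1 M2"
  proof (cases "even m")
    case True
    then have "coprime (2 ^ 3) m'" using par by (intro coprime_power_left_iff[THEN iffD2]) simp
    then show ?thesis using True cop by (simp add: M1_def M2_def)
  next
    case False
    then have "coprime m (2 ^ 3)" by (intro coprime_power_right_iff[THEN iffD2]) simp
    then show ?thesis using False cop by (simp add: M1_def M2_def)
  qed
  define lift where "lift u t \<longleftrightarrow> 0 < t \<and> [int t = u] (mod int M1) \<and> [int t = 1] (mod int M2)" for u t
  have ex_lift: "\<exists>t. lift u t" if u: "coprime u (int m)" for u
  proof -
    obtain t where t: "[t = nat (u mod int M1)] (mod M1)" "[t = 1] (mod M2)"
      using binary_chinese_remainder_nat[OF copM] by blast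
    have M1: "0 < M1" using m0 by (simp add: M1_def)
    have "[int t = u mod int M1] (mod int M1)"
      using t(1) M1 by (metis cong_int_iff int_nat_eq pos_mod_sign of_nat_0_less_iff)
    then have "[int t = u] (mod int M1)" by (simp add: cong_def)
    moreover have "[int t = 1] (mod int M2)" using t(2) cong_int_iff[of t 1 M2] by simp
    moreover have "t \<noteq> 0"
    proof
      assume t0: "t = 0"
      show False
      proof (cases "even m")
        case True
        have "int M1 dvd u" using \<open>[int t = u] (mod int M1)\<close> t0 by (simp add: cong_def mod_0_imp_dvd)
        then have "2 dvd u" using True by (auto simp: M1_def elim: dvd_trans[rotated])
        then show False using u True using coprime_not_both_even by auto
      next
        case False
        then have "8 dvd M2" by (simp add: M2_def)
        then have "[t = 1] (mod 8)" using t(2) cong_dvd_modulus_nat by blast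
        then show False using t0 by (simp add: cong_def)
      qed
    qed
    ultimately show ?thesis by (auto simp: lift_def)
  qed
  have mM: "int m dvd int M1" "int m' dvd int M2" by (auto simp: M1_def M2_def)
  have lift_props: "odd t" "coprime (int t) (int N)" "[int t = u] (mod int m)" "[int t = 1] (mod int m')"
    if "lift u t" "coprime u (int m)" for u t
  proof -
    show 1: "[int t = u] (mod int m)" "[int t = 1] (mod int m')"
      using that mM unfolding lift_def by (auto intro: cong_dvd_modulus)
    have "coprime (int t) (int m)" using 1(1) that(2) by (meson cong_imp_coprime cong_sym)
    moreover have "coprime (int t) (int m')" using 1(2) by (meson cong_imp_coprime cong_sym coprime_1_left)
    ultimately show c: "coprime (int t) (int N)" unfolding N by simp
    then show "odd t" using N_even using coprime_not_both_even by auto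
  qed
  have gA: "A.g c = H.g c * H'.g c" for c
  proof -
    have "fqm (tors (m * m')) q (int (m * m'))" using fqm_UNIV tors_N N by simp
    then show ?thesis using g_tors[OF cop f f', of c] tors_N N by simp
  qed
  define S where "S = of_real (sqrt (real CARD('a))) / H'.g 1"
  define F where "F u = ee (of_int (u * int s) / 8)" for u :: int
  \<comment> \<open>For an odd component the lift is 1 modulo 8, so its eighth root of unity does
    not depend on \<open>u\<close>.\<close>
  define E where "E u = (if even m then F u else F 1)" for u
  have g: "H.g u = S * (of_int (kronecker (int CARD('a)) t) * E u)" if "lift u t" "coprime u (int m)" for u t
  proof -
    note p = lift_props[OF that]
    have "A.g (int t) = H.g u * H'.g 1"
      unfolding gA H.g_cong[OF p(3)] H'.g_cong[OF p(4)] ..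
    moreover have "A.g (int t) = of_real (sqrt (real CARD('a))) * (of_int (kronecker (int CARD('a)) t) * ee (of_nat (t * s) / 8))"
      by (rule gauss_closed_form[OF fqm_UNIV sgn p(1,2)])
    moreover have "ee (of_nat (t * s) / 8) = E u"
    proof -
      let ?w = "if even m then u else 1"
      have "8 dvd int (if even m then M1 else M2)" by (simp add: M1_def M2_def)
      then have "[int t = ?w] (mod 8)" using that(1) unfolding lift_def by (auto intro: cong_dvd_modulus split: if_splits)
      then obtain j where j: "int t = ?w + 8 * j" by (metis cong_iff_lin cong_sym)
      have "(of_nat (t * s) / 8 :: complex) = of_int (?w * int s) / 8 + of_int (j * int s)"
      proof -
        have "(of_nat (t * s) :: complex) = of_int (int t * int s)" by simp
        also have "\<dots> = of_int (?w * int s + 8 * (j * int s))" unfolding j by (simp add: algebra_simps)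
        finally show ?thesis by (simp add: add_divide_distrib)
      qed
      then have "ee (of_nat (t * s) / 8) = F ?w" unfolding F_def by (simp only: ee_add_of_int)
      then show ?thesis by (simp add: E_def)
    qed
    ultimately show ?thesis using H'.g1_nonzero by (simp add: S_def field_simps)
  qed
  \<comment> \<open>The symbols at the lifts \<open>ta\<close> and \<open>ta * tc\<close> multiply
    to the symbol at \<open>tc\<close>, which is also the one on the right; only the eighth roots of
    unity remain.\<close>
  have key: "H.g a * H.g (a * c) * E c * E 1 = H.g c * H.g 1 * E a * E (a * c)"
    if a: "coprime a (int m)" and c: "coprime c (int m)" for a c
  proof -
    obtain ta tc where t: "lift a ta" "lift c tc" using ex_lift a c by meson
    have tac: "lift (a * c) (ta * tc)"
      using t cong_mult[of "int ta" a "int M1" "int tc" c] cong_mult[of "int ta" 1 "int M2" "int tc" 1] by (simp add: lift_def)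
    have t1: "lift 1 1" by (simp add: lift_def)
    have ac: "coprime (a * c) (int m)" using a c by simp
    note p = lift_props[OF t(1) a]
    have k: "kronecker (int CARD('a)) ta * kronecker (int CARD('a)) ta = 1"
      using p(1) card_prime_to[OF p(2)] by (rule kronecker_square)
    have "odd (ta * tc)" using lift_props[OF tac ac] by simp
    then have "0 < ta" "0 < tc" by (auto intro: Nat.gr0I)
    then have km: "kronecker (int CARD('a)) (ta * tc) = kronecker (int CARD('a)) ta * kronecker (int CARD('a)) tc"
      by (rule kronecker_mult_right)
    have kk: "of_int (kronecker (int CARD('a)) ta) * (of_int (kronecker (int CARD('a)) ta) * z) = (z :: complex)" for z
      using k by (metis (no_types, lifting) mult.assoc mult_1 of_int_1 of_int_mult)
    show ?thesis
      unfolding g[OF t(1) a] g[OF tac ac] g[OF t(2) c] g[OF t1 coprime_1_left] km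
      by (simp add: mult_ac kk)
  qed
  have E0: "E u \<noteq> 0" for u by (simp add: E_def F_def)
  have cl: "coprime x (int m) \<longleftrightarrow> \<not> int l dvd x" for x
  proof
    assume "coprime x (int m)"
    moreover have "int l dvd int m" using m by simp
    ultimately show "\<not> int l dvd x" using l by (meson coprime_common_divisor not_prime_unit prime_nat_int_transfer)
  next
    assume "\<not> int l dvd x"
    then have "coprime x (int l)" using l by (metis coprime_commute prime_imp_coprime prime_nat_int_transfer)
    then show "coprime x (int m)" using m by simp
  qed
  have evl: "even m \<Longrightarrow> l = 2" using l m by (metis even_power primes_dvd_imp_eq two_is_prime_nat)
  interpret L: fqm_local "tors m" q "int m" "int l" "Jm m"
  proof unfold_locales
    show "prime (int l)" using l by simp
    show "coprime x (int m) \<longleftrightarrow> \<not> int l dvd x" for x by (rule cl)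
    show "Jm m (0, 1, - 1, 0, 1) = 1" by (simp add: Jm_def)
    show "Jm m (tT (a, b, c, d, e)) = Jm m (a, b, c, d, e)" if "\<not> int l dvd c" for a b c d e
    proof (cases "even m")
      case True
      then have "odd (nat \<bar>c\<bar>)" using that evl by (simp add: even_nat_iff)
      then have "kronecker (a + c) (nat \<bar>c\<bar>) = kronecker a (nat \<bar>c\<bar>)"
        by (intro kronecker_cong) (simp_all add: cong_iff_dvd_diff)
      then show ?thesis using True by (simp add: Jm_def)
    qed (simp add: Jm_def)
    show "of_int (Jm m (tS (a, b, c, d, e))) * H.g c * H.g 1 = of_int (Jm m (a, b, c, d, e)) * H.g a * H.g (a * c)"
      if ok: "mt_ok (a, b, c, d, e)" and a: "\<not> int l dvd a" and c: "\<not> int l dvd c" for a b c d e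
    proof -
      have k: "H.g a * H.g (a * c) * E c * E 1 = H.g c * H.g 1 * E a * E (a * c)"
        using a c by (intro key) (auto simp: cl)
      show ?thesis
      proof (cases "even m")
        case False
        then show ?thesis using k E0[of 1] by (simp add: Jm_def E_def)
      next
        case True
        then have o: "odd a" "odd c" using a c evl by auto
        have cop: "coprime a c"
        proof (rule coprimeI)
          fix z assume "z dvd a" "z dvd c"
          then have "z dvd a * d - b * c" by simp
          then show "is_unit z" using ok by simp
        qed
        \<comment> \<open>Reciprocity together with \<open>sg a c\<close> changes \<open>Jm\<close>
          by \<open>sqr4 a c\<close>, and the eighth roots of unity change by the same sign. This
          match is the compatibility of the metaplectic cocycle with an odd signature.\<close>
        have J: "Jm m (tS (a, b, c, d, e)) = Jm m (a, b, c, d, e) * sqr4 a c"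
          using kronecker_tS[OF o cop] True by (simp add: Jm_def algebra_simps)
        have "E a * E (a * c) = of_int (sqr4 a c) * (E c * E 1)"
        proof -
          have "E a * E (a * c) = ee (of_int ((a - 1) * (c + 1) * int s) / 8) * (E c * E 1)"
            using True unfolding E_def F_def
            by (simp flip: ee_add) (rule arg_cong[of _ _ ee], simp add: field_simps)
          then show ?thesis by (simp only: ee_sqr4[OF o odd_s])
        qed
        then have "H.g a * H.g (a * c) * (E c * E 1) = H.g c * H.g 1 * of_int (sqr4 a c) * (E c * E 1)"
          using k by (simp add: mult_ac)
        then have "H.g a * H.g (a * c) = H.g c * H.g 1 * of_int (sqr4 a c)" using E0 by simp
        then show ?thesis unfolding J by (simp add: mult_ac)
      qed
    qed
  qed
  show ?thesis
    unfolding good_def using L.reach_local_formula cl by blast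
qed

text \<open>\<open>m\<close> runs over the divisors of \<open>N\<close> that are coprime to their
  cofactor. Splitting off the full power of one prime keeps both factors in this class.\<close>

lemma good_hall: "N = m * m' \<Longrightarrow> coprime m m' \<Longrightarrow> good m"
proof (induction m arbitrary: m' rule: less_induct)
  case (less m)
  show ?case
  proof (cases "m = 1")
    case True
    then show ?thesis using good_1 by simp
  next
    case False
    then obtain l where l: "prime l" "l dvd m" using prime_factor_nat by blast
    have m0: "m \<noteq> 0" using less.prems N_pos by auto
    define k where "k = multiplicity l m"
    obtain r where r: "m = l ^ k * r" "\<not> l dvd r"
      using multiplicity_decompose'[of m l] m0 l(1) unfolding k_def by (metis not_prime_unit)
    have k: "0 < k" using l m0 unfolding k_def by (simp add: prime_multiplicity_gt_zero_iff)
    have cop: "coprime (l ^ k) r" using l(1) r(2) k by (simp add: prime_imp_coprime)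
    have "1 < l ^ k" using one_less_power[OF prime_gt_1_nat[OF l(1)] k] .
    moreover have "0 < r" using r m0 by (auto intro: Nat.gr0I)
    ultimately have "r < m" unfolding r(1) by simp
    have N: "N = l ^ k * (r * m')" "N = r * (l ^ k * m')" "N = l ^ k * r * m'" using less.prems(1) r by (simp_all add: mult_ac)
    have c: "coprime (l ^ k) m'" "coprime r m'" using less.prems(2) unfolding r(1) by (simp_all only: coprime_mult_left_iff)
    have "good (l ^ k)" by (rule good_prime_power[OF N(1) _ l(1) refl k]) (use cop c in simp)
    moreover have "good r" by (rule less.IH[OF \<open>r < m\<close> N(2)]) (use cop c in \<open>simp add: coprime_commute\<close>)
    ultimately show ?thesis unfolding r(1) using good_mult[OF N(3) cop] less.prems(2) r(1) by simp
  qed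
qed

theorem reach_formula:
  assumes "reach q (a, b, c, d, e) K" "coprime c (int N)" "[c * v = 1] (mod int N)"
  shows "K UNIV x y = of_int (e * kronecker a (nat \<bar>c\<bar>)) * cnj (A.g c) / of_nat CARD('a) * A.gker v a d x y"
proof -
  have "good N" by (rule good_hall[of N 1]) simp_all
  then show ?thesis using assms N_even unfolding good_def tors_N by (auto simp: Jm_def)
qed

end

section \<open>The metaplectic group\<close>

lemma mat2_nth [simp]: "mat2 a b c d $ 1 $ 1 = a" "mat2 a b c d $ 1 $ 2 = b"
  "mat2 a b c d $ 2 $ 1 = c" "mat2 a b c d $ 2 $ 2 = d"
  by (simp_all add: mat2_def)

lemma mat2_eqI:
  fixes M N :: "'b::zero^2^2"
  assumes "M $ 1 $ 1 = N $ 1 $ 1" "M $ 1 $ 2 = N $ 1 $ 2" "M $ 2 $ 1 = N $ 2 $ 1" "M $ 2 $ 2 = N $ 2 $ 2"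
  shows "M = N"
  using assms by (simp add: vec_eq_iff forall_2)

lemma mat2_eta:
  fixes M :: "'b::zero^2^2"
  shows "M = mat2 (M $ 1 $ 1) (M $ 1 $ 2) (M $ 2 $ 1) (M $ 2 $ 2)"
  by (rule mat2_eqI) simp_all

lemma mat2_eq_iff [simp]: "mat2 a b c d = mat2 a' b' c' d' \<longleftrightarrow> a = a' \<and> b = b' \<and> c = c' \<and> d = d'"
  by (metis mat2_nth)

lemma mat2_mult: "mat2 a b c d ** mat2 a' b' c' d' =
    mat2 (a * a' + b * c') (a * b' + b * d') (c * a' + d * c') (c * b' + d * (d' :: 'b::comm_ring_1))"
  by (rule mat2_eqI) (simp_all add: matrix_matrix_mult_def sum_2)

lemma mat2_1: "mat 1 = mat2 1 0 0 (1 :: 'b::{zero,one})"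
  by (rule mat2_eqI) (simp_all add: mat_def)

lemma det_mat2 [simp]: "det (mat2 a b c (d :: 'b::comm_ring_1)) = a * d - b * c"
  by (simp add: det_2)

lemma mult_nth_2:
  fixes M N :: "real^2^2"
  shows "(M ** N) $ i $ j = M $ i $ 1 * N $ 1 $ j + M $ i $ 2 * N $ 2 $ j"
  by (simp add: matrix_matrix_mult_def sum_2)

lemma auto_factor_nonzero: "0 < det M \<Longrightarrow> z \<in> uhp \<Longrightarrow> auto_factor M z \<noteq> 0"
proof
  assume d: "0 < det M" and z: "z \<in> uhp" and 0: "auto_factor M z = 0"
  have "M $ 2 $ 1 * Im z = 0" "M $ 2 $ 1 * Re z + M $ 2 $ 2 = 0"
    using arg_cong[OF 0, of Im] arg_cong[OF 0, of Re] by (simp_all add: auto_factor_def)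
  then have "M $ 2 $ 1 = 0" "M $ 2 $ 2 = 0" using z by (auto simp: uhp_def)
  then show False using d by (simp add: det_2)
qed

lemma Im_moebius: "0 < det M \<Longrightarrow> z \<in> uhp \<Longrightarrow> Im (moebius M z) = det M * Im z / (norm (auto_factor M z))\<^sup>2"
proof -
  assume d: "0 < det M" and z: "z \<in> uhp"
  let ?w = "auto_factor M z"
  have "Im (moebius M z) = (Im (of_real (M $ 1 $ 1) * z + of_real (M $ 1 $ 2)) * Re ?w
      - Re (of_real (M $ 1 $ 1) * z + of_real (M $ 1 $ 2)) * Im ?w) / (norm ?w)\<^sup>2"
    unfolding moebius_def cmod_power2 by (simp add: Im_divide)
  also have "Im (of_real (M $ 1 $ 1) * z + of_real (M $ 1 $ 2)) * Re ?w
      - Re (of_real (M $ 1 $ 1) * z + of_real (M $ 1 $ 2)) * Im ?w = det M * Im z"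
    by (simp add: auto_factor_def det_2 algebra_simps)
  finally show ?thesis .
qed

lemma moebius_uhp: "0 < det M \<Longrightarrow> z \<in> uhp \<Longrightarrow> moebius M z \<in> uhp"
  using Im_moebius[of M z] auto_factor_nonzero[of M z] by (simp add: uhp_def)

lemma auto_factor_mult:
  assumes "0 < det N" "z \<in> uhp"
  shows "auto_factor (M ** N) z = auto_factor M (moebius N z) * auto_factor N z"
  using auto_factor_nonzero[OF assms]
  by (simp add: auto_factor_def[of M] auto_factor_def[of "M ** N"] moebius_def mult_nth_2 field_simps)
     (simp add: auto_factor_def algebra_simps)

lemma moebius_mult:
  assumes "0 < det M" "0 < det N" "z \<in> uhp"
  shows "moebius (M ** N) z = moebius M (moebius N z)"
proof -
  have n: "auto_factor N z \<noteq> 0" "auto_factor M (moebius N z) \<noteq> 0"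
    using auto_factor_nonzero moebius_uhp assms by auto
  have "(of_real ((M ** N) $ 1 $ 1) * z + of_real ((M ** N) $ 1 $ 2))
      = (of_real (M $ 1 $ 1) * moebius N z + of_real (M $ 1 $ 2)) * auto_factor N z"
    using n(1) by (simp add: moebius_def mult_nth_2 field_simps) (simp add: auto_factor_def algebra_simps)
  then show ?thesis
    unfolding moebius_def[of "M ** N"] moebius_def[of M] auto_factor_mult[OF assms(2,3)] using n by simp
qed

lemma moebius_holomorphic: "0 < det M \<Longrightarrow> moebius M holomorphic_on uhp"
  unfolding moebius_def[abs_def] auto_factor_def
  using auto_factor_nonzero[of M] by (intro holomorphic_intros) (auto simp: auto_factor_def)

definition mp1 :: mp where "mp1 = (mat 1, restrict (\<lambda>z. 1) uhp)"

lemma Mp2R_D: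
  assumes "g \<in> Mp2R"
  shows "0 < det (fst g)" "snd g \<in> extensional uhp" "snd g holomorphic_on uhp"
    "z \<in> uhp \<Longrightarrow> (snd g z)\<^sup>2 = auto_factor (fst g) z" "z \<in> uhp \<Longrightarrow> snd g z \<noteq> 0"
proof -
  show *: "0 < det (fst g)" "snd g \<in> extensional uhp" "snd g holomorphic_on uhp"
    "z \<in> uhp \<Longrightarrow> (snd g z)\<^sup>2 = auto_factor (fst g) z" for z
    using assms by (auto simp: Mp2R_def)
  show "z \<in> uhp \<Longrightarrow> snd g z \<noteq> 0" using *(4)[of z] auto_factor_nonzero[OF *(1), of z] by (metis zero_eq_power2)
qed

lemma mp_mult_nth [simp]: "fst (mp_mult g h) = fst g ** fst h"
  "z \<in> uhp \<Longrightarrow> snd (mp_mult g h) z = snd g (moebius (fst h) z) * snd h z"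
  by (simp_all add: mp_mult_def)

lemma mp_mult_Mp2R: "g \<in> Mp2R \<Longrightarrow> h \<in> Mp2R \<Longrightarrow> mp_mult g h \<in> Mp2R"
proof -
  assume g: "g \<in> Mp2R" and h: "h \<in> Mp2R"
  note G = Mp2R_D[OF g] and H = Mp2R_D[OF h]
  have "(\<lambda>z. snd g (moebius (fst h) z) * snd h z) holomorphic_on uhp"
    using holomorphic_on_compose_gen[OF moebius_holomorphic[OF H(1)] G(3)] moebius_uhp[OF H(1)] H(3)
    by (intro holomorphic_on_mult) (auto simp: o_def)
  then have "snd (mp_mult g h) holomorphic_on uhp"
    by (rule holomorphic_transform) simp
  then show ?thesis
    using G(1,4) H(1,4) moebius_uhp[OF H(1)]
    by (auto simp: Mp2R_def mp_mult_def det_mul auto_factor_mult power_mult_distrib)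
qed

lemma mp_eqI: "g \<in> Mp2R \<Longrightarrow> h \<in> Mp2R \<Longrightarrow> fst g = fst h \<Longrightarrow> (\<And>z. z \<in> uhp \<Longrightarrow> snd g z = snd h z) \<Longrightarrow> g = h"
  using extensionalityI[OF Mp2R_D(2) Mp2R_D(2)] by (metis prod.collapse)

lemma mp_mult_assoc:
  assumes g: "g \<in> Mp2R" and h: "h \<in> Mp2R" and k: "k \<in> Mp2R"
  shows "mp_mult (mp_mult g h) k = mp_mult g (mp_mult h k)"
proof (rule mp_eqI)
  fix z assume z: "z \<in> uhp"
  then show "snd (mp_mult (mp_mult g h) k) z = snd (mp_mult g (mp_mult h k)) z"
    using moebius_mult[OF Mp2R_D(1)[OF h] Mp2R_D(1)[OF k] z] moebius_uhp[OF Mp2R_D(1)[OF k] z] by simp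
qed (use assms in \<open>auto intro!: mp_mult_Mp2R simp: matrix_mul_assoc\<close>)

lemma mp1_Mp2R: "mp1 \<in> Mp2R"
proof -
  have "restrict (\<lambda>z. 1 :: complex) uhp holomorphic_on uhp"
    by (rule holomorphic_transform[of "\<lambda>_. 1"]) auto
  then show ?thesis by (auto simp: mp1_def Mp2R_def auto_factor_def mat2_1)
qed

lemma mp_mult_mp1 [simp]: "g \<in> Mp2R \<Longrightarrow> mp_mult mp1 g = g" "g \<in> Mp2R \<Longrightarrow> mp_mult g mp1 = g"
proof -
  assume g: "g \<in> Mp2R"
  have m: "moebius (mat 1) z = z" for z by (simp add: moebius_def auto_factor_def mat2_1)
  show "mp_mult mp1 g = g" "mp_mult g mp1 = g"
    using g mp_mult_Mp2R mp1_Mp2R moebius_uhp[OF Mp2R_D(1)[OF g]]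
    by (intro mp_eqI; simp add: mp1_def m)+
qed

lemma connected_uhp: "connected uhp"
  unfolding uhp_def by (intro convex_connected convex_halfspace_Im_gt)

lemma i_uhp: "\<i> \<in> uhp"
  by (simp add: uhp_def)

text \<open>The quotient of two holomorphic roots of the same function is continuous with values
  \<plusminus>1 on a connected set.\<close>

lemma mp_same_matrix:
  assumes g: "g \<in> Mp2R" and h: "h \<in> Mp2R" and eq: "fst g = fst h"
  obtains \<epsilon> :: complex where "\<epsilon> \<in> {1, -1}" "\<And>z. z \<in> uhp \<Longrightarrow> snd g z = \<epsilon> * snd h z"
proof -
  let ?r = "\<lambda>z. snd g z / snd h z"
  note G = Mp2R_D[OF g] and H = Mp2R_D[OF h]
  have sq: "?r z = 1 \<or> ?r z = - 1" if "z \<in> uhp" for z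
  proof -
    have "(?r z)\<^sup>2 = 1" using G(4)[OF that] H(4)[OF that] H(5)[OF that] eq
      by (simp only: power_divide) (metis divide_self zero_eq_power2)
    then show ?thesis by (simp add: power2_eq_1_iff)
  qed
  have "continuous_on uhp ?r"
    using G(3) H(3,5) by (intro continuous_intros holomorphic_on_imp_continuous_on) auto
  moreover have "finite (?r ` uhp)"
    by (rule finite_subset[of _ "{1, -1}"]) (use sq in blast, simp)
  ultimately have "?r constant_on uhp" using connected_uhp by (rule continuous_finite_range_constant[rotated])
  then obtain \<epsilon> where e: "\<And>z. z \<in> uhp \<Longrightarrow> ?r z = \<epsilon>" unfolding constant_on_def by blast
  show thesis
  proof
    show "\<epsilon> \<in> {1, -1}" using sq[OF i_uhp] e[OF i_uhp] by auto
    show "snd g z = \<epsilon> * snd h z" if "z \<in> uhp" for z using e[OF that] H(5)[OF that] by (simp add: field_simps)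
  qed
qed

definition mp_of :: "mt \<Rightarrow> mp" where
  "mp_of X = (case X of (a, b, c, d, e) \<Rightarrow> (mat2 (real_of_int a) (real_of_int b) (real_of_int c) (real_of_int d),
     restrict (\<lambda>z. of_int e * csqrt (of_int c * z + of_int d)) uhp))"

lemma mp_of_nth [simp]:
  "fst (mp_of (a, b, c, d, e)) = mat2 (real_of_int a) (real_of_int b) (real_of_int c) (real_of_int d)"
  "z \<in> uhp \<Longrightarrow> snd (mp_of (a, b, c, d, e)) z = of_int e * csqrt (of_int c * z + of_int d)"
  by (simp_all add: mp_of_def)

lemma mp_of_Mp2R: "mt_ok X \<Longrightarrow> mp_of X \<in> Mp2R"
proof (cases X)
  case X: (fields a b c d e)
  assume "mt_ok X"
  then have det: "a * d - b * c = 1" and e: "e = 1 \<or> e = -1" by (auto simp: X)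
  have "(\<lambda>z. of_int e * csqrt (of_int c * z + of_int d)) holomorphic_on uhp"
  proof (cases "c = 0")
    case False
    then have "of_int c * z + of_int d \<notin> \<real>\<^sub>\<le>\<^sub>0" if "z \<in> uhp" for z
      using that by (auto simp: uhp_def complex_nonpos_Reals_iff)
    then show ?thesis by (intro holomorphic_intros) auto
  qed simp
  then have "snd (mp_of X) holomorphic_on uhp" by (rule holomorphic_transform) (simp add: X)
  moreover have "0 < det (fst (mp_of X))"
  proof -
    have "real_of_int (a * d - b * c) = 1" by (simp only: det of_int_1)
    then show ?thesis by (simp add: X)
  qed
  moreover have "(of_int e :: complex)\<^sup>2 = 1" using e by auto
  ultimately show ?thesis
    unfolding Mp2R_def by (auto simp: X mp_of_def auto_factor_def power_mult_distrib)
qed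

lemma mp_of_Mp2Z: "mt_ok X \<Longrightarrow> mp_of X \<in> Mp2Z"
proof (cases X)
  case X: (fields a b c d e)
  assume ok: "mt_ok X"
  then have "real_of_int (a * d - b * c) = 1" by (simp add: X)
  then have "fst (mp_of X) \<in> SL2Z" by (simp add: X SL2Z_def forall_2)
  then show ?thesis using mp_of_Mp2R[OF ok] by (simp add: Mp2Z_def)
qed

lemma Mp2Z_cases:
  assumes g: "g \<in> Mp2Z"
  obtains a b c d e where "mt_ok (a, b, c, d, e)" "g = mp_of (a, b, c, d, e)"
proof -
  define M where "M = fst g"
  have gR: "g \<in> Mp2R" and M: "M \<in> SL2Z" using g by (auto simp: Mp2Z_def M_def)
  have "M $ 1 $ 1 \<in> \<int>" "M $ 1 $ 2 \<in> \<int>" "M $ 2 $ 1 \<in> \<int>" "M $ 2 $ 2 \<in> \<int>"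
    using M by (auto simp: SL2Z_def)
  then obtain a b c d where abcd: "M $ 1 $ 1 = of_int a" "M $ 1 $ 2 = of_int b" "M $ 2 $ 1 = of_int c" "M $ 2 $ 2 = of_int d"
    by (elim Ints_cases) blast
  have "det M = 1" using M by (simp add: SL2Z_def)
  then have "real_of_int (a * d - b * c) = 1" by (simp add: det_2 abcd)
  then have det: "a * d - b * c = 1" by (simp only: of_int_eq_1_iff)
  then have ok: "mt_ok (a, b, c, d, e)" if "e \<in> {1, -1}" for e using that by simp
  have Mm: "M = mat2 (of_int a) (of_int b) (of_int c) (of_int d)" using mat2_eta[of M] by (simp add: abcd)
  obtain \<epsilon> :: complex where eps: "\<epsilon> \<in> {1, -1}" "\<And>z. z \<in> uhp \<Longrightarrow> snd g z = \<epsilon> * snd (mp_of (a, b, c, d, 1)) z"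
    by (rule mp_same_matrix[OF gR mp_of_Mp2R[OF ok[of 1]]]) (use Mm M_def in auto)
  then obtain e :: int where e: "e \<in> {1, -1}" "\<epsilon> = of_int e" by (metis insertCI insertE of_int_1 of_int_minus singletonD)
  have "g = mp_of (a, b, c, d, e)"
    using gR mp_of_Mp2R[OF ok[OF e(1)]] eps(2) e(2) Mm by (intro mp_eqI) (auto simp: M_def)
  then show thesis using that ok[OF e(1)] by blast
qed

lemma mpS_eq: "mpS = mp_of (0, -1, 1, 0, 1)" and mpT_eq: "mpT = mp_of (1, 1, 0, 1, 1)" and mp1_eq: "mp1 = mp_of (1, 0, 0, 1, 1)"
  by (simp_all add: mpS_def mpT_def mp1_def mp_of_def mat2_1)

text \<open>Both sides have the same square, so only a sign is open. It is read off from real and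
  imaginary parts: the principal root of a point in the upper half-plane lies in the open first
  quadrant, that of a point in the lower half-plane in the open fourth quadrant.\<close>

lemma csqrt_mult_moebius:
  assumes det: "a * d - b * c = 1" and z: "z \<in> uhp"
  defines "w \<equiv> of_int c * z + of_int d"
  shows "csqrt ((of_int a * z + of_int b) / w) * csqrt w = of_int (sg a c) * csqrt (of_int a * z + of_int b)"
proof -
  let ?M = "mat2 (real_of_int a) (real_of_int b) (real_of_int c) (real_of_int d)"
  have d1: "det ?M = 1"
  proof -
    have "real_of_int (a * d - b * c) = 1" by (simp only: det of_int_1)
    then show ?thesis by simp
  qed
  define t where "t = of_int a * z + of_int b"
  have w0: "w \<noteq> 0" using auto_factor_nonzero[of ?M z] d1 z by (simp add: auto_factor_def w_def)
  have imz: "0 < Im z" using z by (simp add: uhp_def)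
  have im: "0 < Im (t / w)"
    using moebius_uhp[of ?M z] d1 z by (simp add: uhp_def moebius_def auto_factor_def t_def w_def)
  define u v r where "u = csqrt (t / w)" and "v = csqrt w" and "r = csqrt t"
  have sq: "u\<^sup>2 = t / w" "v\<^sup>2 = w" "r\<^sup>2 = t" by (simp_all add: u_def v_def r_def)
  have "(u * v)\<^sup>2 = r\<^sup>2" using sq w0 by (simp add: power_mult_distrib)
  then have pm: "u * v = r \<or> u * v = - r" by (simp add: power2_eq_iff)
  have imsq: "Im (y\<^sup>2) = 2 * Re y * Im y" for y :: complex by (simp add: power2_eq_square)
  have princ: "0 < Re (csqrt y) \<or> Re (csqrt y) = 0 \<and> 0 \<le> Im (csqrt y)" for y by (rule csqrt_principal)
  have u: "0 < Re u" "0 < Im u"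
  proof -
    have "0 < 2 * Re u * Im u" using im sq(1) imsq[of u] by simp
    then show "0 < Re u" "0 < Im u" using princ[of "t / w"] by (auto simp: u_def zero_less_mult_iff)
  qed
  have pos: "0 < Re (csqrt y)" "0 < Im (csqrt y)" if "0 < Im y" for y
  proof -
    have "0 < 2 * Re (csqrt y) * Im (csqrt y)" using that imsq[of "csqrt y"] by simp
    then show "0 < Re (csqrt y)" "0 < Im (csqrt y)" using princ[of y] by (auto simp: zero_less_mult_iff)
  qed
  have neg: "0 < Re (csqrt y)" "Im (csqrt y) < 0" if "Im y < 0" for y
  proof -
    have "Re (csqrt y) * Im (csqrt y) < 0" using that imsq[of "csqrt y"] by (simp only: power2_csqrt)
    then show "0 < Re (csqrt y)" "Im (csqrt y) < 0" using princ[of y] by (auto simp: mult_less_0_iff simp del: csqrt.sel)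
  qed
  have Imw: "Im w = of_int c * Im z" and Imt: "Im t = of_int a * Im z" by (simp_all add: w_def t_def)
  have Re_r: "0 \<le> Re r" using princ[of t] by (auto simp: r_def)
  have minus_case: "u * v = - r \<Longrightarrow> Im (u * v) = - Im r" "u * v = - r \<Longrightarrow> Re (u * v) = - Re r"
    by (simp_all only: uminus_complex.sel)
  have plus_case: "u * v = r \<Longrightarrow> Im (u * v) = Im r" "u * v = r \<Longrightarrow> Re (u * v) = Re r"
    by (simp_all only:)
  consider "c < 0" | "0 < c" "0 < a" | "0 < c" "a < 0" | "0 < c" "a = 0" | "c = 0" by linarith
  then have "u * v = of_int (sg a c) * r"
  proof cases
    case 1
    then have "Im w < 0" unfolding Imw using imz by (simp add: mult_less_0_iff)
    then have "0 < Re u * Re v" "Im u * Im v < 0" using u neg[of w] by (simp_all add: v_def mult_pos_neg)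
    then have "0 < Re (u * v)" by simp
    then have "u * v = r" using pm Re_r minus_case(2) by linarith
    then show ?thesis using 1 by (simp add: sg_def)
  next
    case 2
    then have "0 < Im w" "0 < Im t" unfolding Imw Imt using imz by simp_all
    then have v: "0 < Re v" "0 < Im v" and r: "0 < Im r" using pos[of w] pos[of t] by (simp_all add: v_def r_def)
    have "0 < Im (u * v)" using u v by (simp add: add_pos_pos)
    then have "u * v = r" using pm r minus_case(1) by linarith
    then show ?thesis using 2 by (simp add: sg_def)
  next
    case 3
    then have "0 < Im w" "Im t < 0" unfolding Imw Imt using imz by (simp_all add: mult_less_0_iff)
    then have v: "0 < Re v" "0 < Im v" and r: "Im r < 0" using pos[of w] neg[of t] by (simp_all add: v_def r_def)
    have "0 < Im (u * v)" using u v by (simp add: add_pos_pos)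
    then have "u * v = - r" using pm r plus_case(1) by linarith
    then show ?thesis using 3 by (simp add: sg_def)
  next
    case 4
    then have "(- b) * c = 1" using det by simp
    then have "b = - 1" using 4 by (auto simp only: zmult_eq_1_iff)
    then have "r = \<i>" using 4 by (simp add: r_def t_def)
    then have r: "0 < Im r" by simp
    have "0 < Im w" unfolding Imw using imz 4 by simp
    then have v: "0 < Re v" "0 < Im v" using pos[of w] by (simp_all add: v_def)
    have "0 < Im (u * v)" using u v by (simp add: add_pos_pos)
    then have "u * v = r" using pm r minus_case(1) by linarith
    then show ?thesis using 4 by (simp add: sg_def)
  next
    case 5
    then have "a * d = 1" using det by simp
    then have "(a = 1 \<and> d = 1) \<or> (a = - 1 \<and> d = - 1)" by (simp add: zmult_eq_1_iff)
    then show ?thesis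
    proof
      assume h: "a = 1 \<and> d = 1"
      then have "v = 1" using 5 by (simp add: v_def w_def)
      moreover have "u = r" using h 5 by (simp add: u_def r_def w_def)
      ultimately show ?thesis using h 5 by (simp add: sg_def)
    next
      \<comment> \<open>On the branch cut \<open>csqrt (- 1)\<close> is \<i>, and the product gets a
        negative real part; this is why the condition in \<open>sg\<close> includes
        \<open>c = 0\<close>.\<close>
      assume h: "a = - 1 \<and> d = - 1"
      then have v: "v = \<i>" using 5 by (simp add: v_def w_def)
      then have "Re (u * v) < 0" using u by simp
      then have "u * v = - r" using pm Re_r plus_case(2) by linarith
      then show ?thesis using h 5 by (simp add: sg_def)
    qed
  qed
  then show ?thesis by (simp add: u_def v_def r_def t_def)
qed

lemma mpS_mult: "mt_ok X \<Longrightarrow> mp_mult mpS (mp_of X) = mp_of (tS X)"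
proof (cases X)
  case X: (fields a b c d e)
  assume ok: "mt_ok X"
  have S: "mpS \<in> Mp2R" unfolding mpS_eq by (intro mp_of_Mp2R) simp
  show ?thesis
  proof (rule mp_eqI)
    show "mp_mult mpS (mp_of X) \<in> Mp2R" by (intro mp_mult_Mp2R S mp_of_Mp2R ok)
    show "mp_of (tS X) \<in> Mp2R" by (intro mp_of_Mp2R mt_ok_steps ok)
    show "fst (mp_mult mpS (mp_of X)) = fst (mp_of (tS X))" by (simp add: mpS_def X mat2_mult)
    fix z assume z: "z \<in> uhp"
    have "moebius (fst (mp_of X)) z \<in> uhp" by (intro moebius_uhp z Mp2R_D(1) mp_of_Mp2R ok)
    moreover have "moebius (fst (mp_of X)) z = (of_int a * z + of_int b) / (of_int c * z + of_int d)"
      by (simp add: X moebius_def auto_factor_def)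
    ultimately show "snd (mp_mult mpS (mp_of X)) z = snd (mp_of (tS X)) z"
      using csqrt_mult_moebius[of a d b c z] ok z by (simp add: X mpS_def)
  qed
qed

lemma mpT_mult: "mt_ok X \<Longrightarrow> mp_mult mpT (mp_of X) = mp_of (tT X)"
proof (cases X)
  case X: (fields a b c d e)
  assume ok: "mt_ok X"
  have T: "mpT \<in> Mp2R" unfolding mpT_eq by (intro mp_of_Mp2R) simp
  show ?thesis
  proof (rule mp_eqI)
    show "mp_mult mpT (mp_of X) \<in> Mp2R" by (intro mp_mult_Mp2R T mp_of_Mp2R ok)
    show "mp_of (tT X) \<in> Mp2R" by (intro mp_of_Mp2R mt_ok_steps ok)
    show "fst (mp_mult mpT (mp_of X)) = fst (mp_of (tT X))" by (simp add: mpT_def X mat2_mult)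
    fix z assume z: "z \<in> uhp"
    have "moebius (fst (mp_of X)) z \<in> uhp" by (intro moebius_uhp z Mp2R_D(1) mp_of_Mp2R ok)
    then show "snd (mp_mult mpT (mp_of X)) z = snd (mp_of (tT X)) z"
      using z by (simp add: X mpT_def)
  qed
qed

section \<open>Generation of the metaplectic group by words\<close>

lemma reach_T_power: "\<exists>K. reach q (a, b, c, d, e) K \<Longrightarrow> \<exists>K. reach q (a + j * c, b + j * d, c, d, e) K"
proof (induction j rule: int_induct[of _ 0])
  case (step1 i)
  then obtain K where "reach q (a + i * c, b + i * d, c, d, e) K" by blast
  from reach.T[OF this] show ?case by (auto simp: algebra_simps)
next
  case (step2 i)
  then obtain K where "reach q (a + i * c, b + i * d, c, d, e) K" by blast
  from reach.T'[OF this] show ?case by (auto simp: algebra_simps)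
qed simp

text \<open>Euclid's algorithm on the first column: powers of \<open>T\<close> reduce
  \<open>a\<close> modulo \<open>c\<close>, and \<open>S\<close> exchanges the two entries.\<close>

lemma reach_all: "mt_ok (a, b, c, d, e) \<Longrightarrow> \<exists>K. reach q (a, b, c, d, e) K"
proof (induction "nat \<bar>c\<bar>" arbitrary: a b c d e rule: less_induct)
  case less
  show ?case
  proof (cases "c = 0")
    case True
    have S: "\<exists>K. reach q (tS X) K" if "\<exists>K. reach q X K" for X using that reach.S by blast
    \<comment> \<open>Repeating the square of \<open>S\<close> runs through both roots over both
      matrices \<plusminus>1, so the metaplectic sign is reached as well.\<close>
    have 1: "\<exists>K. reach q (1, 0, 0, 1, 1) K" using reach.base by blast
    have 2: "\<exists>K. reach q (- 1, 0, 0, - 1, 1) K" using S[OF S[OF 1]] by (simp add: sg_def)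
    have 3: "\<exists>K. reach q (1, 0, 0, 1, - 1) K" using S[OF S[OF 2]] by (simp add: sg_def)
    have 4: "\<exists>K. reach q (- 1, 0, 0, - 1, - 1) K" using S[OF S[OF 3]] by (simp add: sg_def)
    have "a * d = 1" "e = 1 \<or> e = - 1" using less.prems True by auto
    then have "(a = 1 \<and> d = 1) \<or> (a = - 1 \<and> d = - 1)" "e = 1 \<or> e = - 1" by (simp_all add: zmult_eq_1_iff)
    then show ?thesis
      using True reach_T_power[OF 1, of b] reach_T_power[OF 2, of "- b"] reach_T_power[OF 3, of b] reach_T_power[OF 4, of "- b"]
      by auto
  next
    case False
    define j where "j = a div c"
    define a' b' where "a' = a - j * c" and "b' = b - j * d"
    have a': "\<bar>a'\<bar> < \<bar>c\<bar>"
      using False abs_mod_less[of c a] by (simp add: a'_def j_def minus_div_mult_eq_mod)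
    have ok: "mt_ok (a', b', c, d, e)" using less.prems by (simp add: a'_def b'_def algebra_simps)
    have "mt_ok (c, d, - a', - b', e * sg c (- a'))" using mt_ok_steps(2)[OF ok] by simp
    from less.hyps[OF _ this] obtain K where "reach q (c, d, - a', - b', e * sg c (- a')) K" using a' False by auto
    from reach.S[OF this] have "\<exists>K. reach q (a', b', c, d, e) K" by auto
    from reach_T_power[OF this, of j] show ?thesis by (simp add: a'_def b'_def)
  qed
qed

section \<open>The Weil representation on the metaplectic group\<close>

locale weil = odd_disc +
  fixes \<rho> :: "mp \<Rightarrow> 'a operator"
  assumes weil: "weil_representation q \<rho>" and sig: "has_signature q s"
begin

lemma rho_mult: "g \<in> Mp2Z \<Longrightarrow> h \<in> Mp2Z \<Longrightarrow> \<rho> (mp_mult g h) = \<rho> g ** \<rho> h"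
  using weil by (simp add: weil_representation_def)

lemma rho_T: "\<rho> mpT $ y $ x = (if y = x then er (q x) else 0)"
  using weil by (simp add: weil_representation_def weil_T_def er_def)

text \<open>\<open>sig q\<close> is the least representative of the signature and \<open>s\<close>
  an arbitrary one; both describe the same Gauss sum, so the prefactor is
  \<open>1 / g 1\<close>.\<close>

lemma rho_S: "\<rho> mpS $ y $ x = er (- bil q x y) / A.g 1"
proof -
  have "has_signature q (sig q)" using sig unfolding sig_def by (rule LeastI)
  then have "A.g 1 = of_real (sqrt (real CARD('a))) * ee (of_nat (sig q) / 8)"
    by (simp add: has_signature_def A.g_def er_def)
  then have "ee (- (of_nat (sig q) / 8)) / of_real (sqrt (real CARD('a))) = 1 / A.g 1"
    by (simp add: ee_minus field_simps)
  then show ?thesis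
    using weil by (simp add: weil_representation_def weil_S_def er_def of_rat_minus)
qed

lemma mpS_Mp2Z: "mpS \<in> Mp2Z" and mpT_Mp2Z: "mpT \<in> Mp2Z" and mp1_Mp2Z: "mp1 \<in> Mp2Z"
  unfolding mpS_eq mpT_eq mp1_eq by (intro mp_of_Mp2Z; simp)+

lemma Mp2Z_Mp2R: "g \<in> Mp2Z \<Longrightarrow> g \<in> Mp2R"
  by (simp add: Mp2Z_def)

text \<open>Multiplicativity alone makes the image of the identity only an idempotent; it is 1
  because the operator of \<open>S\<close> has a right inverse, again by orthogonality.\<close>

lemma rho_1: "\<rho> mp1 = mat 1"
proof -
  have e: "\<rho> mp1 ** \<rho> mpS = \<rho> mpS"
    using rho_mult[OF mp1_Mp2Z mpS_Mp2Z] Mp2Z_Mp2R[OF mpS_Mp2Z] by simp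
  define B :: "'a operator" where "B = (\<chi> y x. er (bil q x y) * A.g 1 / of_nat CARD('a))"
  have "\<rho> mpS ** B = mat 1"
  proof (intro vec_eq_iff[THEN iffD2] allI)
    fix y x
    have "(\<rho> mpS ** B) $ y $ x = (\<Sum>w\<in>UNIV. er (- bil q w y) * (er (bil q x w) * A.g 1) / (A.g 1 * of_nat CARD('a)))"
      unfolding matrix_matrix_mult_def vec_lambda_beta B_def rho_S by (rule sum.cong[OF refl]) simp
    also have "\<dots> = (\<Sum>w\<in>UNIV. er (bil q (x - y) w) / of_nat CARD('a))"
    proof (rule sum.cong[OF refl])
      fix w
      have "er (bil q (x - y) w) = er (bil q x w) * er (bil q (- y) w)"
        using A.er_bil_add_left[of x "- y" w] by simp
      also have "er (bil q (- y) w) = er (- bil q w y)"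
        using A.er_bil_zmult_left[of y w "- 1"] by (simp add: A.bil_commute)
      finally show "er (- bil q w y) * (er (bil q x w) * A.g 1) / (A.g 1 * of_nat CARD('a)) = er (bil q (x - y) w) / of_nat CARD('a)"
        using A.g1_nonzero by simp
    qed
    also have "\<dots> = (mat 1 :: 'a operator) $ y $ x"
      unfolding sum_divide_distrib[symmetric] by (subst A.character_sum) (auto simp: mat_def)
    finally show "(\<rho> mpS ** B) $ y $ x = (mat 1 :: 'a operator) $ y $ x" .
  qed
  then show ?thesis using e by (metis matrix_mul_assoc matrix_mul_rid)
qed

text \<open>Column \<open>x\<close> of the operator is the function \<open>K UNIV x\<close>, whence
  the exchanged indices. This carries the formulas for words over to \<rho>.\<close>

lemma rho_reach: "reach q X K \<Longrightarrow> \<rho> (mp_of X) = (\<chi> y x. K UNIV x y)"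
proof (induction rule: reach.induct)
  case base
  then show ?case using rho_1 by (simp add: mp1_eq mat_def vec_eq_iff)
next
  case (S X K)
  have ok: "mt_ok X" by (rule reach_ok[OF S(1)])
  have "\<rho> (mp_of (tS X)) = \<rho> mpS ** \<rho> (mp_of X)"
    using rho_mult[OF mpS_Mp2Z mp_of_Mp2Z[OF ok]] mpS_mult[OF ok] by simp
  then show ?case unfolding S.IH
    by (simp add: vec_eq_iff matrix_matrix_mult_def rho_S opS_def sum_divide_distrib)
next
  case (T X K)
  have ok: "mt_ok X" by (rule reach_ok[OF T(1)])
  have "\<rho> (mp_of (tT X)) = \<rho> mpT ** \<rho> (mp_of X)"
    using rho_mult[OF mpT_Mp2Z mp_of_Mp2Z[OF ok]] mpT_mult[OF ok] by simp
  then show ?case unfolding T.IH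
    by (simp add: vec_eq_iff matrix_matrix_mult_def rho_T opT_def if_distrib[of "\<lambda>x. x * _"] cong: if_cong)
next
  case (T' X K)
  have ok: "mt_ok (tT' X)" by (intro mt_ok_steps reach_ok[OF T'(1)])
  have e: "\<rho> (mp_of X) = \<rho> mpT ** \<rho> (mp_of (tT' X))"
    using rho_mult[OF mpT_Mp2Z mp_of_Mp2Z[OF ok]] mpT_mult[OF ok] by simp
  have "er (q y) * \<rho> (mp_of (tT' X)) $ y $ x = K UNIV x y" for x y
    using arg_cong[OF e, of "\<lambda>A. A $ y $ x"] unfolding T'.IH
    by (simp add: matrix_matrix_mult_def rho_T if_distrib[of "\<lambda>x. x * _"] cong: if_cong)
  then show ?case
    by (simp add: vec_eq_iff opT'_def er_minus field_simps)
qed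

theorem rho_formula:
  assumes "mt_ok (a, b, c, d, e)" "coprime c (int N)" "[c * v = 1] (mod int N)"
  shows "\<rho> (mp_of (a, b, c, d, e)) $ y $ x =
    of_int (e * kronecker a (nat \<bar>c\<bar>)) * cnj (A.g c) / of_nat CARD('a) * A.gker v a d x y"
proof -
  obtain K where K: "reach q (a, b, c, d, e) K" using reach_all[OF assms(1)] by blast
  then show ?thesis using rho_reach[OF K] reach_formula[OF K assms(2,3)] by simp
qed

end

section \<open>Extension of the Weil representation\<close>

lemma mp_inverse:
  assumes g: "g \<in> Mp2Z"
  obtains h where "h \<in> Mp2Z" "mp_mult h g = mp1" "mp_mult g h = mp1"
proof -
  obtain a b c d e where ok: "mt_ok (a, b, c, d, e)" and ge: "g = mp_of (a, b, c, d, e)" using g by (rule Mp2Z_cases)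
  define h where "h e' = mp_of (d, - b, - c, a, e')" for e' :: int
  have okh: "mt_ok (d, - b, - c, a, e')" if "e' \<in> {1, -1}" for e' using ok that by (simp add: mult.commute)
  have hZ: "h e' \<in> Mp2Z" if "e' \<in> {1, -1}" for e' unfolding h_def by (intro mp_of_Mp2Z okh that)
  have gR: "g \<in> Mp2R" and hR: "e' \<in> {1, -1} \<Longrightarrow> h e' \<in> Mp2R" for e' using g hZ by (auto simp: Mp2Z_def)
  have det: "real_of_int a * real_of_int d - real_of_int b * real_of_int c = 1"
  proof -
    have "real_of_int (a * d - b * c) = 1" using ok by (simp only: mt_ok.simps of_int_1)
    then show ?thesis by simp
  qed
  have m1: "fst (mp_mult (h e') g) = fst mp1" "fst (mp_mult g (h e')) = fst mp1" for e'
    using det by (simp_all add: h_def ge mat2_mult mp1_def mat2_1 algebra_simps)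
  obtain \<epsilon> where eps: "\<epsilon> \<in> {1, -1}" "\<And>z. z \<in> uhp \<Longrightarrow> snd (mp_mult (h 1) g) z = \<epsilon> * snd mp1 z"
    using mp_same_matrix[OF mp_mult_Mp2R[OF hR[of 1] gR] mp1_Mp2R m1(1)] by auto
  obtain e' :: int where e': "e' \<in> {1, -1}" "\<epsilon> = of_int e'"
    using eps(1) by (metis insertCI insertE of_int_1 of_int_minus singletonD)
  have hg: "mp_mult (h e') g = mp1"
  proof (rule mp_eqI[OF mp_mult_Mp2R[OF hR[OF e'(1)] gR] mp1_Mp2R m1(1)])
    fix z assume z: "z \<in> uhp"
    have mz: "moebius (fst g) z \<in> uhp" using moebius_uhp[OF Mp2R_D(1)[OF gR] z] .
    have "snd (mp_mult (h e') g) z = of_int e' * snd (mp_mult (h 1) g) z"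
      using z mz by (simp add: h_def)
    also have "\<dots> = snd mp1 z" using eps(2)[OF z] e' by auto
    finally show "snd (mp_mult (h e') g) z = snd mp1 z" .
  qed
  obtain \<delta> where del: "\<delta> \<in> {1, -1}" "\<And>z. z \<in> uhp \<Longrightarrow> snd (mp_mult g (h e')) z = \<delta> * snd mp1 z"
    using mp_same_matrix[OF mp_mult_Mp2R[OF gR hR[OF e'(1)]] mp1_Mp2R m1(2)] by auto
  have "mp_mult (mp_mult g (h e')) g = g"
    using mp_mult_assoc[OF gR hR[OF e'(1)] gR] hg gR by simp
  then have "snd (mp_mult (mp_mult g (h e')) g) \<i> = snd g \<i>" by simp
  then have "\<delta> * snd g \<i> = snd g \<i>"
    using del(2) moebius_uhp[OF Mp2R_D(1)[OF gR] i_uhp] i_uhp by (simp add: mp1_def)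
  then have "\<delta> = 1" using Mp2R_D(5)[OF gR i_uhp] by simp
  then have "mp_mult g (h e') = mp1"
    using del(2) by (intro mp_eqI[OF mp_mult_Mp2R[OF gR hR[OF e'(1)]] mp1_Mp2R m1(2)]) simp
  then show thesis using that hZ[OF e'(1)] hg by blast
qed

lemma SL2Z_mult: "M \<in> SL2Z \<Longrightarrow> M' \<in> SL2Z \<Longrightarrow> M ** M' \<in> SL2Z"
  by (auto simp: SL2Z_def det_mul mult_nth_2 intro!: Ints_add Ints_mult)

lemma mp_mult_Mp2Z: "g \<in> Mp2Z \<Longrightarrow> h \<in> Mp2Z \<Longrightarrow> mp_mult g h \<in> Mp2Z"
  using mp_mult_Mp2R SL2Z_mult by (auto simp: Mp2Z_def)

text \<open>Stated through integrality of quotients, so that it also applies to real matrices such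
  as \<open>pinv\<close> times \<open>M\<close>.\<close>

definition mcong :: "nat \<Rightarrow> real^2^2 \<Rightarrow> real^2^2 \<Rightarrow> bool" where
  "mcong N A B \<longleftrightarrow> (\<forall>i j. (A $ i $ j - B $ i $ j) / real N \<in> \<int>)"

lemma mcong_aux: "(x * a + y * b - (x * a' + y * b')) / n = x * ((a - a') / n) + y * ((b - b') / (n :: real))"
  and mcong_aux': "(a * x + b * y - (a' * x + b' * y)) / n = ((a - a') / n) * x + ((b - b') / n) * y"
  by (simp_all add: left_diff_distrib right_diff_distrib add_divide_distrib diff_divide_distrib)

lemma mcong_mult_left: "X \<in> SL2Z \<Longrightarrow> mcong N A B \<Longrightarrow> mcong N (X ** A) (X ** B)"
  unfolding mcong_def
proof (intro allI)
  fix i j :: 2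
  assume X: "X \<in> SL2Z" and AB: "\<forall>i j. (A $ i $ j - B $ i $ j) / real N \<in> \<int>"
  have "((X ** A) $ i $ j - (X ** B) $ i $ j) / real N
      = X $ i $ 1 * ((A $ 1 $ j - B $ 1 $ j) / real N) + X $ i $ 2 * ((A $ 2 $ j - B $ 2 $ j) / real N)"
    unfolding mult_nth_2 by (rule mcong_aux)
  also have "\<dots> \<in> \<int>" using X AB by (intro Ints_add Ints_mult) (auto simp: SL2Z_def)
  finally show "((X ** A) $ i $ j - (X ** B) $ i $ j) / real N \<in> \<int>" .
qed

lemma mcong_mult_right: "X \<in> SL2Z \<Longrightarrow> mcong N A B \<Longrightarrow> mcong N (A ** X) (B ** X)"
  unfolding mcong_def
proof (intro allI)
  fix i j :: 2
  assume X: "X \<in> SL2Z" and AB: "\<forall>i j. (A $ i $ j - B $ i $ j) / real N \<in> \<int>"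
  have "((A ** X) $ i $ j - (B ** X) $ i $ j) / real N
      = ((A $ i $ 1 - B $ i $ 1) / real N) * X $ 1 $ j + ((A $ i $ 2 - B $ i $ 2) / real N) * X $ 2 $ j"
    unfolding mult_nth_2 by (rule mcong_aux')
  also have "\<dots> \<in> \<int>" using X AB by (intro Ints_add Ints_mult) (auto simp: SL2Z_def)
  finally show "((A ** X) $ i $ j - (B ** X) $ i $ j) / real N \<in> \<int>" .
qed

text \<open>The witness is the product of the primes of \<open>N\<close> not dividing
  \<open>c\<close>. At such a prime \<open>d * j\<close> vanishes and \<open>c\<close> does not; at
  the others \<open>c\<close> vanishes while \<open>d\<close> and \<open>j\<close> are
  units.\<close>

lemma exists_coprime_shift:
  fixes c d :: int
  assumes cd: "coprime c d" and N: "0 < (N :: nat)"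
  shows "\<exists>j::nat. coprime (c + d * int j) (int N)"
proof -
  define j where "j = \<Prod>{l \<in> prime_factors N. \<not> int l dvd c}"
  have "coprime (c + d * int j) (int N)"
  proof (rule ccontr)
    assume "\<not> coprime (c + d * int j) (int N)"
    then have "\<not> coprime (nat \<bar>c + d * int j\<bar>) N"
      by (metis coprime_int_iff coprime_abs_left_iff int_nat_eq abs_ge_zero)
    then have "gcd (nat \<bar>c + d * int j\<bar>) N \<noteq> 1" by (rule contrapos_nn) (rule gcd_eq_1_imp_coprime)
    from prime_factor_nat[OF this] obtain l where l: "prime l" "l dvd gcd (nat \<bar>c + d * int j\<bar>) N" by blast
    then have l: "prime l" "l dvd nat \<bar>c + d * int j\<bar>" "l dvd N" using dvd_trans gcd_dvd1 gcd_dvd2 by blast+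
    have "int l dvd int (nat \<bar>c + d * int j\<bar>)" using l(2) by (simp only: int_dvd_int_iff)
    then have ld: "int l dvd c + d * int j" by simp
    have lf: "l \<in> prime_factors N" using l N by (simp add: in_prime_factors_iff)
    have pl: "prime (int l)" using l by simp
    show False
    proof (cases "int l dvd c")
      case True
      then have "int l dvd d * int j" using ld by (simp add: dvd_add_right_iff)
      then have "int l dvd d \<or> l dvd j" using pl by (simp add: prime_dvd_mult_iff)
      moreover have "\<not> int l dvd d" using cd True pl by (meson coprime_common_divisor not_prime_unit)
      moreover have "\<not> l dvd j"
      proof
        assume "l dvd j"
        then obtain r where "r \<in> prime_factors N" "\<not> int r dvd c" "l dvd r"
          unfolding j_def using l(1) by (auto simp: prime_dvd_prod_iff)
        then have "l = r" using l(1) by (auto simp: in_prime_factors_iff primes_dvd_imp_eq)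
        then show False using True \<open>\<not> int r dvd c\<close> by simp
      qed
      ultimately show False by blast
    next
      case False
      then have "l dvd j" unfolding j_def using lf by (intro dvd_prodI) auto
      then have "int l dvd d * int j" by simp
      then show False using ld False by (simp add: dvd_add_left_iff)
    qed
  qed
  then show ?thesis by blast
qed

section \<open>Commutation of the Weil representation with the operator of diag(p^2, 1)\<close>

locale hecke_setup = weil +
  fixes \<rho>' :: "(real^2^2) \<times> int \<Rightarrow> 'a operator" and p :: nat
  assumes ext: "weil_extension q \<rho> \<rho>'" and level: "level q = int N"
    and p: "prime p" and pN: "coprime (int p) (int N)"
begin

definition diag_mp :: mp where "diag_mp = (mat2 (real (p\<^sup>2)) 0 0 1, restrict (\<lambda>z. 1) uhp)"

definition diag_op :: "'a operator" where "diag_op = \<rho>' (mat2 (real (p\<^sup>2)) 0 0 1, int p mod int N)"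

definition pinv :: int where "pinv = modular_inverse (int N) (int p)"

lemma p_pinv: "[int p * pinv = 1] (mod int N)" "[pinv * int p = 1] (mod int N)"
  unfolding pinv_def using cong_modular_inverse1[OF pN] cong_modular_inverse2[OF pN] by auto

lemma odd_p: "odd p"
  using coprime_not_both_even(1)[OF pN] N_even by auto

lemma p_gt_2: "2 < p"
  using odd_p prime_ge_2_nat[OF p] by (cases "p = 2") auto

lemma p_pos: "0 < p"
  using p_gt_2 by simp

lemma N_gt_1: "1 < N"
  using N_even N_pos by (cases "N = 1") auto

lemma zmult_p_pinv [simp]: "zmult (int p) (zmult pinv x) = (x :: 'a)" "zmult pinv (zmult (int p) x) = (x :: 'a)"
  using p_pinv A.zmult_cong[of x "int p * pinv" 1] A.zmult_cong[of x "pinv * int p" 1] by (simp_all add: zmult_zmult)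

lemma diag_op_nth: "diag_op $ y $ x = (if y = zmult pinv x then 1 else 0)"
proof -
  have "\<rho>' (mat2 (real_of_int ((int p)\<^sup>2)) 0 0 1, int p mod int N) *v axis x 1 = axis (zmult pinv x) 1"
  proof -
    have "\<forall>m. 0 < m \<and> coprime m (int N) \<longrightarrow> (\<forall>x. \<rho>' (mat2 (real_of_int (m\<^sup>2)) 0 0 1, m mod int N) *v axis x 1
        = axis (zmult (modular_inverse (int N) m) x) 1)"
      using ext unfolding weil_extension_def Let_def level by blast
    then show ?thesis using pN p_pos unfolding pinv_def by (metis of_nat_0_less_iff)
  qed
  then have "diag_op *v axis x 1 = axis (zmult pinv x) 1" by (simp add: diag_op_def)
  then have "(diag_op *v axis x 1) $ y = axis (zmult pinv x) 1 $ y" by simp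
  moreover have "(diag_op *v axis x 1) $ y = diag_op $ y $ x"
    by (simp add: matrix_vector_mult_def axis_def if_distrib cong: if_cong)
  ultimately show ?thesis by (simp add: axis_def)
qed

lemma diag_op_mult_left: "(diag_op ** X) $ y $ x = X $ zmult (int p) y $ x"
proof -
  have "(diag_op ** X) $ y $ x = (\<Sum>k\<in>UNIV. if k = zmult (int p) y then X $ k $ x else 0)"
    unfolding matrix_matrix_mult_def vec_lambda_beta
  proof (rule sum.cong[OF refl])
    fix k
    have "y = zmult pinv k \<longleftrightarrow> k = zmult (int p) y" by auto
    then show "diag_op $ y $ k * X $ k $ x = (if k = zmult (int p) y then X $ k $ x else 0)" by (simp add: diag_op_nth)
  qed
  then show ?thesis by simp
qed

lemma diag_op_mult_right: "(X ** diag_op) $ y $ x = X $ y $ zmult pinv x"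
  unfolding matrix_matrix_mult_def by (simp add: diag_op_nth if_distrib cong: if_cong)

lemma diag_mp_Mp2R: "diag_mp \<in> Mp2R"
proof -
  have "restrict (\<lambda>z. 1 :: complex) uhp holomorphic_on uhp"
    by (rule holomorphic_transform[of "\<lambda>_. 1"]) auto
  then show ?thesis using p_pos by (auto simp: diag_mp_def Mp2R_def auto_factor_def)
qed

lemma diag_mp_nth [simp]: "fst diag_mp = mat2 ((real p)\<^sup>2) 0 0 1" "z \<in> uhp \<Longrightarrow> snd diag_mp z = 1"
  by (simp_all add: diag_mp_def)

lemma moebius_diag_mp: "moebius (mat2 ((real p)\<^sup>2) 0 0 1) z = (of_nat p)\<^sup>2 * z"
  by (simp add: moebius_def auto_factor_def)

lemma diag_mp_uhp: "z \<in> uhp \<Longrightarrow> (of_nat p)\<^sup>2 * z \<in> uhp"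
  using moebius_uhp[OF Mp2R_D(1)[OF diag_mp_Mp2R], of z] by (simp add: moebius_diag_mp)

lemma rho_invertible: "g \<in> Mp2Z \<Longrightarrow> invertible (\<rho> g)"
proof -
  assume g: "g \<in> Mp2Z"
  obtain h where "h \<in> Mp2Z" "mp_mult h g = mp1" "mp_mult g h = mp1" by (rule mp_inverse[OF g])
  then have "\<rho> g ** \<rho> h = mat 1" "\<rho> h ** \<rho> g = mat 1" using rho_mult g rho_1 by metis+
  then show ?thesis unfolding invertible_def by blast
qed

lemma diag_op_invertible: "invertible diag_op"
proof -
  define B :: "'a operator" where "B = (\<chi> y x. if y = zmult (int p) x then 1 else 0)"
  have "diag_op ** B = mat 1"
  proof (intro vec_eq_iff[THEN iffD2] allI)
    fix y x :: 'a
    have "zmult (int p) y = zmult (int p) x \<longleftrightarrow> y = x" using zmult_p_pinv(2) by metis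
    then show "(diag_op ** B) $ y $ x = (mat 1 :: 'a operator) $ y $ x" by (simp add: diag_op_mult_left B_def mat_def)
  qed
  moreover have "B ** diag_op = mat 1"
    by (simp add: vec_eq_iff diag_op_mult_right B_def mat_def)
  ultimately show ?thesis unfolding invertible_def by blast
qed

lemma invertible_cancel_right: "invertible B \<Longrightarrow> A ** B = C ** B \<Longrightarrow> A = (C :: 'a operator)"
  unfolding invertible_def by (metis matrix_mul_assoc matrix_mul_rid)

text \<open>Passing D multiplies \<open>c\<close> by \<open>p\<^sup>2\<close>. As a square prime to
  \<open>N\<close> this does not change the Gauss sum, and in the kernel it is absorbed by scaling
  \<open>x\<close> and \<open>y\<close>.\<close>

lemma intertwine_unit:
  assumes ok: "mt_ok (a, b, c, d, e)" and b: "b = int (p\<^sup>2) * b'" and c: "coprime c (int N)"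
  shows "\<rho> (mp_of (a, b, c, d, e)) ** diag_op = diag_op ** \<rho> (mp_of (a, b', int (p\<^sup>2) * c, d, e))"
proof (intro vec_eq_iff[THEN iffD2] allI)
  fix y x
  obtain v where v: "[c * v = 1] (mod int N)" using cong_solve_coprime_int[OF c] by auto
  define v' where "v' = v * pinv\<^sup>2"
  have ok': "mt_ok (a, b', int (p\<^sup>2) * c, d, e)" using ok b by (simp add: algebra_simps)
  have c': "coprime (int (p\<^sup>2) * c) (int N)" using c pN by simp
  have pp: "[int (p\<^sup>2) * pinv\<^sup>2 = 1] (mod int N)"
    using cong_mult[OF p_pinv(1) p_pinv(1)] by (simp add: power2_eq_square mult_ac)
  have v': "[int (p\<^sup>2) * c * v' = 1] (mod int N)"
    using cong_mult[OF pp v] by (simp add: v'_def mult_ac)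
  have "odd c" using coprime_not_both_even(1)[OF c] N_even by auto
  then have odd_c: "odd (nat \<bar>c\<bar>)" by (simp add: even_nat_iff)
  then have c0: "0 < nat \<bar>c\<bar>" using odd_pos by blast
  \<comment> \<open>\<open>p\<close> divides \<open>b\<close>, hence not \<open>a\<close> because
    the determinant is 1; so the two additional factors (a / p) cancel.\<close>
  have kr: "kronecker a (nat \<bar>int (p\<^sup>2) * c\<bar>) = kronecker a (nat \<bar>c\<bar>)"
  proof -
    have "\<not> int p dvd a"
    proof
      assume "int p dvd a"
      moreover have "int p dvd b" using b by (simp add: power2_eq_square)
      ultimately have "int p dvd a * d - b * c" by simp
      then show False using ok p by simp
    qed
    then have "coprime a (int p)" using p by (metis coprime_commute prime_imp_coprime prime_nat_int_transfer)
    then have "kronecker a p * kronecker a p = 1" using odd_p by (intro kronecker_square)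
    moreover have "nat \<bar>int (p\<^sup>2) * c\<bar> = (p * p) * nat \<bar>c\<bar>" by (simp add: abs_mult nat_mult_distrib power2_eq_square)
    ultimately show ?thesis using c0 p_pos by (simp add: kronecker_mult_right)
  qed
  have gg: "A.g (int (p\<^sup>2) * c) = A.g c"
    using A.g_square[OF pN, of c] by (simp add: mult.commute)
  have gk: "A.gker v a d (zmult pinv x) y = A.gker v' a d x (zmult (int p) y)"
  proof -
    have 1: "er (of_int (v * a) * q y) = er (of_int (v' * a) * q (zmult (int p) y))"
    proof -
      have "of_int (v' * a) * (q (zmult (int p) y) - of_int ((int p)\<^sup>2) * q y) \<in> \<int>"
        by (intro Ints_mult[OF Ints_of_int] A.q_zmult) simp
      then have "er (of_int (v' * a) * q (zmult (int p) y)) = er (of_int (v' * a * (int p)\<^sup>2) * q y)"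
        using er_cong[of "of_int (v' * a) * q (zmult (int p) y)" "of_int (v' * a * (int p)\<^sup>2) * q y"]
        by (simp add: algebra_simps)
      also have "\<dots> = er (of_int (v * a) * q y)"
      proof (rule A.er_q_cong)
        have "[int (p\<^sup>2) * pinv\<^sup>2 * (v * a) = 1 * (v * a)] (mod int N)" by (intro cong_scalar_right pp)
        then show "[v' * a * (int p)\<^sup>2 = v * a] (mod int N)" by (simp add: v'_def mult_ac)
      qed simp
      finally show ?thesis by simp
    qed
    have 2: "er (of_int v * bil q (zmult pinv x) y) = er (of_int v' * bil q x (zmult (int p) y))"
    proof -
      have "er (of_int v * bil q (zmult pinv x) y) = er (bil q (zmult (v * pinv) x) y)"
        using A.er_bil_zmult_left[of "zmult pinv x" y v] by (simp add: zmult_zmult)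
      also have "\<dots> = er (of_int (v * pinv) * bil q x y)" by (rule A.er_bil_zmult_left) simp_all
      also have "\<dots> = er (of_int (v' * int p) * bil q x y)"
      proof (rule A.er_bil_cong)
        have "[v * pinv * 1 = v * pinv * (pinv * int p)] (mod int N)"
          by (intro cong_scalar_left cong_sym[OF p_pinv(2)])
        then show "[v * pinv = v' * int p] (mod int N)" by (simp add: v'_def mult_ac power2_eq_square)
      qed simp_all
      also have "\<dots> = er (bil q (zmult (v' * int p) y) x)"
        using A.er_bil_zmult_left[of y x "v' * int p"] by (simp add: A.bil_commute)
      also have "\<dots> = er (of_int v' * bil q (zmult (int p) y) x)"
        using A.er_bil_zmult_left[of "zmult (int p) y" x v'] by (simp add: zmult_zmult)
      finally show ?thesis by (simp add: A.bil_commute)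
    qed
    have 3: "er (of_int (v * d) * q (zmult pinv x)) = er (of_int (v' * d) * q x)"
    proof -
      have "of_int (v * d) * (q (zmult pinv x) - of_int (pinv\<^sup>2) * q x) \<in> \<int>"
        by (intro Ints_mult[OF Ints_of_int] A.q_zmult) simp
      then show ?thesis
        using er_cong[of "of_int (v * d) * q (zmult pinv x)" "of_int (v' * d) * q x"]
        by (simp add: algebra_simps v'_def)
    qed
    show ?thesis unfolding A.gker_def er_add er_diff 1 2 3 ..
  qed
  show "(\<rho> (mp_of (a, b, c, d, e)) ** diag_op) $ y $ x = (diag_op ** \<rho> (mp_of (a, b', int (p\<^sup>2) * c, d, e))) $ y $ x"
    unfolding diag_op_mult_left diag_op_mult_right rho_formula[OF ok c v] rho_formula[OF ok' c' v'] kr gg gk ..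
qed

lemma intertwine_cases:
  assumes g: "g \<in> Mp2Z" and h: "h \<in> Mp2Z" and eq: "mp_mult g diag_mp = mp_mult diag_mp h"
  obtains a b' c d e where "mt_ok (a, int (p\<^sup>2) * b', c, d, e)" "g = mp_of (a, int (p\<^sup>2) * b', c, d, e)"
    "h = mp_of (a, b', int (p\<^sup>2) * c, d, e)"
proof -
  obtain a b c d e where G: "mt_ok (a, b, c, d, e)" "g = mp_of (a, b, c, d, e)" using g by (rule Mp2Z_cases)
  obtain a' b' c' d' e' where H: "mt_ok (a', b', c', d', e')" "h = mp_of (a', b', c', d', e')" using h by (rule Mp2Z_cases)
  have "fst g ** fst diag_mp = fst diag_mp ** fst h" using arg_cong[OF eq, of fst] by (simp only: mp_mult_nth)
  then have "real_of_int a * real (p\<^sup>2) = real (p\<^sup>2) * real_of_int a' \<and> real_of_int b = real (p\<^sup>2) * real_of_int b' \<and>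
    real_of_int c * real (p\<^sup>2) = real_of_int c' \<and> real_of_int d = real_of_int d'"
    by (simp add: G(2) H(2) mat2_mult)
  then have m: "a = a'" "real_of_int b = real_of_int (int (p\<^sup>2) * b')" "real_of_int c' = real_of_int (int (p\<^sup>2) * c)" "d = d'"
    using p_pos by (simp_all add: mult.commute)
  then have m': "b = int (p\<^sup>2) * b'" "c' = int (p\<^sup>2) * c" by (simp_all only: of_int_eq_iff)
  have "snd (mp_mult g diag_mp) \<i> = snd (mp_mult diag_mp h) \<i>" by (simp only: eq)
  then have "of_int e * csqrt (of_int c * ((of_nat p)\<^sup>2 * \<i>) + of_int d) = of_int e' * csqrt (of_int c' * \<i> + of_int d')"
    using i_uhp diag_mp_uhp[OF i_uhp] moebius_uhp[OF Mp2R_D(1)[OF Mp2Z_Mp2R[OF h]] i_uhp]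
    by (simp add: G H moebius_diag_mp)
  moreover have "of_int c * ((of_nat p)\<^sup>2 * \<i>) = of_int c' * \<i>" by (simp add: m')
  ultimately have "of_int e * csqrt (of_int c' * \<i> + of_int d') = of_int e' * csqrt (of_int c' * \<i> + of_int d')"
    using m by simp
  moreover have "csqrt (of_int c' * \<i> + of_int d') \<noteq> 0"
    using Mp2R_D(5)[OF Mp2Z_Mp2R[OF h] i_uhp] i_uhp by (simp add: H)
  ultimately have "(of_int e :: complex) = of_int e'" by simp
  then have "e = e'" by (simp only: of_int_eq_iff)
  then show thesis using that[of a b' c d e] G H m m' by simp
qed

text \<open>The explicit formula needs \<open>c\<close> prime to \<open>N\<close>. Right
  multiplication by \<open>u\<close> shifts \<open>c\<close> by \<open>d\<close>, and some number of
  shifts reaches such an entry; \<open>u\<close> itself satisfies the relation and its operator is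
  invertible, so the shifts can be undone.\<close>

theorem intertwine:
  assumes "g \<in> Mp2Z" "h \<in> Mp2Z" "mp_mult g diag_mp = mp_mult diag_mp h"
  shows "\<rho> g ** diag_op = diag_op ** \<rho> h"
proof -
  define u u' where "u = mp_of (1, 0, 1, 1, 1)" and "u' = mp_of (1, 0, int (p\<^sup>2), 1, 1)"
  have uZ: "u \<in> Mp2Z" "u' \<in> Mp2Z" unfolding u_def u'_def by (intro mp_of_Mp2Z; simp)+
  have uu': "\<rho> u ** diag_op = diag_op ** \<rho> u'"
    using intertwine_unit[of 1 0 1 1 1 0] by (simp add: u_def u'_def)
  have ueq: "mp_mult u diag_mp = mp_mult diag_mp u'"
  proof (rule mp_eqI)
    show "mp_mult u diag_mp \<in> Mp2R" "mp_mult diag_mp u' \<in> Mp2R" by (intro mp_mult_Mp2R diag_mp_Mp2R Mp2Z_Mp2R uZ)+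
    show "fst (mp_mult u diag_mp) = fst (mp_mult diag_mp u')" by (simp add: u_def u'_def mat2_mult)
    fix z assume z: "z \<in> uhp"
    then have "moebius (fst u') z \<in> uhp" using uZ by (intro moebius_uhp Mp2R_D(1) Mp2Z_Mp2R)
    then show "snd (mp_mult u diag_mp) z = snd (mp_mult diag_mp u') z"
      using z diag_mp_uhp[OF z] by (simp add: u_def u'_def moebius_diag_mp)
  qed
  have key: "\<rho> g ** diag_op = diag_op ** \<rho> h"
    if "g \<in> Mp2Z" "h \<in> Mp2Z" "mp_mult g diag_mp = mp_mult diag_mp h"
      "g = mp_of (a, b, c, d, e)" "coprime (c + d * int j) (int N)" for g h a b c d e j
    using that
  proof (induction j arbitrary: g h a b c d e)
    case 0
    obtain a1 b1 c1 d1 e1 where 1: "mt_ok (a1, int (p\<^sup>2) * b1, c1, d1, e1)" "g = mp_of (a1, int (p\<^sup>2) * b1, c1, d1, e1)"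
      "h = mp_of (a1, b1, int (p\<^sup>2) * c1, d1, e1)" by (rule intertwine_cases[OF 0(1-3)])
    have "real_of_int c = real_of_int c1" using 0(4) 1(2) by (metis mat2_eq_iff mp_of_nth(1))
    then have "coprime c1 (int N)" using 0(5) by simp
    then show ?case unfolding 1(2,3) by (rule intertwine_unit[OF 1(1) refl])
  next
    case (Suc j)
    have gu: "mp_mult g u \<in> Mp2Z" "mp_mult h u' \<in> Mp2Z" using Suc.prems uZ by (auto intro: mp_mult_Mp2Z)
    note R = Mp2Z_Mp2R[OF Suc.prems(1)] Mp2Z_Mp2R[OF Suc.prems(2)] Mp2Z_Mp2R[OF uZ(1)] Mp2Z_Mp2R[OF uZ(2)]
    have eq: "mp_mult (mp_mult g u) diag_mp = mp_mult diag_mp (mp_mult h u')"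
      using mp_mult_assoc[OF R(1,3) diag_mp_Mp2R] mp_mult_assoc[OF R(1) diag_mp_Mp2R R(4)]
        mp_mult_assoc[OF diag_mp_Mp2R R(2,4)] Suc.prems(3) ueq by simp
    obtain a2 b2 c2 d2 e2 where 2: "mp_mult g u = mp_of (a2, b2, c2, d2, e2)" using gu(1) by (rule Mp2Z_cases)
    have "fst (mp_mult g u) = mat2 (real_of_int (a + b)) (real_of_int b) (real_of_int (c + d)) (real_of_int d)"
      by (simp add: Suc.prems(4) u_def mat2_mult)
    then have "real_of_int c2 = real_of_int (c + d)" "real_of_int d2 = real_of_int d" using 2 by simp_all
    then have "c2 = c + d" "d2 = d" by (simp_all only: of_int_eq_iff)
    then have "coprime (c2 + d2 * int j) (int N)" using Suc.prems(5) by (simp add: algebra_simps)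
    from Suc.IH[OF gu eq 2 this] have "\<rho> g ** \<rho> u ** diag_op = diag_op ** \<rho> h ** \<rho> u'"
      using rho_mult Suc.prems uZ by (simp add: matrix_mul_assoc)
    then have "(\<rho> g ** diag_op) ** \<rho> u' = (diag_op ** \<rho> h) ** \<rho> u'"
      using uu' by (metis matrix_mul_assoc)
    then show ?case using invertible_cancel_right[OF rho_invertible[OF uZ(2)]] by blast
  qed
  obtain a b c d e where g: "mt_ok (a, b, c, d, e)" "g = mp_of (a, b, c, d, e)" using assms(1) by (rule Mp2Z_cases)
  have "coprime c d"
  proof (rule coprimeI)
    fix z assume "z dvd c" "z dvd d"
    then have "z dvd a * d - b * c" by simp
    then show "is_unit z" using g(1) by simp
  qed
  then obtain j where "coprime (c + d * int j) (int N)" using exists_coprime_shift[OF _ N_pos] by blast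
  then show ?thesis using key[OF assms g(2)] by blast
qed

text \<open>The central element with matrix 1 and root -1 acts by -1. It is enough to see this after
  multiplying by the invertible operator of \<open>S\<close>, where \<open>rho_formula\<close>
  exhibits the sign \<open>e\<close>.\<close>

lemma rho_neg: "mt_ok (a, b, c, d, e) \<Longrightarrow> \<rho> (mp_of (a, b, c, d, - e)) = - \<rho> (mp_of (a, b, c, d, e))"
proof -
  assume ok: "mt_ok (a, b, c, d, e)"
  define z where "z = mp_of (1, 0, 0, 1, - 1)"
  have zZ: "z \<in> Mp2Z" unfolding z_def by (rule mp_of_Mp2Z) simp
  have neg: "mp_mult z (mp_of (a, b, c, d, e)) = mp_of (a, b, c, d, - e)" if ok: "mt_ok (a, b, c, d, e)" for a b c d e
  proof (rule mp_eqI)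
    have okn: "mt_ok (a, b, c, d, - e)" using ok by auto
    show "mp_of (a, b, c, d, - e) \<in> Mp2R" by (rule mp_of_Mp2R[OF okn])
    show "mp_mult z (mp_of (a, b, c, d, e)) \<in> Mp2R" by (intro mp_mult_Mp2R mp_of_Mp2R[OF ok] Mp2Z_Mp2R[OF zZ])
    show "fst (mp_mult z (mp_of (a, b, c, d, e))) = fst (mp_of (a, b, c, d, - e))" by (simp add: z_def mat2_mult)
    fix w assume w: "w \<in> uhp"
    have "moebius (fst (mp_of (a, b, c, d, e))) w \<in> uhp" by (intro moebius_uhp w Mp2R_D(1) mp_of_Mp2R[OF ok])
    then show "snd (mp_mult z (mp_of (a, b, c, d, e))) w = snd (mp_of (a, b, c, d, - e)) w"
      using w by (simp add: z_def)
  qed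
  have okS: "mt_ok (0, - 1, 1, 0, 1)" "mt_ok (0, - 1, 1, 0, - 1)" by simp_all
  have "\<rho> z ** \<rho> mpS = - \<rho> mpS"
  proof -
    have "\<rho> z ** \<rho> mpS = \<rho> (mp_of (0, - 1, 1, 0, - 1))"
      using rho_mult[OF zZ mpS_Mp2Z] neg[OF okS(1)] by (simp add: mpS_eq)
    also have "\<dots> = - \<rho> mpS"
      unfolding mpS_eq using rho_formula[OF okS(1), of 1] rho_formula[OF okS(2), of 1] by (simp add: vec_eq_iff)
    finally show ?thesis .
  qed
  also have "\<dots> = - mat 1 ** \<rho> mpS" by (simp add: vec_eq_iff matrix_matrix_mult_def mat_def sum_negf if_distrib[of "\<lambda>x. x * _"] cong: if_cong)
  finally have z1: "\<rho> z = - mat 1" by (rule invertible_cancel_right[OF rho_invertible[OF mpS_Mp2Z]])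
  have "\<rho> (mp_of (a, b, c, d, - e)) = \<rho> z ** \<rho> (mp_of (a, b, c, d, e))"
    using rho_mult[OF zZ mp_of_Mp2Z[OF ok]] neg[OF ok] by simp
  then show ?thesis unfolding z1
    by (simp add: vec_eq_iff matrix_matrix_mult_def mat_def sum_negf if_distrib[of "\<lambda>x. x * _"] cong: if_cong)
qed

end

section \<open>Operators on the double coset, and their signs\<close>

context hecke_setup
begin

abbreviation pN where "pN \<equiv> int p mod int N"

lemma gauss_eq: "gauss q u = A.g u"
  by (simp add: gauss_def A.g_def er_def of_rat_mult)

text \<open>Both Gauss sums are sqrt |A| times a sign and an eighth root of unity, and for odd
  \<open>p\<close> their quotient is a fourth root of unity. Its square is what matters, because in
  \<open>coset_op_sign\<close> the quotient enters twice, through \<rho>' and through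
  \<open>rho_diag\<close>.\<close>

lemma psi_square: "(A.g 1 / A.g (int p))\<^sup>2 \<in> {1, - 1}"
proof -
  define S :: complex where "S = of_real (sqrt (real CARD('a)))"
  define kr where "kr = kronecker (int CARD('a)) p"
  have "S \<noteq> 0" by (simp add: S_def card_gt_0_iff)
  have kr: "(of_int kr :: complex)\<^sup>2 = 1"
    using kronecker_square[OF odd_p card_prime_to[OF pN]] unfolding kr_def power2_eq_square by (metis of_int_1 of_int_mult)
  have gp: "A.g (int p) = S * (of_int kr * ee (of_nat (p * s) / 8))"
    using gauss_closed_form[OF fqm_UNIV sgn odd_p pN] by (simp add: S_def kr_def)
  have g1: "A.g 1 = S * ee (of_nat s / 8)" using sgn by (simp add: S_def)
  obtain h where h: "p = 2 * h + 1" using odd_p by (elim oddE)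
  have "ee (of_nat (p * s) / 8) ^ 4 = ee (of_nat s / 8) ^ 4"
  proof -
    have "ee (of_nat (p * s) / 8) ^ 4 = ee (of_nat s / 2 + of_int (int (h * s)))"
      unfolding ee_of_nat_mult[symmetric] h by (rule arg_cong[of _ _ ee]) (simp add: field_simps)
    also have "\<dots> = ee (of_nat s / 8) ^ 4"
      unfolding ee_add_of_int ee_of_nat_mult[symmetric] by (rule arg_cong[of _ _ ee]) simp
    finally show ?thesis .
  qed
  then have "A.g (int p) ^ 4 = A.g 1 ^ 4"
    unfolding gp g1 power_mult_distrib using kr by (simp add: power4_eq_xxxx power2_eq_square mult.assoc)
  then have "((A.g 1 / A.g (int p))\<^sup>2)\<^sup>2 = 1"
    using A.g_nonzero[OF pN] A.g1_nonzero by (simp add: power_divide flip: power_mult)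
  then have "(A.g 1 / A.g (int p))\<^sup>2 = 1 \<or> (A.g 1 / A.g (int p))\<^sup>2 = - 1" by (simp only: power2_eq_1_iff)
  then show ?thesis by blast
qed

lemma matrix_inv_cancel:
  assumes "invertible U"
  shows "matrix_inv U ** U = mat 1" "U ** matrix_inv U = mat 1"
proof -
  have "U ** matrix_inv U = mat 1 \<and> matrix_inv U ** U = mat 1"
    using assms unfolding matrix_inv_def invertible_def by (rule someI_ex)
  then show "matrix_inv U ** U = mat 1" "U ** matrix_inv U = mat 1" by auto
qed

lemma invertible_cancel_left: "invertible B \<Longrightarrow> B ** A = B ** C \<Longrightarrow> A = (C :: 'a operator)"
  unfolding invertible_def by (metis matrix_mul_assoc matrix_mul_lid)

text \<open>After one more step \<open>S\<close> the lower left entry is the unit \<open>a\<close>,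
  so the explicit formula applies. Since \<open>b\<close> and \<open>c\<close> vanish modulo
  \<open>N\<close>, the kernel reduces to its bilinear term.\<close>

lemma rho_diag:
  assumes ok: "mt_ok (a, b, c, d, e)" and a: "[a = int p] (mod int N)" and b: "int N dvd b" and c: "int N dvd c"
  shows "\<exists>\<sigma>\<in>{1, - 1}. \<rho> (mp_of (a, b, c, d, e)) = cscale (\<sigma> * (A.g 1 / A.g (int p))) diag_op"
proof -
  have cop: "coprime a (int N)" using a pN by (meson cong_imp_coprime cong_sym)
  define \<sigma> :: complex where "\<sigma> = of_int (e * sg a c * kronecker (- c) (nat \<bar>a\<bar>))"
  have "odd a" using coprime_not_both_even(1)[OF cop] N_even by auto
  then have oa: "odd (nat \<bar>a\<bar>)" by (simp add: even_nat_iff)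
  have "coprime (- c) (int (nat \<bar>a\<bar>))"
  proof (rule coprimeI)
    fix z assume "z dvd - c" "z dvd int (nat \<bar>a\<bar>)"
    then have "z dvd a * d - b * c" by simp
    then show "is_unit z" using ok by simp
  qed
  then have "kronecker (- c) (nat \<bar>a\<bar>) \<in> {1, - 1}" by (rule kronecker_sign[OF oa])
  then have sig: "\<sigma> \<in> {1, - 1}" using ok unfolding \<sigma>_def sg_def by auto
  have av: "[a * pinv = 1] (mod int N)" using cong_scalar_right[OF a, of pinv] p_pinv(1) by (rule cong_trans)
  have okS: "mt_ok (- c, - d, a, b, e * sg a c)" using mt_ok_steps(1)[OF ok] by simp
  have "\<rho> mpS ** \<rho> (mp_of (a, b, c, d, e)) = \<rho> mpS ** cscale (\<sigma> * (A.g 1 / A.g (int p))) diag_op"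
  proof (intro vec_eq_iff[THEN iffD2] allI)
    fix y x
    have gk: "A.gker pinv (- c) b x y = er (- of_int pinv * bil q x y)"
    proof -
      have z: "[pinv * - c = 0] (mod int N)" "[pinv * b = 0] (mod int N)" using b c by (simp_all add: cong_0_iff)
      have "er (of_int (pinv * - c) * q y) = er (of_int 0 * q y)" by (rule A.er_q_cong[OF _ z(1)]) simp
      moreover have "er (of_int (pinv * b) * q x) = er (of_int 0 * q x)" by (rule A.er_q_cong[OF _ z(2)]) simp
      ultimately show ?thesis unfolding A.gker_def er_add er_diff by (simp add: er_minus divide_inverse)
    qed
    have "(\<rho> mpS ** \<rho> (mp_of (a, b, c, d, e))) $ y $ x = \<rho> (mp_of (- c, - d, a, b, e * sg a c)) $ y $ x"
      using rho_mult[OF mpS_Mp2Z mp_of_Mp2Z[OF ok]] mpS_mult[OF ok] by simp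
    also have "\<dots> = \<sigma> * cnj (A.g a) / of_nat CARD('a) * er (- of_int pinv * bil q x y)"
      unfolding rho_formula[OF okS cop av] gk \<sigma>_def ..
    also have "A.g a = A.g (int p)" by (rule A.g_cong[OF a])
    also have "cnj (A.g (int p)) = of_nat CARD('a) / A.g (int p)"
      using A.g_mult_cnj[OF pN] A.g_nonzero[OF pN] by (simp add: field_simps)
    also have "er (- of_int pinv * bil q x y) = er (- bil q (zmult pinv x) y)"
      using A.er_bil_zmult_left[of x y pinv] by (simp add: er_minus)
    also have "\<sigma> * (of_nat CARD('a) / A.g (int p)) / of_nat CARD('a) * er (- bil q (zmult pinv x) y)
        = (\<rho> mpS ** cscale (\<sigma> * (A.g 1 / A.g (int p))) diag_op) $ y $ x"
    proof -
      have "(\<rho> mpS ** cscale (\<sigma> * (A.g 1 / A.g (int p))) diag_op) $ y $ x = \<sigma> * (A.g 1 / A.g (int p)) * (\<rho> mpS ** diag_op) $ y $ x"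
        unfolding matrix_matrix_mult_def cscale_def vec_lambda_beta sum_distrib_left by (simp add: mult_ac)
      then show ?thesis unfolding diag_op_mult_right rho_S using A.g1_nonzero by simp
    qed
    finally show "(\<rho> mpS ** \<rho> (mp_of (a, b, c, d, e))) $ y $ x = (\<rho> mpS ** cscale (\<sigma> * (A.g 1 / A.g (int p))) diag_op) $ y $ x" .
  qed
  then show ?thesis using invertible_cancel_left[OF rho_invertible[OF mpS_Mp2Z]] sig by blast
qed

text \<open>For an integral matrix the least clearing integer is 1, so \<open>reduction\<close> is
  the entrywise residue.\<close>

lemma QN_I:
  fixes M :: "real^2^2"
  assumes int: "\<And>i j. M $ i $ j \<in> \<int>" and det: "det M = (real p)\<^sup>2"
  shows "(M, pN) \<in> QN (int N)" "[reduction (int N) M $ i $ j = \<lfloor>M $ i $ j\<rfloor>] (mod int N)" "M \<in> HN (int N)"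
proof -
  define X :: "int^2^2" where "X = (\<chi> i j. \<lfloor>M $ i $ j\<rfloor>)"
  have X: "M $ i $ j = real_of_int (X $ i $ j)" for i j using int[of i j] by (simp add: X_def)
  have "real_of_int (det X) = det M" by (simp add: det_2 X)
  then have "real_of_int (det X) = real_of_int ((int p)\<^sup>2)" using det by simp
  then have detX: "det X = (int p)\<^sup>2" by (simp only: of_int_eq_iff)
  have c1: "clears (int N) M 1"
    unfolding clears_def using X detX pN by (auto intro!: exI[of _ X])
  have L: "(LEAST n. clears (int N) M n) = 1"
    by (rule Least_equality[of "clears (int N) M" 1, OF c1]) (simp add: clears_def)
  have mi: "[modular_inverse (int N) 1 = 1] (mod int N)"
    using cong_modular_inverse1[of 1 "int N"] by simp
  have red: "[reduction (int N) M $ i $ j = \<lfloor>M $ i $ j\<rfloor>] (mod int N)" for i j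
    using cong_scalar_right[OF mi, of "\<lfloor>M $ i $ j\<rfloor>"] by (simp add: reduction_def L Let_def)
  then show "[reduction (int N) M $ i $ j = \<lfloor>M $ i $ j\<rfloor>] (mod int N)" .
  have GN: "M \<in> GN (int N)" using c1 det p_pos by (auto simp: GN_def)
  have units: "pN \<in> unitsN (int N)"
    using N_pos pN by (simp add: unitsN_def coprime_mod_left_iff)
  have "[det (reduction (int N) M) = det X] (mod int N)"
    unfolding det_2 X_def vec_lambda_beta by (intro cong_diff cong_mult red)
  moreover have "[(int p)\<^sup>2 = pN\<^sup>2] (mod int N)" by (intro cong_pow) (simp add: cong_def)
  ultimately have dr: "[det (reduction (int N) M) = pN\<^sup>2] (mod int N)"
    unfolding detX by (rule cong_trans)
  show "(M, pN) \<in> QN (int N)" using GN units dr by (simp add: QN_def)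
  show "M \<in> HN (int N)" using GN units dr by (auto simp: HN_def)
qed

lemma Mp2Z_ints: "g \<in> Mp2Z \<Longrightarrow> fst g $ i $ j \<in> \<int>" "g \<in> Mp2Z \<Longrightarrow> det (fst g) = 1" "g \<in> Mp2Z \<Longrightarrow> fst g \<in> SL2Z"
  by (auto simp: Mp2Z_def SL2Z_def)

text \<open>A relation, because an element has many decompositions; that they all give the same
  operator is the purpose of \<open>intertwine\<close>.\<close>

definition coset_op :: "mp \<Rightarrow> 'a operator \<Rightarrow> bool" where
  "coset_op g U \<longleftrightarrow> (\<exists>\<alpha>\<in>Mp2Z. \<exists>\<beta>\<in>Mp2Z. g = mp_mult (mp_mult \<alpha> diag_mp) \<beta> \<and> U = \<rho> \<alpha> ** diag_op ** \<rho> \<beta>)"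

lemma coset_op_I: "\<alpha> \<in> Mp2Z \<Longrightarrow> \<beta> \<in> Mp2Z \<Longrightarrow> coset_op (mp_mult (mp_mult \<alpha> diag_mp) \<beta>) (\<rho> \<alpha> ** diag_op ** \<rho> \<beta>)"
  unfolding coset_op_def by blast

lemma coset_op_matrix:
  assumes "coset_op g U"
  shows "fst g $ i $ j \<in> \<int>" "det (fst g) = (real p)\<^sup>2" "g \<in> Mp2R"
proof -
  obtain \<alpha> \<beta> where ab: "\<alpha> \<in> Mp2Z" "\<beta> \<in> Mp2Z" "g = mp_mult (mp_mult \<alpha> diag_mp) \<beta>" using assms unfolding coset_op_def by blast
  have D: "fst diag_mp $ i $ j \<in> \<int>" for i j
  proof -
    have "\<forall>i j. fst diag_mp $ i $ j \<in> \<int>" by (simp add: forall_2)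
    then show ?thesis by blast
  qed
  show "fst g $ i $ j \<in> \<int>"
    unfolding ab mp_mult_nth mult_nth_2 using ab Mp2Z_ints D by (intro Ints_add Ints_mult)
  show "det (fst g) = (real p)\<^sup>2" using ab Mp2Z_ints(2) by (simp add: det_mul)
  show "g \<in> Mp2R" unfolding ab using ab by (intro mp_mult_Mp2R diag_mp_Mp2R Mp2Z_Mp2R)
qed

text \<open>Comparing the two decompositions gives \<open>ai \<alpha>\<close> to the left of D and
  \<open>\<beta>' bi\<close> to the right of it, a pair to which \<open>intertwine\<close>
  applies.\<close>

lemma coset_op_unique:
  assumes "coset_op g U" "coset_op g U'"
  shows "U = U'"
proof -
  obtain \<alpha> \<beta> where ab: "\<alpha> \<in> Mp2Z" "\<beta> \<in> Mp2Z" "g = mp_mult (mp_mult \<alpha> diag_mp) \<beta>" "U = \<rho> \<alpha> ** diag_op ** \<rho> \<beta>"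
    using assms(1) unfolding coset_op_def by blast
  obtain \<alpha>' \<beta>' where ab': "\<alpha>' \<in> Mp2Z" "\<beta>' \<in> Mp2Z" "g = mp_mult (mp_mult \<alpha>' diag_mp) \<beta>'" "U' = \<rho> \<alpha>' ** diag_op ** \<rho> \<beta>'"
    using assms(2) unfolding coset_op_def by blast
  obtain ai where ai: "ai \<in> Mp2Z" "mp_mult ai \<alpha>' = mp1" "mp_mult \<alpha>' ai = mp1" by (rule mp_inverse[OF ab'(1)])
  obtain bi where bi: "bi \<in> Mp2Z" "mp_mult bi \<beta> = mp1" "mp_mult \<beta> bi = mp1" by (rule mp_inverse[OF ab(2)])
  note R = Mp2Z_Mp2R[OF ab(1)] Mp2Z_Mp2R[OF ab(2)] Mp2Z_Mp2R[OF ab'(1)] Mp2Z_Mp2R[OF ab'(2)]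
    Mp2Z_Mp2R[OF ai(1)] Mp2Z_Mp2R[OF bi(1)] diag_mp_Mp2R mp_mult_Mp2R
  have "mp_mult (mp_mult ai g) bi = mp_mult (mp_mult ai \<alpha>) diag_mp"
    unfolding ab(3) using R bi by (simp add: mp_mult_assoc)
  moreover have "mp_mult (mp_mult ai g) bi = mp_mult diag_mp (mp_mult \<beta>' bi)"
  proof -
    have "mp_mult ai g = mp_mult (mp_mult ai \<alpha>') (mp_mult diag_mp \<beta>')"
      unfolding ab'(3) using R by (simp add: mp_mult_assoc)
    then show ?thesis using R ai by (simp add: mp_mult_assoc)
  qed
  ultimately have "\<rho> (mp_mult ai \<alpha>) ** diag_op = diag_op ** \<rho> (mp_mult \<beta>' bi)"
    using ab ab' ai bi by (intro intertwine mp_mult_Mp2Z) auto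
  then have e: "\<rho> ai ** \<rho> \<alpha> ** diag_op = diag_op ** \<rho> \<beta>' ** \<rho> bi" using ab ab' ai bi by (simp add: rho_mult matrix_mul_assoc)
  have ra: "\<rho> \<alpha>' ** \<rho> ai = mat 1" and rb: "\<rho> bi ** \<rho> \<beta> = mat 1"
    using rho_mult[OF ab'(1) ai(1)] rho_mult[OF bi(1) ab(2)] ai bi rho_1 by simp_all
  have "U = (\<rho> \<alpha>' ** \<rho> ai) ** \<rho> \<alpha> ** diag_op ** \<rho> \<beta>" unfolding ra ab(4) by simp
  also have "\<dots> = \<rho> \<alpha>' ** (\<rho> ai ** \<rho> \<alpha> ** diag_op) ** \<rho> \<beta>" by (simp only: matrix_mul_assoc)
  also have "\<dots> = \<rho> \<alpha>' ** diag_op ** \<rho> \<beta>' ** (\<rho> bi ** \<rho> \<beta>)" unfolding e by (simp only: matrix_mul_assoc)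
  also have "\<dots> = U'" unfolding rb ab'(4) by simp
  finally show ?thesis .
qed

lemma coset_op_left: "\<gamma> \<in> Mp2Z \<Longrightarrow> coset_op g U \<Longrightarrow> coset_op (mp_mult \<gamma> g) (\<rho> \<gamma> ** U)"
proof -
  assume c: "\<gamma> \<in> Mp2Z" and "coset_op g U"
  then obtain \<alpha> \<beta> where ab: "\<alpha> \<in> Mp2Z" "\<beta> \<in> Mp2Z" "g = mp_mult (mp_mult \<alpha> diag_mp) \<beta>" "U = \<rho> \<alpha> ** diag_op ** \<rho> \<beta>"
    unfolding coset_op_def by blast
  have "mp_mult \<gamma> g = mp_mult (mp_mult (mp_mult \<gamma> \<alpha>) diag_mp) \<beta>"
    unfolding ab(3) using ab c Mp2Z_Mp2R diag_mp_Mp2R mp_mult_Mp2R by (simp add: mp_mult_assoc)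
  moreover have "\<rho> \<gamma> ** U = \<rho> (mp_mult \<gamma> \<alpha>) ** diag_op ** \<rho> \<beta>" unfolding ab(4) using ab c by (simp add: rho_mult matrix_mul_assoc)
  ultimately show ?thesis using ab c mp_mult_Mp2Z unfolding coset_op_def by blast
qed

lemma coset_op_right: "\<gamma> \<in> Mp2Z \<Longrightarrow> coset_op g U \<Longrightarrow> coset_op (mp_mult g \<gamma>) (U ** \<rho> \<gamma>)"
proof -
  assume c: "\<gamma> \<in> Mp2Z" and "coset_op g U"
  then obtain \<alpha> \<beta> where ab: "\<alpha> \<in> Mp2Z" "\<beta> \<in> Mp2Z" "g = mp_mult (mp_mult \<alpha> diag_mp) \<beta>" "U = \<rho> \<alpha> ** diag_op ** \<rho> \<beta>"
    unfolding coset_op_def by blast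
  have "mp_mult g \<gamma> = mp_mult (mp_mult \<alpha> diag_mp) (mp_mult \<beta> \<gamma>)"
    unfolding ab(3) using ab c Mp2Z_Mp2R diag_mp_Mp2R mp_mult_Mp2R by (simp add: mp_mult_assoc)
  moreover have "U ** \<rho> \<gamma> = \<rho> \<alpha> ** diag_op ** \<rho> (mp_mult \<beta> \<gamma>)" unfolding ab(4) using ab c by (simp add: rho_mult matrix_mul_assoc)
  ultimately show ?thesis using ab c mp_mult_Mp2Z unfolding coset_op_def by blast
qed

lemma coset_op_diag_mp: "coset_op diag_mp diag_op"
  using coset_op_I[OF mp1_Mp2Z mp1_Mp2Z] diag_mp_Mp2R by (simp add: rho_1)

lemma coset_op_invertible: "coset_op g U \<Longrightarrow> invertible U"
  unfolding coset_op_def using rho_invertible diag_op_invertible invertible_mult by blast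

lemma cscale_cscale: "cscale a (cscale b U) = cscale (a * b) U"
  by (simp add: cscale_def mult.assoc)

lemma cscale_mult: "cscale a U ** V = cscale a (U ** V)" "U ** cscale a V = cscale a (U ** V)"
  by (simp_all add: cscale_def matrix_matrix_mult_def vec_eq_iff sum_distrib_left mult_ac)

text \<open>The operator \<open>\<rho>' (M, p)\<close> is only given as \<open>\<plusminus> (g / g_p) \<rho>(\<gamma>)\<close> for some \<open>\<gamma>\<close>; the formula for
  \<open>\<rho>\<close> on matrices congruent to \<open>diag (p, 1/p)\<close> makes this independent of \<open>\<gamma>\<close> up to sign.\<close>

theorem coset_op_sign:
  assumes "coset_op g U"
  shows "\<exists>t\<in>{1, - 1 :: real}. U = t *\<^sub>R \<rho>' (fst g, pN)"
proof -
  obtain \<alpha> \<beta> where ab: "\<alpha> \<in> Mp2Z" "\<beta> \<in> Mp2Z" "g = mp_mult (mp_mult \<alpha> diag_mp) \<beta>" "U = \<rho> \<alpha> ** diag_op ** \<rho> \<beta>"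
    using assms unfolding coset_op_def by blast
  define M where "M = fst g"
  note M = QN_I[OF coset_op_matrix(1,2)[OF assms], folded M_def]
  obtain \<gamma> \<sigma> where gam: "\<gamma> \<in> Mp2Z"
      "\<And>i j. [\<lfloor>fst \<gamma> $ i $ j\<rfloor> = modular_inverse (int N) pN * reduction (int N) M $ i $ j] (mod int N)"
    and sg: "\<sigma> \<in> {1, - 1}" "\<rho>' (M, pN) = cscale (\<sigma> * (gauss q 1 / gauss q pN)) (\<rho> \<gamma>)"
    using ext M(1) unfolding weil_extension_def Let_def level by fastforce
  have gpN: "A.g pN = A.g (int p)" by (rule A.g_cong) (simp add: cong_def)
  have piv: "[modular_inverse (int N) pN = pinv] (mod int N)"
  proof -
    have "coprime pN (int N)" using pN N_pos by (simp add: coprime_mod_left_iff)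
    then have 1: "[pN * modular_inverse (int N) pN = 1] (mod int N)" by (rule cong_modular_inverse1)
    have "[int p * modular_inverse (int N) pN = pN * modular_inverse (int N) pN] (mod int N)"
      by (intro cong_scalar_right) (simp add: cong_def)
    then have "[int p * modular_inverse (int N) pN = 1] (mod int N)" using 1 cong_trans by blast
    then have "[pinv * (int p * modular_inverse (int N) pN) = pinv * 1] (mod int N)" by (rule cong_scalar_left)
    moreover have "[(pinv * int p) * modular_inverse (int N) pN = 1 * modular_inverse (int N) pN] (mod int N)"
      by (intro cong_scalar_right p_pinv)
    ultimately show ?thesis unfolding mult.assoc mult_1 mult_1_right by (metis cong_sym cong_trans)
  qed
  have mc: "mcong N (fst \<gamma>) (real_of_int pinv *\<^sub>R M)"
    unfolding mcong_def
  proof (intro allI)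
    fix i j :: 2
    have "[modular_inverse (int N) pN * reduction (int N) M $ i $ j = pinv * \<lfloor>M $ i $ j\<rfloor>] (mod int N)"
      by (intro cong_mult piv M(2))
    then have "[\<lfloor>fst \<gamma> $ i $ j\<rfloor> = pinv * \<lfloor>M $ i $ j\<rfloor>] (mod int N)"
      using gam(2) cong_trans by blast
    then obtain k where "\<lfloor>fst \<gamma> $ i $ j\<rfloor> - pinv * \<lfloor>M $ i $ j\<rfloor> = int N * k" by (metis cong_iff_dvd_diff dvd_def)
    then have "real_of_int (\<lfloor>fst \<gamma> $ i $ j\<rfloor> - pinv * \<lfloor>M $ i $ j\<rfloor>) = real_of_int (int N * k)" by (simp only:)
    moreover have "real_of_int \<lfloor>fst \<gamma> $ i $ j\<rfloor> = fst \<gamma> $ i $ j" "real_of_int \<lfloor>M $ i $ j\<rfloor> = M $ i $ j"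
      using Mp2Z_ints(1)[OF gam(1)] coset_op_matrix(1)[OF assms] by (simp_all add: M_def)
    ultimately have "fst \<gamma> $ i $ j - (real_of_int pinv *\<^sub>R M) $ i $ j = real N * real_of_int k" by simp
    then show "(fst \<gamma> $ i $ j - (real_of_int pinv *\<^sub>R M) $ i $ j) / real N \<in> \<int>" using N_pos by simp
  qed
  obtain ai where ai: "ai \<in> Mp2Z" "mp_mult ai \<alpha> = mp1" "mp_mult \<alpha> ai = mp1" by (rule mp_inverse[OF ab(1)])
  obtain bi where bi: "bi \<in> Mp2Z" "mp_mult bi \<beta> = mp1" "mp_mult \<beta> bi = mp1" by (rule mp_inverse[OF ab(2)])
  note R = Mp2Z_Mp2R[OF ab(1)] Mp2Z_Mp2R[OF ab(2)] Mp2Z_Mp2R[OF ai(1)] Mp2Z_Mp2R[OF bi(1)] Mp2Z_Mp2R[OF gam(1)]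
    diag_mp_Mp2R mp_mult_Mp2R
  \<comment> \<open>Removing \<alpha> and \<beta> from \<gamma> leaves a matrix congruent to
    \<open>pinv\<close> times D, that is, to diag(p, 1/p).\<close>
  define \<delta> where "\<delta> = mp_mult (mp_mult ai \<gamma>) bi"
  have dZ: "\<delta> \<in> Mp2Z" unfolding \<delta>_def by (intro mp_mult_Mp2Z ai bi gam)
  have "mcong N (fst \<delta>) (fst ai ** (real_of_int pinv *\<^sub>R M) ** fst bi)"
    unfolding \<delta>_def mp_mult_nth by (intro mcong_mult_left mcong_mult_right Mp2Z_ints(3) ai bi mc)
  also have "fst ai ** (real_of_int pinv *\<^sub>R M) ** fst bi = real_of_int pinv *\<^sub>R (fst ai ** M ** fst bi)"
    by (simp add: vec_eq_iff matrix_matrix_mult_def sum_distrib_left sum_distrib_right mult_ac)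
  also have "fst ai ** M ** fst bi = fst diag_mp"
  proof -
    have "fst ai ** M ** fst bi = (fst ai ** fst \<alpha>) ** fst diag_mp ** (fst \<beta> ** fst bi)"
      unfolding M_def ab(3) mp_mult_nth by (simp only: matrix_mul_assoc)
    moreover have "fst ai ** fst \<alpha> = mat 1" "fst \<beta> ** fst bi = mat 1"
      using arg_cong[OF ai(2), of fst] arg_cong[OF bi(3), of fst] by (simp_all add: mp1_def)
    ultimately show ?thesis by (simp only: matrix_mul_lid matrix_mul_rid)
  qed
  finally have md: "mcong N (fst \<delta>) (real_of_int pinv *\<^sub>R mat2 ((real p)\<^sup>2) 0 0 1)" by simp
  obtain a b c d e where del: "mt_ok (a, b, c, d, e)" "\<delta> = mp_of (a, b, c, d, e)" using dZ by (rule Mp2Z_cases)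
  have int_div: "int N dvd z" if q: "real_of_int z / real N \<in> \<int>" for z
  proof -
    obtain k where "real_of_int z / real N = of_int k" using Ints_cases[OF q] by blast
    then have "real_of_int z = real_of_int (int N * k)" using N_pos by (simp add: field_simps)
    then show ?thesis by (simp only: of_int_eq_iff dvd_triv_left)
  qed
  have "real_of_int (a - pinv * (int p)\<^sup>2) / real N \<in> \<int>" "real_of_int b / real N \<in> \<int>" "real_of_int c / real N \<in> \<int>"
    using md[unfolded mcong_def, rule_format, of 1 1] md[unfolded mcong_def, rule_format, of 1 2]
      md[unfolded mcong_def, rule_format, of 2 1] by (simp_all add: del)
  note dv = this[THEN int_div]
  have "[a = int p] (mod int N)"
  proof -
    have "[a = pinv * (int p)\<^sup>2] (mod int N)" using dv(1) by (simp add: cong_iff_dvd_diff)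
    moreover have "[pinv * (int p)\<^sup>2 = int p] (mod int N)"
      using cong_scalar_right[OF p_pinv(2), of "int p"] by (simp add: power2_eq_square mult.assoc)
    ultimately show ?thesis by (rule cong_trans)
  qed
  then obtain \<epsilon> where ep: "\<epsilon> \<in> {1, - 1}" "\<rho> \<delta> = cscale (\<epsilon> * (A.g 1 / A.g (int p))) diag_op"
    using rho_diag[OF del(1) _ dv(2,3)] del(2) by blast
  have "\<gamma> = mp_mult (mp_mult \<alpha> \<delta>) \<beta>"
  proof -
    have "mp_mult (mp_mult \<alpha> \<delta>) \<beta> = mp_mult (mp_mult (mp_mult \<alpha> ai) \<gamma>) (mp_mult bi \<beta>)"
      unfolding \<delta>_def using R by (simp add: mp_mult_assoc)
    then show ?thesis using ai bi R by simp
  qed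
  then have "\<rho> \<gamma> = \<rho> \<alpha> ** \<rho> \<delta> ** \<rho> \<beta>" using ab dZ mp_mult_Mp2Z by (simp add: rho_mult)
  then have rep_mp: "\<rho> \<gamma> = cscale (\<epsilon> * (A.g 1 / A.g (int p))) U" unfolding ep(2) ab(4) by (simp add: cscale_mult)
  \<comment> \<open>One factor \<open>g 1 / g p\<close> stems from the normalization of \<rho>' and
    one from \<open>rho_diag\<close>; their product is a sign.\<close>
  define \<tau> where "\<tau> = \<sigma> * \<epsilon> * (A.g 1 / A.g (int p))\<^sup>2"
  have rM: "\<rho>' (M, pN) = cscale \<tau> U"
    unfolding sg(2) rep_mp gauss_eq gpN cscale_cscale \<tau>_def by (simp add: power2_eq_square mult_ac)
  have "\<tau> = 1 \<or> \<tau> = - 1" using sg(1) ep(1) psi_square unfolding \<tau>_def by auto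
  then show ?thesis
  proof
    assume "\<tau> = 1"
    then have "U = 1 *\<^sub>R \<rho>' (M, pN)" unfolding rM by (simp add: cscale_def vec_eq_iff)
    then show ?thesis unfolding M_def by blast
  next
    assume "\<tau> = - 1"
    then have "U = (- 1) *\<^sub>R \<rho>' (M, pN)" unfolding rM by (simp add: cscale_def vec_eq_iff)
    then show ?thesis unfolding M_def by blast
  qed
qed

section \<open>The double coset\<close>

definition q2_elem :: "mp \<Rightarrow> int \<Rightarrow> real \<Rightarrow> q2" where
  "q2_elem g r t = (fst g, snd g, r, t)"

lemma q2_elem_mult: "q2_elem g r t \<otimes>\<^bsub>Q2 (int N) \<rho>'\<^esub> q2_elem h r' t' =
    q2_elem (mp_mult g h) ((r * r') mod int N) (t * t' * inverse (cocycle (int N) \<rho>' (fst g, r) (fst h, r')))"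
  by (simp add: q2_elem_def Q2_def mp_mult_def)

text \<open>If the operators and their product are known together with their signs relative to
  \<rho>', the cocycle is forced; the non-vanishing product makes the value unique, as
  \<open>THE\<close> requires.\<close>

lemma cocycle_sign:
  assumes U: "U1 = s1 *\<^sub>R \<rho>' (M1, r1)" "U2 = s2 *\<^sub>R \<rho>' (M2, r2)"
    and U12: "U1 ** U2 = u *\<^sub>R \<rho>' (M1 ** M2, (r1 * r2) mod int N)"
    and u: "s1 \<in> {1, - 1}" "s2 \<in> {1, - 1}" "u \<in> {1, - 1 :: real}" and nz: "U1 ** U2 \<noteq> 0"
  shows "s1 * s2 * inverse (cocycle (int N) \<rho>' (M1, r1) (M2, r2)) = u"
proof -
  have inv: "x * (x * y) = (y :: real)" "x *\<^sub>R (x *\<^sub>R Z) = (Z :: 'a operator)" if "x \<in> {1, - 1}" for x y Z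
    using that by auto
  have "\<rho>' (M1, r1) = s1 *\<^sub>R U1" "\<rho>' (M2, r2) = s2 *\<^sub>R U2" "\<rho>' (M1 ** M2, (r1 * r2) mod int N) = u *\<^sub>R (U1 ** U2)"
    using u(1) u(2) u(3) unfolding U(1) U(2) by (simp_all only: inv U12[unfolded U])
  moreover have "(s1 *\<^sub>R U1) ** (s2 *\<^sub>R U2) = (s1 * s2) *\<^sub>R (U1 ** U2)"
    using u by (auto simp: matrix_matrix_mult_def vec_eq_iff sum_negf)
  ultimately have e: "\<rho>' (qn_mult (int N) (M1, r1) (M2, r2)) = c *\<^sub>R (\<rho>' (M1, r1) ** \<rho>' (M2, r2)) \<longleftrightarrow>
      u *\<^sub>R (U1 ** U2) = (c * s1 * s2) *\<^sub>R (U1 ** U2)" for c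
    by (simp add: qn_mult_def mult.assoc)
  have "cocycle (int N) \<rho>' (M1, r1) (M2, r2) = u * s1 * s2"
    unfolding cocycle_def e
  proof (rule the_equality)
    show "u * s1 * s2 \<in> {1, - 1} \<and> u *\<^sub>R (U1 ** U2) = (u * s1 * s2 * s1 * s2) *\<^sub>R (U1 ** U2)"
      using u by auto
    fix c :: real assume c: "c \<in> {1, - 1} \<and> u *\<^sub>R (U1 ** U2) = (c * s1 * s2) *\<^sub>R (U1 ** U2)"
    then have "u = c * s1 * s2" using nz by simp
    then show "c = u * s1 * s2" using u by auto
  qed
  then show ?thesis using u by auto
qed

lemma one_mod_N: "1 mod int N = 1"
  using N_gt_1 by simp

lemma rho'_1: "mt_ok (a, b, c, d, e) \<Longrightarrow> \<rho> (mp_of (a, b, c, d, e)) = real_of_int e *\<^sub>R \<rho>' (fst (mp_of (a, b, c, d, e)), 1 mod int N)"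
proof -
  assume ok: "mt_ok (a, b, c, d, e)"
  define M where "M = fst (mp_of (a, b, c, d, e))"
  have ok1: "mt_ok (a, b, c, d, 1)" using ok by simp
  have "M \<in> SL2Z" unfolding M_def by (intro Mp2Z_ints mp_of_Mp2Z ok)
  then have "\<rho>' (M, 1 mod int N) = \<rho> (M, root_factor M)"
    using ext unfolding weil_extension_def Let_def level by blast
  also have "(M, root_factor M) = mp_of (a, b, c, d, 1)"
    by (simp add: M_def mp_of_def root_factor_def auto_factor_def)
  finally have "\<rho>' (M, 1 mod int N) = \<rho> (mp_of (a, b, c, d, 1))" .
  moreover have "e = 1 \<or> e = - 1" using ok by auto
  ultimately show ?thesis using rho_neg[OF ok1] unfolding M_def[symmetric] by auto
qed

lemma rho_nonzero: "invertible U \<Longrightarrow> U \<noteq> (0 :: 'a operator)"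
proof
  assume "invertible U" and 0: "U = 0"
  then obtain B :: "'a operator" where "U ** B = mat 1" unfolding invertible_def by blast
  then have "(U ** B) $ 0 $ 0 = (mat 1 :: 'a operator) $ 0 $ 0" by simp
  then show False by (simp add: 0 matrix_matrix_mult_def mat_def)
qed

text \<open>The sign \<open>t\<close> in \<Delta> is the one for which
  \<open>t *\<^sub>R \<rho>' (fst \<alpha>, 1)\<close> is the true operator of \<alpha>, because
  changing the root negates \<rho>. In this form products with elements of \<Delta> follow from
  products of operators.\<close>

lemma Delta_iff: "\<eta> \<in> Delta (int N) \<longleftrightarrow>
    (\<exists>\<alpha>\<in>Mp2Z. \<exists>t\<in>{1, - 1}. \<eta> = q2_elem \<alpha> 1 t \<and> \<rho> \<alpha> = t *\<^sub>R \<rho>' (fst \<alpha>, 1))"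
proof
  assume "\<eta> \<in> Delta (int N)"
  then obtain M t where M: "M \<in> SL2Z" "t \<in> {1, - 1}" "\<eta> = (M, restrict (\<lambda>z. of_real t * root_factor M z) uhp, 1, t)"
    unfolding Delta_def using one_mod_N by auto
  obtain e :: int where e: "e \<in> {1, - 1}" "t = real_of_int e" using M(2) by (metis insertCI insertE of_int_1 of_int_minus singletonD)
  define h where "h = (M, root_factor M)"
  have "M $ 1 $ 1 \<in> \<int>" "M $ 1 $ 2 \<in> \<int>" "M $ 2 $ 1 \<in> \<int>" "M $ 2 $ 2 \<in> \<int>" using M(1) by (auto simp: SL2Z_def)
  then obtain a b c d where abcd: "M $ 1 $ 1 = of_int a" "M $ 1 $ 2 = of_int b" "M $ 2 $ 1 = of_int c" "M $ 2 $ 2 = of_int d"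
    by (elim Ints_cases) blast
  have "det M = 1" using M(1) by (simp add: SL2Z_def)
  then have "real_of_int (a * d - b * c) = 1" by (simp add: det_2 abcd)
  then have ok: "mt_ok (a, b, c, d, e)" using e(1) by (simp only: of_int_eq_1_iff mt_ok.simps)
  have Mm: "M = mat2 (of_int a) (of_int b) (of_int c) (of_int d)" using mat2_eta[of M] by (simp add: abcd)
  have "\<eta> = q2_elem (mp_of (a, b, c, d, e)) 1 t"
    unfolding M(3) q2_elem_def by (auto simp: Mm mp_of_def root_factor_def auto_factor_def e intro!: restrict_ext)
  moreover have "\<rho> (mp_of (a, b, c, d, e)) = t *\<^sub>R \<rho>' (fst (mp_of (a, b, c, d, e)), 1)"
    using rho'_1[OF ok] e one_mod_N by simp
  ultimately show "\<exists>\<alpha>\<in>Mp2Z. \<exists>t\<in>{1, - 1}. \<eta> = q2_elem \<alpha> 1 t \<and> \<rho> \<alpha> = t *\<^sub>R \<rho>' (fst \<alpha>, 1)"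
    using mp_of_Mp2Z[OF ok] M(2) by blast
next
  assume "\<exists>\<alpha>\<in>Mp2Z. \<exists>t\<in>{1, - 1}. \<eta> = q2_elem \<alpha> 1 t \<and> \<rho> \<alpha> = t *\<^sub>R \<rho>' (fst \<alpha>, 1)"
  then obtain \<alpha> t where a: "\<alpha> \<in> Mp2Z" "t \<in> {1, - 1}" "\<eta> = q2_elem \<alpha> 1 t" "\<rho> \<alpha> = t *\<^sub>R \<rho>' (fst \<alpha>, 1)" by blast
  obtain a b c d e where ok: "mt_ok (a, b, c, d, e)" "\<alpha> = mp_of (a, b, c, d, e)" using a(1) by (rule Mp2Z_cases)
  have "\<rho> \<alpha> = real_of_int e *\<^sub>R \<rho>' (fst \<alpha>, 1)" using rho'_1[OF ok(1)] ok(2) one_mod_N by simp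
  then have "t *\<^sub>R \<rho>' (fst \<alpha>, 1) = real_of_int e *\<^sub>R \<rho>' (fst \<alpha>, 1)" using a(4) by simp
  moreover have "\<rho>' (fst \<alpha>, 1) \<noteq> 0" using a(4) rho_nonzero[OF rho_invertible[OF a(1)]] by auto
  ultimately have t: "t = real_of_int e" by simp
  have "snd \<alpha> = restrict (\<lambda>z. of_real t * root_factor (fst \<alpha>) z) uhp"
    unfolding ok(2) t by (auto simp: mp_of_def root_factor_def auto_factor_def intro!: restrict_ext)
  then show "\<eta> \<in> Delta (int N)" unfolding a(3) q2_elem_def Delta_def using a(2) Mp2Z_ints(3)[OF a(1)] one_mod_N by simp
qed

text \<open>Records that the element of \<Q>_2(N) over \<open>g\<close> with sign \<open>t\<close>
  acts by \<open>U\<close>; signs are carried along through operators and not through cocycle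
  values.\<close>

definition lifts :: "mp \<Rightarrow> real \<Rightarrow> 'a operator \<Rightarrow> bool" where
  "lifts g t U \<longleftrightarrow> coset_op g U \<and> t \<in> {1, - 1} \<and> U = t *\<^sub>R \<rho>' (fst g, pN)"

lemma lifts_exists: "coset_op g U \<Longrightarrow> \<exists>t. lifts g t U"
  unfolding lifts_def using coset_op_sign by blast

lemma mult_left:
  assumes a: "\<alpha> \<in> Mp2Z" "t \<in> {1, - 1}" "\<rho> \<alpha> = t *\<^sub>R \<rho>' (fst \<alpha>, 1)" and g: "lifts g u U"
  shows "\<exists>u'. q2_elem \<alpha> 1 t \<otimes>\<^bsub>Q2 (int N) \<rho>'\<^esub> q2_elem g pN u = q2_elem (mp_mult \<alpha> g) pN u' \<and> lifts (mp_mult \<alpha> g) u' (\<rho> \<alpha> ** U)"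
proof -
  have X: "coset_op (mp_mult \<alpha> g) (\<rho> \<alpha> ** U)" using coset_op_left a g unfolding lifts_def by blast
  then obtain u' where u': "lifts (mp_mult \<alpha> g) u' (\<rho> \<alpha> ** U)" using lifts_exists by blast
  have "t * u * inverse (cocycle (int N) \<rho>' (fst \<alpha>, 1) (fst g, pN)) = u'"
    using a g u' rho_nonzero[OF coset_op_invertible[OF X]]
    by (intro cocycle_sign[of "\<rho> \<alpha>" t _ _ U u _ _ u']) (auto simp: lifts_def)
  then show ?thesis using u' by (auto simp: q2_elem_mult)
qed

lemma mult_right:
  assumes a: "\<alpha> \<in> Mp2Z" "t \<in> {1, - 1}" "\<rho> \<alpha> = t *\<^sub>R \<rho>' (fst \<alpha>, 1)" and g: "lifts g u U"
  shows "\<exists>u'. q2_elem g pN u \<otimes>\<^bsub>Q2 (int N) \<rho>'\<^esub> q2_elem \<alpha> 1 t = q2_elem (mp_mult g \<alpha>) pN u' \<and> lifts (mp_mult g \<alpha>) u' (U ** \<rho> \<alpha>)"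
proof -
  have X: "coset_op (mp_mult g \<alpha>) (U ** \<rho> \<alpha>)" using coset_op_right a g unfolding lifts_def by blast
  then obtain u' where u': "lifts (mp_mult g \<alpha>) u' (U ** \<rho> \<alpha>)" using lifts_exists by blast
  have "u * t * inverse (cocycle (int N) \<rho>' (fst g, pN) (fst \<alpha>, 1)) = u'"
    using a g u' rho_nonzero[OF coset_op_invertible[OF X]]
    by (intro cocycle_sign[of U u _ _ "\<rho> \<alpha>" t _ _ u']) (auto simp: lifts_def)
  then show ?thesis using u' by (auto simp: q2_elem_mult)
qed

text \<open>Here the uniqueness of the operator pays off: if both signs occurred over the same
  \<open>g\<close>, their contributions to the Hecke operator would be negatives of each
  other.\<close>

lemma lifts_unique: "lifts g u U \<Longrightarrow> lifts g u' U' \<Longrightarrow> u = u' \<and> U = U'"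
proof -
  assume 1: "lifts g u U" and 2: "lifts g u' U'"
  have U: "U = U'" using coset_op_unique 1 2 unfolding lifts_def by blast
  have "u *\<^sub>R \<rho>' (fst g, pN) = u' *\<^sub>R \<rho>' (fst g, pN)" using 1 2 U unfolding lifts_def by metis
  moreover have "\<rho>' (fst g, pN) \<noteq> 0" using 1 rho_nonzero[OF coset_op_invertible, of g U] unfolding lifts_def by auto
  ultimately show ?thesis using U by simp
qed

lemma rho_sign_exists: "\<alpha> \<in> Mp2Z \<Longrightarrow> \<exists>t\<in>{1, - 1 :: real}. \<rho> \<alpha> = t *\<^sub>R \<rho>' (fst \<alpha>, 1)"
proof -
  assume "\<alpha> \<in> Mp2Z"
  then obtain a b c d e where ok: "mt_ok (a, b, c, d, e)" "\<alpha> = mp_of (a, b, c, d, e)" by (rule Mp2Z_cases)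
  then show ?thesis using rho'_1[OF ok(1)] one_mod_N by (intro bexI[of _ "real_of_int e"]) auto
qed

lemma coset_eq:
  assumes g: "lifts g u U"
  shows "Delta (int N) #>\<^bsub>Q2 (int N) \<rho>'\<^esub> q2_elem g pN u =
     {q2_elem (mp_mult \<alpha> g) pN u' | \<alpha> u'. \<alpha> \<in> Mp2Z \<and> lifts (mp_mult \<alpha> g) u' (\<rho> \<alpha> ** U)}" (is "?L = ?R")
proof (intro equalityI subsetI)
  fix \<eta> assume "\<eta> \<in> ?L"
  then obtain \<delta> where d: "\<delta> \<in> Delta (int N)" "\<eta> = \<delta> \<otimes>\<^bsub>Q2 (int N) \<rho>'\<^esub> q2_elem g pN u" unfolding r_coset_def by blast
  then obtain \<alpha> t where a: "\<alpha> \<in> Mp2Z" "t \<in> {1, - 1}" "\<delta> = q2_elem \<alpha> 1 t" "\<rho> \<alpha> = t *\<^sub>R \<rho>' (fst \<alpha>, 1)"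
    unfolding Delta_iff by blast
  then show "\<eta> \<in> ?R" using mult_left[OF a(1,2,4) g] d(2) by blast
next
  fix \<eta> assume "\<eta> \<in> ?R"
  then obtain \<alpha> u' where a: "\<eta> = q2_elem (mp_mult \<alpha> g) pN u'" "\<alpha> \<in> Mp2Z" "lifts (mp_mult \<alpha> g) u' (\<rho> \<alpha> ** U)" by blast
  obtain t where t: "t \<in> {1, - 1}" "\<rho> \<alpha> = t *\<^sub>R \<rho>' (fst \<alpha>, 1)" using rho_sign_exists[OF a(2)] by blast
  obtain u'' where u: "q2_elem \<alpha> 1 t \<otimes>\<^bsub>Q2 (int N) \<rho>'\<^esub> q2_elem g pN u = q2_elem (mp_mult \<alpha> g) pN u''" "lifts (mp_mult \<alpha> g) u'' (\<rho> \<alpha> ** U)"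
    using mult_left[OF a(2) t g] by blast
  have "u'' = u'" using lifts_unique[OF u(2) a(3)] by simp
  moreover have "q2_elem \<alpha> 1 t \<in> Delta (int N)" unfolding Delta_iff using a(2) t by blast
  ultimately show "\<eta> \<in> ?L" unfolding r_coset_def using u(1) a(1) by force
qed

lemma double_coset_eq:
  "(Delta (int N) #>\<^bsub>Q2 (int N) \<rho>'\<^esub> q2_elem diag_mp pN 1) <#>\<^bsub>Q2 (int N) \<rho>'\<^esub> Delta (int N) = {q2_elem g pN u | g u U. lifts g u U}"
  (is "?L = ?R")
proof -
  have D: "lifts diag_mp 1 diag_op" using coset_op_diag_mp by (simp add: lifts_def diag_op_def)
  show ?thesis
  proof (intro equalityI subsetI)
    fix \<eta> assume "\<eta> \<in> ?L"
    then obtain h k where hk: "h \<in> Delta (int N) #>\<^bsub>Q2 (int N) \<rho>'\<^esub> q2_elem diag_mp pN 1" "k \<in> Delta (int N)" "\<eta> = h \<otimes>\<^bsub>Q2 (int N) \<rho>'\<^esub> k"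
      unfolding set_mult_def by blast
    obtain g u U where g: "h = q2_elem g pN u" "lifts g u U" using hk(1) unfolding coset_eq[OF D] by blast
    obtain \<alpha> t where "\<alpha> \<in> Mp2Z" "t \<in> {1, - 1}" "k = q2_elem \<alpha> 1 t" "\<rho> \<alpha> = t *\<^sub>R \<rho>' (fst \<alpha>, 1)"
      using hk(2) unfolding Delta_iff by blast
    then show "\<eta> \<in> ?R" using mult_right[OF _ _ _ g(2)] hk(3) g(1) by blast
  next
    fix \<eta> assume "\<eta> \<in> ?R"
    then obtain g u U where g: "\<eta> = q2_elem g pN u" "lifts g u U" by blast
    then obtain \<alpha> \<beta> where ab: "\<alpha> \<in> Mp2Z" "\<beta> \<in> Mp2Z" "g = mp_mult (mp_mult \<alpha> diag_mp) \<beta>" "U = \<rho> \<alpha> ** diag_op ** \<rho> \<beta>"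
      unfolding lifts_def coset_op_def by blast
    obtain s1 where s1: "lifts (mp_mult \<alpha> diag_mp) s1 (\<rho> \<alpha> ** diag_op)" using lifts_exists[OF coset_op_left[OF ab(1) coset_op_diag_mp]] by blast
    have h: "q2_elem (mp_mult \<alpha> diag_mp) pN s1 \<in> Delta (int N) #>\<^bsub>Q2 (int N) \<rho>'\<^esub> q2_elem diag_mp pN 1"
      unfolding coset_eq[OF D] using ab s1 by blast
    obtain t where t: "t \<in> {1, - 1}" "\<rho> \<beta> = t *\<^sub>R \<rho>' (fst \<beta>, 1)" using rho_sign_exists[OF ab(2)] by blast
    have k: "q2_elem \<beta> 1 t \<in> Delta (int N)" unfolding Delta_iff using ab(2) t by blast
    obtain u' where u': "q2_elem (mp_mult \<alpha> diag_mp) pN s1 \<otimes>\<^bsub>Q2 (int N) \<rho>'\<^esub> q2_elem \<beta> 1 t = q2_elem g pN u'" "lifts g u' U"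
      using mult_right[OF ab(2) t s1] unfolding ab(3,4) by blast
    have "u' = u" using lifts_unique[OF u'(2) g(2)] by simp
    then show "\<eta> \<in> ?L" unfolding set_mult_def using h k u'(1) g(1) by force
  qed
qed

section \<open>The slash action in terms of the coset operators\<close>

definition slash_op :: "real \<Rightarrow> (complex \<Rightarrow> 'a group_alg) \<Rightarrow> mp \<Rightarrow> 'a operator \<Rightarrow> complex \<Rightarrow> 'a group_alg" where
  "slash_op k f g U z = (of_real (real p powr k) * snd g z powi (- \<lfloor>2 * k\<rfloor>)) *s (matrix_inv U *v f (moebius (fst g) z))"

text \<open>The determinant is \<open>p\<^sup>2\<close>, so its power \<open>k / 2\<close> is
  \<open>p\<close> to the power \<open>k\<close>; the sign \<open>u\<close> is absorbed in
  \<open>U\<close>.\<close>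

lemma slashA_slash_op:
  assumes "lifts g u U"
  shows "slashA k \<rho>' f (q2_elem g pN u) z = slash_op k f g U z"
proof -
  have U: "rhoA \<rho>' (fst g, snd g, pN, u) = U" using assms by (simp add: rhoA_def lifts_def)
  have X: "coset_op g U" using assms unfolding lifts_def by blast
  have dg: "det (fst g) powr (k / 2) = real p powr k"
  proof -
    have "det (fst g) = real p powr 2" using coset_op_matrix(2)[OF X] p_pos by (simp add: powr_numeral)
    then show ?thesis by (simp only: powr_powr) simp
  qed
  have lin: "(\<Sum>x\<in>UNIV. v $ x *s (A *v axis x 1)) = A *v v" for A :: "'a operator" and v :: "'a group_alg"
    by (simp add: vec_eq_iff matrix_vector_mult_def axis_def if_distrib mult.commute cong: if_cong)
  have "slashA k \<rho>' f (q2_elem g pN u) z = (\<Sum>x\<in>UNIV. ((of_real (real p powr k) * snd g z powi (- \<lfloor>2 * k\<rfloor>)) *s f (moebius (fst g) z)) $ x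
      *s (matrix_inv U *v axis x 1))"
    unfolding slashA_def q2_elem_def prod.case slash_def U fst_conv snd_conv dg by simp
  also have "\<dots> = matrix_inv U *v ((of_real (real p powr k) * snd g z powi (- \<lfloor>2 * k\<rfloor>)) *s f (moebius (fst g) z))"
    by (rule lin)
  finally show ?thesis by (simp add: slash_op_def vector_scalar_commute)
qed

lemma matrix_inv_mult:
  assumes "invertible U"
  shows "matrix_inv U *v (U *v v) = (v :: 'a group_alg)"
  using assms by (simp add: matrix_vector_mul_assoc matrix_inv_cancel(1))

text \<open>Modularity of \<open>f\<close> produces the automorphy factor and the operator of
  \<alpha>, and both cancel. Hence the value is constant on a coset.\<close>

lemma slash_op_left:
  assumes f: "f \<in> modular_forms k q \<rho>" and a: "\<alpha> \<in> Mp2Z" and g: "coset_op g U" and z: "z \<in> uhp"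
  shows "slash_op k f (mp_mult \<alpha> g) (\<rho> \<alpha> ** U) z = slash_op k f g U z"
proof -
  let ?w = "moebius (fst g) z" and ?K = "\<lfloor>2 * k\<rfloor>"
  have gR: "g \<in> Mp2R" using coset_op_matrix(3)[OF g] .
  have aR: "\<alpha> \<in> Mp2R" using a by (rule Mp2Z_Mp2R)
  have w: "?w \<in> uhp" using moebius_uhp[OF Mp2R_D(1)[OF gR] z] .
  have mz: "moebius (fst \<alpha> ** fst g) z = moebius (fst \<alpha>) ?w"
    by (rule moebius_mult[OF Mp2R_D(1)[OF aR] Mp2R_D(1)[OF gR] z])
  have fw: "f (moebius (fst \<alpha>) ?w) = snd \<alpha> ?w powi ?K *s (\<rho> \<alpha> *v f ?w)"
  proof -
    have "\<forall>(M, \<phi>)\<in>Mp2Z. \<forall>z\<in>uhp. f (moebius M z) = (\<phi> z) powi \<lfloor>2 * k\<rfloor> *s (\<rho> (M, \<phi>) *v f z)"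
      using f by (simp add: modular_forms_def)
    then show ?thesis using a w by (cases \<alpha>) auto
  qed
  have nz: "snd \<alpha> ?w \<noteq> 0" using Mp2R_D(5)[OF aR w] .
  have inv: "matrix_inv (\<rho> \<alpha> ** U) *v (\<rho> \<alpha> *v f ?w) = matrix_inv U *v f ?w"
  proof -
    have iU: "invertible U" and ia: "invertible (\<rho> \<alpha>)" using coset_op_invertible[OF g] rho_invertible[OF a] by auto
    have "f ?w = U *v (matrix_inv U *v f ?w)"
      using iU by (simp add: matrix_vector_mul_assoc matrix_inv_cancel(2))
    then have "\<rho> \<alpha> *v f ?w = (\<rho> \<alpha> ** U) *v (matrix_inv U *v f ?w)"
      by (metis matrix_vector_mul_assoc)
    then show ?thesis using matrix_inv_mult[OF invertible_mult[OF ia iU]] by simp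
  qed
  have "matrix_inv (\<rho> \<alpha> ** U) *v (snd \<alpha> ?w powi ?K *s (\<rho> \<alpha> *v f ?w)) = snd \<alpha> ?w powi ?K *s (matrix_inv U *v f ?w)"
    using inv by (simp add: vector_scalar_commute)
  moreover have "(snd \<alpha> ?w * snd g z) powi (- ?K) * snd \<alpha> ?w powi ?K = snd g z powi (- ?K)"
    using nz by (simp add: power_int_mult_distrib power_int_minus)
  ultimately show ?thesis
    unfolding slash_op_def mp_mult_nth(1) mp_mult_nth(2)[OF z] mz fw by (simp add: mult.assoc)
qed

end

section \<open>Representatives of the double coset\<close>

text \<open>\<open>h\<close> is the gcd of the first column, the Bezout coefficients complete that
  column to determinant 1, and division by \<open>k\<close> reduces the remaining entry. As
  \<open>h\<close> divides \<open>p\<^sup>2\<close>, three shapes are possible.\<close>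

lemma hermite_normal_form:
  fixes A B C D :: int and p :: nat
  assumes det: "A * D - B * C = (int p)\<^sup>2" and p: "prime p"
    and prim: "\<not> (int p dvd A \<and> int p dvd B \<and> int p dvd C \<and> int p dvd D)"
  obtains a b c d h j k where "a * d - b * c = 1" "A = a * h" "B = a * j + b * k" "C = c * h" "D = c * j + d * k"
    "(h, j, k) \<in> insert ((int p)\<^sup>2, 0, 1) ((\<lambda>j. (int p, j, int p)) ` {1..<int p} \<union> (\<lambda>j. (1, j, (int p)\<^sup>2)) ` {0..<(int p)\<^sup>2})"
proof -
  have p0: "0 < int p" using prime_gt_0_nat[OF p] by simp
  define h where "h = gcd A C"
  have "h \<noteq> 0"
  proof
    assume "h = 0"
    then have "A = 0" "C = 0" by (simp_all add: h_def)
    then show False using det p0 by simp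
  qed
  then have h0: "0 < h" by (simp add: h_def)
  obtain A' C' where AC: "A = h * A'" "C = h * C'" unfolding h_def by (meson dvdE gcd_dvd1 gcd_dvd2)
  obtain x y where xy: "x * A + y * C = h" using bezout_int[of A C] unfolding h_def by auto
  then have "h * (x * A' + y * C') = h * 1" by (simp add: AC algebra_simps)
  then have xy1: "x * A' + y * C' = 1" using h0 by simp
  define k where "k = A' * D - C' * B"
  have hk: "h * k = (int p)\<^sup>2" using det by (simp add: k_def AC algebra_simps)
  have k0: "0 < k" using hk h0 p0 by (metis zero_less_mult_pos zero_less_power)
  define m where "m = x * B + y * D"
  define j t where "j = m mod k" and "t = m div k"
  have mj: "m = j + t * k" by (simp add: j_def t_def)
  have jk: "0 \<le> j" "j < k" using k0 by (simp_all add: j_def)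
  have B: "B = A' * j + (A' * t - y) * k"
  proof -
    have "A' * j + (A' * t - y) * k = A' * m - y * k" by (simp add: mj algebra_simps)
    also have "\<dots> = B * (x * A' + y * C')" by (simp add: m_def k_def algebra_simps)
    finally show ?thesis using xy1 by simp
  qed
  have D: "D = C' * j + (C' * t + x) * k"
  proof -
    have "C' * j + (C' * t + x) * k = C' * m + x * k" by (simp add: mj algebra_simps)
    also have "\<dots> = D * (x * A' + y * C')" by (simp add: m_def k_def algebra_simps)
    finally show ?thesis using xy1 by simp
  qed
  have u: "A' * (C' * t + x) - (A' * t - y) * C' = 1" using xy1 by (simp add: algebra_simps)
  have "nat h dvd p\<^sup>2"
  proof -
    have "h dvd (int p)\<^sup>2" unfolding hk[symmetric] by simp
    then show ?thesis using h0 by (simp add: nat_dvd_iff)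
  qed
  then obtain i where i: "i \<le> 2" "nat h = p ^ i" using divides_primepow_nat[OF p] by blast
  have hi: "h = int p ^ i" using i(2) h0 by (metis int_nat_eq less_imp_le of_nat_power)
  have "i = 0 \<or> i = 1 \<or> i = 2" using i(1) by auto
  then have "(h, j, k) \<in> insert ((int p)\<^sup>2, 0, 1) ((\<lambda>j. (int p, j, int p)) ` {1..<int p} \<union> (\<lambda>j. (1, j, (int p)\<^sup>2)) ` {0..<(int p)\<^sup>2})"
  proof (elim disjE)
    assume "i = 0"
    then show ?thesis using hi hk jk by auto
  next
    assume i: "i = 1"
    then have h: "h = int p" using hi by simp
    then have k: "k = int p" using hk p0 by (simp add: power2_eq_square)
    \<comment> \<open>With \<open>h = k = p\<close> and \<open>j = 0\<close> the matrix would be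
      divisible by \<open>p\<close>; this is why the middle family starts at 1.\<close>
    have "j \<noteq> 0"
    proof
      assume "j = 0"
      then have "int p dvd B" "int p dvd D" using B D k by simp_all
      then show False using prim AC h by simp
    qed
    then show ?thesis using h k jk by auto
  next
    assume i: "i = 2"
    then have h: "h = (int p)\<^sup>2" using hi by simp
    then have "k = 1" using hk p0 by simp
    then show ?thesis using h jk by auto
  qed
  then show thesis by (intro that[OF u _ B _ D]) (simp_all add: AC mult.commute)
qed

text \<open>\<open>sqrt t / csqrt w\<close> has positive real part and is therefore the principal
  root of \<open>t / w\<close>. This fixes the constant roots of the representatives without a sign
  ambiguity.\<close>

lemma csqrt_quotient:
  assumes w: "w \<in> uhp" and t: "0 < t"
  shows "csqrt (of_real t / w) * csqrt w = of_real (sqrt t)"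
proof -
  have w0: "w \<noteq> 0" using w by (auto simp: uhp_def)
  have sq: "(csqrt (of_real t / w) * csqrt w)\<^sup>2 = (of_real (sqrt t))\<^sup>2"
    using w0 t by (simp add: power_mult_distrib flip: of_real_power)
  have cw: "0 < Re (csqrt w)" "0 < Im (csqrt w)" "(csqrt w)\<^sup>2 = w"
  proof -
    have i: "0 < Im ((csqrt w)\<^sup>2)" using w by (simp add: uhp_def)
    have "0 \<le> Re (csqrt w)" using csqrt_principal[of w] by auto
    moreover have "2 * Re (csqrt w) * Im (csqrt w) > 0" using i unfolding power2_eq_square by simp
    ultimately show "0 < Re (csqrt w)" "0 < Im (csqrt w)" by (auto simp: zero_less_mult_iff)
    show "(csqrt w)\<^sup>2 = w" by simp
  qed
  have "csqrt (of_real t / w) = of_real (sqrt t) / csqrt w"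
  proof (rule csqrt_unique)
    show "(of_real (sqrt t) / csqrt w)\<^sup>2 = of_real t / w"
      using t by (simp add: power_divide flip: of_real_power)
    define v where "v = csqrt w"
    have v: "0 < Re v" using cw by (simp add: v_def)
    have "Re (of_real (sqrt t) / v) = sqrt t * Re v / ((Re v)\<^sup>2 + (Im v)\<^sup>2)" by (simp add: Re_divide)
    also have "\<dots> > 0" using v t by (intro divide_pos_pos mult_pos_pos) (simp_all add: add_pos_nonneg)
    finally have "0 < Re (of_real (sqrt t) / csqrt w)" unfolding v_def .
    then show "0 < Re (of_real (sqrt t) / csqrt w) \<or> Re (of_real (sqrt t) / csqrt w) = 0 \<and> 0 \<le> Im (of_real (sqrt t) / csqrt w)"
      by simp
  qed
  then show ?thesis using w0 by simp
qed

context hecke_setup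
begin

definition rep_mp :: "int \<times> int \<times> int \<Rightarrow> mp" where
  "rep_mp = (\<lambda>(h, j, k). (mat2 (of_int h) (of_int j) 0 (of_int k), restrict (\<lambda>z. of_real (sqrt (of_int k))) uhp))"

definition rep_op :: "int \<times> int \<times> int \<Rightarrow> 'a operator" where
  "rep_op = (\<lambda>(h, j, k). if k = 1 then diag_op
     else if k = int p then (\<chi> y x. if y = x then A.g 1 / A.g (int p) * of_int (Legendre j (int p)) * er (of_int (pinv * j) * q x) else 0)
     else (\<chi> y x. if y = zmult (int p) x then er (of_int j * q x) else 0))"

definition reps :: "(int \<times> int \<times> int) set" where
  "reps = insert ((int p)\<^sup>2, 0, 1) ((\<lambda>j. (int p, j, int p)) ` {1..<int p} \<union> (\<lambda>j. (1, j, (int p)\<^sup>2)) ` {0..<(int p)\<^sup>2})"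

lemma p_ne: "int p \<noteq> 1" "(int p)\<^sup>2 \<noteq> 1" "(int p)\<^sup>2 \<noteq> int p"
  using p_gt_2 by (auto simp: power2_eq_square zmult_eq_1_iff)

lemma rep_mp_Mp2R: "0 < h \<Longrightarrow> 0 < k \<Longrightarrow> rep_mp (h, j, k) \<in> Mp2R"
proof -
  assume hk: "0 < h" "0 < k"
  have "restrict (\<lambda>z. of_real (sqrt (of_int k)) :: complex) uhp holomorphic_on uhp"
    by (rule holomorphic_transform[of "\<lambda>_. of_real (sqrt (of_int k))"]) auto
  moreover have "(of_real (sqrt (real_of_int k)) :: complex)\<^sup>2 = of_int k"
    using hk by (simp flip: of_real_power)
  ultimately show ?thesis using hk by (auto simp: rep_mp_def Mp2R_def auto_factor_def)
qed

lemma sum_er_shift: "(\<Sum>w\<in>UNIV. er (bil q w x) * er (- bil q w y)) = (if x = y then of_nat CARD('a) else 0)"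
proof -
  have "er (bil q w x) * er (- bil q w y) = er (bil q (x - y) w)" for w
  proof -
    have "er (bil q w ((x - y) + y)) = er (bil q w (x - y)) * er (bil q w y)" by (rule A.er_bil_add_right) simp_all
    then show ?thesis by (simp add: er_minus A.bil_commute[of w])
  qed
  then show ?thesis using A.character_sum[of "x - y"] by simp
qed

lemma cnj_g_p: "cnj (A.g (int p)) = of_nat CARD('a) / A.g (int p)"
  using A.g_mult_cnj[OF pN] A.g_nonzero[OF pN] by (simp add: field_simps)

text \<open>The matrix is (0, 1; -1, 0) D (0, -1; 1, j). Both outer lower left entries are
  \<plusminus>1, so \<open>rho_formula\<close> applies and the product collapses by
  orthogonality.\<close>

lemma coset_op_rep_2:
  assumes "0 \<le> j"
  shows "coset_op (rep_mp (1, j, (int p)\<^sup>2)) (rep_op (1, j, (int p)\<^sup>2))"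
proof -
  define \<alpha> \<beta> where "\<alpha> = mp_of (0, 1, - 1, 0, 1)" and "\<beta> = mp_of (0, - 1, 1, j, 1)"
  have ok: "mt_ok (0, 1, - 1, 0, 1)" "mt_ok (0, - 1, 1, j, 1)" by simp_all
  have Z: "\<alpha> \<in> Mp2Z" "\<beta> \<in> Mp2Z" unfolding \<alpha>_def \<beta>_def by (intro mp_of_Mp2Z ok)+
  have "mp_mult (mp_mult \<alpha> diag_mp) \<beta> = rep_mp (1, j, (int p)\<^sup>2)"
  proof (rule mp_eqI)
    show "mp_mult (mp_mult \<alpha> diag_mp) \<beta> \<in> Mp2R" by (intro mp_mult_Mp2R Mp2Z_Mp2R Z diag_mp_Mp2R)
    show "rep_mp (1, j, (int p)\<^sup>2) \<in> Mp2R" using p_pos by (intro rep_mp_Mp2R) auto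
    show "fst (mp_mult (mp_mult \<alpha> diag_mp) \<beta>) = fst (rep_mp (1, j, (int p)\<^sup>2))"
      by (simp add: \<alpha>_def \<beta>_def rep_mp_def mat2_mult)
    fix z assume z: "z \<in> uhp"
    have w: "z + of_int j \<in> uhp" using z by (simp add: uhp_def)
    have m: "moebius (fst \<beta>) z \<in> uhp" using z Z by (intro moebius_uhp Mp2R_D(1) Mp2Z_Mp2R)
    have mz: "moebius (fst \<beta>) z = - 1 / (z + of_int j)" by (simp add: \<beta>_def moebius_def auto_factor_def)
    have "snd (mp_mult (mp_mult \<alpha> diag_mp) \<beta>) z = csqrt (- ((of_nat p)\<^sup>2 * moebius (fst \<beta>) z)) * csqrt (z + of_int j)"
      using z m diag_mp_uhp[OF m] by (simp add: \<alpha>_def moebius_diag_mp) (simp add: \<beta>_def)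
    also have "- ((of_nat p)\<^sup>2 * moebius (fst \<beta>) z) = of_real ((real p)\<^sup>2) / (z + of_int j)"
      by (simp add: mz)
    also have "csqrt \<dots> * csqrt (z + of_int j) = of_real (sqrt ((real p)\<^sup>2))"
      using p_pos by (intro csqrt_quotient[OF w]) simp
    finally show "snd (mp_mult (mp_mult \<alpha> diag_mp) \<beta>) z = snd (rep_mp (1, j, (int p)\<^sup>2)) z"
      using z by (simp add: rep_mp_def)
  qed
  moreover have "\<rho> \<alpha> ** diag_op ** \<rho> \<beta> = rep_op (1, j, (int p)\<^sup>2)"
  proof (intro vec_eq_iff[THEN iffD2] allI)
    fix y x :: 'a
    have gg: "cnj (A.g (- 1)) = A.g 1"
      using A.g_minus[of 1] by simp
    have a: "\<rho> \<alpha> $ y $ w = A.g 1 / of_nat CARD('a) * er (bil q w y)" for w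
      unfolding \<alpha>_def using rho_formula[OF ok(1), of "- 1" y w] gg by (simp add: A.gker_def kronecker_1)
    have b: "\<rho> \<beta> $ w $ x = cnj (A.g 1) / of_nat CARD('a) * (er (of_int j * q x) * er (- bil q x w))" for w
      unfolding \<beta>_def using rho_formula[OF ok(2), of 1 w x] by (simp add: A.gker_def kronecker_1 er_diff er_minus divide_inverse)
    have "(\<rho> \<alpha> ** diag_op ** \<rho> \<beta>) $ y $ x = (\<Sum>w\<in>UNIV. \<rho> \<alpha> $ y $ zmult pinv w * \<rho> \<beta> $ w $ x)"
      by (simp only: matrix_matrix_mult_def[of "\<rho> \<alpha> ** diag_op"] vec_lambda_beta diag_op_mult_right)
    also have "\<dots> = A.g 1 * cnj (A.g 1) / (of_nat CARD('a))\<^sup>2 * er (of_int j * q x)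
        * (\<Sum>w\<in>UNIV. er (bil q w (zmult pinv y)) * er (- bil q w x))"
      unfolding sum_distrib_left
    proof (rule sum.cong[OF refl])
      fix w
      have "er (bil q (zmult pinv w) y) = er (bil q w (zmult pinv y))"
        using A.er_bil_zmult_left[of w y pinv] A.er_bil_zmult_left[of y w pinv] by (simp add: A.bil_commute)
      then show "\<rho> \<alpha> $ y $ zmult pinv w * \<rho> \<beta> $ w $ x = A.g 1 * cnj (A.g 1) / (of_nat CARD('a))\<^sup>2 * er (of_int j * q x)
        * (er (bil q w (zmult pinv y)) * er (- bil q w x))"
        by (simp add: a b A.bil_commute[of x] power2_eq_square)
    qed
    also have "\<dots> = (if y = zmult (int p) x then er (of_int j * q x) else 0)"
    proof -
      have "zmult pinv y = x \<longleftrightarrow> y = zmult (int p) x" by auto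
      then show ?thesis using A.g_mult_cnj[of 1] unfolding sum_er_shift by (simp add: power2_eq_square)
    qed
    finally show "(\<rho> \<alpha> ** diag_op ** \<rho> \<beta>) $ y $ x = rep_op (1, j, (int p)\<^sup>2) $ y $ x"
      using p_ne by (simp add: rep_op_def)
  qed
  ultimately show ?thesis using coset_op_I[OF Z] by simp
qed

text \<open>With \<open>e * j - f * int p = 1\<close> the matrix is (0, 1; -1, p e) D (e, f; p, j).
  The lower left entries -1 and \<open>p\<close> are prime to \<open>N\<close>; the second one
  brings in \<open>1 / g p\<close> and the symbol (e / p), which equals (j / p).\<close>

lemma coset_op_rep_1:
  assumes "1 \<le> j" "j < int p"
  shows "coset_op (rep_mp (int p, j, int p)) (rep_op (int p, j, int p))"
proof -
  have "\<not> int p dvd j" using assms by (simp add: zdvd_not_zless)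
  then have "coprime (int p) j" using p by (simp add: prime_imp_coprime)
  then obtain e0 f0 where "e0 * j + f0 * int p = 1"
    using bezout_int[of j "int p"] by (metis coprime_commute coprime_imp_gcd_eq_1)
  then obtain e f where ef: "e * j - f * int p = 1" by (metis diff_minus_eq_add mult_minus_left)
  define \<alpha> \<beta> where "\<alpha> = mp_of (0, 1, - 1, int p * e, 1)" and "\<beta> = mp_of (e, f, int p, j, 1)"
  have ok: "mt_ok (0, 1, - 1, int p * e, 1)" "mt_ok (e, f, int p, j, 1)" using ef by simp_all
  have efr: "real_of_int e * real_of_int j - real_of_int f * real p = 1"
    using arg_cong[OF ef, of real_of_int] by simp
  have efc: "of_int e * of_int j - of_int f * of_nat p = (1 :: complex)"
    using arg_cong[OF ef, of "of_int :: int \<Rightarrow> complex"] by simp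
  have Z: "\<alpha> \<in> Mp2Z" "\<beta> \<in> Mp2Z" unfolding \<alpha>_def \<beta>_def by (intro mp_of_Mp2Z ok)+
  have "mp_mult (mp_mult \<alpha> diag_mp) \<beta> = rep_mp (int p, j, int p)"
  proof (rule mp_eqI)
    show "mp_mult (mp_mult \<alpha> diag_mp) \<beta> \<in> Mp2R" by (intro mp_mult_Mp2R Mp2Z_Mp2R Z diag_mp_Mp2R)
    show "rep_mp (int p, j, int p) \<in> Mp2R" using p_pos by (intro rep_mp_Mp2R) auto
    have m22: "real p * real_of_int e * real_of_int j - (real p)\<^sup>2 * real_of_int f = real p"
      using arg_cong[OF efr, of "\<lambda>x. real p * x"] by (simp add: algebra_simps power2_eq_square)
    show "fst (mp_mult (mp_mult \<alpha> diag_mp) \<beta>) = fst (rep_mp (int p, j, int p))"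
      using m22 by (simp add: \<alpha>_def \<beta>_def rep_mp_def mat2_mult power2_eq_square)
    fix z assume z: "z \<in> uhp"
    have w: "of_nat p * z + of_int j \<in> uhp" using z p_pos by (simp add: uhp_def)
    have w0: "of_nat p * z + of_int j \<noteq> 0"
    proof
      assume "of_nat p * z + of_int j = 0"
      then have "Im (of_nat p * z + of_int j) = 0" by (simp only: zero_complex.sel)
      then show False using w by (auto simp: uhp_def)
    qed
    have m: "moebius (fst \<beta>) z \<in> uhp" using z Z by (intro moebius_uhp Mp2R_D(1) Mp2Z_Mp2R)
    have mz: "moebius (fst \<beta>) z = (of_int e * z + of_int f) / (of_nat p * z + of_int j)"
      by (simp add: \<beta>_def moebius_def auto_factor_def)
    have "snd (mp_mult (mp_mult \<alpha> diag_mp) \<beta>) z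
        = csqrt (of_nat p * of_int e - (of_nat p)\<^sup>2 * moebius (fst \<beta>) z) * csqrt (of_nat p * z + of_int j)"
      using z m diag_mp_uhp[OF m] by (simp add: \<alpha>_def moebius_diag_mp) (simp add: \<beta>_def)
    also have "of_nat p * of_int e - (of_nat p)\<^sup>2 * moebius (fst \<beta>) z
        = of_nat p * (of_int e * of_int j - of_int f * of_nat p) / (of_nat p * z + of_int j)"
      unfolding mz using w0 by (simp add: field_simps power2_eq_square)
    also have "\<dots> = of_real (real p) / (of_nat p * z + of_int j)" unfolding efc by simp
    also have "csqrt \<dots> * csqrt (of_nat p * z + of_int j) = of_real (sqrt (real p))"
      using p_pos by (intro csqrt_quotient[OF w]) simp
    finally show "snd (mp_mult (mp_mult \<alpha> diag_mp) \<beta>) z = snd (rep_mp (int p, j, int p)) z"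
      using z by (simp add: rep_mp_def)
  qed
  moreover have "\<rho> \<alpha> ** diag_op ** \<rho> \<beta> = rep_op (int p, j, int p)"
  proof (intro vec_eq_iff[THEN iffD2] allI)
    fix y x :: 'a
    have gg: "cnj (A.g (- 1)) = A.g 1"
      using A.g_minus[of 1] by simp
    have a: "\<rho> \<alpha> $ y $ w = A.g 1 / of_nat CARD('a) * (er (bil q w y) * er (- of_int (int p * e) * q w))" for w
      unfolding \<alpha>_def using rho_formula[OF ok(1), of "- 1" y w] gg by (simp add: A.gker_def kronecker_1 er_add[symmetric])
    have kr: "kronecker e p = Legendre j (int p)"
    proof -
      have "Legendre (e * j) (int p) = Legendre 1 (int p)"
        using ef by (intro Legendre_cong) (simp add: cong_iff_dvd_diff, metis dvd_triv_right add_diff_cancel_left' diff_add_cancel)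
      then have 1: "Legendre e (int p) * Legendre j (int p) = 1"
        using p p_gt_2 by (simp add: Legendre_mult Legendre_1)
      then have "Legendre e (int p) = Legendre j (int p)"
        using Legendre_values[of e "int p"] Legendre_values[of j "int p"] by auto
      then show ?thesis using kronecker_odd_prime[OF p, of e] p_gt_2 by simp
    qed
    have b: "\<rho> \<beta> $ w $ x = of_int (Legendre j (int p)) / A.g (int p)
        * (er (of_int (pinv * e) * q w) * er (- (of_int pinv * bil q x w)) * er (of_int (pinv * j) * q x))" for w
      unfolding \<beta>_def rho_formula[OF ok(2) pN p_pinv(1)] using kr by (simp add: A.gker_def er_add[symmetric] cnj_g_p)
    have "(\<rho> \<alpha> ** diag_op ** \<rho> \<beta>) $ y $ x = (\<Sum>w\<in>UNIV. \<rho> \<alpha> $ y $ zmult pinv w * \<rho> \<beta> $ w $ x)"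
      by (simp only: matrix_matrix_mult_def[of "\<rho> \<alpha> ** diag_op"] vec_lambda_beta diag_op_mult_right)
    also have "\<dots> = A.g 1 / A.g (int p) / of_nat CARD('a) * of_int (Legendre j (int p)) * er (of_int (pinv * j) * q x)
        * (\<Sum>w\<in>UNIV. er (bil q w (zmult pinv y)) * er (- bil q w (zmult pinv x)))"
      unfolding sum_distrib_left
    proof (rule sum.cong[OF refl])
      fix w
      have 1: "er (bil q (zmult pinv w) y) = er (bil q w (zmult pinv y))"
        using A.er_bil_zmult_left[of w y pinv] A.er_bil_zmult_left[of y w pinv] by (simp add: A.bil_commute)
      have 2: "er (- (of_int pinv * bil q x w)) = er (- bil q w (zmult pinv x))"
        using A.er_bil_zmult_left[of x w pinv] by (simp add: A.bil_commute er_minus)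
      \<comment> \<open>The quadratic terms in \<open>w\<close> of the two kernels cancel, so that a
        character sum remains.\<close>
      have 3: "er (- of_int (int p * e) * q (zmult pinv w)) * er (of_int (pinv * e) * q w) = 1"
      proof -
        have "of_int (- (int p * e)) * (q (zmult pinv w) - of_int (pinv\<^sup>2) * q w) \<in> \<int>"
          by (intro Ints_mult[OF Ints_of_int] A.q_zmult) simp
        then have "er (of_int (- (int p * e)) * q (zmult pinv w)) = er (of_int (- (int p * e) * pinv\<^sup>2) * q w)"
          by (intro er_cong) (simp add: right_diff_distrib mult.assoc)
        also have "\<dots> = er (of_int (- (pinv * e)) * q w)"
        proof (rule A.er_q_cong)
          have "[(int p * pinv) * - (pinv * e) = 1 * - (pinv * e)] (mod int N)" by (intro cong_scalar_right p_pinv)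
          then show "[- (int p * e) * pinv\<^sup>2 = - (pinv * e)] (mod int N)" by (simp add: power2_eq_square mult_ac)
        qed simp
        finally show ?thesis by (simp flip: er_add)
      qed
      have "\<rho> \<alpha> $ y $ zmult pinv w * \<rho> \<beta> $ w $ x = A.g 1 / A.g (int p) / of_nat CARD('a) * of_int (Legendre j (int p)) * er (of_int (pinv * j) * q x)
        * (er (bil q w (zmult pinv y)) * er (- bil q w (zmult pinv x)))
        * (er (- of_int (int p * e) * q (zmult pinv w)) * er (of_int (pinv * e) * q w))"
        unfolding a b 1 2 by (simp only: mult_ac times_divide_eq_left times_divide_eq_right divide_divide_eq_left)
      then show "\<rho> \<alpha> $ y $ zmult pinv w * \<rho> \<beta> $ w $ x = A.g 1 / A.g (int p) / of_nat CARD('a) * of_int (Legendre j (int p)) * er (of_int (pinv * j) * q x)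
        * (er (bil q w (zmult pinv y)) * er (- bil q w (zmult pinv x)))"
        unfolding 3 by simp
    qed
    also have "\<dots> = (if y = x then A.g 1 / A.g (int p) * of_int (Legendre j (int p)) * er (of_int (pinv * j) * q x) else 0)"
    proof -
      have "zmult pinv y = zmult pinv x \<longleftrightarrow> y = x" using zmult_p_pinv(1) by metis
      then show ?thesis unfolding sum_er_shift by simp
    qed
    finally show "(\<rho> \<alpha> ** diag_op ** \<rho> \<beta>) $ y $ x = rep_op (int p, j, int p) $ y $ x"
      using p_ne by (simp add: rep_op_def)
  qed
  ultimately show ?thesis using coset_op_I[OF Z] by simp
qed

lemma coset_op_reps: "i \<in> reps \<Longrightarrow> coset_op (rep_mp i) (rep_op i)"
proof -
  assume "i \<in> reps"
  moreover have "rep_mp ((int p)\<^sup>2, 0, 1) = diag_mp" by (simp add: rep_mp_def diag_mp_def)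
  moreover have "rep_op ((int p)\<^sup>2, 0, 1) = diag_op" by (simp add: rep_op_def)
  ultimately show ?thesis using coset_op_diag_mp coset_op_rep_1 coset_op_rep_2 unfolding reps_def by auto
qed

lemma rep_exists:
  assumes "coset_op g U"
  obtains \<alpha> i where "\<alpha> \<in> Mp2Z" "i \<in> reps" "g = mp_mult \<alpha> (rep_mp i)"
proof -
  have "\<exists>z. fst g $ i $ j = of_int z" for i j using coset_op_matrix(1)[OF assms] by (metis Ints_cases)
  then obtain A B C D where M: "fst g $ 1 $ 1 = of_int A" "fst g $ 1 $ 2 = of_int B" "fst g $ 2 $ 1 = of_int C" "fst g $ 2 $ 2 = of_int D"
    by metis
  have M': "fst g = mat2 (of_int A) (of_int B) (of_int C) (of_int D)" using mat2_eta[of "fst g"] by (simp only: M)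
  have "real_of_int (A * D - B * C) = real_of_int ((int p)\<^sup>2)" using coset_op_matrix(2)[OF assms] by (simp add: M')
  then have det: "A * D - B * C = (int p)\<^sup>2" by (simp only: of_int_eq_iff)
  \<comment> \<open>D has an entry 1, and multiplication by invertible integral matrices cannot
    create a common factor \<open>p\<close> of all entries.\<close>
  have prim: "\<not> (int p dvd A \<and> int p dvd B \<and> int p dvd C \<and> int p dvd D)"
  proof
    assume dv: "int p dvd A \<and> int p dvd B \<and> int p dvd C \<and> int p dvd D"
    then obtain A' B' C' D' where d: "A = int p * A'" "B = int p * B'" "C = int p * C'" "D = int p * D'" by (elim conjE dvdE)
    obtain \<alpha> \<beta> where ab: "\<alpha> \<in> Mp2Z" "\<beta> \<in> Mp2Z" "g = mp_mult (mp_mult \<alpha> diag_mp) \<beta>" using assms unfolding coset_op_def by blast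
    obtain ai where ai: "ai \<in> Mp2Z" "mp_mult ai \<alpha> = mp1" "mp_mult \<alpha> ai = mp1" by (rule mp_inverse[OF ab(1)])
    obtain bi where bi: "bi \<in> Mp2Z" "mp_mult bi \<beta> = mp1" "mp_mult \<beta> bi = mp1" by (rule mp_inverse[OF ab(2)])
    have "fst ai ** fst g ** fst bi = (fst ai ** fst \<alpha>) ** fst diag_mp ** (fst \<beta> ** fst bi)"
      unfolding ab(3) mp_mult_nth by (simp only: matrix_mul_assoc)
    moreover have "fst ai ** fst \<alpha> = mat 1" "fst \<beta> ** fst bi = mat 1"
      using arg_cong[OF ai(2), of fst] arg_cong[OF bi(3), of fst] by (simp_all add: mp1_def)
    ultimately have e: "fst ai ** fst g ** fst bi = fst diag_mp" by (simp only: matrix_mul_lid matrix_mul_rid)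
    define G where "G = mat2 (real_of_int A') (of_int B') (of_int C') (of_int D')"
    have gG: "fst g $ i $ j = real p * G $ i $ j" for i j
    proof -
      have "\<forall>i j. fst g $ i $ j = real p * G $ i $ j" by (simp add: forall_2 M' d G_def)
      then show ?thesis by blast
    qed
    have Gi: "G $ i $ j \<in> \<int>" for i j
    proof -
      have "\<forall>i j. G $ i $ j \<in> \<int>" by (simp add: forall_2 G_def)
      then show ?thesis by blast
    qed
    have "(fst ai ** fst g ** fst bi) $ 2 $ 2 = real p * (fst ai ** G ** fst bi) $ 2 $ 2"
      unfolding mult_nth_2 gG by (simp add: algebra_simps)
    then have "1 = real p * (fst ai ** G ** fst bi) $ 2 $ 2" unfolding e by simp
    moreover have "(fst ai ** G ** fst bi) $ 2 $ 2 \<in> \<int>"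
      unfolding mult_nth_2 using ai bi Mp2Z_ints Gi by (intro Ints_add Ints_mult)
    ultimately obtain z where "1 = real p * real_of_int z" by (metis Ints_cases)
    then have "real_of_int 1 = real_of_int (int p * z)" by simp
    then have "1 = int p * z" by (simp only: of_int_eq_iff)
    then show False using p_gt_2 by (metis dvd_triv_left int_dvd_int_iff nat_dvd_1_iff_1 of_nat_1 less_irrefl numeral_less_iff one_less_numeral_iff semiring_norm(76) not_less_iff_gr_or_eq)
  qed
  obtain a b c d h j k where n: "a * d - b * c = 1" "A = a * h" "B = a * j + b * k" "C = c * h" "D = c * j + d * k" "(h, j, k) \<in> reps"
    using hermite_normal_form[OF det p prim] unfolding reps_def by metis
  define i where "i = (h, j, k)"
  have ok: "mt_ok (a, b, c, d, e)" if "e \<in> {1, - 1}" for e using n(1) that by simp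
  have gR: "g \<in> Mp2R" and iR: "rep_mp i \<in> Mp2R" unfolding i_def using coset_op_matrix(3)[OF assms] coset_op_matrix(3)[OF coset_op_reps[OF n(6)]] by auto
  have aR: "mp_of (a, b, c, d, e) \<in> Mp2R" if "e \<in> {1, - 1}" for e using ok[OF that] by (rule mp_of_Mp2R)
  have fe: "fst (mp_mult (mp_of (a, b, c, d, e)) (rep_mp i)) = fst g" for e
    by (simp add: i_def rep_mp_def mat2_mult M' n)
  obtain \<epsilon> where eps: "\<epsilon> \<in> {1, -1}" "\<And>z. z \<in> uhp \<Longrightarrow> snd g z = \<epsilon> * snd (mp_mult (mp_of (a, b, c, d, 1)) (rep_mp i)) z"
    using mp_same_matrix[OF gR mp_mult_Mp2R[OF aR[of 1] iR] fe[symmetric]] by auto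
  obtain e :: int where e: "e \<in> {1, -1}" "\<epsilon> = of_int e"
    using eps(1) by (metis insertCI insertE of_int_1 of_int_minus singletonD)
  have "g = mp_mult (mp_of (a, b, c, d, e)) (rep_mp i)"
  proof (rule mp_eqI[OF gR mp_mult_Mp2R[OF aR[OF e(1)] iR] fe[symmetric]])
    fix z assume z: "z \<in> uhp"
    have "moebius (fst (rep_mp i)) z \<in> uhp" using moebius_uhp[OF Mp2R_D(1)[OF iR] z] .
    then show "snd g z = snd (mp_mult (mp_of (a, b, c, d, e)) (rep_mp i)) z" using eps(2)[OF z] z by (simp add: e(2))
  qed
  then show thesis using that[OF mp_of_Mp2Z[OF ok[OF e(1)]] n(6)] by (simp add: i_def)
qed

lemma reps_bounds: "(h, j, k) \<in> reps \<Longrightarrow> 0 < h \<and> 0 \<le> j \<and> j < k"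
  using p_pos unfolding reps_def by auto

lemma rep_inj:
  assumes "\<alpha> \<in> Mp2Z" "i \<in> reps" "i' \<in> reps" "rep_mp i = mp_mult \<alpha> (rep_mp i')"
  shows "i = i'"
proof -
  obtain h j k h' j' k' where ij: "i = (h, j, k)" "i' = (h', j', k')" by (metis prod_cases3)
  note b = reps_bounds[OF assms(2)[unfolded ij]] reps_bounds[OF assms(3)[unfolded ij]]
  obtain a b c d e where A: "mt_ok (a, b, c, d, e)" "\<alpha> = mp_of (a, b, c, d, e)" using assms(1) by (rule Mp2Z_cases)
  have "fst (rep_mp i) = fst \<alpha> ** fst (rep_mp i')" using arg_cong[OF assms(4), of fst] by simp
  then have "real_of_int h = real_of_int (a * h') \<and> real_of_int j = real_of_int (a * j' + b * k')
      \<and> real_of_int (c * h') = real_of_int 0 \<and> real_of_int k = real_of_int (c * j' + d * k')"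
    by (simp add: ij rep_mp_def A mat2_mult)
  then have m: "h = a * h'" "j = a * j' + b * k'" "c * h' = 0" "k = c * j' + d * k'" by (simp_all only: of_int_eq_iff)
  then have c: "c = 0" using b by auto
  then have "a * d = 1" using A by simp
  moreover have "0 < a" using m(1) b by (metis zero_less_mult_pos2)
  ultimately have ad: "a = 1" "d = 1" by (auto simp: zmult_eq_1_iff)
  then have k: "k = k'" "j = j' + b * k'" using m c by simp_all
  have "j mod k' = j' mod k'" using k(2) by simp
  then have "j = j'" using b k(1) by simp
  then show ?thesis using m(1) ad k ij by simp
qed

section \<open>Cosets as orbits, and the Hecke operator as a sum over representatives\<close>

definition orbit :: "mp \<Rightarrow> mp set" where
  "orbit g = (\<lambda>\<alpha>. mp_mult \<alpha> g) ` Mp2Z"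

lemma orbit_mult:
  assumes "\<alpha> \<in> Mp2Z" "g \<in> Mp2R"
  shows "orbit (mp_mult \<alpha> g) = orbit g"
proof -
  obtain ai where ai: "ai \<in> Mp2Z" "mp_mult ai \<alpha> = mp1" "mp_mult \<alpha> ai = mp1" by (rule mp_inverse[OF assms(1)])
  have 1: "mp_mult \<beta> (mp_mult \<alpha> g) = mp_mult (mp_mult \<beta> \<alpha>) g" if "\<beta> \<in> Mp2Z" for \<beta>
    using that assms by (simp add: mp_mult_assoc Mp2Z_Mp2R)
  have 2: "mp_mult \<beta> g = mp_mult (mp_mult \<beta> ai) (mp_mult \<alpha> g)" if "\<beta> \<in> Mp2Z" for \<beta>
  proof -
    have "mp_mult (mp_mult \<beta> ai) (mp_mult \<alpha> g) = mp_mult \<beta> (mp_mult (mp_mult ai \<alpha>) g)"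
      using that assms ai(1) by (simp add: mp_mult_assoc Mp2Z_Mp2R mp_mult_Mp2R)
    then show ?thesis using ai assms by simp
  qed
  show ?thesis
  proof (intro equalityI subsetI)
    fix X assume "X \<in> orbit (mp_mult \<alpha> g)"
    then obtain \<beta> where b: "\<beta> \<in> Mp2Z" "X = mp_mult \<beta> (mp_mult \<alpha> g)" unfolding orbit_def by blast
    show "X \<in> orbit g" unfolding b(2) 1[OF b(1)] orbit_def by (intro imageI mp_mult_Mp2Z b(1) assms(1))
  next
    fix X assume "X \<in> orbit g"
    then obtain \<beta> where b: "\<beta> \<in> Mp2Z" "X = mp_mult \<beta> g" unfolding orbit_def by blast
    show "X \<in> orbit (mp_mult \<alpha> g)" unfolding b(2) 2[OF b(1)] orbit_def by (intro imageI mp_mult_Mp2Z b(1) ai(1))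
  qed
qed

text \<open>The sign is a function of the metaplectic element, so a coset amounts to an orbit under
  \<open>Mp2Z\<close>.\<close>

lemma coset_orbit:
  assumes g: "lifts g u U"
  shows "Delta (int N) #>\<^bsub>Q2 (int N) \<rho>'\<^esub> q2_elem g pN u = {q2_elem g' pN u' | g' u'. g' \<in> orbit g \<and> (\<exists>U'. lifts g' u' U')}"
proof -
  have "lifts (mp_mult \<alpha> g) u' (\<rho> \<alpha> ** U) \<longleftrightarrow> (\<exists>U'. lifts (mp_mult \<alpha> g) u' U')" if "\<alpha> \<in> Mp2Z" for \<alpha> u'
    using coset_op_unique coset_op_left[OF that] g unfolding lifts_def by metis
  then show ?thesis unfolding coset_eq[OF g] orbit_def by blast
qed

lemma q2_elem_inj: "q2_elem g r t = q2_elem g' r' t' \<longleftrightarrow> g = g' \<and> r = r' \<and> t = t'"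
  by (auto simp: q2_elem_def prod_eq_iff)

definition rep_sign :: "int \<times> int \<times> int \<Rightarrow> real" where
  "rep_sign i = (SOME u. lifts (rep_mp i) u (rep_op i))"

lemma lifts_rep_sign: "i \<in> reps \<Longrightarrow> lifts (rep_mp i) (rep_sign i) (rep_op i)"
  unfolding rep_sign_def using lifts_exists[OF coset_op_reps] by (rule someI_ex)

theorem hecke_reps:
  assumes f: "f \<in> modular_forms k q \<rho>" and z: "z \<in> uhp" and xi: "\<xi> = q2_elem diag_mp pN 1"
  shows "hecke k (int N) \<rho>' \<xi> f z = of_real (real p powr (k - 2)) *s (\<Sum>i\<in>reps. slash_op k f (rep_mp i) (rep_op i) z)"
proof -
  let ?C = "\<lambda>\<eta>. Delta (int N) #>\<^bsub>Q2 (int N) \<rho>'\<^esub> \<eta>"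
  let ?c = "\<lambda>i. ?C (q2_elem (rep_mp i) pN (rep_sign i))"
  have self: "q2_elem (rep_mp i) pN (rep_sign i) \<in> ?c i" if "i \<in> reps" for i
  proof -
    have "rep_mp i \<in> orbit (rep_mp i)"
      unfolding orbit_def using mp1_Mp2Z coset_op_matrix(3)[OF coset_op_reps[OF that]] by (metis mp_mult_mp1(1) image_eqI)
    then show ?thesis unfolding coset_orbit[OF lifts_rep_sign[OF that]] using lifts_rep_sign[OF that] by blast
  qed
  have inj: "inj_on ?c reps"
  proof (rule inj_onI)
    fix i i' assume i: "i \<in> reps" "i' \<in> reps" "?c i = ?c i'"
    then have "q2_elem (rep_mp i) pN (rep_sign i) \<in> ?c i'" using self by metis
    then have "rep_mp i \<in> orbit (rep_mp i')" unfolding coset_orbit[OF lifts_rep_sign[OF i(2)]] by (auto simp: q2_elem_inj)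
    then show "i = i'" using rep_inj i unfolding orbit_def by blast
  qed
  have im: "?C ` {q2_elem g pN u | g u U. lifts g u U} = ?c ` reps"
  proof (intro equalityI subsetI)
    fix X assume "X \<in> ?C ` {q2_elem g pN u | g u U. lifts g u U}"
    then obtain g u U where g: "X = ?C (q2_elem g pN u)" "lifts g u U" by blast
    obtain \<alpha> i where a: "\<alpha> \<in> Mp2Z" "i \<in> reps" "g = mp_mult \<alpha> (rep_mp i)"
      using rep_exists g(2) unfolding lifts_def by metis
    have "orbit g = orbit (rep_mp i)" unfolding a(3) using a coset_op_matrix(3)[OF coset_op_reps] by (intro orbit_mult) auto
    then have "X = ?c i" unfolding g(1) coset_orbit[OF g(2)] coset_orbit[OF lifts_rep_sign[OF a(2)]] by simp
    then show "X \<in> ?c ` reps" using a(2) by blast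
  next
    fix X assume "X \<in> ?c ` reps"
    then show "X \<in> ?C ` {q2_elem g pN u | g u U. lifts g u U}" using lifts_rep_sign by blast
  qed
  \<comment> \<open>Whatever element \<open>SOME\<close> picks, it differs from the representative
    by an element of \<open>Mp2Z\<close> on the left, which modularity absorbs.\<close>
  have val: "slashA k \<rho>' f (SOME \<eta>. \<eta> \<in> ?c i) z = slash_op k f (rep_mp i) (rep_op i) z" if i: "i \<in> reps" for i
  proof -
    have "(SOME \<eta>. \<eta> \<in> ?c i) \<in> ?c i" using self[OF i] by (rule someI)
    then obtain \<alpha> u' where a: "(SOME \<eta>. \<eta> \<in> ?c i) = q2_elem (mp_mult \<alpha> (rep_mp i)) pN u'" "\<alpha> \<in> Mp2Z"
        "lifts (mp_mult \<alpha> (rep_mp i)) u' (\<rho> \<alpha> ** rep_op i)"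
      unfolding coset_eq[OF lifts_rep_sign[OF i]] by blast
    show ?thesis unfolding a(1) slashA_slash_op[OF a(3)] by (rule slash_op_left[OF f a(2) coset_op_reps[OF i] z])
  qed
  have "det (fst \<xi>) = real p powr 2" using p_pos by (simp add: xi q2_elem_def powr_numeral)
  then have d: "det (fst \<xi>) powr (k / 2 - 1) = real p powr (k - 2)"
    by (simp only: powr_powr) (simp add: right_diff_distrib)
  have "hecke k (int N) \<rho>' \<xi> f z = of_real (real p powr (k - 2)) *s (\<Sum>X\<in>?c ` reps. slashA k \<rho>' f (SOME \<eta>. \<eta> \<in> X) z)"
    unfolding hecke_def d unfolding xi double_coset_eq im ..
  also have "(\<Sum>X\<in>?c ` reps. slashA k \<rho>' f (SOME \<eta>. \<eta> \<in> X) z) = (\<Sum>i\<in>reps. slash_op k f (rep_mp i) (rep_op i) z)"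
    by (simp add: sum.reindex[OF inj] val)
  finally show ?thesis .
qed

lemma matrix_inv_monomial:
  fixes F :: "'a group_alg"
  assumes U: "\<And>y x. U $ y $ x = (if y = \<pi> x then w x else 0)" and bij: "bij \<pi>" and w: "\<And>x. w x \<noteq> 0"
    and inv: "invertible U"
  shows "(matrix_inv U *v F) $ x = F $ \<pi> x / w x"
proof -
  define G where "G = matrix_inv U *v F"
  have "U *v G = F" unfolding G_def using matrix_inv_cancel(2)[OF inv] by (simp add: matrix_vector_mul_assoc)
  then have "F $ \<pi> x = (U *v G) $ \<pi> x" by simp
  also have "\<dots> = (\<Sum>x'\<in>UNIV. if x' = x then w x * G $ x else 0)"
    unfolding matrix_vector_mult_def vec_lambda_beta U using bij_is_inj[OF bij] by (intro sum.cong refl) (auto dest: injD)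
  also have "\<dots> = w x * G $ x" by simp
  finally show ?thesis using w unfolding G_def by simp
qed

lemma bij_zmult: "bij (zmult (int p) :: 'a \<Rightarrow> 'a)" "bij (zmult pinv :: 'a \<Rightarrow> 'a)"
  by (rule bij_betw_byWitness[of _ "zmult pinv"] bij_betw_byWitness[of _ "zmult (int p)"]; simp)+

text \<open>The Hecke operator in coordinates: the three terms come from the representatives
  \<open>(p\<^sup>2, 0; 0, 1)\<close>, \<open>(p, j; 0, p)\<close> and \<open>(1, j; 0, p\<^sup>2)\<close>.\<close>

theorem hecke_nth:
  assumes f: "f \<in> modular_forms k q \<rho>" and z: "z \<in> uhp" and xi: "\<xi> = q2_elem diag_mp pN 1" and k: "k - 1 / 2 \<in> \<int>"
  shows "hecke k (int N) \<rho>' \<xi> f z $ x =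
    of_real (real p powr (2 * k - 2)) * f ((of_nat p)\<^sup>2 * z) $ zmult pinv x
    + of_real (real p powr (k - 2)) * (A.g (int p) / A.g 1)
        * (\<Sum>j\<in>{1..<int p}. of_int (Legendre j (int p)) * er (- (of_int (pinv * j) * q x)) * f (z + of_int j / of_nat p) $ x)
    + (\<Sum>j\<in>{0..<(int p)\<^sup>2}. er (- (of_int j * q x)) * f ((z + of_int j) / (of_nat p)\<^sup>2) $ zmult (int p) x) / (of_nat p)\<^sup>2"
proof -
  let ?K = "\<lfloor>2 * k\<rfloor>" and ?F = "\<lambda>i. slash_op k f (rep_mp i) (rep_op i) z $ x"
  obtain m where m: "k - 1 / 2 = of_int m" using k by (elim Ints_cases)
  \<comment> \<open>\<open>2 * k\<close> is an integer, so the floor in the slash action is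
    exact.\<close>
  have K: "real_of_int ?K = 2 * k" 
  proof -
    have "2 * k = of_int (2 * m + 1)" using m by simp
    then show ?thesis by (metis floor_of_int)
  qed
  have pw: "(of_real t :: complex) powi (- ?K) = of_real (t powr (- 2 * k))" if "0 < t" for t :: real
  proof -
    have "t powr (- 2 * k) = t powr (real_of_int (- ?K))" unfolding of_int_minus K by simp
    also have "\<dots> = t powi (- ?K)" using that by (intro powr_real_of_int') auto
    finally show ?thesis by simp
  qed
  have p0: "0 < real p" using p_pos by simp
  have F0: "of_real (real p powr (k - 2)) * ?F ((int p)\<^sup>2, 0, 1) = of_real (real p powr (2 * k - 2)) * f ((of_nat p)\<^sup>2 * z) $ zmult pinv x"
  proof -
    have "?F ((int p)\<^sup>2, 0, 1) = of_real (real p powr k) * (matrix_inv diag_op *v f ((of_nat p)\<^sup>2 * z)) $ x"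
      using z by (simp add: slash_op_def rep_mp_def rep_op_def moebius_def auto_factor_def)
    also have "(matrix_inv diag_op *v f ((of_nat p)\<^sup>2 * z)) $ x = f ((of_nat p)\<^sup>2 * z) $ zmult pinv x / 1"
      by (rule matrix_inv_monomial[OF diag_op_nth bij_zmult(2) _ diag_op_invertible]) simp
    finally have "of_real (real p powr (k - 2)) * ?F ((int p)\<^sup>2, 0, 1) = of_real (real p powr (k - 2) * real p powr k) * f ((of_nat p)\<^sup>2 * z) $ zmult pinv x"
      by simp
    also have "real p powr (k - 2) * real p powr k = real p powr (2 * k - 2)" by (simp flip: powr_add)
    finally show ?thesis .
  qed
  have F1: "?F (int p, j, int p) = (A.g (int p) / A.g 1) * (of_int (Legendre j (int p)) * er (- (of_int (pinv * j) * q x)) * f (z + of_int j / of_nat p) $ x)"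
    if j: "1 \<le> j" "j < int p" for j
  proof -
    define w where "w x = A.g 1 / A.g (int p) * of_int (Legendre j (int p)) * er (of_int (pinv * j) * q x)" for x
    have "\<not> int p dvd j" using j by (simp add: zdvd_not_zless)
    then have L0: "Legendre j (int p) \<noteq> 0" by (simp add: Legendre_eq_0_iff)
    \<comment> \<open>The inverse operator carries the inverse of the symbol, which is the symbol
      itself because it is \<plusminus>1.\<close>
    have L: "(of_int (Legendre j (int p)) :: complex) = 1 / of_int (Legendre j (int p))"
      using Legendre_values[of j "int p"] L0 by auto
    have w: "w x \<noteq> 0" for x unfolding w_def using A.g1_nonzero A.g_nonzero[OF pN] L0 by simp
    have "(int p, j, int p) \<in> reps" using j by (auto simp: reps_def)
    then have i: "invertible (rep_op (int p, j, int p))" by (intro coset_op_invertible[OF coset_op_reps])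
    have U: "rep_op (int p, j, int p) $ y $ x = (if y = id x then w x else 0)" for y x
      using p_ne by (simp add: rep_op_def w_def)
    have mz: "moebius (fst (rep_mp (int p, j, int p))) z = z + of_int j / of_nat p"
      using p_pos by (simp add: rep_mp_def moebius_def auto_factor_def field_simps)
    have "sqrt (real p) powr (- 2 * k) = real p powr (- k)"
      using p0 by (simp add: powr_half_sqrt[symmetric] powr_powr)
    then have s: "(of_real (sqrt (real p)) :: complex) powi (- ?K) = of_real (real p powr (- k))" using pw[of "sqrt (real p)"] p0 by simp
    have "?F (int p, j, int p) = of_real (real p powr k) * of_real (sqrt (real p)) powi (- ?K) * (matrix_inv (rep_op (int p, j, int p)) *v f (z + of_int j / of_nat p)) $ x"
      using z unfolding slash_op_def mz by (simp add: rep_mp_def)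
    also have "of_real (real p powr k) * of_real (sqrt (real p)) powi (- ?K) = (1 :: complex)"
      unfolding s using p0 by (simp add: powr_minus field_simps flip: of_real_mult)
    also have "(matrix_inv (rep_op (int p, j, int p)) *v f (z + of_int j / of_nat p)) $ x = f (z + of_int j / of_nat p) $ id x / w x"
      by (rule matrix_inv_monomial[OF U bij_id w i])
    also have "\<dots> = (A.g (int p) / A.g 1) * ((1 / of_int (Legendre j (int p))) * er (- (of_int (pinv * j) * q x)) * f (z + of_int j / of_nat p) $ x)"
      unfolding w_def er_minus by (simp add: field_simps)
    finally show ?thesis using L by simp
  qed
  have F2: "of_real (real p powr (k - 2)) * ?F (1, j, (int p)\<^sup>2) = er (- (of_int j * q x)) * f ((z + of_int j) / (of_nat p)\<^sup>2) $ zmult (int p) x / (of_nat p)\<^sup>2"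
    if j: "0 \<le> j" "j < (int p)\<^sup>2" for j
  proof -
    have "(1, j, (int p)\<^sup>2) \<in> reps" using j by (auto simp: reps_def)
    then have i: "invertible (rep_op (1, j, (int p)\<^sup>2))" by (intro coset_op_invertible[OF coset_op_reps])
    have U: "rep_op (1, j, (int p)\<^sup>2) $ y $ x = (if y = zmult (int p) x then er (of_int j * q x) else 0)" for y x
      using p_ne by (simp add: rep_op_def)
    have mz: "moebius (fst (rep_mp (1, j, (int p)\<^sup>2))) z = (z + of_int j) / (of_nat p)\<^sup>2"
      by (simp add: rep_mp_def moebius_def auto_factor_def)
    have "?F (1, j, (int p)\<^sup>2) = of_real (real p powr k) * of_real (real p) powi (- ?K) * (matrix_inv (rep_op (1, j, (int p)\<^sup>2)) *v f ((z + of_int j) / (of_nat p)\<^sup>2)) $ x"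
      using z unfolding slash_op_def mz by (simp add: rep_mp_def)
    also have "of_real (real p) powi (- ?K) = (of_real (real p powr (- 2 * k)) :: complex)" using pw p0 by blast
    also have "(matrix_inv (rep_op (1, j, (int p)\<^sup>2)) *v f ((z + of_int j) / (of_nat p)\<^sup>2)) $ x = f ((z + of_int j) / (of_nat p)\<^sup>2) $ zmult (int p) x / er (of_int j * q x)"
      by (rule matrix_inv_monomial[OF U bij_zmult(1) _ i]) simp
    also have "\<dots> = er (- (of_int j * q x)) * f ((z + of_int j) / (of_nat p)\<^sup>2) $ zmult (int p) x"
      by (simp add: er_minus field_simps)
    finally have "of_real (real p powr (k - 2)) * ?F (1, j, (int p)\<^sup>2) = of_real (real p powr (k - 2) * (real p powr k * real p powr (- 2 * k)))
        * (er (- (of_int j * q x)) * f ((z + of_int j) / (of_nat p)\<^sup>2) $ zmult (int p) x)"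
      by (simp add: mult.assoc)
    also have "real p powr (k - 2) * (real p powr k * real p powr (- 2 * k)) = real p powr (- 2)" by (simp flip: powr_add)
    also have "\<dots> = 1 / (real p)\<^sup>2" using p0 by (simp add: powr_minus_divide powr_numeral)
    finally show ?thesis by simp
  qed
  have dis: "((int p)\<^sup>2, 0, 1) \<notin> (\<lambda>j. (int p, j, int p)) ` {1..<int p} \<union> (\<lambda>j. (1, j, (int p)\<^sup>2)) ` {0..<(int p)\<^sup>2}"
    "(\<lambda>j. (int p, j, int p)) ` {1..<int p} \<inter> (\<lambda>j. (1, j, (int p)\<^sup>2)) ` {0..<(int p)\<^sup>2} = {}"
    using p_ne by auto
  have "hecke k (int N) \<rho>' \<xi> f z $ x = of_real (real p powr (k - 2)) * (\<Sum>i\<in>reps. ?F i)"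
    unfolding hecke_reps[OF f z xi] by (simp add: sum_component)
  also have "(\<Sum>i\<in>reps. ?F i) = ?F ((int p)\<^sup>2, 0, 1) + ((\<Sum>j\<in>{1..<int p}. ?F (int p, j, int p)) + (\<Sum>j\<in>{0..<(int p)\<^sup>2}. ?F (1, j, (int p)\<^sup>2)))"
    unfolding reps_def using dis by (simp add: sum.union_disjoint sum.reindex inj_on_def)
  also have "of_real (real p powr (k - 2)) * \<dots> = of_real (real p powr (k - 2)) * ?F ((int p)\<^sup>2, 0, 1)
      + of_real (real p powr (k - 2)) * (\<Sum>j\<in>{1..<int p}. ?F (int p, j, int p))
      + (\<Sum>j\<in>{0..<(int p)\<^sup>2}. of_real (real p powr (k - 2)) * ?F (1, j, (int p)\<^sup>2))"
    by (simp add: distrib_left sum_distrib_left)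
  also have "(\<Sum>j\<in>{1..<int p}. ?F (int p, j, int p)) = (A.g (int p) / A.g 1)
      * (\<Sum>j\<in>{1..<int p}. of_int (Legendre j (int p)) * er (- (of_int (pinv * j) * q x)) * f (z + of_int j / of_nat p) $ x)"
    unfolding sum_distrib_left by (intro sum.cong refl F1) auto
  also have "(\<Sum>j\<in>{0..<(int p)\<^sup>2}. of_real (real p powr (k - 2)) * ?F (1, j, (int p)\<^sup>2))
      = (\<Sum>j\<in>{0..<(int p)\<^sup>2}. er (- (of_int j * q x)) * f ((z + of_int j) / (of_nat p)\<^sup>2) $ zmult (int p) x) / (of_nat p)\<^sup>2"
    unfolding sum_divide_distrib by (intro sum.cong refl F2) auto
  finally show ?thesis unfolding F0 by (simp add: mult.assoc)
qed

end

section \<open>Fourier expansions\<close>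

lemma sum_er:
  assumes M: "0 < M" and t: "of_int M * t \<in> \<int>"
  shows "(\<Sum>j\<in>{0..<M}. er (of_int j * t)) = (if t \<in> \<int> then of_int M else 0)"
proof -
  obtain l where l: "of_int M * t = of_int l" using t by (elim Ints_cases)
  then have tl: "t = of_int l / of_int M" using M by (simp add: field_simps)
  have "t \<in> \<int> \<longleftrightarrow> M dvd l"
    using efr_eq_1_iff[OF M, of l] unfolding efr_def tl by (simp only: er_eq_1_iff)
  moreover have "(\<Sum>j\<in>{0..<M}. er (of_int j * t)) = (\<Sum>j\<in>{0..<M}. efr M (l * j))"
    by (intro sum.cong refl) (simp add: efr_def tl mult.commute)
  ultimately show ?thesis using sum_efr[OF M, of l] by simp
qed

lemma Ints_coprime:
  fixes t :: rat
  assumes "of_int a * t \<in> \<int>" "of_int b * t \<in> \<int>" "coprime a b"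
  shows "t \<in> \<int>"
proof -
  obtain u v where "u * a + v * b = 1" using bezout_int[of a b] assms(3) by (metis coprime_imp_gcd_eq_1)
  then have "of_int (u * a + v * b) * t = (1 :: rat) * t" by simp
  then have "t = of_int u * (of_int a * t) + of_int v * (of_int b * t)" by (simp add: algebra_simps)
  moreover have "of_int u * (of_int a * t) + of_int v * (of_int b * t) \<in> \<int>" by (intro Ints_add Ints_mult[OF Ints_of_int] assms)
  ultimately show ?thesis by simp
qed

lemma has_sum_finite_sum:
  fixes F :: "'i \<Rightarrow> 'n \<Rightarrow> 'b::topological_comm_monoid_add"
  shows "(\<And>j. j \<in> J \<Longrightarrow> (F j has_sum a j) A) \<Longrightarrow> ((\<lambda>n. \<Sum>j\<in>J. F j n) has_sum (\<Sum>j\<in>J. a j)) A"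
  by (induction J rule: infinite_finite_induct) (auto intro: has_sum_add)

lemma ee_er: "ee (of_rat n * (z + of_int j / of_int M)) = ee (of_rat n * z) * er (of_int j * (n / of_int M))"
proof -
  have "of_rat n * (z + of_int j / of_int M) = of_rat n * z + of_rat (of_int j * (n / of_int M))"
    by (simp add: of_rat_mult of_rat_divide distrib_left)
  then show ?thesis by (simp add: ee_add er_def)
qed

text \<open>Averaging \<open>F (z + j / M) e (- n\<^sub>0 (z + j / M))\<close> over \<open>j\<close> leaves the terms \<open>n \<equiv> n\<^sub>0 (mod M)\<close>; all but
  \<open>n\<^sub>0\<close> itself disappear as \<open>M\<close> grows.\<close>

lemma fourier_zero:
  fixes e :: "rat \<Rightarrow> complex" and a :: rat
  defines "S \<equiv> {n. n - a \<in> \<int>}"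
  assumes 0: "\<And>z. z \<in> uhp \<Longrightarrow> ((\<lambda>n. e n * ee (of_rat n * z)) has_sum 0) S" and n0: "n0 \<in> S"
  shows "e n0 = 0"
proof (rule ccontr)
  assume ne: "e n0 \<noteq> 0"
  define G where "G n = e n * ee (of_rat n * \<i>)" for n
  define B where "B M = {n \<in> S. (n - n0) / of_int M \<in> \<int>}" for M :: int
  have diff: "n - n0 \<in> \<int>" if "n \<in> S" for n
    using Ints_diff[of "n - a" "n0 - a"] that n0 by (simp add: S_def)
  have avg: "(G has_sum 0) (B M)" if M: "0 < M" for M
  proof -
    have "((\<lambda>n. \<Sum>j\<in>{0..<M}. er (- (of_int j * (n0 / of_int M))) * (e n * ee (of_rat n * (\<i> + of_int j / of_int M)))) has_sum
        (\<Sum>j\<in>{0..<M}. er (- (of_int j * (n0 / of_int M))) * 0)) S"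
    proof (intro has_sum_finite_sum has_sum_cmult_right 0)
      show "\<i> + of_int j / of_int M \<in> uhp" for j by (simp add: uhp_def)
    qed
    moreover have "(\<Sum>j\<in>{0..<M}. er (- (of_int j * (n0 / of_int M))) * (e n * ee (of_rat n * (\<i> + of_int j / of_int M))))
        = of_int M * (if (n - n0) / of_int M \<in> \<int> then G n else 0)" if n: "n \<in> S" for n
    proof -
      have "er (- (of_int j * (n0 / of_int M))) * (e n * ee (of_rat n * (\<i> + of_int j / of_int M)))
          = G n * er (of_int j * ((n - n0) / of_int M))" for j
      proof -
        have "of_int j * ((n - n0) / of_int M) = of_int j * (n / of_int M) + - (of_int j * (n0 / of_int M))"
          by (simp add: diff_divide_distrib right_diff_distrib)
        then show ?thesis unfolding ee_er G_def by (simp only: er_add mult_ac)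
      qed
      then show ?thesis using sum_er[OF M, of "(n - n0) / of_int M"] diff[OF n] M by (simp flip: sum_distrib_left)
    qed
    ultimately have "((\<lambda>n. of_int M * (if (n - n0) / of_int M \<in> \<int> then G n else 0)) has_sum 0) S"
      by (subst (asm) has_sum_cong) auto
    from has_sum_cmult_right[OF this, of "1 / of_int M"]
    have "((\<lambda>n. if (n - n0) / of_int M \<in> \<int> then G n else 0) has_sum 0) S" using M by simp
    then show ?thesis
      by (subst has_sum_cong_neutral[where g = "\<lambda>n. if (n - n0) / of_int M \<in> \<int> then G n else 0" and T = S])
        (auto simp: B_def)
  qed
  have "(G has_sum 0) S" unfolding G_def by (rule 0[OF i_uhp])
  then have abs: "(\<lambda>n. norm (G n)) summable_on S"
    using has_sum_imp_summable summable_on_iff_abs_summable_on_complex by blast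
  have G0: "0 < norm (G n0)" using ne by (simp add: G_def)
  obtain F where F: "finite F" "F \<subseteq> S" "dist (\<Sum>n\<in>F. norm (G n)) (\<Sum>\<^sub>\<infinity>n\<in>S. norm (G n)) \<le> norm (G n0) / 2"
    using has_sum_finite_approximation[OF has_sum_infsum[OF abs], of "norm (G n0) / 2"] G0 by auto
  obtain b where b: "\<And>n. n \<in> F \<Longrightarrow> \<bar>n - n0\<bar> \<le> b"
  proof -
    have "finite ((\<lambda>n. \<bar>n - n0\<bar>) ` F)" using F(1) by simp
    then show thesis using that[of "Max ((\<lambda>n. \<bar>n - n0\<bar>) ` F)"] by (auto intro: Max_ge)
  qed
  \<comment> \<open>\<open>M\<close> exceeds the distance of every element of \<open>F\<close> from
    \<open>n0\<close>, so that \<open>n0\<close> is the only member of \<open>F\<close> surviving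
    the average.\<close>
  define M where "M = max 1 (\<lfloor>b\<rfloor> + 1)"
  have M: "0 < M" "b < of_int M" unfolding M_def by (auto simp: max_def) linarith+
  have far: "n = n0" if n: "n \<in> F" "n \<in> B M" for n
  proof -
    obtain l where l: "(n - n0) / of_int M = of_int l" using n(2) unfolding B_def by (auto elim: Ints_cases)
    then have nl: "n - n0 = of_int (l * M)" using M by (simp add: field_simps)
    have "\<bar>of_int (l * M)\<bar> < (of_int M :: rat)" using b[OF n(1)] M(2) unfolding nl by linarith
    then have "\<bar>l * M\<bar> < M" by (simp only: of_int_abs[symmetric] of_int_less_iff)
    then have "l = 0" using M(1) by (cases "l = 0") (auto simp: abs_mult)
    then show ?thesis using nl by simp
  qed
  let ?R = "B M - {n0}"
  have n0B: "n0 \<in> B M" using n0 by (simp add: B_def)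
  have absR: "(\<lambda>n. norm (G n)) summable_on ?R" by (rule summable_on_subset_banach[OF abs]) (auto simp: B_def)
  then have sR: "G summable_on ?R" by (rule abs_summable_summable)
  have "(G has_sum (G n0 + infsum G ?R)) (insert n0 ?R)"
    by (rule has_sum_insert) (use sR in auto)
  then have "G n0 + infsum G ?R = 0"
    using avg[OF M(1)] n0B by (simp add: insert_absorb) (metis has_sum_unique)
  then have "norm (G n0) = norm (infsum G ?R)" by (metis add_eq_0_iff norm_minus_cancel)
  also have "\<dots> \<le> (\<Sum>\<^sub>\<infinity>n\<in>?R. norm (G n))" using absR by (rule norm_infsum_bound)
  also have "\<dots> \<le> (\<Sum>\<^sub>\<infinity>n\<in>S - F. norm (G n))"
    using far by (intro infsum_mono2 absR summable_on_subset_banach[OF abs]) (auto simp: B_def)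
  also have "\<dots> = (\<Sum>\<^sub>\<infinity>n\<in>S. norm (G n)) - (\<Sum>n\<in>F. norm (G n))"
    using infsum_Diff[OF abs, of F] F by simp
  also have "\<dots> \<le> norm (G n0) / 2" using F(3) unfolding dist_real_def by linarith
  finally show False using G0 by simp
qed

lemma fourier_unique:
  assumes "fourier_expansion q f b" "fourier_expansion q f b'" "n - q x \<in> \<int>"
  shows "b x n = b' x n"
proof -
  have "b x n - b' x n = 0"
  proof (rule fourier_zero[of "\<lambda>n. b x n - b' x n" "q x" n])
    fix z assume z: "z \<in> uhp"
    have "((\<lambda>n. b x n * ee (of_rat n * z)) has_sum f z $ x) {n. n - q x \<in> \<int>}"
      and 2: "((\<lambda>n. b' x n * ee (of_rat n * z)) has_sum f z $ x) {n. n - q x \<in> \<int>}"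
      using assms z unfolding fourier_expansion_def by blast+
    then have "((\<lambda>n. b x n * ee (of_rat n * z) + (- 1) * (b' x n * ee (of_rat n * z))) has_sum (f z $ x + (- 1) * f z $ x)) {n. n - q x \<in> \<int>}"
      by (intro has_sum_add has_sum_cmult_right)
    then show "((\<lambda>n. (b x n - b' x n) * ee (of_rat n * z)) has_sum 0) {n. n - q x \<in> \<int>}"
      by (simp add: algebra_simps)
  qed (use assms in simp)
  then show ?thesis by simp
qed

text \<open>The factor \<open>N\<close> clears the denominator of \<open>n\<close> and is prime to
  \<open>p\<close>; the last hypothesis says that the integer \<open>l\<close> represents
  \<open>n\<close> modulo \<open>p\<close>.\<close>

lemma rat_legendre_eq:
  assumes p: "prime p" "2 < p" and pN: "coprime (int p) N" and n: "of_int N * n \<in> \<int>"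
    and l: "of_int N * (of_int l - n) = of_int (int p * w)"
  shows "rat_legendre (- n) p = Legendre (- 1) (int p) * Legendre l (int p)"
proof -
  obtain a b where ab: "quotient_of n = (a, b)" by (cases "quotient_of n")
  then have b: "0 < b" "coprime a b" "n = of_int a / of_int b" using quotient_of_denom_pos quotient_of_coprime quotient_of_div by blast+
  obtain m where m: "of_int N * n = of_int m" using n by (elim Ints_cases)
  then have "(of_int (N * a) :: rat) = of_int (m * b)" using b by (simp add: field_simps)
  then have Nab: "N * a = m * b" by (simp only: of_int_eq_iff)
  then have "b dvd N * a" by simp
  then have "b dvd N" using b(2) by (metis coprime_commute coprime_dvd_mult_left_iff)
  then obtain N' where N': "N = b * N'" by (elim dvdE)
  have pb: "coprime (int p) b" "coprime (int p) N'" using pN N' by auto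
  have "of_int N * (of_int l - n) = (of_int (N * l - N' * a) :: rat)"
    using b by (simp add: N' field_simps)
  then have "(of_int (N * l - N' * a) :: rat) = of_int (int p * w)" using l by simp
  then have "N * l - N' * a = int p * w" by (simp only: of_int_eq_iff)
  then have "N' * (b * l - a) = int p * w" by (simp add: N' algebra_simps)
  then have "int p dvd N' * (b * l - a)" by simp
  then have "int p dvd b * l - a" using pb(2) by (simp add: coprime_dvd_mult_right_iff)
  then have c1: "[a = b * l] (mod int p)" by (metis cong_iff_dvd_diff cong_sym)
  have inv: "[b * modular_inverse (int p) b = 1] (mod int p)"
    using cong_modular_inverse1[of b "int p"] pb by (simp add: coprime_commute)
  have "[- a * modular_inverse (int p) b = - (b * l) * modular_inverse (int p) b] (mod int p)"
    using c1 by (intro cong_scalar_right) (simp only: cong_minus_minus_iff)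
  also have "- (b * l) * modular_inverse (int p) b = (b * modular_inverse (int p) b) * (- 1 * l)" by simp
  also have "[(b * modular_inverse (int p) b) * (- 1 * l) = 1 * (- 1 * l)] (mod int p)" by (intro cong_scalar_right inv)
  finally have "[- a * modular_inverse (int p) b = - 1 * l] (mod int p)" by simp
  then have "Legendre (- a * modular_inverse (int p) b) (int p) = Legendre (- 1 * l) (int p)" by (rule Legendre_cong)
  also have "\<dots> = Legendre (- 1) (int p) * Legendre l (int p)" by (rule Legendre_mult[OF p])
  finally show ?thesis by (simp add: rat_legendre_def rat_uminus_code ab)
qed

text \<open>The denominator of \<open>n\<close> divides \<open>N\<close> and is thus prime to
  \<open>m\<close>, so divisibility of the numerator can be tested after clearing
  denominators.\<close>

lemma dvd_rat_iff:
  assumes m: "m \<noteq> 0" "coprime m N" and N: "N \<noteq> 0" and n: "of_int N * n \<in> \<int>"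
  shows "dvd_rat m n \<longleftrightarrow> of_int N * (n / of_int m) \<in> \<int>"
proof -
  obtain a b where ab: "quotient_of n = (a, b)" by (cases "quotient_of n")
  then have b: "0 < b" "coprime a b" "n = of_int a / of_int b" using quotient_of_denom_pos quotient_of_coprime quotient_of_div by blast+
  obtain k where k: "of_int N * n = of_int k" using n by (elim Ints_cases)
  then have "(of_int (N * a) :: rat) = of_int (k * b)" using b by (simp add: field_simps)
  then have Nab: "N * a = k * b" by (simp only: of_int_eq_iff)
  then have "b dvd N * a" by simp
  then have "b dvd N" using b(2) by (metis coprime_commute coprime_dvd_mult_left_iff)
  then obtain N' where N': "N = b * N'" by (elim dvdE)
  have cN: "coprime m N'" using m(2) N' by simp
  have e: "of_int N * (n / of_int m) = (of_int (N' * a) / of_int m :: rat)" using b by (simp add: N')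
  have "dvd_rat m n \<longleftrightarrow> m dvd a" by (simp add: dvd_rat_def ab)
  also have "\<dots> \<longleftrightarrow> m dvd N' * a" using cN by (simp add: coprime_dvd_mult_right_iff)
  also have "\<dots> \<longleftrightarrow> (of_int (N' * a) / of_int m :: rat) \<in> \<int>"
  proof
    assume "m dvd N' * a"
    then show "(of_int (N' * a) / of_int m :: rat) \<in> \<int>" using m(1) by (elim dvdE) (simp only:, simp)
  next
    assume "(of_int (N' * a) / of_int m :: rat) \<in> \<int>"
    then obtain l where "(of_int (N' * a) / of_int m :: rat) = of_int l" by (rule Ints_cases)
    then have "(of_int (N' * a) :: rat) = of_int (m * l)" using m(1) by (simp add: field_simps)
    then have "N' * a = m * l" by (simp only: of_int_eq_iff)
    then show "m dvd N' * a" by simp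
  qed
  finally show ?thesis unfolding e .
qed

section \<open>Fourier expansions of the three families of representatives\<close>

context hecke_setup
begin

definition supp :: "'a \<Rightarrow> rat set" where
  "supp x = {n. n - q x \<in> \<int>}"

lemma N_q: "of_int (int N) * q x \<in> \<int>"
  using A.m_q[of x] by simp

lemma supp_N: "n \<in> supp x \<Longrightarrow> of_int (int N) * n \<in> \<int>"
proof -
  assume "n \<in> supp x"
  then have "of_int (int N) * (n - q x) + of_int (int N) * q x \<in> \<int>"
    by (intro Ints_add[OF Ints_mult[OF Ints_of_int] N_q]) (simp add: supp_def)
  then show ?thesis by (simp add: right_diff_distrib)
qed

lemma q_p: "q (zmult (int p) x) - (of_nat p)\<^sup>2 * q x \<in> \<int>"
  using A.q_zmult[of x "int p"] by simp

text \<open>Membership of \<open>p\<^sup>2 n\<close> controls only \<open>p\<^sup>2\<close> times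
  \<open>n - q x\<close>; bounding the denominator by \<open>N\<close>, which is prime to
  \<open>p\<close>, recovers integrality.\<close>

lemma supp_p_iff: "n \<in> supp x \<longleftrightarrow> (of_nat p)\<^sup>2 * n \<in> supp (zmult (int p) x) \<and> of_int (int N) * n \<in> \<int>"
proof
  assume n: "n \<in> supp x"
  have "of_int ((int p)\<^sup>2) * (n - q x) - (q (zmult (int p) x) - (of_nat p)\<^sup>2 * q x) \<in> \<int>"
    using n q_p by (intro Ints_diff[OF Ints_mult[OF Ints_of_int]]) (auto simp: supp_def)
  then show "(of_nat p)\<^sup>2 * n \<in> supp (zmult (int p) x) \<and> of_int (int N) * n \<in> \<int>"
    using supp_N[OF n] by (simp add: supp_def right_diff_distrib)
next
  assume n: "(of_nat p)\<^sup>2 * n \<in> supp (zmult (int p) x) \<and> of_int (int N) * n \<in> \<int>"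
  have "((of_nat p)\<^sup>2 * n - q (zmult (int p) x)) + (q (zmult (int p) x) - (of_nat p)\<^sup>2 * q x) \<in> \<int>"
    using n q_p by (intro Ints_add) (auto simp: supp_def)
  then have 1: "of_int ((int p)\<^sup>2) * (n - q x) \<in> \<int>" by (simp add: right_diff_distrib)
  have 2: "of_int (int N) * (n - q x) \<in> \<int>"
    using n N_q Ints_diff unfolding right_diff_distrib by blast
  show "n \<in> supp x" using Ints_coprime[OF 1 2] pN by (simp add: supp_def)
qed

context
  fixes f :: "complex \<Rightarrow> 'a group_alg" and c :: "'a \<Rightarrow> rat \<Rightarrow> complex"
  assumes fe: "fourier_expansion q f c"
begin

lemma fe_nth: "z \<in> uhp \<Longrightarrow> ((\<lambda>n. c x n * ee (of_rat n * z)) has_sum f z $ x) (supp x)"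
  using fe unfolding fourier_expansion_def supp_def by blast

text \<open>Writing \<open>n\<close> as \<open>p\<^sup>2 m\<close> reindexes the expansion at
  \<open>zmult pinv x\<close>; the exponents outside the image are those not divisible by
  \<open>p\<^sup>2\<close>, where the coefficient is 0.\<close>

lemma fourier_term_0:
  assumes z: "z \<in> uhp"
  shows "((\<lambda>n. (if dvd_rat ((int p)\<^sup>2) n then c (zmult pinv x) (n / of_nat (p\<^sup>2)) else 0) * ee (of_rat n * z))
    has_sum f ((of_nat p)\<^sup>2 * z) $ zmult pinv x) (supp x)"
proof -
  let ?h = "\<lambda>m. (of_nat p)\<^sup>2 * m" and ?y = "zmult pinv x"
  let ?g = "\<lambda>n. (if dvd_rat ((int p)\<^sup>2) n then c ?y (n / of_nat (p\<^sup>2)) else 0) * ee (of_rat n * z)"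
  have p0: "(of_nat p :: rat) \<noteq> 0" using p_pos by simp
  have cop: "coprime ((int p)\<^sup>2) (int N)" using pN by simp
  have mem: "n \<in> supp x \<and> dvd_rat ((int p)\<^sup>2) n \<longleftrightarrow> n \<in> ?h ` supp ?y" for n
  proof -
    have "n \<in> ?h ` supp ?y \<longleftrightarrow> n / (of_nat p)\<^sup>2 \<in> supp ?y" using p0 by (auto simp: image_iff intro!: bexI[of _ "n / (of_nat p)\<^sup>2"])
    also have "\<dots> \<longleftrightarrow> n \<in> supp x \<and> of_int (int N) * (n / (of_nat p)\<^sup>2) \<in> \<int>"
      unfolding supp_p_iff[of _ ?y] using p0 by simp
    also have "\<dots> \<longleftrightarrow> n \<in> supp x \<and> dvd_rat ((int p)\<^sup>2) n"
      using dvd_rat_iff[OF _ cop, of n] supp_N[of n x] p_pos N_pos by auto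
    finally show ?thesis by blast
  qed
  have "((\<lambda>m. c ?y m * ee (of_rat m * ((of_nat p)\<^sup>2 * z))) has_sum f ((of_nat p)\<^sup>2 * z) $ ?y) (supp ?y)"
    by (rule fe_nth[OF diag_mp_uhp[OF z]])
  moreover have "(?g \<circ> ?h) m = c ?y m * ee (of_rat m * ((of_nat p)\<^sup>2 * z))" if "m \<in> supp ?y" for m
  proof -
    have "dvd_rat ((int p)\<^sup>2) (?h m)" using mem[of "?h m"] that by blast
    then show ?thesis using p0 by (simp add: of_rat_mult of_rat_power mult_ac)
  qed
  ultimately have "((?g \<circ> ?h) has_sum f ((of_nat p)\<^sup>2 * z) $ ?y) (supp ?y)"
    by (subst has_sum_cong) auto
  then have "(?g has_sum f ((of_nat p)\<^sup>2 * z) $ ?y) (?h ` supp ?y)"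
    using p0 by (subst has_sum_reindex) (auto simp: inj_on_def)
  then show ?thesis
    using mem by (subst has_sum_cong_neutral[where g = ?g and T = "?h ` supp ?y"]) auto
qed

text \<open>The sum over \<open>j\<close> is a complete character sum: it keeps the exponents
  \<open>m\<close> with \<open>m / p\<^sup>2\<close> in \<open>supp x\<close>, and its value
  \<open>p\<^sup>2\<close> cancels the denominator.\<close>

lemma fourier_term_2:
  assumes z: "z \<in> uhp"
  shows "((\<lambda>n. c (zmult (int p) x) (of_nat (p\<^sup>2) * n) * ee (of_rat n * z)) has_sum
    (\<Sum>j\<in>{0..<(int p)\<^sup>2}. er (- (of_int j * q x)) * f ((z + of_int j) / (of_nat p)\<^sup>2) $ zmult (int p) x) / (of_nat p)\<^sup>2) (supp x)"
    (is "(_ has_sum ?s / _) _")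
proof -
  let ?h = "\<lambda>m. (of_nat p)\<^sup>2 * m" and ?y = "zmult (int p) x"
  let ?g = "\<lambda>m. c ?y m * ee (of_rat (m / (of_nat p)\<^sup>2) * z)"
  have p0: "(of_nat p :: rat) \<noteq> 0" "(of_nat p :: complex) \<noteq> 0" using p_pos by auto
  have pp: "0 < (int p)\<^sup>2" using p_pos by simp
  have u: "(z + of_int j) / (of_nat p)\<^sup>2 \<in> uhp" for j
  proof -
    have "(z + of_int j) / (of_nat p)\<^sup>2 = (z + of_int j) / of_real ((real p)\<^sup>2)" by simp
    also have "Im \<dots> = Im z / (real p)\<^sup>2" unfolding Im_divide_of_real by simp
    finally show ?thesis using z p_pos by (simp add: uhp_def)
  qed
  have s: "((\<lambda>m. \<Sum>j\<in>{0..<(int p)\<^sup>2}. er (- (of_int j * q x)) * (c ?y m * ee (of_rat m * ((z + of_int j) / (of_nat p)\<^sup>2)))) has_sum ?s) (supp ?y)"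
    by (intro has_sum_finite_sum has_sum_cmult_right fe_nth u)
  have avg: "(\<Sum>j\<in>{0..<(int p)\<^sup>2}. er (- (of_int j * q x)) * (c ?y m * ee (of_rat m * ((z + of_int j) / (of_nat p)\<^sup>2))))
      = (of_nat p)\<^sup>2 * (if m / (of_nat p)\<^sup>2 - q x \<in> \<int> then ?g m else 0)" if m: "m \<in> supp ?y" for m
  proof -
    have "er (- (of_int j * q x)) * (c ?y m * ee (of_rat m * ((z + of_int j) / (of_nat p)\<^sup>2)))
        = ?g m * er (of_int j * (m / (of_nat p)\<^sup>2 - q x))" for j
    proof -
      have "of_rat m * ((z + of_int j) / (of_nat p)\<^sup>2) = of_rat (m / (of_nat p)\<^sup>2) * z + of_rat (of_int j * (m / (of_nat p)\<^sup>2))"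
        by (simp add: of_rat_mult of_rat_divide of_rat_power distrib_left add_divide_distrib)
      then have "ee (of_rat m * ((z + of_int j) / (of_nat p)\<^sup>2)) = ee (of_rat (m / (of_nat p)\<^sup>2) * z) * er (of_int j * (m / (of_nat p)\<^sup>2))"
        by (simp only: ee_add er_def)
      moreover have "of_int j * (m / (of_nat p)\<^sup>2 - q x) = of_int j * (m / (of_nat p)\<^sup>2) + - (of_int j * q x)"
        by (simp add: right_diff_distrib)
      ultimately show ?thesis by (simp only: er_add mult_ac)
    qed
    then have "(\<Sum>j\<in>{0..<(int p)\<^sup>2}. er (- (of_int j * q x)) * (c ?y m * ee (of_rat m * ((z + of_int j) / (of_nat p)\<^sup>2))))
        = ?g m * (\<Sum>j\<in>{0..<(int p)\<^sup>2}. er (of_int j * (m / (of_nat p)\<^sup>2 - q x)))"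
      by (simp only: sum_distrib_left)
    also have "(\<Sum>j\<in>{0..<(int p)\<^sup>2}. er (of_int j * (m / (of_nat p)\<^sup>2 - q x))) = (if m / (of_nat p)\<^sup>2 - q x \<in> \<int> then of_int ((int p)\<^sup>2) else 0)"
    proof (rule sum_er[OF pp])
      have "(m - q ?y) + (q ?y - (of_nat p)\<^sup>2 * q x) \<in> \<int>" using m q_p by (intro Ints_add) (auto simp: supp_def)
      then show "of_int ((int p)\<^sup>2) * (m / (of_nat p)\<^sup>2 - q x) \<in> \<int>" using p0 by (simp add: right_diff_distrib)
    qed
    finally show ?thesis by simp
  qed
  have "((\<lambda>m. (of_nat p)\<^sup>2 * (if m / (of_nat p)\<^sup>2 - q x \<in> \<int> then ?g m else 0)) has_sum ?s) (supp ?y)"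
    using s by (subst (asm) has_sum_cong[OF avg]) simp_all
  from has_sum_cmult_right[OF this, of "1 / (of_nat p)\<^sup>2"]
  have 1: "((\<lambda>m. if m / (of_nat p)\<^sup>2 - q x \<in> \<int> then ?g m else 0) has_sum ?s / (of_nat p)\<^sup>2) (supp ?y)" using p0 by simp
  have mem: "m \<in> supp ?y \<and> m / (of_nat p)\<^sup>2 - q x \<in> \<int> \<longleftrightarrow> m \<in> ?h ` supp x" for m
  proof -
    have "m \<in> ?h ` supp x \<longleftrightarrow> m / (of_nat p)\<^sup>2 \<in> supp x" using p0 by (auto simp: image_iff intro!: bexI[of _ "m / (of_nat p)\<^sup>2"])
    moreover have "m / (of_nat p)\<^sup>2 \<in> supp x \<Longrightarrow> m \<in> supp ?y" using supp_p_iff[of "m / (of_nat p)\<^sup>2" x] p0 by simp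
    ultimately show ?thesis by (auto simp: supp_def)
  qed
  have "(?g has_sum ?s / (of_nat p)\<^sup>2) (?h ` supp x)"
    using 1 mem by (subst (asm) has_sum_cong_neutral[where g = ?g and T = "?h ` supp x"]) auto
  then have "((?g \<circ> ?h) has_sum ?s / (of_nat p)\<^sup>2) (supp x)"
    using p0 by (subst (asm) has_sum_reindex) (auto simp: inj_on_def)
  then show ?thesis using p0 by (simp add: o_def)
qed

text \<open>The index \<open>j = 0\<close> may be added because its symbol vanishes. Then the sum
  over \<open>j\<close> is a quadratic Gauss sum whose frequency is an integer representing
  \<open>n\<close> modulo \<open>p\<close>; the factor (-1 / p) only changes the sign of
  \<open>n\<close> in the symbol.\<close>

lemma fourier_term_1:
  assumes z: "z \<in> uhp"
  shows "((\<lambda>n. eps p * of_real (sqrt (real p)) * of_int (Legendre (- 1) (int p) * rat_legendre (- n) p) * c x n * ee (of_rat n * z)) has_sum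
    (\<Sum>j\<in>{1..<int p}. of_int (Legendre j (int p)) * er (- (of_int (pinv * j) * q x)) * f (z + of_int j / of_nat p) $ x)) (supp x)"
    (is "(_ has_sum ?s) _")
proof -
  have p0: "(of_nat p :: rat) \<noteq> 0" "(of_nat p :: complex) \<noteq> 0" using p_pos by auto
  have u: "z + of_int j / of_nat p \<in> uhp" for j
  proof -
    have "of_int j / of_nat p = complex_of_real (of_int j / real p)" by simp
    then show ?thesis using z by (simp only: uhp_def mem_Collect_eq plus_complex.sel Im_complex_of_real add_0_right)
  qed
  have s: "((\<lambda>n. \<Sum>j\<in>{1..<int p}. of_int (Legendre j (int p)) * er (- (of_int (pinv * j) * q x)) * (c x n * ee (of_rat n * (z + of_int j / of_nat p)))) has_sum ?s) (supp x)"
    by (intro has_sum_finite_sum has_sum_cmult_right fe_nth u)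
  have "(\<Sum>j\<in>{1..<int p}. of_int (Legendre j (int p)) * er (- (of_int (pinv * j) * q x)) * (c x n * ee (of_rat n * (z + of_int j / of_nat p))))
      = eps p * of_real (sqrt (real p)) * of_int (Legendre (- 1) (int p) * rat_legendre (- n) p) * c x n * ee (of_rat n * z)"
    if n: "n \<in> supp x" for n
  proof -
    \<comment> \<open>Both exponents together are \<open>j * t / p\<close>; \<open>t\<close> is an
      integer because \<open>p * pinv\<close> is 1 modulo \<open>N\<close> and \<open>N\<close>
      clears \<open>q\<close>.\<close>
    define t where "t = n - of_int (int p * pinv) * q x"
    have "(n - q x) - of_int (int p * pinv - 1) * q x \<in> \<int>"
    proof (rule Ints_diff)
      obtain v where v: "int p * pinv - 1 = int N * v" using p_pinv(1) by (metis cong_iff_dvd_diff dvd_def)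
      have "of_int v * (of_int (int N) * q x) \<in> \<int>" by (rule Ints_mult[OF Ints_of_int N_q])
      then show "of_int (int p * pinv - 1) * q x \<in> \<int>" unfolding v by (simp add: mult_ac)
      show "n - q x \<in> \<int>" using n by (simp add: supp_def)
    qed
    then have "t \<in> \<int>" by (simp add: t_def algebra_simps)
    then obtain l where l: "t = of_int l" by (elim Ints_cases)
    obtain r where r: "of_int (int N) * q x = of_int r" using N_q by (metis Ints_cases)
    have "of_int (int N) * (of_int l - n) = - (of_int (int p * pinv) * (of_int (int N) * q x))"
      unfolding l[symmetric] t_def by (simp add: algebra_simps)
    also have "\<dots> = of_int (int p * (- pinv * r))" unfolding r by simp
    finally have rl: "rat_legendre (- n) p = Legendre (- 1) (int p) * Legendre l (int p)"
      by (rule rat_legendre_eq[OF p p_gt_2 pN supp_N[OF n]])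
    have "Legendre (- 1) (int p) * Legendre (- 1) (int p) = 1"
      using p p_gt_2 by (intro Legendre_square) (auto simp: zdvd_not_zless)
    then have L: "Legendre (- 1) (int p) * rat_legendre (- n) p = Legendre l (int p)"
      unfolding rl by (simp add: mult.assoc[symmetric])
    have L0: "Legendre 0 (int p) = 0" by (simp add: Legendre_eq_0_iff)
    have "(\<Sum>j\<in>{1..<int p}. of_int (Legendre j (int p)) * er (- (of_int (pinv * j) * q x)) * (c x n * ee (of_rat n * (z + of_int j / of_nat p))))
        = (\<Sum>j\<in>{1..<int p}. c x n * ee (of_rat n * z) * (of_int (Legendre j (int p)) * efr (int p) (l * j)))"
    proof (rule sum.cong[OF refl])
      fix j
      have "of_int (l * j) / of_int (int p) = of_int j * (n / of_int (int p)) + - (of_int (pinv * j) * q x)"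
        using p0 unfolding of_int_mult[of l j] l[symmetric] t_def by (simp add: field_simps)
      then have "efr (int p) (l * j) = er (of_int j * (n / of_int (int p))) * er (- (of_int (pinv * j) * q x))"
        by (simp only: efr_def er_add)
      then show "of_int (Legendre j (int p)) * er (- (of_int (pinv * j) * q x)) * (c x n * ee (of_rat n * (z + of_int j / of_nat p)))
        = c x n * ee (of_rat n * z) * (of_int (Legendre j (int p)) * efr (int p) (l * j))"
        using ee_er[of n z j "int p"] by (simp add: mult_ac)
    qed
    also have "\<dots> = c x n * ee (of_rat n * z) * (\<Sum>j\<in>{1..<int p}. of_int (Legendre j (int p)) * efr (int p) (l * j))"
      by (simp only: sum_distrib_left)
    also have "(\<Sum>j\<in>{1..<int p}. of_int (Legendre j (int p)) * efr (int p) (l * j)) = (\<Sum>j\<in>{0..<int p}. of_int (Legendre j (int p)) * efr (int p) (l * j))"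
    proof (rule sum.mono_neutral_left)
      show "\<forall>j\<in>{0..<int p} - {1..<int p}. of_int (Legendre j (int p)) * efr (int p) (l * j) = 0"
      proof
        fix j assume "j \<in> {0..<int p} - {1..<int p}"
        then have "j = 0" by auto
        then show "of_int (Legendre j (int p)) * efr (int p) (l * j) = 0" by (simp add: L0)
      qed
    qed auto
    also have "\<dots> = of_int (Legendre l (int p)) * (eps p * of_real (sqrt (real p)))"
      by (rule Legendre_gauss_sum[OF p p_gt_2])
    finally show ?thesis unfolding L by (simp add: mult_ac)
  qed
  then show ?thesis using s by (subst (asm) has_sum_cong) auto
qed

end

section \<open>The constant of the middle term\<close>

lemma eps_square: "odd m \<Longrightarrow> eps m = (if m mod 4 = 1 then 1 else \<i>)"
  by (simp add: eps_def cong_def)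

lemma psi_eq: "A.g (int p) / A.g 1 = of_int (kronecker (int CARD('a)) p) * ee (of_nat (p - 1) / 8) ^ s"
proof -
  have e: "ee (of_nat (p * s) / 8) = ee (of_nat (p - 1) / 8) ^ s * ee (of_nat s / 8)"
  proof -
    have "of_nat (p * s) / 8 = of_nat s * (of_nat (p - 1) / 8) + (of_nat s / 8 :: complex)"
      using p_pos by (simp add: field_simps of_nat_diff)
    then show ?thesis by (simp only: ee_add ee_of_nat_mult)
  qed
  show ?thesis
    unfolding gauss_closed_form[OF fqm_UNIV sgn odd_p pN] sgn e by simp
qed

lemma ee_quarter: "ee (1 / 4) = \<i>" "ee (1 / 2) = - 1" "ee (3 / 4) = - \<i>"
proof -
  show 1: "ee (1 / 4) = \<i>"
  proof -
    have "2 * of_real pi * \<i> * (1 / 4) = \<i> * complex_of_real (pi / 2)" by simp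
    then show ?thesis by (simp only: ee_def cis_conv_exp[symmetric] cis_pi_half)
  qed
  show 2: "ee (1 / 2) = - 1" using ee_add[of "1 / 4" "1 / 4"] 1 by simp
  show "ee (3 / 4) = - \<i>" using ee_add[of "1 / 4" "1 / 2"] 1 2 by simp
qed

lemma ee_mod_8: "ee (of_nat (p - 1) / 8) = (if p mod 8 = 1 then 1 else if p mod 8 = 3 then \<i> else if p mod 8 = 5 then - 1 else - \<i>)"
proof -
  define r where "r = p mod 8"
  have r: "r = 1 \<or> r = 3 \<or> r = 5 \<or> r = 7" using odd_p unfolding r_def by presburger
  have p8: "p = r + 8 * (p div 8)" unfolding r_def by simp
  have "of_nat (p - 1) / 8 = of_nat (r - 1) / 8 + (of_int (int (p div 8)) :: complex)"
  proof -
    have "p - 1 = (r - 1) + 8 * (p div 8)" using p8 r by auto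
    then have "(of_nat (p - 1) :: complex) = of_nat ((r - 1) + 8 * (p div 8))" by simp
    then show ?thesis by (simp add: add_divide_distrib)
  qed
  then have "ee (of_nat (p - 1) / 8) = ee (of_nat (r - 1) / 8)" by (simp only: ee_add_of_int)
  then show ?thesis using r unfolding r_def[symmetric] by (auto simp: ee_quarter)
qed

text \<open>The constant of the middle term; both sides depend only on \<open>p mod 8\<close>, on the odd part of \<open>|A|\<close> modulo 4
  and on the symbol of \<open>p\<close> modulo \<open>2\<^sup>s |A|\<close>, by quadratic reciprocity.\<close>

theorem middle_constant:
  "A.g (int p) / A.g 1 * eps p * of_int (Legendre (- 1) (int p)) =
    eps p powi (int s + kronecker (- 1) CARD('a)) * of_int (kronecker (int p) (CARD('a) * 2 ^ s))"
proof -
  define n where "n = CARD('a)"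
  have n0: "n \<noteq> 0" by (simp add: n_def)
  \<comment> \<open>Reciprocity treats the odd part \<open>m\<close>, and
    \<open>kronecker_2_left\<close> treats the power of 2.\<close>
  obtain m v where nm: "n = 2 ^ v * m" "odd m"
    using multiplicity_decompose'[of n 2] n0 by (metis mult.commute not_prime_unit prime_nat_iff two_is_prime_nat is_unit_power_iff dvd_def)
  have m0: "0 < m" using nm n0 by (cases m) auto
  have "coprime (int n) (int p)" using card_prime_to[OF pN] by (simp add: n_def)
  then have "coprime n p" by simp
  then have cm: "coprime m p" using nm(1) by simp
  define K2 Km where "K2 = kronecker (int p) 2" and "Km = kronecker (int p) m"
  have K2v: "K2 = (if p mod 8 = 1 \<or> p mod 8 = 7 then 1 else - 1)"
  proof -
    have "int p mod 8 = int (p mod 8)" by (simp add: zmod_int)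
    then show ?thesis using odd_p by (auto simp: K2_def kronecker_prime_eq kronecker_prime_def)
  qed
  have kp: "kronecker (int p) (n * 2 ^ s) = K2 ^ v * Km * K2 ^ s"
    unfolding nm(1) using m0 by (simp add: kronecker_mult_right kronecker_power_right K2_def Km_def)
  have "kronecker (int 2 ^ v) p = K2 ^ v" for v
  proof (induction v)
    case 0
    then show ?case using odd_p by (simp add: kronecker_1_left)
  next
    case (Suc v)
    have "kronecker (int 2 * int 2 ^ v) p = kronecker (int 2) p * kronecker (int 2 ^ v) p" by (rule kronecker_mult_left[OF odd_p])
    then show ?case using Suc kronecker_odd_prime[OF p, of 2] p_gt_2 kronecker_2_left[OF p p_gt_2] by (simp add: K2_def)
  qed
  moreover have "kronecker (int n) p = kronecker (int 2 ^ v) p * kronecker (int m) p"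
    using kronecker_mult_left[OF odd_p, of "int 2 ^ v" "int m"] by (simp add: nm(1))
  ultimately have kn: "kronecker (int n) p = K2 ^ v * kronecker (int m) p" by simp
  have rec: "kronecker (int m) p = Km * (if m mod 4 = 3 \<and> p mod 4 = 3 then - 1 else 1)"
  proof -
    have 1: "kronecker (int m) p * Km = (if m mod 4 = 3 \<and> p mod 4 = 3 then - 1 else 1)"
      unfolding Km_def by (rule kronecker_reciprocity[OF nm(2) odd_p cm])
    have "Km * Km = 1" unfolding Km_def using cm by (intro kronecker_square[OF nm(2)]) (simp add: coprime_commute)
    then have "kronecker (int m) p = (kronecker (int m) p * Km) * Km" by (simp add: mult.assoc)
    then show ?thesis unfolding 1 by simp
  qed
  have k2: "kronecker (- 1) 2 = 1" by (simp add: kronecker_prime_eq kronecker_prime_def)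
  have km1: "kronecker (- 1) n = (if m mod 4 = 1 then 1 else - 1)"
    unfolding nm(1) using m0 by (simp add: kronecker_mult_right kronecker_power_right k2 kronecker_minus_1[OF nm(2)])
  have lp: "Legendre (- 1) (int p) = (if p mod 4 = 1 then 1 else - 1)"
    using kronecker_minus_1[OF odd_p] kronecker_odd_prime[OF p, of "- 1"] p_gt_2 by simp
  have m4: "m mod 4 = 1 \<or> m mod 4 = 3" by (rule odd_mod4[OF nm(2)])
  have p8: "p mod 8 = 1 \<or> p mod 8 = 3 \<or> p mod 8 = 5 \<or> p mod 8 = 7" using odd_p by presburger
  have p4: "p mod 4 = (p mod 8) mod 4" by (simp add: mod_mod_cancel)
  obtain h where h: "s = 2 * h + 1" using odd_s by (elim oddE)
  have i_pow: "\<i> ^ s = (- 1) ^ h * \<i>" "(- \<i>) ^ s = - ((- 1) ^ h * \<i>)" "(- 1 :: complex) ^ s = - 1"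
    unfolding h by (simp_all add: power_add power_mult)
  \<comment> \<open>For odd \<open>s\<close> the exponent in the theorem is even, so this power of
    \<i> is a sign.\<close>
  have i_powi: "\<i> powi (int s + 1) = - ((- 1) ^ h)" "\<i> powi (int s - 1) = (- 1) ^ h"
  proof -
    have ii: "\<i> * (y * \<i>) = - y" "y * \<i> * \<i> = - y" for y
    proof -
      show "y * \<i> * \<i> = - y" by (simp add: mult.assoc)
      then show "\<i> * (y * \<i>) = - y" by (simp only: mult.commute)
    qed
    show "\<i> powi (int s + 1) = - ((- 1) ^ h)" "\<i> powi (int s - 1) = (- 1) ^ h"
      using i_pow(1) by (simp_all add: power_int_add power_int_diff ii)
  qed
  show ?thesis
    unfolding psi_eq n_def[symmetric] kp kn rec km1 eps_square[OF odd_p] lp ee_mod_8 K2v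
    using m4 p8 by (elim disjE) (simp_all add: p4 i_pow i_powi mult_ac)
qed

theorem hecke_fourier:
  assumes f: "f \<in> modular_forms k q \<rho>" and fe: "fourier_expansion q f c" and xi: "\<xi> = q2_elem diag_mp pN 1" and k: "k - 1 / 2 \<in> \<int>"
  shows "fourier_expansion q (hecke k (int N) \<rho>' \<xi> f) (\<lambda>x n.
      c (zmult (int p) x) (of_nat (p\<^sup>2) * n)
      + eps p powi (int s + kronecker (- 1) CARD('a)) * of_int (kronecker (int p) (CARD('a) * 2 ^ s))
        * of_real (real p powr (k - 3 / 2)) * of_int (rat_legendre (- n) p) * c x n
      + of_real (real p powr (2 * k - 2))
        * (if dvd_rat ((int p)\<^sup>2) n then c (zmult pinv x) (n / of_nat (p\<^sup>2)) else 0))"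
  unfolding fourier_expansion_def
proof (intro ballI allI)
  fix z :: complex and x :: 'a
  assume z: "z \<in> uhp"
  let ?C = "eps p powi (int s + kronecker (- 1) CARD('a)) * of_int (kronecker (int p) (CARD('a) * 2 ^ s))"
  let ?G = "complex_of_real (real p powr (k - 2)) * (A.g (int p) / A.g 1)"
  \<comment> \<open>The Gauss sum over \<open>j\<close> contributes sqrt p, which raises the
    exponent \<open>k - 2\<close> of the normalization to \<open>k - 3 / 2\<close>.\<close>
  have pk: "real p powr (k - 2) * sqrt (real p) = real p powr (k - 3 / 2)"
    using p_pos by (simp add: powr_half_sqrt[symmetric] flip: powr_add)
  have mid: "?G * (eps p * of_real (sqrt (real p)) * of_int (Legendre (- 1) (int p) * r))
      = ?C * of_real (real p powr (k - 3 / 2)) * of_int r" for r :: int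
    unfolding middle_constant[symmetric] pk[symmetric] by simp
  have "((\<lambda>n. of_real (real p powr (2 * k - 2)) * ((if dvd_rat ((int p)\<^sup>2) n then c (zmult pinv x) (n / of_nat (p\<^sup>2)) else 0) * ee (of_rat n * z))
      + ?G * (eps p * of_real (sqrt (real p)) * of_int (Legendre (- 1) (int p) * rat_legendre (- n) p) * c x n * ee (of_rat n * z))
      + c (zmult (int p) x) (of_nat (p\<^sup>2) * n) * ee (of_rat n * z)) has_sum hecke k (int N) \<rho>' \<xi> f z $ x) (supp x)"
    unfolding hecke_nth[OF f z xi k]
    by (intro has_sum_add has_sum_cmult_right fourier_term_0[OF fe z] fourier_term_1[OF fe z] fourier_term_2[OF fe z])
  also have "(\<lambda>n. of_real (real p powr (2 * k - 2)) * ((if dvd_rat ((int p)\<^sup>2) n then c (zmult pinv x) (n / of_nat (p\<^sup>2)) else 0) * ee (of_rat n * z))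
      + ?G * (eps p * of_real (sqrt (real p)) * of_int (Legendre (- 1) (int p) * rat_legendre (- n) p) * c x n * ee (of_rat n * z))
      + c (zmult (int p) x) (of_nat (p\<^sup>2) * n) * ee (of_rat n * z))
    = (\<lambda>n. (c (zmult (int p) x) (of_nat (p\<^sup>2) * n)
      + ?C * of_real (real p powr (k - 3 / 2)) * of_int (rat_legendre (- n) p) * c x n
      + of_real (real p powr (2 * k - 2))
        * (if dvd_rat ((int p)\<^sup>2) n then c (zmult pinv x) (n / of_nat (p\<^sup>2)) else 0)) * ee (of_rat n * z))"
  proof (rule HOL.ext)
    fix n
    have "a * (d * E) + ?G * (u * w * E) + y * E = (y + ?G * u * w + a * d) * E" for a d E u w y :: complex
      by (simp add: algebra_simps)
    note this[of _ _ _ "eps p * of_real (sqrt (real p)) * of_int (Legendre (- 1) (int p) * rat_legendre (- n) p)", unfolded mid]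
    then show "of_real (real p powr (2 * k - 2)) * ((if dvd_rat ((int p)\<^sup>2) n then c (zmult pinv x) (n / of_nat (p\<^sup>2)) else 0) * ee (of_rat n * z))
      + ?G * (eps p * of_real (sqrt (real p)) * of_int (Legendre (- 1) (int p) * rat_legendre (- n) p) * c x n * ee (of_rat n * z))
      + c (zmult (int p) x) (of_nat (p\<^sup>2) * n) * ee (of_rat n * z)
    = (c (zmult (int p) x) (of_nat (p\<^sup>2) * n)
      + ?C * of_real (real p powr (k - 3 / 2)) * of_int (rat_legendre (- n) p) * c x n
      + of_real (real p powr (2 * k - 2))
        * (if dvd_rat ((int p)\<^sup>2) n then c (zmult pinv x) (n / of_nat (p\<^sup>2)) else 0)) * ee (of_rat n * z)" .
  qed
  finally show "((\<lambda>n. (c (zmult (int p) x) (of_nat (p\<^sup>2) * n)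
      + ?C * of_real (real p powr (k - 3 / 2)) * of_int (rat_legendre (- n) p) * c x n
      + of_real (real p powr (2 * k - 2))
        * (if dvd_rat ((int p)\<^sup>2) n then c (zmult pinv x) (n / of_nat (p\<^sup>2)) else 0)) * ee (of_rat n * z)) has_sum
      hecke k (int N) \<rho>' \<xi> f z $ x) {n. n - q x \<in> \<int>}"
    unfolding supp_def .
qed

end

lemma hecke_setup_intro:
  fixes q :: "'a::{finite,ab_group_add} \<Rightarrow> rat"
  assumes disc: "discriminant_form q" and sig: "has_signature q s" "odd s" and N: "N = level q"
    and rho: "weil_representation q \<rho>" "weil_extension q \<rho> \<rho>'" and p: "prime p" "coprime (int p) N"
  shows "hecke_setup q (nat N) s \<rho> \<rho>' p"
proof -
  have N0: "int (nat N) = N" "0 \<le> N" unfolding N level_def by simp_all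
  have fqm: "fqm UNIV q N" unfolding N by (rule fqm_level[OF disc])
  then have g1: "fqm.g UNIV q 1 = of_real (sqrt (real CARD('a))) * ee (of_nat s / 8)"
    using sig(1) by (simp add: fqm.g_def has_signature_def er_def)
  interpret odd_disc q "nat N" s
    by (rule odd_disc.intro) (use fqm g1 sig(2) N0 in simp_all)
  show ?thesis
    by unfold_locales (use rho sig(1) N N0 p in simp_all)
qed

theorem theorem4p9:
  fixes q :: "'a::{finite,ab_group_add} \<Rightarrow> rat"
    and N :: int and s p :: nat and k :: real
    and \<rho> :: "mp \<Rightarrow> 'a operator"
    and \<rho>' :: "(real^2^2) \<times> int \<Rightarrow> 'a operator"
    and \<xi> :: q2
    and f :: "complex \<Rightarrow> 'a group_alg"
    and c :: "'a \<Rightarrow> rat \<Rightarrow> complex"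
  assumes "discriminant_form q"
    and "has_signature q s" and "odd s"
    and "N = level q"
    and "weil_representation q \<rho>"
    and "weil_extension q \<rho> \<rho>'"
    and "k - 1 / 2 \<in> \<int>"
    and "prime p" and "coprime (int p) N"
    and "\<xi> = (mat2 (real (p\<^sup>2)) 0 0 1, restrict (\<lambda>z. 1) uhp, int p mod N, 1)"
    and "f \<in> modular_forms k q \<rho>"
    and "fourier_expansion q f c"
  shows "(\<exists>b. fourier_expansion q (hecke k N \<rho>' \<xi> f) b) \<and>
    (\<forall>b. fourier_expansion q (hecke k N \<rho>' \<xi> f) b \<longrightarrow>
      (\<forall>x n. n - q x \<in> \<int> \<longrightarrow>
        b x n =
          c (zmult (int p) x) (of_nat (p\<^sup>2) * n)
          + eps p powi (int s + kronecker (-1) CARD('a))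
            * of_int (kronecker (int p) (CARD('a) * 2 ^ s))
            * of_real (real p powr (k - 3 / 2))
            * of_int (rat_legendre (- n) p) * c x n
          + of_real (real p powr (2 * k - 2))
            * (if dvd_rat ((int p)\<^sup>2) n
               then c (zmult (modular_inverse N (int p)) x) (n / of_nat (p\<^sup>2)) else 0)))"
proof -
  interpret H: hecke_setup q "nat N" s \<rho> \<rho>' p
    using assms by (intro hecke_setup_intro)
  have N: "int (nat N) = N" unfolding assms(4) level_def by simp
  have xi: "\<xi> = H.q2_elem H.diag_mp (int p mod int (nat N)) 1"
    unfolding assms(10) H.q2_elem_def H.diag_mp_def N by simp
  note F = H.hecke_fourier[OF assms(11,12) xi assms(7), unfolded H.pinv_def N]
  show ?thesis using F fourier_unique[OF _ F] by blast
qed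

end
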